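(* Let $n\ge3$, $M=3n-3$, and let $D$ be a three-row diagram given by column multiplicities $m_C\ge0$. Then $$\dim S_D=\sum_\tau\mathcal R(\tau),$$ summed over all standard column tabloids $\tau$, where: (i) if $\tau$ is not singular, $\mathcal R(\tau)=\dfrac{\mathrm{RR}_M(b(\tau);r(\tau))}{\prod_{s=1}^M r(\tau)_s}$; (ii) if $\tau=\tau_{ijk}$ is singular, $\mathcal R(\tau)=\dfrac{\mathrm{RR}_M\big(b(\tau);\ i-j,\ i-j,\ i-j,\ j-k,\ j-k,\ j-k,\ r'(i,j,k)\big)}{(i-j)^3(j-k)^3\prod r'(i,j,k)}$, where $\prod r'(i,j,k)$ is the product of the entries of $r'(i,j,k)$.
   Context: $S_D$ is the Schur module of $GL(n,\mathbb C)$: with $m_C$ columns of $D$ having occupied rows $C$ ($C$ nonempty in $\{1,2,3\}$), $S_D=(\mathbb C^n)^{\otimes D}\alpha_D\beta_D$, where $\alpha_D$ averages over row-preserving permutations of the squares and $\beta_D$ is the signed average over column-preserving ones. A standard column tabloid $\tau$ assigns to each nonempty $C\subseteq\{1,2,3\}$ a subset $\tau(C)\subseteq[1,n]$ of size $|C|$ with $\tau(C)\subset\tau(C')$ whenever $C\subset C'$. For $a\ne b$, $d_{ab}(\tau)$ is the number of connected components of the graph on the subsets $C$ with $a\in\tau(C)$, $b\notin\tau(C)$, edges joining comparable subsets. For distinct $i,j,k$, the singular tabloid $\tau_{ijk}$ has $\tau(\{1\})=\tau(\{2\})=\tau(\{3\})=\{i\}$, $\tau$ of each two-element subset $=\{i,j\}$,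 $\tau(\{1,2,3\})=\{i,j,k\}$; others are non-singular. $b(\tau)=\sum_C m_C\sum_{a\in\tau(C)}a$. For non-singular $\tau$, $r(\tau)$ is the multiset of $M$ integers containing $a-b$ with multiplicity $d_{ab}(\tau)$ for each ordered pair $a\ne b$ in $[1,n]$. $r'(i,j,k)$ is the multiset with entries $i-l$, $j-l$, $k-l$ for each $l\in[1,n]\setminus\{i,j,k\}$. The polynomial $\mathrm{RR}_M(b;r_1,\dots,r_M)$ is the coefficient of $U^M$ in the power series $\exp(bU)\prod_{s=1}^M\frac{r_sU}{1-\exp(-r_sU)}$. *)

theory Defs
  imports "HOL-Analysis.Analysis" "HOL-Library.Function_Algebras" "HOL-Library.Multiset"
          "HOL-Combinatorics.Permutations" "HOL-Computational_Algebra.Formal_Power_Series"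
begin

section \<open>Three-row diagrams and the Schur module\<close>

text \<open>The admissible column shapes: nonempty subsets of the row set {1,2,3}.\<close>
definition col_shapes :: "nat set set" where
  "col_shapes = {C. C \<subseteq> {1,2,3} \<and> C \<noteq> {}}"

text \<open>A diagram D is given by multiplicities m C (only the values on col_shapes matter).
  Squares are triples (C, j, r): the j-th column of shape C (j < m C), in row r \<in> C.
  The column of a square is (C, j), its row is r.\<close>
type_synonym square = "nat set \<times> nat \<times> nat"

definition squares :: "(nat set \<Rightarrow> nat) \<Rightarrow> square set" where
  "squares m = {(C, j, r). C \<in> col_shapes \<and> j < m C \<and> r \<in> C}"

definition sq_row :: "square \<Rightarrow> nat" where "sq_row x = snd (snd x)"
definition sq_col :: "square \<Rightarrow> nat set \<times> nat" where "sq_col x = (fst x, fst (snd x))"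

text \<open>Fillings of D with entries in [1,n]: they index the standard basis e_f of the
  tensor power (C^n)^{\<otimes>D}.  (Extensional: value 0 off the diagram.)\<close>
definition fillings :: "nat \<Rightarrow> (nat set \<Rightarrow> nat) \<Rightarrow> (square \<Rightarrow> nat) set" where
  "fillings n m = {f. (\<forall>x\<in>squares m. f x \<in> {1..n}) \<and> (\<forall>x. x \<notin> squares m \<longrightarrow> f x = 0)}"

text \<open>Vectors of (C^n)^{\<otimes>D} are represented by their coefficient functions with respect
  to the basis e_f, f a filling.\<close>
type_synonym tensor = "(square \<Rightarrow> nat) \<Rightarrow> complex"

definition tensor_space :: "nat \<Rightarrow> (nat set \<Rightarrow> nat) \<Rightarrow> tensor set" where
  "tensor_space n m = {v. \<forall>g. g \<notin> fillings n m \<longrightarrow> v g = 0}"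

definition row_group :: "(nat set \<Rightarrow> nat) \<Rightarrow> (square \<Rightarrow> square) set" where
  "row_group m = {\<sigma>. \<sigma> permutes squares m \<and> (\<forall>x. sq_row (\<sigma> x) = sq_row x)}"

definition col_group :: "(nat set \<Rightarrow> nat) \<Rightarrow> (square \<Rightarrow> square) set" where
  "col_group m = {\<sigma>. \<sigma> permutes squares m \<and> (\<forall>x. sq_col (\<sigma> x) = sq_col x)}"

text \<open>Right action of a permutation of the squares on the tensor power:
  e_f \<cdot> \<sigma> = e_(f \<circ> \<sigma>), i.e. on coefficients (v\<cdot>\<sigma>)(g) = v (g \<circ> inv \<sigma>).\<close>
definition perm_act :: "tensor \<Rightarrow> (square \<Rightarrow> square) \<Rightarrow> tensor" where
  "perm_act v \<sigma> = (\<lambda>g. v (g \<circ> inv \<sigma>))"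

text \<open>v \<alpha>_D: average over row-preserving permutations.\<close>
definition alpha_D :: "(nat set \<Rightarrow> nat) \<Rightarrow> tensor \<Rightarrow> tensor" where
  "alpha_D m v = (\<lambda>g. (1 / of_nat (card (row_group m))) *
      (\<Sum>\<sigma>\<in>row_group m. perm_act v \<sigma> g))"

text \<open>v \<beta>_D: signed average over column-preserving permutations.\<close>
definition beta_D :: "(nat set \<Rightarrow> nat) \<Rightarrow> tensor \<Rightarrow> tensor" where
  "beta_D m v = (\<lambda>g. (1 / of_nat (card (col_group m))) *
      (\<Sum>\<sigma>\<in>col_group m. of_int (sign \<sigma>) * perm_act v \<sigma> g))"

text \<open>S_D = (C^n)^{\<otimes>D} \<alpha>_D \<beta>_D.\<close>
definition schur_module :: "nat \<Rightarrow> (nat set \<Rightarrow> nat) \<Rightarrow> tensor set" where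
  "schur_module n m = (\<lambda>v. beta_D m (alpha_D m v)) ` tensor_space n m"

text \<open>Complex dimension, via the library notion for the complex vector space of
  coefficient functions.\<close>
definition dim_schur :: "nat \<Rightarrow> (nat set \<Rightarrow> nat) \<Rightarrow> nat" where
  "dim_schur n m = vector_space.dim (\<lambda>(c::complex) (v::tensor). (\<lambda>g. c * v g)) (schur_module n m)"

section \<open>Standard column tabloids\<close>

definition std_tabloids :: "nat \<Rightarrow> (nat set \<Rightarrow> nat set) set" where
  "std_tabloids n = {\<tau>. (\<forall>C\<in>col_shapes. \<tau> C \<subseteq> {1..n} \<and> card (\<tau> C) = card C)
      \<and> (\<forall>C\<in>col_shapes. \<forall>C'\<in>col_shapes. C \<subset> C' \<longrightarrow> \<tau> C \<subset> \<tau> C')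
      \<and> (\<forall>C. C \<notin> col_shapes \<longrightarrow> \<tau> C = {})}"

text \<open>d_ab(\<tau>): number of connected components of the graph with vertices
  {C. a \<in> \<tau> C, b \<notin> \<tau> C} and edges between comparable subsets.\<close>
definition d_ab :: "(nat set \<Rightarrow> nat set) \<Rightarrow> nat \<Rightarrow> nat \<Rightarrow> nat" where
  "d_ab \<tau> a b = (let V = {C\<in>col_shapes. a \<in> \<tau> C \<and> b \<notin> \<tau> C};
                      E = {(C, C'). C \<in> V \<and> C' \<in> V \<and> (C \<subset> C' \<or> C' \<subset> C)}
                  in card (V // (E\<^sup>*)))"

definition sing_tab :: "nat \<Rightarrow> nat \<Rightarrow> nat \<Rightarrow> nat set \<Rightarrow> nat set" where
  "sing_tab i j k = (\<lambda>C. if C \<in> col_shapes then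
       (if card C = 1 then {i} else if card C = 2 then {i, j} else {i, j, k}) else {})"

definition is_singular :: "nat \<Rightarrow> (nat set \<Rightarrow> nat set) \<Rightarrow> bool" where
  "is_singular n \<tau> \<longleftrightarrow> (\<exists>i\<in>{1..n}. \<exists>j\<in>{1..n}. \<exists>k\<in>{1..n}.
       i \<noteq> j \<and> j \<noteq> k \<and> i \<noteq> k \<and> \<tau> = sing_tab i j k)"

definition b_tab :: "(nat set \<Rightarrow> nat) \<Rightarrow> (nat set \<Rightarrow> nat set) \<Rightarrow> int" where
  "b_tab m \<tau> = (\<Sum>C\<in>col_shapes. int (m C) * (\<Sum>a\<in>\<tau> C. int a))"

definition r_tab :: "nat \<Rightarrow> (nat set \<Rightarrow> nat set) \<Rightarrow> int multiset" where
  "r_tab n \<tau> = (\<Sum>a\<in>{1..n}. \<Sum>b\<in>{1..n} - {a}. replicate_mset (d_ab \<tau> a b) (int a - int b))"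

definition r'_mset :: "nat \<Rightarrow> nat \<Rightarrow> nat \<Rightarrow> nat \<Rightarrow> int multiset" where
  "r'_mset n i j k = (\<Sum>l\<in>{1..n} - {i, j, k}. {#int i - int l, int j - int l, int k - int l#})"

section \<open>The Riemann--Roch type polynomial\<close>

text \<open>RR_M(b; r_1..r_M): coefficient of U^M in exp(bU) \<Prod>_s r_s U / (1 - exp(-r_s U)).\<close>
definition RR :: "nat \<Rightarrow> int \<Rightarrow> int multiset \<Rightarrow> real" where
  "RR M b rs = fps_nth (fps_exp (real_of_int b) *
      (\<Prod>r\<in>#rs. (fps_const (real_of_int r) * fps_X) / (1 - fps_exp (- real_of_int r)))) M"

definition R_contrib :: "nat \<Rightarrow> (nat set \<Rightarrow> nat) \<Rightarrow> (nat set \<Rightarrow> nat set) \<Rightarrow> real" where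
  "R_contrib n m \<tau> =
    (let M = 3 * n - 3 in
     if is_singular n \<tau> then
       (let (i, j, k) = (THE (i, j, k). i \<in> {1..n} \<and> j \<in> {1..n} \<and> k \<in> {1..n} \<and>
                           i \<noteq> j \<and> j \<noteq> k \<and> i \<noteq> k \<and> \<tau> = sing_tab i j k);
            x = int i - int j; y = int j - int k
        in RR M (b_tab m \<tau>) (replicate_mset 3 x + replicate_mset 3 y + r'_mset n i j k)
           / (real_of_int x ^ 3 * real_of_int y ^ 3 * real_of_int (\<Prod>r\<in>#r'_mset n i j k. r)))
     else RR M (b_tab m \<tau>) (r_tab n \<tau>) / real_of_int (\<Prod>r\<in>#r_tab n \<tau>. r))"

end

theory Submission
  imports Defs "HOL-Combinatorics.Cycles" "HOL-Computational_Algebra.Formal_Laurent_Series"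
begin

text \<open>By Maschke's theorem \<open>S\<^sub>D\<close> is the image of an idempotent of the group algebra of the permutations
  of the squares, so its character is a weighted sum over fillings.  Since \<open>D\<close> has three rows, the
  idempotent is killed by antisymmetrising four squares; a superspace with one odd vector then expresses
  the character for \<open>n\<close> colours as the sum over all three-element sets \<open>K\<close> of colours of
  the character for \<open>K\<close> divided by \<open>\<Prod>\<^sub>a\<^sub>\<in>\<^sub>K \<Prod>\<^sub>b\<^sub>\<notin>\<^sub>K (1 - x\<^sub>b / x\<^sub>a)\<close>.

  For three colours \<open>S\<^sub>D\<close> is spanned by products of minors of a \<open>3 \<times> 3\<close> matrix, and the incidence
  relations \<open>p\<^sub>1 q\<^sub>1 + p\<^sub>2 q\<^sub>2 + p\<^sub>3 q\<^sub>3 = 0\<close> between the six neighbouring lines and planes leave a basis of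
  standard monomials.  The generating function of these is a cyclic sum over a hexagon, whose vertex sums
  are localized by Lagrange interpolation at the colours.  The nonvanishing terms are the column
  tabloids, and the exponent of \<open>1 - x\<^sub>b / x\<^sub>a\<close> in the denominator of a term is the Euler characteristic of
  the graph defining \<open>d\<^sub>a\<^sub>b\<close>: the number of its components, except for the full hexagon, which has Euler
  characteristic \<open>0\<close> and occurs exactly for singular tabloids.  Putting \<open>x\<^sub>a = exp (a U)\<close> and taking the
  constant coefficient of the resulting Laurent series gives the dimension.\<close>

section \<open>The group algebra of a finite permutation group\<close>

text \<open>For a general diagram the product \<alpha>\<beta> need not be a multiple of an
  idempotent, so no explicit Young symmetrizer is at hand. Regularity of the group algebra replaces
  it: if e c e = e, then c e is an idempotent with the image of e, and as a left multiple of e it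
  inherits the antisymmetry of e. The price is that c is unknown. So for three colours the trace is
  not computed from coefficients but identified, one content at a time, with the dimension of a span
  of products of minors. Such a span is measured by degrees. The nine matrix entries become powers
  of one variable with exponents written in base \<open>N\<close>, so that the degree of a
  polynomial records its leading monomial, and distinct degrees give independence. The tabloid terms
  have poles where colour weights coincide, and only their sum is regular there. Hence the weights
  stay the distinct units exp(aU) of a field of Laurent series until the sum is complete; taking the
  coefficient of U^M in the Riemann-Roch polynomial compensates the pole of order M of a single
  term.\<close>

definition conv :: "('b \<Rightarrow> 'b) set \<Rightarrow> (('b \<Rightarrow> 'b) \<Rightarrow> complex) \<Rightarrow> (('b \<Rightarrow> 'b) \<Rightarrow> complex) \<Rightarrow> ('b \<Rightarrow> 'b) \<Rightarrow> complex"
  where "conv G a b = (\<lambda>\<rho>. \<Sum>\<sigma>\<in>G. a \<sigma> * b (inv \<sigma> \<circ> \<rho>))"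

lemma sum_apply: "(\<Sum>i\<in>A. f i) x = (\<Sum>i\<in>A. f i x)"
  by (induction A rule: infinite_finite_induct) auto

locale perms =
  fixes S :: "'b set"
  assumes finS: "finite S"
begin

definition G where "G = {\<sigma>. \<sigma> permutes S}"

lemma finG [simp, intro]: "finite G"
  by (simp add: G_def finite_permutations finS)

lemma G_id [simp]: "id \<in> G" "(\<lambda>x. x) \<in> G"
  by (auto simp: G_def permutes_id permutes_def)

lemma G_comp [simp]: "a \<in> G \<Longrightarrow> b \<in> G \<Longrightarrow> a \<circ> b \<in> G"
  by (auto simp: G_def intro: permutes_compose)

lemma G_inv [simp]: "a \<in> G \<Longrightarrow> inv a \<in> G"
  by (auto simp: G_def intro: permutes_inv)

lemma G_inv_comp [simp]: "a \<in> G \<Longrightarrow> inv a \<circ> (a \<circ> b) = b" "a \<in> G \<Longrightarrow> a \<circ> (inv a \<circ> b) = b"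
  "a \<in> G \<Longrightarrow> inv a \<circ> a = id" "a \<in> G \<Longrightarrow> a \<circ> inv a = id"
  by (auto simp: G_def fun_eq_iff permutes_inverses)

lemma G_comp_inv: "a \<in> G \<Longrightarrow> b \<in> G \<Longrightarrow> inv (a \<circ> b) = inv b \<circ> inv a"
  by (metis G_def mem_Collect_eq o_inv_distrib permutes_bij)

lemma G_inv_inv [simp]: "a \<in> G \<Longrightarrow> inv (inv a) = a"
  by (metis G_def mem_Collect_eq permutes_inv_inv)

lemma G_neq: "card G \<noteq> 0"
  using G_id(1) finG card_0_eq by blast

lemma sum_G_left:
  assumes "a \<in> G" shows "(\<Sum>\<sigma>\<in>G. f (a \<circ> \<sigma>)) = (\<Sum>\<sigma>\<in>G. f \<sigma>)"
  by (rule sum.reindex_bij_witness[of _ "\<lambda>\<sigma>. inv a \<circ> \<sigma>" "\<lambda>\<sigma>. a \<circ> \<sigma>"]) (use assms in auto)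

lemma sum_G_right:
  assumes "a \<in> G" shows "(\<Sum>\<sigma>\<in>G. f (\<sigma> \<circ> a)) = (\<Sum>\<sigma>\<in>G. f \<sigma>)"
  by (rule sum.reindex_bij_witness[of _ "\<lambda>\<sigma>. \<sigma> \<circ> inv a" "\<lambda>\<sigma>. \<sigma> \<circ> a"])
     (use assms in \<open>auto simp: comp_assoc\<close>)

lemma sum_G_inv: "(\<Sum>\<sigma>\<in>G. f (inv \<sigma>)) = (\<Sum>\<sigma>\<in>G. f \<sigma>)"
  by (rule sum.reindex_bij_witness[of _ "inv" "inv"]) auto

text \<open>Maschke averaging: a linear right inverse of right multiplication by \<open>e\<close>, averaged over
  the group, becomes right multiplication by an element.\<close>
lemma group_algebra_regular:
  "\<exists>c. \<forall>\<rho>\<in>G. conv G e (conv G c e) \<rho> = e \<rho>"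
proof -
  interpret V: vector_space "\<lambda>(c::complex) (v::('b \<Rightarrow> 'b) \<Rightarrow> complex). (\<lambda>g. c * v g)"
    by unfold_locales (auto simp: fun_eq_iff algebra_simps)
  interpret VP: vector_space_pair "\<lambda>(c::complex) (v::('b \<Rightarrow> 'b) \<Rightarrow> complex). (\<lambda>g. c * v g)"
     "\<lambda>(c::complex) (v::('b \<Rightarrow> 'b) \<Rightarrow> complex). (\<lambda>g. c * v g)" ..
  define R where "R = (\<lambda>a \<rho>. if \<rho> \<in> G then conv G a e \<rho> else 0)"
  have linR: "Vector_Spaces.linear (\<lambda>c v g. c * v g) (\<lambda>c v g. c * v g) R"
    by unfold_locales (auto simp: R_def conv_def fun_eq_iff algebra_simps sum.distrib sum_distrib_left)
  \<comment> \<open>\<open>R\<close> is right multiplication by \<open>e\<close>, and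
    \<open>h\<close> is a linear right inverse on its range that need not respect the group
    yet.\<close>
  obtain h where h: "Vector_Spaces.linear (\<lambda>c v g. c * v g) (\<lambda>c v g. c * v g) h"
     "\<And>v. v \<in> range R \<Longrightarrow> R (h v) = v"
    using VP.linear_exists_right_inverse_on[OF linR V.subspace_UNIV] by auto
  interpret h: Vector_Spaces.linear "\<lambda>(c::complex) (v::('b \<Rightarrow> 'b) \<Rightarrow> complex). (\<lambda>g. c * v g)"
     "\<lambda>(c::complex) (v::('b \<Rightarrow> 'b) \<Rightarrow> complex). (\<lambda>g. c * v g)" h by (rule h(1))
  interpret R: Vector_Spaces.linear "\<lambda>(c::complex) (v::('b \<Rightarrow> 'b) \<Rightarrow> complex). (\<lambda>g. c * v g)"
     "\<lambda>(c::complex) (v::('b \<Rightarrow> 'b) \<Rightarrow> complex). (\<lambda>g. c * v g)" R by (rule linR)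
  define \<delta> where "\<delta> = (\<lambda>\<tau> \<rho>. if \<rho> = (\<tau>::'b\<Rightarrow>'b) then 1 else (0::complex))"
  define T where "T = (\<lambda>x. R (h x))"
  have R\<delta>: "R (\<delta> (inv \<tau>)) = (\<lambda>\<rho>. if \<rho> \<in> G then e (\<tau> \<circ> \<rho>) else 0)" if "\<tau> \<in> G" for \<tau>
  proof
    fix \<rho>
    have "(\<Sum>\<sigma>\<in>G. \<delta> (inv \<tau>) \<sigma> * e (inv \<sigma> \<circ> \<rho>)) = (\<Sum>\<sigma>\<in>G. if \<sigma> = inv \<tau> then e (\<tau> \<circ> \<rho>) else 0)"
      by (intro sum.cong refl) (use that in \<open>auto simp: \<delta>_def\<close>)
    then show "R (\<delta> (inv \<tau>)) \<rho> = (if \<rho> \<in> G then e (\<tau> \<circ> \<rho>) else 0)"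
      using that by (simp add: R_def conv_def)
  qed
  \<comment> \<open>The average of the conjugates of \<open>h\<close> by the group commutes with
    left multiplication, hence is right multiplication by its value at the identity. That value is
    \<open>c\<close>.\<close>
  define c where "c = (\<lambda>\<rho>. 1 / of_nat (card G) * (\<Sum>\<tau>\<in>G. h (\<delta> (inv \<tau>)) (inv \<tau> \<circ> \<rho>)))"
  have ce: "conv G c e \<rho> = 1 / of_nat (card G) * (\<Sum>\<tau>\<in>G. T (\<delta> (inv \<tau>)) (inv \<tau> \<circ> \<rho>))"
    if "\<rho> \<in> G" for \<rho>
  proof -
    have inner: "(\<Sum>\<sigma>\<in>G. h (\<delta> (inv \<tau>)) (inv \<tau> \<circ> \<sigma>) * e (inv \<sigma> \<circ> \<rho>)) = T (\<delta> (inv \<tau>)) (inv \<tau> \<circ> \<rho>)"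
      if "\<tau> \<in> G" for \<tau>
    proof -
      have "T (\<delta> (inv \<tau>)) (inv \<tau> \<circ> \<rho>) = (\<Sum>\<sigma>\<in>G. h (\<delta> (inv \<tau>)) \<sigma> * e (inv \<sigma> \<circ> (inv \<tau> \<circ> \<rho>)))"
        using that \<open>\<rho> \<in> G\<close> by (simp add: T_def R_def conv_def)
      also have "\<dots> = (\<Sum>\<sigma>\<in>G. h (\<delta> (inv \<tau>)) (inv \<tau> \<circ> \<sigma>) * e (inv (inv \<tau> \<circ> \<sigma>) \<circ> (inv \<tau> \<circ> \<rho>)))"
        using that by (subst sum_G_left[symmetric, of "inv \<tau>"]) auto
      also have "\<dots> = (\<Sum>\<sigma>\<in>G. h (\<delta> (inv \<tau>)) (inv \<tau> \<circ> \<sigma>) * e (inv \<sigma> \<circ> \<rho>))"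
        using that by (intro sum.cong refl) (simp add: G_comp_inv comp_assoc)
      finally show ?thesis by simp
    qed
    have "conv G c e \<rho> = 1 / of_nat (card G) *
       (\<Sum>\<tau>\<in>G. \<Sum>\<sigma>\<in>G. h (\<delta> (inv \<tau>)) (inv \<tau> \<circ> \<sigma>) * e (inv \<sigma> \<circ> \<rho>))"
      unfolding conv_def c_def
      by (subst sum.swap) (simp add: sum_distrib_left sum_distrib_right mult.assoc)
    also have "\<dots> = 1 / of_nat (card G) * (\<Sum>\<tau>\<in>G. T (\<delta> (inv \<tau>)) (inv \<tau> \<circ> \<rho>))"
      by (simp add: inner)
    finally show ?thesis .
  qed
  have "conv G e (conv G c e) \<rho> = e \<rho>" if \<rho>: "\<rho> \<in> G" for \<rho>
  proof -
    have "conv G e (conv G c e) \<rho>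
       = 1 / of_nat (card G) * (\<Sum>\<sigma>\<in>G. \<Sum>\<tau>\<in>G. e \<sigma> * T (\<delta> (inv \<tau>)) (inv \<tau> \<circ> (inv \<sigma> \<circ> \<rho>)))"
      unfolding conv_def[of _ e] using \<rho>
      by (simp add: ce sum_distrib_left mult_ac)
    also have "(\<Sum>\<sigma>\<in>G. \<Sum>\<tau>\<in>G. e \<sigma> * T (\<delta> (inv \<tau>)) (inv \<tau> \<circ> (inv \<sigma> \<circ> \<rho>)))
       = (\<Sum>\<sigma>\<in>G. \<Sum>\<tau>\<in>G. e \<sigma> * T (\<delta> (inv \<tau> \<circ> \<sigma>)) (inv \<tau> \<circ> \<rho>))"
    proof (rule sum.cong[OF refl], goal_cases)
      case (1 \<sigma>)
      show ?case
        using 1 by (subst sum_G_left[symmetric, of "inv \<sigma>"]) (auto simp: G_comp_inv comp_assoc intro!: sum.cong)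
    qed
    also have "\<dots> = (\<Sum>\<tau>\<in>G. \<Sum>\<sigma>\<in>G. e \<sigma> * T (\<delta> (inv \<tau> \<circ> \<sigma>)) (inv \<tau> \<circ> \<rho>))"
      by (rule sum.swap)
    also have "\<dots> = (\<Sum>\<tau>\<in>G. e \<rho>)"
    proof (rule sum.cong[OF refl], goal_cases)
      case (1 \<tau>)
      have "(\<Sum>\<sigma>\<in>G. e \<sigma> * T (\<delta> (inv \<tau> \<circ> \<sigma>)) (inv \<tau> \<circ> \<rho>))
          = (\<Sum>\<sigma>\<in>G. (\<lambda>g. e \<sigma> * T (\<delta> (inv \<tau> \<circ> \<sigma>)) g)) (inv \<tau> \<circ> \<rho>)"
        by (simp add: sum_apply)
      also have "(\<Sum>\<sigma>\<in>G. (\<lambda>g. e \<sigma> * T (\<delta> (inv \<tau> \<circ> \<sigma>)) g)) = T (\<Sum>\<sigma>\<in>G. (\<lambda>g. e \<sigma> * \<delta> (inv \<tau> \<circ> \<sigma>) g))"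
        by (simp add: T_def h.sum h.scale R.sum R.scale)
      also have "(\<Sum>\<sigma>\<in>G. (\<lambda>g. e \<sigma> * \<delta> (inv \<tau> \<circ> \<sigma>) g)) = R (\<delta> (inv \<tau>))"
      proof
        fix g
        have eq: "(g = inv \<tau> \<circ> \<sigma>) = (\<sigma> = \<tau> \<circ> g)" if "\<sigma> \<in> G" for \<sigma>
          using 1 by auto
        have "(\<Sum>\<sigma>\<in>G. (\<lambda>g. e \<sigma> * \<delta> (inv \<tau> \<circ> \<sigma>) g)) g = (\<Sum>\<sigma>\<in>G. if \<sigma> = \<tau> \<circ> g then e \<sigma> else 0)"
          unfolding sum_apply by (rule sum.cong) (auto simp: \<delta>_def eq)
        also have "\<dots> = (if \<tau> \<circ> g \<in> G then e (\<tau> \<circ> g) else 0)"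
          by simp
        also have "\<tau> \<circ> g \<in> G \<longleftrightarrow> g \<in> G"
          using 1 by (metis G_comp G_inv G_inv_comp(1))
        finally show "(\<Sum>\<sigma>\<in>G. (\<lambda>g. e \<sigma> * \<delta> (inv \<tau> \<circ> \<sigma>) g)) g = R (\<delta> (inv \<tau>)) g"
          unfolding R\<delta>[OF 1] .
      qed
      \<comment> \<open>The left translates of \<open>e\<close> are values of \<open>R\<close>, and
        there \<open>R\<close> after \<open>h\<close> is the identity.\<close>
      also have "T (R (\<delta> (inv \<tau>))) = R (\<delta> (inv \<tau>))"
        unfolding T_def by (rule h(2)) auto
      also have "R (\<delta> (inv \<tau>)) (inv \<tau> \<circ> \<rho>) = e \<rho>"
        using 1 \<rho> by (simp add: R\<delta>)
      finally show ?case .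
    qed
    finally show ?thesis
      using G_neq by simp
  qed
  then show ?thesis by blast
qed

end

section \<open>Traces of projections on tensor powers\<close>

lemma vector_space_fun:
  "vector_space (\<lambda>(c::complex) (v::'i \<Rightarrow> complex). (\<lambda>g. c * v g))"
  by unfold_locales (auto simp: fun_eq_iff algebra_simps)

text \<open>In a basis \<open>B\<close> of \<open>W\<close> the diagonal entries regroup, for each
  \<open>b\<close>, into the coefficient of \<open>b\<close> in P b = b, which is 1. So the trace
  counts the basis.\<close>

lemma trace_projection:
  fixes P :: "('i \<Rightarrow> complex) \<Rightarrow> ('i \<Rightarrow> complex)"
  assumes fin: "finite I"
    and lin: "Vector_Spaces.linear (\<lambda>(c::complex) v. (\<lambda>g. c * v g)) (\<lambda>(c::complex) v. (\<lambda>g. c * v g)) P"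
    and sub: "module.subspace (\<lambda>(c::complex) v. (\<lambda>g. c * v g)) W"
    and WI: "\<And>w g. w \<in> W \<Longrightarrow> g \<notin> I \<Longrightarrow> w g = 0"
    and PW: "\<And>h. h \<in> I \<Longrightarrow> P (\<lambda>g. if g = h then 1 else 0) \<in> W"
    and Pid: "\<And>w. w \<in> W \<Longrightarrow> P w = w"
  shows "of_nat (vector_space.dim (\<lambda>(c::complex) v. (\<lambda>g. c * v g)) W)
    = (\<Sum>h\<in>I. P (\<lambda>g. if g = h then 1 else 0) h)"
proof -
  interpret V: vector_space "\<lambda>(c::complex) (v::'i \<Rightarrow> complex). (\<lambda>g. c * v g)"
    by (rule vector_space_fun)
  interpret P: Vector_Spaces.linear "\<lambda>(c::complex) (v::'i \<Rightarrow> complex). (\<lambda>g. c * v g)"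
     "\<lambda>(c::complex) (v::'i \<Rightarrow> complex). (\<lambda>g. c * v g)" P by (rule lin)
  define \<delta> where "\<delta> = (\<lambda>h g. if g = (h::'i) then 1 else (0::complex))"
  obtain B where B: "B \<subseteq> W" "V.independent B" "W \<subseteq> V.span B" "card B = V.dim W"
    using V.basis_exists[of W] by auto
  have spanB: "V.span B = W"
    using B sub by (simp add: V.span_minimal subset_antisym)
  have expand: "w = (\<Sum>h\<in>I. (\<lambda>g. w h * \<delta> h g))" if "w \<in> W" for w
  proof
    fix g
    have "(\<Sum>h\<in>I. w h * \<delta> h g) = (\<Sum>h\<in>I. if h = g then w h else 0)"
      by (rule sum.cong) (auto simp: \<delta>_def)
    then show "w g = (\<Sum>h\<in>I. (\<lambda>g. w h * \<delta> h g)) g"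
      using that WI[of w g] fin by (simp add: sum_apply)
  qed
  have "W \<subseteq> V.span (\<delta> ` I)"
  proof
    fix w assume "w \<in> W"
    then have "w = (\<Sum>h\<in>I. (\<lambda>g. w h * \<delta> h g))" by (rule expand)
    also have "\<dots> \<in> V.span (\<delta> ` I)"
      by (intro V.span_sum V.span_scale V.span_base imageI)
    finally show "w \<in> V.span (\<delta> ` I)" .
  qed
  then have finB: "finite B"
    using V.independent_span_bound[of "\<delta> ` I" B] B fin by auto
  have "(\<Sum>h\<in>I. P (\<delta> h) h) = (\<Sum>h\<in>I. (\<Sum>b\<in>B. (\<lambda>g. V.representation B (P (\<delta> h)) b * b g)) h)"
  proof (rule sum.cong[OF refl])
    fix h assume "h \<in> I"
    then have "P (\<delta> h) \<in> V.span B"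
      using PW spanB by (auto simp: \<delta>_def)
    then show "P (\<delta> h) h = (\<Sum>b\<in>B. (\<lambda>g. V.representation B (P (\<delta> h)) b * b g)) h"
      using V.sum_representation_eq[OF B(2) _ finB] by auto
  qed
  also have "\<dots> = (\<Sum>b\<in>B. \<Sum>h\<in>I. b h * V.representation B (P (\<delta> h)) b)"
    unfolding sum_apply by (subst sum.swap) (simp add: mult.commute)
  also have "\<dots> = (\<Sum>b\<in>B. 1)"
  proof (rule sum.cong[OF refl])
    fix b assume b: "b \<in> B"
    have Ph: "(\<lambda>g. b h * P (\<delta> h) g) \<in> V.span B" "P (\<delta> h) \<in> V.span B" if "h \<in> I" for h
      using PW[OF that] spanB by (auto simp: \<delta>_def intro!: V.span_scale)
    have "V.representation B (\<Sum>h\<in>I. (\<lambda>g. b h * P (\<delta> h) g)) b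
       = (\<Sum>h\<in>I. b h * V.representation B (P (\<delta> h)) b)"
      by (subst V.representation_sum[OF B(2)]) (auto simp: Ph V.representation_scale[OF B(2)] intro!: sum.cong)
    also have "(\<Sum>h\<in>I. (\<lambda>g. b h * P (\<delta> h) g)) = P (\<Sum>h\<in>I. (\<lambda>g. b h * \<delta> h g))"
      by (simp add: P.sum P.scale)
    also have "\<dots> = b"
      using expand[of b] Pid[of b] b B(1) by auto
    also have "V.representation B b b = 1"
      using V.representation_basis[OF B(2) b] by simp
    finally show "(\<Sum>h\<in>I. b h * V.representation B (P (\<delta> h)) b) = 1" by simp
  qed
  finally show ?thesis
    using B(4) by (simp add: \<delta>_def)
qed

definition act :: "('b \<Rightarrow> 'b) set \<Rightarrow> (('b \<Rightarrow> 'b) \<Rightarrow> complex) \<Rightarrow> (('b \<Rightarrow> nat) \<Rightarrow> complex) \<Rightarrow> ('b \<Rightarrow> nat) \<Rightarrow> complex"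
  where "act G a v = (\<lambda>g. \<Sum>\<sigma>\<in>G. a \<sigma> * v (g \<circ> inv \<sigma>))"

text \<open>Colour sets are arbitrary because the reduction below deletes colours one at a time. Off
  \<open>S\<close> the value 0 is a normal form; as a colour of squares it is reserved for the odd
  vector.\<close>

definition colourings :: "'b set \<Rightarrow> nat set \<Rightarrow> ('b \<Rightarrow> nat) set"
  where "colourings S A = {f. (\<forall>x\<in>S. f x \<in> A) \<and> (\<forall>x. x \<notin> S \<longrightarrow> f x = 0)}"

lemma finite_colourings [intro]:
  assumes "finite S" "finite A" shows "finite (colourings S A)"
proof (rule finite_subset)
  show "colourings S A \<subseteq> {f. \<forall>x. (x \<in> S \<longrightarrow> f x \<in> A) \<and> (x \<notin> S \<longrightarrow> f x = 0)}"
    by (auto simp: colourings_def)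
  show "finite {f. \<forall>x. (x \<in> S \<longrightarrow> f x \<in> A) \<and> (x \<notin> S \<longrightarrow> f x = (0::nat))}"
    using assms by (rule finite_set_of_finite_funs)
qed

context perms
begin

lemma colourings_comp:
  assumes "\<sigma> \<in> G" "g \<in> colourings S A" shows "g \<circ> \<sigma> \<in> colourings S A"
  using assms by (auto simp: colourings_def G_def permutes_in_image permutes_not_in)

lemma colourings_comp_iff [simp]:
  assumes "\<sigma> \<in> G" shows "g \<circ> \<sigma> \<in> colourings S A \<longleftrightarrow> g \<in> colourings S A"
proof
  assume "g \<circ> \<sigma> \<in> colourings S A"
  then have "g \<circ> \<sigma> \<circ> inv \<sigma> \<in> colourings S A"
    using assms colourings_comp[of "inv \<sigma>" "g \<circ> \<sigma>"] by simp
  then show "g \<in> colourings S A"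
    using assms by (simp add: comp_assoc)
qed (use assms colourings_comp in auto)

lemma act_conv: "act G b (act G a v) = act G (conv G a b) v"
proof
  fix g
  have "act G (conv G a b) v g = (\<Sum>\<sigma>\<in>G. \<Sum>\<rho>\<in>G. a \<sigma> * b (inv \<sigma> \<circ> \<rho>) * v (g \<circ> inv \<rho>))"
    unfolding act_def conv_def by (subst sum.swap) (simp add: sum_distrib_right)
  also have "\<dots> = (\<Sum>\<sigma>\<in>G. \<Sum>\<tau>\<in>G. b \<tau> * (a \<sigma> * v (g \<circ> inv \<tau> \<circ> inv \<sigma>)))"
    by (rule sum.cong[OF refl], subst sum_G_left[symmetric])
       (auto simp: G_comp_inv comp_assoc intro!: sum.cong)
  also have "\<dots> = act G b (act G a v) g"
    unfolding act_def by (subst sum.swap) (simp add: sum_distrib_left)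
  finally show "act G b (act G a v) g = act G (conv G a b) v g" by simp
qed

lemma act_cong: "(\<And>\<sigma>. \<sigma> \<in> G \<Longrightarrow> a \<sigma> = b \<sigma>) \<Longrightarrow> act G a v = act G b v"
  by (simp add: act_def)

lemma act_outside:
  assumes "\<And>g. g \<notin> colourings S A \<Longrightarrow> v g = 0" "g \<notin> colourings S A"
  shows "act G a v g = 0"
  using assms by (simp add: act_def)

lemma linear_act:
  "Vector_Spaces.linear (\<lambda>(c::complex) v. (\<lambda>g. c * v g)) (\<lambda>(c::complex) v. (\<lambda>g. c * v g)) (act G a)"
proof -
  interpret V: vector_space "\<lambda>(c::complex) (v::('b \<Rightarrow> nat) \<Rightarrow> complex). (\<lambda>g. c * v g)"
    by (rule vector_space_fun)
  show ?thesis
    by unfold_locales (auto simp: act_def fun_eq_iff algebra_simps sum.distrib sum_distrib_left)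
qed

lemma trace_entry:
  "act G a (\<lambda>g. if g = h then 1 else 0) h = (\<Sum>\<sigma> | \<sigma> \<in> G \<and> h \<circ> \<sigma> = h. a \<sigma>)"
proof -
  have eq: "h \<circ> inv \<sigma> = h \<longleftrightarrow> h \<circ> \<sigma> = h" if "\<sigma> \<in> G" for \<sigma>
    using that by (metis G_inv_comp(3) G_inv_comp(4) comp_assoc comp_id)
  have "act G a (\<lambda>g. if g = h then 1 else 0) h = (\<Sum>\<sigma>\<in>G. if h \<circ> \<sigma> = h then a \<sigma> else 0)"
    unfolding act_def by (rule sum.cong) (auto simp: eq)
  also have "\<dots> = (\<Sum>\<sigma> | \<sigma> \<in> G \<and> h \<circ> \<sigma> = h. a \<sigma>)"
    by (subst sum.inter_filter[symmetric]) auto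
  finally show ?thesis .
qed

text \<open>Since e c e = e, the action of c e maps into the image of \<open>e\<close> and fixes
  that image pointwise, so its trace is the dimension of the image.\<close>

lemma dim_act_image:
  assumes A: "finite A"
    and e': "\<And>\<sigma>. \<sigma> \<in> G \<Longrightarrow> conv G e (conv G c e) \<sigma> = e \<sigma>"
  shows "of_nat (vector_space.dim (\<lambda>(c::complex) v. (\<lambda>g. c * v g))
       (act G e ` {v. \<forall>g. g \<notin> colourings S A \<longrightarrow> v g = 0}))
    = (\<Sum>h\<in>colourings S A. \<Sum>\<sigma> | \<sigma> \<in> G \<and> h \<circ> \<sigma> = h. conv G c e \<sigma>)"
proof -
  let ?W = "act G e ` {v. \<forall>g. g \<notin> colourings S A \<longrightarrow> v g = 0}"
  interpret V: vector_space "\<lambda>(c::complex) (v::('b \<Rightarrow> nat) \<Rightarrow> complex). (\<lambda>g. c * v g)"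
    by (rule vector_space_fun)
  interpret L: Vector_Spaces.linear "\<lambda>(c::complex) v. (\<lambda>g. c * v g)"
    "\<lambda>(c::complex) (v::('b \<Rightarrow> nat) \<Rightarrow> complex). (\<lambda>g. c * v g)" "act G e"
    by (rule linear_act)
  have "of_nat (V.dim ?W) = (\<Sum>h\<in>colourings S A. act G (conv G c e) (\<lambda>g. if g = h then 1 else 0) h)"
  proof (rule trace_projection)
    show "V.subspace ?W"
      by (rule L.subspace_image) (auto simp: V.subspace_def)
    show "act G (conv G c e) (\<lambda>g. if g = h then 1 else 0) \<in> ?W" if "h \<in> colourings S A" for h
      unfolding act_conv[symmetric]
      by (intro imageI CollectI allI impI act_outside[of A]) (use that in auto)
    show "act G (conv G c e) w = w" if "w \<in> ?W" for w
      using that e' by (auto simp: act_conv intro!: act_cong)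
    show "w g = 0" if "w \<in> ?W" "g \<notin> colourings S A" for w g
      using that act_outside[of A _ g e] by blast
  qed (use A finS in \<open>auto intro: linear_act\<close>)
  then show ?thesis by (simp add: trace_entry)
qed

end

section \<open>Reduction to three colours\<close>

text \<open>The Lagrange basis polynomial \<open>L i\<close> takes at 0 the product of the values -
  x_l / (x_i - x_l), and each of these is 1 / (1 - x_i / x_l).\<close>

lemma lagrange_at_zero:
  fixes x :: "nat \<Rightarrow> 'a::field"
  assumes A: "finite A" "inj_on x A" "\<And>i. i \<in> A \<Longrightarrow> x i \<noteq> 0" and p: "degree p < card A"
  shows "poly p 0 = (\<Sum>i\<in>A. poly p (x i) / (\<Prod>l\<in>A-{i}. 1 - x i / x l))"
proof -
  define L where "L = (\<lambda>i. \<Prod>l\<in>A-{i}. smult (1 / (x i - x l)) [:- x l, 1:])"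
  define r where "r = (\<Sum>i\<in>A. smult (poly p (x i)) (L i))"
  have degL: "degree (L i) < card A" if "i \<in> A" for i
  proof -
    have "degree (L i) \<le> (\<Sum>l\<in>A-{i}. 1)"
      unfolding L_def
      by (rule order.trans[OF degree_prod_sum_le], use A in simp)
         (rule sum_mono, unfold o_def, rule order.trans[OF degree_smult_le], simp)
    also have "\<dots> = card A - 1" using that A by simp
    also have "card A - 1 < card A" using p by linarith
    finally show ?thesis .
  qed
  have "card A > 0" using p by simp
  have "degree (smult (poly p (x i)) (L i)) \<le> card A - 1" if "i \<in> A" for i
    using degL[OF that] degree_smult_le[of "poly p (x i)" "L i"] by linarith
  then have "degree r \<le> card A - 1"
    unfolding r_def using A(1) by (intro degree_sum_le) auto
  then have "degree r < card A" using \<open>card A > 0\<close> by linarith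
  have L: "poly (L i) (x j) = (if i = j then 1 else 0)" if "i \<in> A" "j \<in> A" for i j
  proof (cases "i = j")
    case True
    have "poly (smult (1 / (x i - x l)) [:- x l, 1:]) (x i) = 1" if "l \<in> A - {i}" for l
    proof -
      have "x i \<noteq> x l" using that \<open>i \<in> A\<close> A(2) by (auto simp: inj_on_def)
      then have "1 / (x i - x l) * (x i - x l) = 1" by simp
      then show ?thesis by (simp only: poly_smult poly_pCons poly_0) (simp add: algebra_simps)
    qed
    then show ?thesis
      using True unfolding L_def poly_prod by (simp only: prod.neutral_const cong: prod.cong) simp
  next
    case False
    then show ?thesis
      using that A by (auto simp: L_def poly_prod intro!: prod_zero bexI[of _ j])
  qed
  have "p = r"
  proof (rule poly_eqI_degree[of "x ` A"])
    show "poly p y = poly r y" if "y \<in> x ` A" for y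
      using that A by (auto simp: r_def poly_sum L if_distrib[where f="\<lambda>x. _ * x"] cong: if_cong)
  qed (use p \<open>degree r < card A\<close> A in \<open>auto simp: card_image\<close>)
  then have "poly p 0 = poly r 0" by simp
  also have "\<dots> = (\<Sum>i\<in>A. poly p (x i) * (\<Prod>l\<in>A-{i}. - x l / (x i - x l)))"
    by (simp add: r_def poly_sum L_def poly_prod)
  also have "\<dots> = (\<Sum>i\<in>A. poly p (x i) * (\<Prod>l\<in>A-{i}. 1 / (1 - x i / x l)))"
  proof (intro sum.cong refl arg_cong2[where f="(*)"] prod.cong, goal_cases)
    case (1 i l)
    then have "x l \<noteq> 0" "x i \<noteq> x l" using A by (auto simp: inj_on_def)
    then show ?case by (simp add: field_simps)
  qed
  finally show ?thesis by (simp add: prod_dividef)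
qed

lemma sign_cycle_of_list:
  assumes "distinct cs" "cs \<noteq> []"
  shows "sign (cycle_of_list cs) = (-1) ^ (length cs - 1)"
  using assms
proof (induction cs rule: cycle_of_list.induct)
  case (1 i j cs)
  then have "sign (cycle_of_list (i # j # cs)) = sign (Transposition.transpose i j) * sign (cycle_of_list (j # cs))"
    by (simp only: cycle_of_list.simps sign_compose permutation_swap_id permutation_of_cycle)
  then show ?case using 1 by (simp add: sign_swap_id del: cycle_of_list.simps)
qed (auto simp: id_def[symmetric])

text \<open>In a supertrace the sign of a permutation is taken on the odd squares only; cutting a
  permutation down to an invariant set produces the permutation whose sign is meant.\<close>

definition restr :: "('b \<Rightarrow> 'b) \<Rightarrow> 'b set \<Rightarrow> 'b \<Rightarrow> 'b"
  where "restr \<sigma> T = (\<lambda>z. if z \<in> T then \<sigma> z else z)"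

context perms
begin

lemma restr_permutes:
  assumes "\<sigma> \<in> G" "\<sigma> ` T \<subseteq> T" "T \<subseteq> S" shows "restr \<sigma> T permutes T"
proof (rule bij_imp_permutes)
  have inj: "inj_on \<sigma> T"
    using assms by (auto simp: G_def intro: inj_on_subset permutes_inj)
  have "finite T" using assms finS finite_subset by auto
  then have "\<sigma> ` T = T"
    using assms inj by (simp add: endo_inj_surj)
  then have "bij_betw \<sigma> T T"
    using inj by (simp add: bij_betw_def)
  then show "bij_betw (restr \<sigma> T) T T"
    by (subst bij_betw_cong[of _ _ \<sigma>]) (auto simp: restr_def)
qed (auto simp: restr_def)

lemma restr_G:
  assumes "\<sigma> \<in> G" "\<sigma> ` T \<subseteq> T" "T \<subseteq> S" shows "permutation (restr \<sigma> T)"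
  using restr_permutes[OF assms] finS assms(3) finite_subset permutation_permutes by blast

section \<open>Characters of a superspace with one odd colour\<close>

definition weighted_trace :: "(('b \<Rightarrow> 'b) \<Rightarrow> 'a::field_char_0) \<Rightarrow> nat set \<Rightarrow> (nat \<Rightarrow> 'a) \<Rightarrow> 'a"
  where "weighted_trace \<epsilon> A x =
    (\<Sum>g\<in>colourings S A. (\<Prod>z\<in>S. x (g z)) * (\<Sum>\<sigma> | \<sigma> \<in> G \<and> g \<circ> \<sigma> = g. \<epsilon> \<sigma>))"

text \<open>The trace on the superspace with one additional odd basis vector, of colour \<open>0\<close> and
  weight \<open>- x 0\<close> in the usual sign convention.\<close>
definition super_trace :: "(('b \<Rightarrow> 'b) \<Rightarrow> 'a::field_char_0) \<Rightarrow> nat set \<Rightarrow> (nat \<Rightarrow> 'a) \<Rightarrow> 'a"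
  where "super_trace \<epsilon> A x =
    (\<Sum>g\<in>colourings S (insert 0 A). (\<Prod>z\<in>S. x (g z)) *
       (\<Sum>\<sigma> | \<sigma> \<in> G \<and> g \<circ> \<sigma> = g. of_int (sign (restr \<sigma> {z\<in>S. g z = 0})) * \<epsilon> \<sigma>))"

lemma colourings_zero_free:
  assumes "g \<in> colourings S A" "0 \<notin> A" shows "{z\<in>S. g z = 0} = {}"
proof -
  have "g z \<noteq> 0" if "z \<in> S" for z
  proof
    assume "g z = 0"
    moreover have "g z \<in> A" using that assms(1) by (simp add: colourings_def)
    ultimately show False using assms(2) by simp
  qed
  then show ?thesis by blast
qed

lemma stab_invariant:
  assumes "\<sigma> \<in> G" "g \<circ> \<sigma> = g" shows "\<sigma> ` {z\<in>S. g z = c} \<subseteq> {z\<in>S. g z = c}"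
  using assms by (auto simp: G_def permutes_in_image fun_eq_iff)

text \<open>Multiplying the summation variable by a permutation of the odd squares keeps it in the
  stabilizer of \<open>g\<close> and changes the sign factor by the sign of that permutation.
  Averaging over all such permutations antisymmetrizes \<open>\<epsilon>\<close> in the odd
  squares.\<close>

lemma super_coeff_zero:
  assumes anti: "\<And>\<sigma>. \<sigma> \<in> G \<Longrightarrow> (\<Sum>\<pi> | \<pi> permutes {z\<in>S. g z = 0}. of_int (sign \<pi>) * \<epsilon> (\<sigma> \<circ> \<pi>)) = (0::'a::field_char_0)"
  shows "(\<Sum>\<sigma> | \<sigma> \<in> G \<and> g \<circ> \<sigma> = g. of_int (sign (restr \<sigma> {z\<in>S. g z = 0})) * \<epsilon> \<sigma>) = 0"
proof -
  define T where "T = {z\<in>S. g z = 0}"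
  define I where "I = (\<Sum>\<sigma> | \<sigma> \<in> G \<and> g \<circ> \<sigma> = g. of_int (sign (restr \<sigma> T)) * \<epsilon> \<sigma>)"
  have TS: "T \<subseteq> S" "finite T" using finS by (auto simp: T_def)
  have gpi: "g \<circ> \<pi> = g" if "\<pi> permutes T" for \<pi>
  proof
    fix z
    show "(g \<circ> \<pi>) z = g z"
      using that permutes_in_image[OF that, of z] permutes_not_in[OF that, of z]
      by (cases "z \<in> T") (auto simp: T_def)
  qed
  have piG: "\<pi> \<in> G" if "\<pi> permutes T" for \<pi>
    using that TS by (auto simp: G_def intro: permutes_subset)
  have I\<pi>: "I = (\<Sum>\<sigma> | \<sigma> \<in> G \<and> g \<circ> \<sigma> = g. of_int (sign (restr \<sigma> T)) * (of_int (sign \<pi>) * \<epsilon> (\<sigma> \<circ> \<pi>)))"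
    if \<pi>: "\<pi> permutes T" for \<pi>
  proof -
    have \<pi>': "inv \<pi> permutes T" using \<pi> by (rule permutes_inv)
    have "I = (\<Sum>\<sigma> | \<sigma> \<in> G \<and> g \<circ> \<sigma> = g. of_int (sign (restr (\<sigma> \<circ> \<pi>) T)) * \<epsilon> (\<sigma> \<circ> \<pi>))"
      unfolding I_def
      by (rule sum.reindex_bij_witness[of _ "\<lambda>\<sigma>. \<sigma> \<circ> \<pi>" "\<lambda>\<sigma>. \<sigma> \<circ> inv \<pi>"])
         (use piG[OF \<pi>] piG[OF \<pi>'] gpi[OF \<pi>] gpi[OF \<pi>'] in \<open>auto simp: comp_assoc\<close>,
          (metis comp_assoc)+)
    also have "\<dots> = (\<Sum>\<sigma> | \<sigma> \<in> G \<and> g \<circ> \<sigma> = g. of_int (sign (restr \<sigma> T)) * (of_int (sign \<pi>) * \<epsilon> (\<sigma> \<circ> \<pi>)))"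
    proof (rule sum.cong[OF refl], goal_cases)
      case (1 \<sigma>)
      have "restr (\<sigma> \<circ> \<pi>) T = restr \<sigma> T \<circ> \<pi>"
        using permutes_in_image[OF \<pi>] permutes_not_in[OF \<pi>] by (auto simp: restr_def fun_eq_iff)
      moreover have "permutation (restr \<sigma> T)"
        using 1 TS stab_invariant[of \<sigma> g 0] by (intro restr_G) (auto simp: T_def)
      moreover have "permutation \<pi>" using \<pi> TS permutation_permutes by blast
      ultimately show ?case by (simp add: sign_compose)
    qed
    finally show ?thesis .
  qed
  have "of_nat (card {\<pi>. \<pi> permutes T}) * I = (\<Sum>\<pi> | \<pi> permutes T. I)" by simp
  also have "\<dots> = (\<Sum>\<pi> | \<pi> permutes T. \<Sum>\<sigma> | \<sigma> \<in> G \<and> g \<circ> \<sigma> = g. of_int (sign (restr \<sigma> T)) * (of_int (sign \<pi>) * \<epsilon> (\<sigma> \<circ> \<pi>)))"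
    by (rule sum.cong[OF refl]) (use I\<pi> in simp)
  also have "\<dots> = (\<Sum>\<sigma> | \<sigma> \<in> G \<and> g \<circ> \<sigma> = g. of_int (sign (restr \<sigma> T)) * (\<Sum>\<pi> | \<pi> permutes T. of_int (sign \<pi>) * \<epsilon> (\<sigma> \<circ> \<pi>)))"
    by (subst sum.swap) (simp add: sum_distrib_left)
  also have "\<dots> = 0"
    using anti by (intro sum.neutral) (auto simp: T_def)
  finally have "of_nat (card {\<pi>. \<pi> permutes T}) * I = 0" .
  moreover have "card {\<pi>. \<pi> permutes T} \<noteq> 0"
    using TS by (simp add: card_permutations)
  ultimately show ?thesis by (simp add: I_def T_def)
qed

text \<open>The power of y in a term is the number of odd squares of its colouring, and terms with
  at least \<open>N\<close> odd squares vanish by antisymmetry. The odd weight is -y so that the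
  cancellation against colour i happens at y = x i.\<close>

lemma super_trace_poly:
  fixes \<epsilon> :: "('b \<Rightarrow> 'b) \<Rightarrow> 'a::field_char_0"
  assumes A: "finite A" "0 \<notin> A"
    and anti: "\<And>T \<sigma>. T \<subseteq> S \<Longrightarrow> card T \<ge> N \<Longrightarrow> \<sigma> \<in> G \<Longrightarrow>
      (\<Sum>\<pi> | \<pi> permutes T. of_int (sign \<pi>) * \<epsilon> (\<sigma> \<circ> \<pi>)) = 0"
    and N: "N > 0"
  obtains p where "degree p < N" "\<And>y. super_trace \<epsilon> A (x(0 := - y)) = poly p y"
proof
  define c :: "('b \<Rightarrow> nat) \<Rightarrow> 'a" where "c = (\<lambda>g. (\<Sum>\<sigma> | \<sigma> \<in> G \<and> g \<circ> \<sigma> = g. of_int (sign (restr \<sigma> {z\<in>S. g z = 0})) * \<epsilon> \<sigma>))"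
  define p where "p = (\<Sum>g | g \<in> colourings S (insert 0 A) \<and> card {z\<in>S. g z = 0} < N.
      monom ((-1) ^ card {z\<in>S. g z = 0} * (\<Prod>z\<in>S - {z\<in>S. g z = 0}. x (g z)) * c g) (card {z\<in>S. g z = 0}))"
  have fin: "finite (colourings S (insert 0 A))" using finS A by auto
  show "degree p < N"
    unfolding p_def using N
    by (intro le_less_trans[OF degree_sum_le[of _ _ "N - 1"]])
       (use fin N in \<open>auto intro!: order.trans[OF degree_monom_le]\<close>)
  fix y
  have "super_trace \<epsilon> A (x(0 := - y)) = (\<Sum>g\<in>colourings S (insert 0 A). (\<Prod>z\<in>S. (x(0:=-y)) (g z)) * c g)"
    by (simp add: super_trace_def c_def)
  also have "\<dots> = (\<Sum>g | g \<in> colourings S (insert 0 A) \<and> card {z\<in>S. g z = 0} < N.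
       (\<Prod>z\<in>S. (x(0:=-y)) (g z)) * c g)"
  proof (rule sum.mono_neutral_right)
    show "\<forall>g\<in>colourings S (insert 0 A) - {g \<in> colourings S (insert 0 A). card {z \<in> S. g z = 0} < N}.
       (\<Prod>z\<in>S. (x(0 := - y)) (g z)) * c g = 0"
    proof
      fix g assume "g \<in> colourings S (insert 0 A) - {g \<in> colourings S (insert 0 A). card {z \<in> S. g z = 0} < N}"
      then have "c g = 0"
        unfolding c_def by (intro super_coeff_zero anti) auto
      then show "(\<Prod>z\<in>S. (x(0 := - y)) (g z)) * c g = 0" by simp
    qed
  qed (use fin in auto)
  also have "\<dots> = poly p y"
    unfolding p_def poly_sum poly_monom
  proof (rule sum.cong[OF refl])
    fix g :: "'b \<Rightarrow> nat"
    let ?T = "{z\<in>S. g z = 0}"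
    have "(\<Prod>z\<in>S. (x(0:=-y)) (g z)) = (\<Prod>z\<in>?T. (x(0:=-y)) (g z)) * (\<Prod>z\<in>S-?T. (x(0:=-y)) (g z))"
      using finS by (subst prod.subset_diff[of ?T]) (auto simp: mult.commute)
    also have "(\<Prod>z\<in>?T. (x(0:=-y)) (g z)) = (\<Prod>z\<in>?T. -y)"
      by (rule prod.cong) auto
    also have "\<dots> = (-1) ^ card ?T * y ^ card ?T"
      by (simp add: power_mult_distrib[symmetric])
    also have "(\<Prod>z\<in>S-?T. (x(0:=-y)) (g z)) = (\<Prod>z\<in>S-?T. x (g z))"
      by (rule prod.cong) auto
    finally show "(\<Prod>z\<in>S. (x(0 := - y)) (g z)) * c g =
         (- 1) ^ card ?T * (\<Prod>z\<in>S - ?T. x (g z)) * c g * y ^ card ?T"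
      by simp
  qed
  finally show "super_trace \<epsilon> A (x(0 := - y)) = poly p y" .
qed

lemma super_trace_zero:
  assumes A: "finite A" "0 \<notin> A" and x0: "x 0 = 0"
  shows "super_trace \<epsilon> A x = weighted_trace \<epsilon> A x"
proof -
  have sub: "colourings S A \<subseteq> colourings S (insert 0 A)" by (auto simp: colourings_def)
  have fin: "finite (colourings S (insert 0 A))" using finS A by auto
  show ?thesis
    unfolding super_trace_def weighted_trace_def
  proof (rule sum.mono_neutral_cong_right[OF fin sub])
    show "\<forall>g\<in>colourings S (insert 0 A) - colourings S A. (\<Prod>z\<in>S. x (g z)) *
       (\<Sum>\<sigma> | \<sigma> \<in> G \<and> g \<circ> \<sigma> = g. of_int (sign (restr \<sigma> {z\<in>S. g z = 0})) * \<epsilon> \<sigma>) = 0"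
    proof
      fix g assume "g \<in> colourings S (insert 0 A) - colourings S A"
      then obtain z where "z \<in> S" "g z = 0" by (auto simp: colourings_def)
      then have "(\<Prod>z\<in>S. x (g z)) = 0" using finS x0 by (intro prod_zero bexI[of _ z]) auto
      then show "(\<Prod>z\<in>S. x (g z)) *
       (\<Sum>\<sigma> | \<sigma> \<in> G \<and> g \<circ> \<sigma> = g. of_int (sign (restr \<sigma> {z\<in>S. g z = 0})) * \<epsilon> \<sigma>) = 0" by simp
    qed
    fix g assume "g \<in> colourings S A"
    then have e: "{z\<in>S. g z = 0} = {}" using A by (intro colourings_zero_free) auto
    have r: "restr \<sigma> {} = id" for \<sigma> :: "'b \<Rightarrow> 'b" by (auto simp: restr_def)
    show "(\<Prod>z\<in>S. x (g z)) *
       (\<Sum>\<sigma> | \<sigma> \<in> G \<and> g \<circ> \<sigma> = g. of_int (sign (restr \<sigma> {z\<in>S. g z = 0})) * \<epsilon> \<sigma>)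
      = (\<Prod>z\<in>S. x (g z)) * (\<Sum>\<sigma> | \<sigma> \<in> G \<and> g \<circ> \<sigma> = g. \<epsilon> \<sigma>)"
      unfolding e r by simp
  qed
qed

text \<open>A cycle of length k coloured by 0 contributes (-1)^(k-1) (x 0)^k = - (x i)^k, the
  negative of the same cycle coloured by i. For each permutation, recolouring one cycle is therefore
  a sign-reversing involution on the invariant colourings that use 0 or i.\<close>

lemma super_trace_cancel:
  fixes \<epsilon> :: "('b \<Rightarrow> 'b) \<Rightarrow> 'a::field_char_0"
  assumes A: "finite A" "0 \<notin> A" and i: "i \<in> A" and x0: "x 0 = - x i"
  shows "super_trace \<epsilon> A x = weighted_trace \<epsilon> (A - {i}) x"
proof -
  define w where "w = (\<lambda>\<sigma> g. (\<Prod>z\<in>S. x (g z)) * of_int (sign (restr \<sigma> {z\<in>S. g z = 0})))"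
  have i0: "i \<noteq> 0"
  proof
    assume "i = 0"
    then show False using A(2) i by simp
  qed
  have fin: "finite (colourings S (insert 0 A))" "finite (colourings S (A - {i}))"
    using finS A by auto
  define U where "U = (\<lambda>g. {z\<in>S. g z = 0 \<or> g z = i})"
  have key: "(\<Sum>g | g \<in> colourings S (insert 0 A) \<and> g \<circ> \<sigma> = g \<and> U g \<noteq> {}. w \<sigma> g) = 0" if \<sigma>: "\<sigma> \<in> G" for \<sigma>
  proof -
    let ?Z = "{g. g \<in> colourings S (insert 0 A) \<and> g \<circ> \<sigma> = g \<and> U g \<noteq> {}}"
    \<comment> \<open>The cycle to be recoloured is chosen from \<open>U g\<close> alone, a set that
      recolouring does not change; so recolouring twice meets the same cycle.\<close>
    define z0 where "z0 = (\<lambda>V. SOME z::'b. z \<in> V)"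
    define Or where "Or = (\<lambda>g. set (support \<sigma> (z0 (U g))))"
    define sw where "sw = (\<lambda>g z. if z \<in> Or g then (if g z = 0 then i else 0) else g z)"
    have sw_app: "sw h z = (if z \<in> Or h then (if h z = 0 then i else 0) else h z)" for h z
      by (simp add: sw_def)
    have perm: "permutation \<sigma>" using \<sigma> finS by (auto simp: G_def permutation_permutes)
    have Oeq: "Or g = range (\<lambda>k. (\<sigma> ^^ k) (z0 (U g)))" for g
      unfolding Or_def by (rule support_set[OF perm])
    have O_closed: "\<sigma> z \<in> Or g" if "z \<in> Or g" for z g
    proof -
      obtain k where "z = (\<sigma> ^^ k) (z0 (U g))" using \<open>z \<in> Or g\<close> unfolding Oeq by blast
      then have "\<sigma> z = (\<sigma> ^^ Suc k) (z0 (U g))" by simp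
      then show ?thesis unfolding Oeq by blast
    qed
    have finO: "finite (Or g)" for g by (simp add: Or_def)
    have inj: "inj \<sigma>" using \<sigma> by (auto simp: G_def permutes_inj)
    have O_img: "\<sigma> ` Or g = Or g" for g
      by (rule endo_inj_surj[OF finO]) (use O_closed inj in \<open>auto intro: inj_on_subset\<close>)
    have O_iff: "\<sigma> z \<in> Or g \<longleftrightarrow> z \<in> Or g" for z g
      using O_img[of g] inj by (metis inj_image_mem_iff)
    have z0: "z0 (U g) \<in> U g" if "g \<in> ?Z" for g
      using that unfolding z0_def by (auto intro: someI)
    have g_pow: "g ((\<sigma> ^^ k) z) = g z" if "g \<circ> \<sigma> = g" for g k z
      using that by (induction k) (auto simp: fun_eq_iff)
    have g_O: "g z = g (z0 (U g))" if "g \<in> ?Z" "z \<in> Or g" for g z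
      using that g_pow[of g] Oeq[of g] by auto
    have pow_S: "(\<sigma> ^^ k) z \<in> S" if "z \<in> S" for k z
      using that \<sigma> by (induction k) (auto simp: G_def permutes_in_image)
    have O_U: "Or g \<subseteq> U g" if g: "g \<in> ?Z" for g
    proof
      fix z assume z: "z \<in> Or g"
      then have "z \<in> S" using z0[OF g] pow_S Oeq[of g] by (auto simp: U_def)
      then show "z \<in> U g" using g_O[OF g z] z0[OF g] by (auto simp: U_def)
    qed
    have O_S: "Or g \<subseteq> S" if g: "g \<in> ?Z" for g using O_U[OF g] by (auto simp: U_def)
    have U_sw: "U (sw g) = U g" if g: "g \<in> ?Z" for g
      using O_U[OF g] by (auto simp: U_def sw_def)
    have O_sw: "Or (sw g) = Or g" if g: "g \<in> ?Z" for g
      by (simp add: Or_def U_sw[OF g])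
    have sw_Z: "sw g \<in> ?Z" if g: "g \<in> ?Z" for g
    proof -
      have "sw g \<in> colourings S (insert 0 A)"
        using g O_S[OF g] i by (auto simp: sw_def colourings_def)
      moreover have "sw g \<circ> \<sigma> = sw g"
        using g by (auto simp: fun_eq_iff sw_def O_iff)
      moreover have "U (sw g) \<noteq> {}" using U_sw[OF g] g by simp
      ultimately show ?thesis by simp
    qed
    have sw_sw: "sw (sw g) = g" if g: "g \<in> ?Z" for g
    proof
      fix z
      show "sw (sw g) z = g z"
      proof (cases "z \<in> Or g")
        case True
        then have "g z = 0 \<or> g z = i" using O_U[OF g] by (auto simp: U_def)
        moreover have "sw (sw g) z = (if sw g z = 0 then i else 0)" "sw g z = (if g z = 0 then i else 0)"
          using True by (simp_all add: sw_app O_sw[OF g])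
        ultimately show ?thesis using i0 by auto
      next
        case False
        then show ?thesis by (simp add: sw_app O_sw[OF g])
      qed
    qed
    have sgnOr: "sign (restr \<sigma> (Or g)) = (-1) ^ (card (Or g) - 1)" for g
    proof -
      let ?cs = "support \<sigma> (z0 (U g))"
      have "restr \<sigma> (Or g) = cycle_of_list ?cs"
        using cycle_restrict[OF perm, of _ "z0 (U g)"] id_outside_supp[of _ ?cs]
        by (auto simp: restr_def Or_def fun_eq_iff simp del: set_map)
      moreover have "distinct ?cs" by (rule cycle_of_permutation[OF perm])
      moreover have "?cs \<noteq> []" using least_power_of_permutation(2)[OF perm, of "z0 (U g)"] by simp
      moreover have "card (Or g) = length ?cs"
        unfolding Or_def using \<open>distinct ?cs\<close> by (rule distinct_card)
      ultimately show ?thesis using sign_cycle_of_list[of ?cs] by simp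
    qed
    have cardO: "card (Or g) > 0" for g
      using finO[of g] Oeq[of g] by (auto simp: card_gt_0_iff)
    \<comment> \<open>Only the change from i to 0 is computed. The other direction follows because
      \<open>sw\<close> is an involution.\<close>
    have w_one: "w \<sigma> (sw g) = - w \<sigma> g" if g: "g \<in> ?Z" and gi: "g (z0 (U g)) = i" for g
    proof -
      define T where "T = {z\<in>S. g z = 0}"
      have gO: "g z = i" if "z \<in> Or g" for z using g_O[OF g that] gi by simp
      have T': "{z\<in>S. sw g z = 0} = T \<union> Or g"
        using gO O_S[OF g] i0 by (auto simp: sw_def T_def)
      have disj: "T \<inter> Or g = {}" using gO i0 by (auto simp: T_def)
      have Tcl: "\<sigma> ` T \<subseteq> T" using g stab_invariant[OF \<sigma>, of g 0] by (simp add: T_def)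
      have "restr \<sigma> (T \<union> Or g) = restr \<sigma> T \<circ> restr \<sigma> (Or g)"
        using disj O_closed Tcl by (auto simp: restr_def fun_eq_iff)
      moreover have "permutation (restr \<sigma> T)"
        by (rule restr_G[OF \<sigma> Tcl]) (auto simp: T_def)
      moreover have "permutation (restr \<sigma> (Or g))"
        by (rule restr_G[OF \<sigma>]) (use O_img O_S[OF g] in auto)
      ultimately have sg: "sign (restr \<sigma> (T \<union> Or g)) = sign (restr \<sigma> T) * (-1) ^ (card (Or g) - 1)"
        by (simp add: sign_compose sgnOr)
      have pr: "(\<Prod>z\<in>S. x (h z)) = (\<Prod>z\<in>S - Or g. x (h z)) * (\<Prod>z\<in>Or g. x (h z))" for h
        using O_S[OF g] finS by (subst prod.subset_diff[of "Or g"]) auto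
      have "(\<Prod>z\<in>S. x (sw g z)) = (\<Prod>z\<in>S - Or g. x (g z)) * (\<Prod>z\<in>Or g. - x i)"
        unfolding pr using gO i0 x0 by (intro arg_cong2[where f="(*)"] prod.cong) (auto simp: sw_def)
      also have "(\<Prod>z\<in>Or g. - x i) = (-1) ^ card (Or g) * (\<Prod>z\<in>Or g. x (g z))"
        using gO by (simp add: power_mult_distrib[symmetric])
      finally have ps: "(\<Prod>z\<in>S. x (sw g z)) = (-1) ^ card (Or g) * (\<Prod>z\<in>S. x (g z))"
        unfolding pr[of g] by (simp add: mult_ac)
      obtain k where k: "card (Or g) = Suc k" using cardO[of g] by (cases "card (Or g)") auto
      have "(-1::'a) ^ k * (-1) ^ k = 1" by (simp add: power_mult_distrib[symmetric])
      then show ?thesis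
        unfolding w_def T' ps sg by (simp add: T_def k mult_ac)
    qed
    have w_neg: "w \<sigma> (sw g) = - w \<sigma> g" if g: "g \<in> ?Z" for g
    proof (cases "g (z0 (U g)) = i")
      case True
      then show ?thesis using w_one[OF g] by simp
    next
      case False
      then have "g (z0 (U g)) = 0" using z0[OF g] by (auto simp: U_def)
      moreover have "z0 (U g) \<in> Or g" unfolding Oeq by (rule range_eqI[of _ _ 0]) simp
      ultimately have "sw g (z0 (U (sw g))) = i" by (simp add: U_sw[OF g] sw_app)
      then have "w \<sigma> (sw (sw g)) = - w \<sigma> (sw g)" by (rule w_one[OF sw_Z[OF g]])
      then show ?thesis using sw_sw[OF g] by simp
    qed
    have "sum (w \<sigma>) ?Z = (\<Sum>g\<in>?Z. w \<sigma> (sw g))"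
      by (rule sum.reindex_bij_witness[of _ sw sw]) (use sw_Z sw_sw in auto)
    also have "\<dots> = - sum (w \<sigma>) ?Z"
      using w_neg by (simp add: sum_negf)
    finally show ?thesis by simp
  qed
  have split: "{g. g \<in> colourings S (insert 0 A) \<and> g \<circ> \<sigma> = g} =
      {g. g \<in> colourings S (A - {i}) \<and> g \<circ> \<sigma> = g} \<union>
      {g. g \<in> colourings S (insert 0 A) \<and> g \<circ> \<sigma> = g \<and> U g \<noteq> {}}" for \<sigma>
    by (auto simp: colourings_def U_def)
  have swp: "(\<Sum>g\<in>C. f g * (\<Sum>\<sigma> | \<sigma> \<in> G \<and> g \<circ> \<sigma> = g. h g \<sigma> * \<epsilon> \<sigma>))
     = (\<Sum>\<sigma>\<in>G. \<epsilon> \<sigma> * (\<Sum>g | g \<in> C \<and> g \<circ> \<sigma> = g. f g * h g \<sigma>))" if "finite C" for C f h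
  proof -
    have "(\<Sum>g\<in>C. f g * (\<Sum>\<sigma> | \<sigma> \<in> G \<and> g \<circ> \<sigma> = g. h g \<sigma> * \<epsilon> \<sigma>))
      = (\<Sum>g\<in>C. \<Sum>\<sigma> | \<sigma> \<in> G \<and> g \<circ> \<sigma> = g. \<epsilon> \<sigma> * (f g * h g \<sigma>))"
      by (simp add: sum_distrib_left mult_ac)
    also have "\<dots> = (\<Sum>\<sigma>\<in>G. \<Sum>g | g \<in> C \<and> g \<circ> \<sigma> = g. \<epsilon> \<sigma> * (f g * h g \<sigma>))"
      by (rule sum.swap_restrict) (use that in auto)
    finally show ?thesis by (simp add: sum_distrib_left)
  qed
  have "super_trace \<epsilon> A x = (\<Sum>\<sigma>\<in>G. \<epsilon> \<sigma> * (\<Sum>g | g \<in> colourings S (insert 0 A) \<and> g \<circ> \<sigma> = g. w \<sigma> g))"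
    unfolding super_trace_def w_def by (rule swp[OF fin(1)])
  also have "\<dots> = (\<Sum>\<sigma>\<in>G. \<epsilon> \<sigma> * (\<Sum>g | g \<in> colourings S (A - {i}) \<and> g \<circ> \<sigma> = g. (\<Prod>z\<in>S. x (g z)) * 1))"
  proof (rule sum.cong[OF refl])
    fix \<sigma> assume \<sigma>: "\<sigma> \<in> G"
    have "(\<Sum>g | g \<in> colourings S (insert 0 A) \<and> g \<circ> \<sigma> = g. w \<sigma> g)
       = (\<Sum>g | g \<in> colourings S (A - {i}) \<and> g \<circ> \<sigma> = g. w \<sigma> g) + 0"
      unfolding split
    proof (subst sum.union_disjoint)
      show "{g \<in> colourings S (A - {i}). g \<circ> \<sigma> = g} \<inter>
          {g \<in> colourings S (insert 0 A). g \<circ> \<sigma> = g \<and> U g \<noteq> {}} = {}"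
        using A(2) by (auto simp: colourings_def U_def)
    qed (use fin key[OF \<sigma>] in auto)
    also have "(\<Sum>g | g \<in> colourings S (A - {i}) \<and> g \<circ> \<sigma> = g. w \<sigma> g)
      = (\<Sum>g | g \<in> colourings S (A - {i}) \<and> g \<circ> \<sigma> = g. (\<Prod>z\<in>S. x (g z)) * 1)"
    proof (rule sum.cong[OF refl])
      fix g assume "g \<in> {g. g \<in> colourings S (A - {i}) \<and> g \<circ> \<sigma> = g}"
      then have e: "{z\<in>S. g z = 0} = {}" using A by (intro colourings_zero_free[of _ "A - {i}"]) auto
      have r: "restr \<sigma> {} = id" by (auto simp: restr_def)
      show "w \<sigma> g = (\<Prod>z\<in>S. x (g z)) * 1" unfolding w_def e r by simp
    qed
    finally show "\<epsilon> \<sigma> * (\<Sum>g | g \<in> colourings S (insert 0 A) \<and> g \<circ> \<sigma> = g. w \<sigma> g)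
      = \<epsilon> \<sigma> * (\<Sum>g | g \<in> colourings S (A - {i}) \<and> g \<circ> \<sigma> = g. (\<Prod>z\<in>S. x (g z)) * 1)"
      by (simp only: add_0_right)
  qed
  also have "\<dots> = weighted_trace \<epsilon> (A - {i}) x"
    unfolding weighted_trace_def using swp[OF fin(2), of "\<lambda>g. \<Prod>z\<in>S. x (g z)" "\<lambda>_ _. 1"] by simp
  finally show ?thesis .
qed

lemma weighted_trace_cong:
  assumes "\<And>a. a \<in> A \<Longrightarrow> x a = y a" shows "weighted_trace \<epsilon> A x = weighted_trace \<epsilon> A y"
  unfolding weighted_trace_def
  by (intro sum.cong refl arg_cong2[where f="(*)"] prod.cong) (use assms in \<open>auto simp: colourings_def\<close>)

text \<open>The supertrace is a polynomial of degree below \<open>N\<close> in y. Its value at 0 is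
  the trace for \<open>A\<close>, its value at x i the trace with colour i deleted, and
  interpolation at these nodes relates them.\<close>

lemma weighted_trace_recursion:
  fixes \<epsilon> :: "('b \<Rightarrow> 'b) \<Rightarrow> 'a::field_char_0"
  assumes A: "finite A" "0 \<notin> A" "card A \<ge> N" "N > 0" and x: "inj_on x A" "\<And>i. i \<in> A \<Longrightarrow> x i \<noteq> 0"
    and anti: "\<And>T \<sigma>. T \<subseteq> S \<Longrightarrow> card T \<ge> N \<Longrightarrow> \<sigma> \<in> G \<Longrightarrow>
      (\<Sum>\<pi> | \<pi> permutes T. of_int (sign \<pi>) * \<epsilon> (\<sigma> \<circ> \<pi>)) = 0"
  shows "weighted_trace \<epsilon> A x = (\<Sum>i\<in>A. weighted_trace \<epsilon> (A - {i}) x / (\<Prod>l\<in>A-{i}. 1 - x i / x l))"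
proof -
  obtain p where p: "degree p < N" "\<And>y. super_trace \<epsilon> A (x(0 := - y)) = poly p y"
    using super_trace_poly[OF A(1,2) anti A(4), of x] by blast
  have "weighted_trace \<epsilon> A x = weighted_trace \<epsilon> A (x(0 := - 0))"
    using A by (intro weighted_trace_cong) auto
  also have "\<dots> = poly p 0"
    using A by (subst super_trace_zero[symmetric]) (auto simp: p(2)[symmetric])
  also have "\<dots> = (\<Sum>i\<in>A. poly p (x i) / (\<Prod>l\<in>A-{i}. 1 - x i / x l))"
    using A x p(1) by (intro lagrange_at_zero) auto
  also have "\<dots> = (\<Sum>i\<in>A. weighted_trace \<epsilon> (A - {i}) x / (\<Prod>l\<in>A-{i}. 1 - x i / x l))"
  proof (rule sum.cong[OF refl])
    fix i assume i: "i \<in> A"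
    then have "poly p (x i) = weighted_trace \<epsilon> (A - {i}) (x(0 := - x i))"
      using A unfolding p(2)[symmetric] by (intro super_trace_cancel) auto
    also have "\<dots> = weighted_trace \<epsilon> (A - {i}) x"
      using A by (intro weighted_trace_cong) auto
    finally show "poly p (x i) / (\<Prod>l\<in>A-{i}. 1 - x i / x l) =
      weighted_trace \<epsilon> (A - {i}) x / (\<Prod>l\<in>A-{i}. 1 - x i / x l)" by simp
  qed
  finally show ?thesis .
qed

text \<open>Colours are deleted until \<open>N\<close> remain. For fixed \<open>K\<close> the
  factors separating \<open>K\<close> from its complement do not depend on the colour deleted first,
  and what remains of the sum over that colour is the interpolation formula for the constant
  polynomial 1.\<close>

lemma weighted_trace_subsets:
  fixes \<epsilon> :: "('b \<Rightarrow> 'b) \<Rightarrow> 'a::field_char_0"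
  assumes "finite A" "0 \<notin> A" "card A \<ge> N" and x: "inj_on x A" "\<And>i. i \<in> A \<Longrightarrow> x i \<noteq> 0"
    and anti: "\<And>T \<sigma>. T \<subseteq> S \<Longrightarrow> card T \<ge> Suc N \<Longrightarrow> \<sigma> \<in> G \<Longrightarrow>
      (\<Sum>\<pi> | \<pi> permutes T. of_int (sign \<pi>) * \<epsilon> (\<sigma> \<circ> \<pi>)) = 0"
  shows "weighted_trace \<epsilon> A x =
    (\<Sum>K | K \<subseteq> A \<and> card K = N. weighted_trace \<epsilon> K x / (\<Prod>a\<in>K. \<Prod>b\<in>A-K. 1 - x b / x a))"
  using assms(1-5)
proof (induction "card A" arbitrary: A)
  case 0
  then have "{K. K \<subseteq> A \<and> card K = N} = {A}" by auto
  then show ?case using 0 by simp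
next
  case (Suc k)
  show ?case
  proof (cases "card A = N")
    case True
    then have "{K. K \<subseteq> A \<and> card K = N} = {A}"
      using card_subset_eq[OF Suc.prems(1)] by (auto simp: True)
    then show ?thesis by simp
  next
    case False
    then have cA: "card A \<ge> Suc N" using Suc.prems by simp
    define F where "F = (\<lambda>K. weighted_trace \<epsilon> K x)"
    have "F A = (\<Sum>i\<in>A. F (A - {i}) / (\<Prod>l\<in>A-{i}. 1 - x i / x l))"
      unfolding F_def by (rule weighted_trace_recursion[OF Suc.prems(1,2) cA _ Suc.prems(4,5) anti]) auto
    also have "\<dots> = (\<Sum>i\<in>A. (\<Sum>K | K \<subseteq> A - {i} \<and> card K = N.
        F K / (\<Prod>a\<in>K. \<Prod>b\<in>A-{i}-K. 1 - x b / x a) / (\<Prod>l\<in>A-{i}. 1 - x i / x l)))"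
    proof (rule sum.cong[OF refl])
      fix i assume i: "i \<in> A"
      have "F (A - {i}) = (\<Sum>K | K \<subseteq> A - {i} \<and> card K = N. F K / (\<Prod>a\<in>K. \<Prod>b\<in>A-{i}-K. 1 - x b / x a))"
        unfolding F_def by (rule Suc.hyps(1)) (use i Suc cA in \<open>auto intro: inj_on_subset\<close>)
      then show "F (A - {i}) / (\<Prod>l\<in>A-{i}. 1 - x i / x l) =
         (\<Sum>K | K \<subseteq> A - {i} \<and> card K = N.
        F K / (\<Prod>a\<in>K. \<Prod>b\<in>A-{i}-K. 1 - x b / x a) / (\<Prod>l\<in>A-{i}. 1 - x i / x l))"
        by (simp add: sum_divide_distrib)
    qed
    also have "\<dots> = (\<Sum>i\<in>A. (\<Sum>K | K \<in> {K. K \<subseteq> A \<and> card K = N} \<and> i \<notin> K.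
        F K / (\<Prod>a\<in>K. \<Prod>b\<in>A-{i}-K. 1 - x b / x a) / (\<Prod>l\<in>A-{i}. 1 - x i / x l)))"
      by (intro sum.cong refl) auto
    also have "\<dots> = (\<Sum>K | K \<subseteq> A \<and> card K = N. \<Sum>i | i \<in> A \<and> i \<notin> K.
        F K / (\<Prod>a\<in>K. \<Prod>b\<in>A-{i}-K. 1 - x b / x a) / (\<Prod>l\<in>A-{i}. 1 - x i / x l))"
      by (rule sum.swap_restrict) (use Suc.prems in auto)
    also have "\<dots> = (\<Sum>K | K \<subseteq> A \<and> card K = N. F K / (\<Prod>a\<in>K. \<Prod>b\<in>A-K. 1 - x b / x a))"
    proof (rule sum.cong[OF refl])
      fix K assume "K \<in> {K. K \<subseteq> A \<and> card K = N}"
      then have K: "K \<subseteq> A" "card K = N" by auto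
      have finK: "finite K" "finite (A - K)" using K Suc.prems finite_subset by auto
      have cAK: "card (A - K) > 0" using K cA finK(1) by (simp add: card_Diff_subset)
      have "(\<Sum>i | i \<in> A \<and> i \<notin> K. F K / (\<Prod>a\<in>K. \<Prod>b\<in>A-{i}-K. 1 - x b / x a) / (\<Prod>l\<in>A-{i}. 1 - x i / x l))
        = (\<Sum>i\<in>A-K. F K / (\<Prod>a\<in>K. \<Prod>b\<in>A-K. 1 - x b / x a) * (1 / (\<Prod>l\<in>A-K-{i}. 1 - x i / x l)))"
      proof (rule sum.cong)
        fix i assume i: "i \<in> A - K"
        have e1: "(\<Prod>b\<in>A-K. 1 - x b / x a) = (1 - x i / x a) * (\<Prod>b\<in>A-{i}-K. 1 - x b / x a)" for a
        proof -
          have "A - K - {i} = A - {i} - K" by auto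
          then show ?thesis using prod.remove[OF finK(2) i, of "\<lambda>b. 1 - x b / x a"] by simp
        qed
        have e2: "(\<Prod>l\<in>A-{i}. 1 - x i / x l) = (\<Prod>l\<in>K. 1 - x i / x l) * (\<Prod>l\<in>A-K-{i}. 1 - x i / x l)"
          using i K finK Suc.prems(1)
          by (subst prod.union_disjoint[symmetric]) (auto intro!: prod.cong)
        show "F K / (\<Prod>a\<in>K. \<Prod>b\<in>A-{i}-K. 1 - x b / x a) / (\<Prod>l\<in>A-{i}. 1 - x i / x l)
           = F K / (\<Prod>a\<in>K. \<Prod>b\<in>A-K. 1 - x b / x a) * (1 / (\<Prod>l\<in>A-K-{i}. 1 - x i / x l))"
          unfolding e1 e2 prod.distrib by simp
      qed auto
      also have "\<dots> = F K / (\<Prod>a\<in>K. \<Prod>b\<in>A-K. 1 - x b / x a) *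
          (\<Sum>i\<in>A-K. poly 1 (x i) / (\<Prod>l\<in>A-K-{i}. 1 - x i / x l))"
        by (simp add: sum_distrib_left)
      also have "(\<Sum>i\<in>A-K. poly 1 (x i) / (\<Prod>l\<in>A-K-{i}. 1 - x i / x l)) = poly 1 0"
        by (rule lagrange_at_zero[symmetric]) (use finK cAK Suc.prems in \<open>auto intro: inj_on_subset\<close>)
      finally show "(\<Sum>i | i \<in> A \<and> i \<notin> K. F K / (\<Prod>a\<in>K. \<Prod>b\<in>A-{i}-K. 1 - x b / x a) / (\<Prod>l\<in>A-{i}. 1 - x i / x l))
        = F K / (\<Prod>a\<in>K. \<Prod>b\<in>A-K. 1 - x b / x a)" by simp
    qed
    finally show ?thesis by (simp add: F_def)
  qed
qed

end

section \<open>The Young symmetrizer of a diagram\<close>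

lemma sum_involution_zero:
  fixes F :: "'a \<Rightarrow> 'b::field_char_0"
  assumes "\<And>x. x \<in> A \<Longrightarrow> s x \<in> A" "\<And>x. x \<in> A \<Longrightarrow> s (s x) = x" "\<And>x. x \<in> A \<Longrightarrow> F (s x) = - F x"
  shows "sum F A = 0"
proof -
  have "sum F A = (\<Sum>x\<in>A. F (s x))"
    by (rule sum.reindex_bij_witness[of _ s s]) (use assms in auto)
  also have "\<dots> = - sum F A" using assms(3) by (simp add: sum_negf)
  finally show ?thesis by simp
qed

lemma finite_col_shapes [simp]: "finite col_shapes"
  by (rule finite_subset[of _ "Pow {1,2,3}"]) (auto simp: col_shapes_def)

lemma finite_squares [simp]: "finite (squares m)"
proof (rule finite_subset)
  show "squares m \<subseteq> (SIGMA C:col_shapes. {..<m C} \<times> {1,2,3})"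
    by (auto simp: squares_def col_shapes_def)
qed auto

locale diagram =
  fixes m :: "nat set \<Rightarrow> nat"
begin

sublocale perms "squares m"
  by unfold_locales simp

lemma row_group_G: "\<sigma> \<in> row_group m \<Longrightarrow> \<sigma> \<in> G"
  and col_group_G: "\<sigma> \<in> col_group m \<Longrightarrow> \<sigma> \<in> G"
  by (auto simp: row_group_def col_group_def G_def)

lemma finite_groups [simp]: "finite (row_group m)" "finite (col_group m)"
  by (auto intro: finite_subset[OF _ finG] row_group_G col_group_G)

lemma row_group_comp:
  assumes "\<kappa> \<in> row_group m" "\<rho> \<in> G" shows "\<rho> \<circ> \<kappa> \<in> row_group m \<longleftrightarrow> \<rho> \<in> row_group m"
proof
  assume "\<rho> \<in> row_group m"
  then show "\<rho> \<circ> \<kappa> \<in> row_group m"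
    using assms unfolding row_group_def by (simp add: permutes_compose del: split_paired_All)
next
  assume *: "\<rho> \<circ> \<kappa> \<in> row_group m"
  have "sq_row (\<rho> x) = sq_row x" for x
  proof -
    have "\<kappa> permutes squares m" using assms unfolding row_group_def by blast
    then have k: "\<kappa> (inv \<kappa> x) = x" by (rule permutes_inverses)
    have "sq_row (\<rho> x) = sq_row ((\<rho> \<circ> \<kappa>) (inv \<kappa> x))" by (simp add: k)
    also have "\<dots> = sq_row (inv \<kappa> x)" using * unfolding row_group_def by blast
    also have "\<dots> = sq_row (\<kappa> (inv \<kappa> x))"
    proof -
      have "\<forall>y. sq_row (\<kappa> y) = sq_row y" using assms(1) unfolding row_group_def by blast
      then show ?thesis by metis
    qed
    finally show ?thesis by (simp add: k)
  qed
  then show "\<rho> \<in> row_group m" using assms by (auto simp: row_group_def G_def)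
qed

definition aD :: "(square \<Rightarrow> square) \<Rightarrow> complex"
  where "aD \<sigma> = (if \<sigma> \<in> row_group m then 1 / of_nat (card (row_group m)) else 0)"

definition bD :: "(square \<Rightarrow> square) \<Rightarrow> complex"
  where "bD \<sigma> = (if \<sigma> \<in> col_group m then of_int (sign \<sigma>) / of_nat (card (col_group m)) else 0)"

definition eD where "eD = conv G aD bD"

lemma alpha_act: "alpha_D m v = act G aD v"
proof
  fix g
  have "act G aD v g = (\<Sum>\<sigma>\<in>row_group m. 1 / of_nat (card (row_group m)) * v (g \<circ> inv \<sigma>))"
    unfolding act_def by (rule sum.mono_neutral_cong_right) (auto simp: aD_def row_group_G)
  then show "alpha_D m v g = act G aD v g"
    by (simp add: alpha_D_def perm_act_def sum_distrib_left)
qed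

lemma beta_act: "beta_D m v = act G bD v"
proof
  fix g
  have "act G bD v g = (\<Sum>\<sigma>\<in>col_group m. of_int (sign \<sigma>) / of_nat (card (col_group m)) * v (g \<circ> inv \<sigma>))"
    unfolding act_def by (rule sum.mono_neutral_cong_right) (auto simp: bD_def col_group_G)
  then show "beta_D m v g = act G bD v g"
    by (simp add: beta_D_def perm_act_def sum_distrib_left)
qed

lemma schur_module_act:
  "schur_module n m = act G eD ` {v. \<forall>g. g \<notin> colourings (squares m) {1..n} \<longrightarrow> v g = 0}"
  by (simp add: schur_module_def alpha_act beta_act act_conv eD_def tensor_space_def
      fillings_def colourings_def)

definition cD where "cD = (SOME c. \<forall>\<rho>\<in>G. conv G eD (conv G c eD) \<rho> = eD \<rho>)"

definition projD where "projD = conv G cD eD"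

lemma eD_projD: "\<rho> \<in> G \<Longrightarrow> conv G eD projD \<rho> = eD \<rho>"
  using someI_ex[OF group_algebra_regular[of eD]] unfolding cD_def projD_def by blast

lemma dim_schur_trace:
  "of_nat (dim_schur n m) =
     (\<Sum>h\<in>colourings (squares m) {1..n}. \<Sum>\<sigma> | \<sigma> \<in> G \<and> h \<circ> \<sigma> = h. projD \<sigma>)"
  unfolding dim_schur_def schur_module_act projD_def
  by (rule dim_act_image) (use eD_projD in \<open>auto simp: projD_def\<close>)

text \<open>Four squares are carried by \<open>t\<close> into three rows, so two of the images share
  a row. The transposition of the two preimages flips the sign, but moved across
  \<open>inv t\<close> it becomes a row transposition, which \<open>aD\<close> absorbs. The factor
  \<open>inv t\<close> is what appears when a product with \<open>bD\<close> is expanded.\<close>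

lemma aD_antisym:
  assumes T: "T \<subseteq> squares m" "card T \<ge> 4" and \<sigma>: "\<sigma> \<in> G" and t: "t \<in> G"
  shows "(\<Sum>\<pi> | \<pi> permutes T. of_int (sign \<pi>) * aD (\<sigma> \<circ> \<pi> \<circ> inv t)) = 0"
proof -
  have finT: "finite T" using T finite_squares finite_subset by blast
  have "\<not> inj_on (\<lambda>x. sq_row (t x)) T"
  proof
    assume "inj_on (\<lambda>x. sq_row (t x)) T"
    moreover have "(\<lambda>x. sq_row (t x)) ` T \<subseteq> {1,2,3}"
    proof
      fix r assume "r \<in> (\<lambda>x. sq_row (t x)) ` T"
      then obtain x where "x \<in> T" "r = sq_row (t x)" by auto
      moreover from this have "t x \<in> squares m" using t T by (auto simp: G_def permutes_in_image)
      ultimately show "r \<in> {1,2,3}"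
        by (cases "t x") (auto simp: squares_def sq_row_def col_shapes_def)
    qed
    ultimately have "card T \<le> card {1::nat,2,3}"
      by (metis card_image card_mono finite.emptyI finite_insert)
    then show False using T by simp
  qed
  then obtain x y where xy: "x \<in> T" "y \<in> T" "x \<noteq> y" "sq_row (t x) = sq_row (t y)"
    unfolding inj_on_def by blast
  define \<theta> where "\<theta> = Transposition.transpose x y"
  define \<kappa> where "\<kappa> = Transposition.transpose (t x) (t y)"
  have \<theta>T: "\<theta> permutes T" unfolding \<theta>_def using xy by (intro permutes_swap_id)
  have tS: "t x \<in> squares m" "t y \<in> squares m"
    using xy T t by (auto simp: G_def permutes_in_image)
  have \<kappa>: "\<kappa> \<in> row_group m"
    using tS xy(4) by (auto simp: row_group_def \<kappa>_def Transposition.transpose_def intro: permutes_swap_id)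
  have conj: "\<theta> \<circ> inv t = inv t \<circ> \<kappa>"
  proof -
    have bij: "bij t" using t by (auto simp: G_def permutes_bij)
    have "\<theta> (inv t z) = inv t (\<kappa> z)" for z
    proof -
      obtain w where w: "z = t w" using bij by (metis bij_pointE)
      show ?thesis using bij by (auto simp: w \<theta>_def \<kappa>_def Transposition.transpose_def bij_is_inj inj_eq)
    qed
    then show ?thesis by auto
  qed
  show ?thesis
  proof (rule sum_involution_zero[of _ "\<lambda>\<pi>. \<pi> \<circ> \<theta>"])
    fix \<pi> assume "\<pi> \<in> {\<pi>. \<pi> permutes T}"
    then have \<pi>: "\<pi> permutes T" by simp
    show "\<pi> \<circ> \<theta> \<in> {\<pi>. \<pi> permutes T}" using \<pi> \<theta>T by (auto intro: permutes_compose)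
    show "\<pi> \<circ> \<theta> \<circ> \<theta> = \<pi>" by (simp add: comp_assoc \<theta>_def)
    have "sign (\<pi> \<circ> \<theta>) = - sign \<pi>"
      using \<pi> finT xy(3) permutes_imp_permutation[OF finT]
      by (subst sign_compose) (auto simp: \<theta>_def sign_swap_id permutation_swap_id)
    moreover have "aD (\<sigma> \<circ> (\<pi> \<circ> \<theta>) \<circ> inv t) = aD (\<sigma> \<circ> \<pi> \<circ> inv t)"
    proof -
      have \<pi>G: "\<pi> \<in> G" using permutes_subset[OF \<pi> T(1)] by (simp add: G_def)
      have "\<sigma> \<circ> (\<pi> \<circ> \<theta>) \<circ> inv t = (\<sigma> \<circ> \<pi> \<circ> inv t) \<circ> \<kappa>"
        by (simp add: comp_assoc conj)
      then show ?thesis unfolding aD_def using row_group_comp[OF \<kappa>, of "\<sigma> \<circ> \<pi> \<circ> inv t"] \<sigma> \<pi>G t by simp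
    qed
    ultimately show "of_int (sign (\<pi> \<circ> \<theta>)) * aD (\<sigma> \<circ> (\<pi> \<circ> \<theta>) \<circ> inv t)
      = - (of_int (sign \<pi>) * aD (\<sigma> \<circ> \<pi> \<circ> inv t))" by simp
  qed
qed

text \<open>Four squares never lie in distinct rows, so antisymmetrising them kills \<open>\<alpha>\<^sub>D\<close>, hence the
  two-sided ideal it generates.\<close>
lemma eD_antisym:
  assumes T: "T \<subseteq> squares m" "card T \<ge> 4" and \<sigma>: "\<sigma> \<in> G"
  shows "(\<Sum>\<pi> | \<pi> permutes T. of_int (sign \<pi>) * eD (\<sigma> \<circ> \<pi>)) = 0"
proof -
  have "eD (\<sigma> \<circ> \<pi>) = (\<Sum>t\<in>G. aD (\<sigma> \<circ> \<pi> \<circ> inv t) * bD t)" if "\<pi> permutes T" for \<pi>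
  proof -
    have \<pi>G: "\<sigma> \<circ> \<pi> \<in> G" using permutes_subset[OF that T(1)] \<sigma> by (intro G_comp) (auto simp: G_def)
    have "eD (\<sigma> \<circ> \<pi>) = (\<Sum>t\<in>G. aD (\<sigma> \<circ> \<pi> \<circ> t) * bD (inv (\<sigma> \<circ> \<pi> \<circ> t) \<circ> (\<sigma> \<circ> \<pi>)))"
      unfolding eD_def conv_def by (rule sum_G_left[OF \<pi>G, symmetric])
    also have "\<dots> = (\<Sum>t\<in>G. aD (\<sigma> \<circ> \<pi> \<circ> inv t) * bD (inv (\<sigma> \<circ> \<pi> \<circ> inv t) \<circ> (\<sigma> \<circ> \<pi>)))"
      by (rule sum_G_inv[symmetric])
    also have "\<dots> = (\<Sum>t\<in>G. aD (\<sigma> \<circ> \<pi> \<circ> inv t) * bD t)"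
    proof (rule sum.cong[OF refl])
      fix t assume t: "t \<in> G"
      have "inv (\<rho> \<circ> inv t) \<circ> \<rho> = t \<circ> (inv \<rho> \<circ> \<rho>)" if "\<rho> \<in> G" for \<rho>
        using t that by (simp only: G_comp_inv[OF that G_inv[OF t]] G_inv_inv comp_assoc)
      from this[OF \<pi>G] have "inv (\<sigma> \<circ> \<pi> \<circ> inv t) \<circ> (\<sigma> \<circ> \<pi>) = t \<circ> (inv (\<sigma> \<circ> \<pi>) \<circ> (\<sigma> \<circ> \<pi>))" .
      then show "aD (\<sigma> \<circ> \<pi> \<circ> inv t) * bD (inv (\<sigma> \<circ> \<pi> \<circ> inv t) \<circ> (\<sigma> \<circ> \<pi>))
        = aD (\<sigma> \<circ> \<pi> \<circ> inv t) * bD t"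
        by (simp only: G_inv_comp(3)[OF \<pi>G] comp_id)
    qed
    finally show ?thesis .
  qed
  then have "(\<Sum>\<pi> | \<pi> permutes T. of_int (sign \<pi>) * eD (\<sigma> \<circ> \<pi>)) =
     (\<Sum>\<pi> | \<pi> permutes T. \<Sum>t\<in>G. of_int (sign \<pi>) * aD (\<sigma> \<circ> \<pi> \<circ> inv t) * bD t)"
    by (simp add: sum_distrib_left mult.assoc)
  also have "\<dots> = (\<Sum>t\<in>G. (\<Sum>\<pi> | \<pi> permutes T. of_int (sign \<pi>) * aD (\<sigma> \<circ> \<pi> \<circ> inv t)) * bD t)"
    by (subst sum.swap) (simp add: sum_distrib_right)
  also have "\<dots> = 0"
    using aD_antisym[OF T \<sigma>] by simp
  finally show ?thesis .
qed

text \<open>The antisymmetrization acts on the right and so passes through the left factor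
  \<open>cD\<close>.\<close>

lemma projD_antisym:
  assumes T: "T \<subseteq> squares m" "card T \<ge> 4" and \<sigma>: "\<sigma> \<in> G"
  shows "(\<Sum>\<pi> | \<pi> permutes T. of_int (sign \<pi>) * projD (\<sigma> \<circ> \<pi>)) = 0"
proof -
  have "(\<Sum>\<pi> | \<pi> permutes T. of_int (sign \<pi>) * projD (\<sigma> \<circ> \<pi>)) =
    (\<Sum>k\<in>G. cD k * (\<Sum>\<pi> | \<pi> permutes T. of_int (sign \<pi>) * eD (inv k \<circ> \<sigma> \<circ> \<pi>)))"
    unfolding projD_def conv_def
    by (simp add: sum_distrib_left mult_ac comp_assoc) (rule sum.swap)
  also have "\<dots> = 0"
    using eD_antisym[OF T] \<sigma> by (intro sum.neutral) auto
  finally show ?thesis .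
qed

end

section \<open>Traces as dimensions of spans of tableau polynomials\<close>

lemma vector_space_poly: "vector_space (smult :: 'a::field \<Rightarrow> 'a poly \<Rightarrow> 'a poly)"
  by unfold_locales (auto simp: smult_add_right smult_add_left)

lemma vector_space_self: "vector_space ((*) :: 'a::field \<Rightarrow> 'a \<Rightarrow> 'a)"
  by unfold_locales (auto simp: algebra_simps)

context diagram
begin

text \<open>The exponent of the monomial of a filling when the matrix entry in row r and colour k is
  replaced by the power \<open>\<omega> r k\<close> of a single variable.\<close>

definition code :: "(nat \<Rightarrow> nat \<Rightarrow> nat) \<Rightarrow> (square \<Rightarrow> nat) \<Rightarrow> nat"
  where "code \<omega> g = (\<Sum>x\<in>squares m. \<omega> (sq_row x) (g x))"

text \<open>The image of a filling under \<beta>, read as a polynomial: a product of minors, one for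
  each column (\<open>tab_poly_minors\<close>).\<close>

definition tab_poly :: "(nat \<Rightarrow> nat \<Rightarrow> nat) \<Rightarrow> (square \<Rightarrow> nat) \<Rightarrow> complex poly"
  where "tab_poly \<omega> g = (\<Sum>\<sigma>\<in>col_group m. smult (of_int (sign \<sigma>)) (monom 1 (code \<omega> (g \<circ> inv \<sigma>))))"

lemma code_row:
  assumes "\<kappa> \<in> row_group m" shows "code \<omega> (g \<circ> \<kappa>) = code \<omega> g"
proof -
  have p: "\<kappa> permutes squares m" and r: "\<And>x. sq_row (\<kappa> x) = sq_row x"
    using assms unfolding row_group_def by blast+
  have "code \<omega> (g \<circ> \<kappa>) = (\<Sum>x\<in>squares m. \<omega> (sq_row (\<kappa> x)) (g (\<kappa> x)))"
    by (simp add: code_def r)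
  also have "\<dots> = code \<omega> g"
    unfolding code_def using sum.permute[OF p, of "\<lambda>x. \<omega> (sq_row x) (g x)"] by (simp add: o_def)
  finally show ?thesis .
qed

lemma row_group_inv: "\<kappa> \<in> row_group m \<Longrightarrow> inv \<kappa> \<in> row_group m"
  using row_group_comp[of \<kappa> "inv \<kappa>"] row_group_G[of \<kappa>] by (simp add: row_group_def permutes_id)

lemma card_groups: "card (row_group m) \<noteq> 0" "card (col_group m) \<noteq> 0"
proof -
  have "id \<in> row_group m" "id \<in> col_group m" by (auto simp: row_group_def col_group_def permutes_id)
  then show "card (row_group m) \<noteq> 0" "card (col_group m) \<noteq> 0" by auto
qed

lemma act_aD_row:
  assumes k: "\<kappa> \<in> row_group m" shows "act G aD v (g \<circ> \<kappa>) = act G aD v g"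
proof -
  have kG: "\<kappa> \<in> G" using row_group_G[OF k] .
  have "act G aD v (g \<circ> \<kappa>) = (\<Sum>\<sigma>\<in>G. aD (\<sigma> \<circ> \<kappa>) * v (g \<circ> \<kappa> \<circ> inv (\<sigma> \<circ> \<kappa>)))"
    unfolding act_def by (rule sum_G_right[OF kG, symmetric])
  also have "\<dots> = act G aD v g"
    unfolding act_def
  proof (rule sum.cong[OF refl])
    fix \<sigma> assume s: "\<sigma> \<in> G"
    have "aD (\<sigma> \<circ> \<kappa>) = aD \<sigma>" using row_group_comp[OF k s] by (simp add: aD_def)
    moreover have "g \<circ> \<kappa> \<circ> inv (\<sigma> \<circ> \<kappa>) = g \<circ> inv \<sigma>"
      using s kG by (simp add: G_comp_inv comp_assoc)
    ultimately show "aD (\<sigma> \<circ> \<kappa>) * v (g \<circ> \<kappa> \<circ> inv (\<sigma> \<circ> \<kappa>)) = aD \<sigma> * v (g \<circ> inv \<sigma>)" by simp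
  qed
  finally show ?thesis .
qed

lemma act_aD_fixed:
  assumes "\<And>\<kappa> g. \<kappa> \<in> row_group m \<Longrightarrow> v (g \<circ> \<kappa>) = v g" shows "act G aD v = v"
proof
  fix g
  have "act G aD v g = (\<Sum>\<sigma>\<in>row_group m. 1 / of_nat (card (row_group m)) * v (g \<circ> inv \<sigma>))"
    unfolding act_def by (rule sum.mono_neutral_cong_right) (auto simp: aD_def row_group_G)
  also have "\<dots> = (\<Sum>\<sigma>\<in>row_group m. 1 / of_nat (card (row_group m)) * v g)"
    using assms row_group_inv by (intro sum.cong refl) simp
  also have "\<dots> = v g" using card_groups by simp
  finally show "act G aD v g = v g" .
qed

lemma act_bD: "act G bD v g = (\<Sum>\<sigma>\<in>col_group m. of_int (sign \<sigma>) * v (g \<circ> inv \<sigma>)) / of_nat (card (col_group m))"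
proof -
  have "act G bD v g = (\<Sum>\<sigma>\<in>col_group m. of_int (sign \<sigma>) / of_nat (card (col_group m)) * v (g \<circ> inv \<sigma>))"
    unfolding act_def by (rule sum.mono_neutral_cong_right) (auto simp: bD_def col_group_G)
  then show ?thesis by (simp add: sum_divide_distrib)
qed

context
  fixes I :: "(square \<Rightarrow> nat) set" and \<omega> :: "nat \<Rightarrow> nat \<Rightarrow> nat"
  assumes finI: "finite I"
    and closed: "\<And>g \<sigma>. \<sigma> \<in> G \<Longrightarrow> g \<circ> \<sigma> \<in> I \<longleftrightarrow> g \<in> I"
    and inj: "\<And>g h. g \<in> I \<Longrightarrow> h \<in> I \<Longrightarrow> code \<omega> g = code \<omega> h \<Longrightarrow> \<exists>\<kappa>\<in>row_group m. h = g \<circ> \<kappa>"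
begin

text \<open>Acting by \<open>aD\<close> produces a row-invariant function, and on \<open>I\<close>
  such a function depends on the code alone. The signed column sum added by \<open>bD\<close> then
  uses nothing but the coefficients of the tableau polynomial.\<close>

lemma functional_of_act:
  "\<exists>L. Vector_Spaces.linear smult (*) L \<and> (\<forall>g\<in>I. act G eD v g = L (tab_poly \<omega> g))"
proof -
  define \<phi> where "\<phi> = act G aD v"
  define \<phi>' where "\<phi>' = (\<lambda>k. \<phi> (SOME g. g \<in> I \<and> code \<omega> g = k))"
  \<comment> \<open>A bound for all codes that occur, which makes the sum over coefficients in
    \<open>L\<close> finite.\<close>
  define B where "B = (\<Sum>g\<in>I. code \<omega> g)"
  define L where "L = (\<lambda>p. (\<Sum>k\<le>B. coeff p k * \<phi>' k) / of_nat (card (col_group m)))"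
  have lin: "Vector_Spaces.linear smult (*) L"
  proof -
    interpret V: vector_space "smult :: complex \<Rightarrow> complex poly \<Rightarrow> complex poly" by (rule vector_space_poly)
    interpret W: vector_space "(*) :: complex \<Rightarrow> complex \<Rightarrow> complex" by (rule vector_space_self)
    show ?thesis
      by unfold_locales
         (auto simp: L_def algebra_simps sum.distrib sum_distrib_left add_divide_distrib)
  qed
  have \<phi>': "\<phi>' (code \<omega> g) = \<phi> g" if "g \<in> I" for g
  proof -
    let ?h = "SOME h. h \<in> I \<and> code \<omega> h = code \<omega> g"
    have "?h \<in> I \<and> code \<omega> ?h = code \<omega> g" by (rule someI[of _ g]) (use that in auto)
    then obtain \<kappa> where \<kappa>: "\<kappa> \<in> row_group m" "g = ?h \<circ> \<kappa>" using inj[of ?h g] \<open>g \<in> I\<close> by blast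
    have "\<phi> g = \<phi> (?h \<circ> \<kappa>)" using \<kappa>(2) by (rule arg_cong)
    also have "\<dots> = \<phi> ?h" unfolding \<phi>_def by (rule act_aD_row[OF \<kappa>(1)])
    finally show ?thesis by (simp add: \<phi>'_def)
  qed
  have "act G eD v g = L (tab_poly \<omega> g)" if g: "g \<in> I" for g
  proof -
    have "act G eD v g = act G bD \<phi> g" by (simp add: \<phi>_def act_conv eD_def)
    also have "\<dots> = (\<Sum>\<sigma>\<in>col_group m. of_int (sign \<sigma>) * \<phi>' (code \<omega> (g \<circ> inv \<sigma>))) / of_nat (card (col_group m))"
    proof -
      have "\<phi> (g \<circ> inv \<sigma>) = \<phi>' (code \<omega> (g \<circ> inv \<sigma>))" if "\<sigma> \<in> col_group m" for \<sigma>
        using \<phi>'[of "g \<circ> inv \<sigma>"] g closed[OF G_inv[OF col_group_G[OF that]]] by metis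
      then show ?thesis unfolding act_bD by (simp cong: sum.cong)
    qed
    also have "\<dots> = L (tab_poly \<omega> g)"
    proof -
      have "(\<Sum>k\<le>B. coeff (tab_poly \<omega> g) k * \<phi>' k)
        = (\<Sum>\<sigma>\<in>col_group m. \<Sum>k\<le>B. of_int (sign \<sigma>) * coeff (monom 1 (code \<omega> (g \<circ> inv \<sigma>))) k * \<phi>' k)"
        unfolding tab_poly_def by (subst sum.swap) (simp add: coeff_sum sum_distrib_right)
      also have "\<dots> = (\<Sum>\<sigma>\<in>col_group m. of_int (sign \<sigma>) * \<phi>' (code \<omega> (g \<circ> inv \<sigma>)))"
      proof (rule sum.cong[OF refl])
        fix \<sigma> assume s: "\<sigma> \<in> col_group m"
        then have "g \<circ> inv \<sigma> \<in> I" using g closed[of "inv \<sigma>"] col_group_G by auto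
        then have "code \<omega> (g \<circ> inv \<sigma>) \<le> B" unfolding B_def by (rule member_le_sum) (use finI in auto)
        then have "(\<Sum>k\<le>B. if k = code \<omega> (g \<circ> inv \<sigma>) then of_int (sign \<sigma>) * \<phi>' k else 0)
           = of_int (sign \<sigma>) * \<phi>' (code \<omega> (g \<circ> inv \<sigma>))" by simp
        moreover have "(\<Sum>k\<le>B. of_int (sign \<sigma>) * coeff (monom 1 (code \<omega> (g \<circ> inv \<sigma>))) k * \<phi>' k)
          = (\<Sum>k\<le>B. if k = code \<omega> (g \<circ> inv \<sigma>) then of_int (sign \<sigma>) * \<phi>' k else 0)"
          by (rule sum.cong) auto
        ultimately show "(\<Sum>k\<le>B. of_int (sign \<sigma>) * coeff (monom 1 (code \<omega> (g \<circ> inv \<sigma>))) k * \<phi>' k)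
          = of_int (sign \<sigma>) * \<phi>' (code \<omega> (g \<circ> inv \<sigma>))" by simp
      qed
      finally show ?thesis by (simp add: L_def)
    qed
    finally show ?thesis .
  qed
  then show ?thesis using lin by blast
qed

text \<open>The function is the image under \<open>eD\<close> of the row-invariant function v, whose
  factor \<open>card (col_group m)\<close> undoes the average in \<open>bD\<close>; and
  \<open>projD\<close> fixes the image of \<open>eD\<close>.\<close>

lemma act_of_functional:
  assumes L: "Vector_Spaces.linear smult (*) L"
  shows "act G projD (\<lambda>g. if g \<in> I then L (tab_poly \<omega> g) else 0) = (\<lambda>g. if g \<in> I then L (tab_poly \<omega> g) else 0)"
proof -
  interpret L: Vector_Spaces.linear "smult :: complex \<Rightarrow> complex poly \<Rightarrow> complex poly" "(*)" L by (rule L)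
  define v where "v = (\<lambda>g. if g \<in> I then of_nat (card (col_group m)) * L (monom 1 (code \<omega> g)) else 0)"
  have av: "act G aD v = v"
    by (rule act_aD_fixed) (auto simp: v_def closed row_group_G code_row)
  have ev: "act G eD v = (\<lambda>g. if g \<in> I then L (tab_poly \<omega> g) else 0)"
  proof
    fix g
    have "act G eD v g = act G bD v g"
      unfolding eD_def act_conv[symmetric] av ..
    also have "\<dots> = (if g \<in> I then L (tab_poly \<omega> g) else 0)"
    proof (cases "g \<in> I")
      case True
      have "L (tab_poly \<omega> g) = (\<Sum>\<sigma>\<in>col_group m. of_int (sign \<sigma>) * L (monom 1 (code \<omega> (g \<circ> inv \<sigma>))))"
        unfolding tab_poly_def by (simp only: L.sum L.scale)
      moreover have "(\<Sum>\<sigma>\<in>col_group m. of_int (sign \<sigma>) * v (g \<circ> inv \<sigma>))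
        = of_nat (card (col_group m)) * (\<Sum>\<sigma>\<in>col_group m. of_int (sign \<sigma>) * L (monom 1 (code \<omega> (g \<circ> inv \<sigma>))))"
        unfolding sum_distrib_left using True col_group_G
        by (intro sum.cong refl) (auto simp: v_def closed)
      ultimately show ?thesis using card_groups True by (simp add: act_bD)
    next
      case False
      then show ?thesis
        using col_group_G by (auto simp: act_bD v_def closed intro!: sum.neutral)
    qed
    finally show "act G eD v g = (if g \<in> I then L (tab_poly \<omega> g) else 0)" .
  qed
  have "act G projD (act G eD v) = act G eD v"
    unfolding act_conv by (rule act_cong) (rule eD_projD)
  then show ?thesis by (simp only: ev)
qed

text \<open>The rows of the matrix of \<open>projD\<close> depend linearly on the tableau
  polynomials (\<open>P1\<close>), and the matrix fixes every function obtained from them by a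
  functional (\<open>P2\<close>). With a basis \<open>B\<close> and its dual functionals the trace
  becomes the sum of the values L b b = 1. Since \<open>I\<close> may be any suitable set stable
  under \<open>G\<close>, one content can be treated at a time.\<close>

lemma trace_dim_span:
  "(\<Sum>g\<in>I. \<Sum>\<sigma> | \<sigma> \<in> G \<and> g \<circ> \<sigma> = g. projD \<sigma>)
    = of_nat (vector_space.dim smult (tab_poly \<omega> ` I))"
proof -
  interpret V: vector_space "smult :: complex \<Rightarrow> complex poly \<Rightarrow> complex poly" by (rule vector_space_poly)
  interpret W: vector_space "(*) :: complex \<Rightarrow> complex \<Rightarrow> complex" by (rule vector_space_self)
  interpret VP: vector_space_pair "smult :: complex \<Rightarrow> complex poly \<Rightarrow> complex poly"
    "(*) :: complex \<Rightarrow> complex \<Rightarrow> complex" ..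
  obtain B where B: "B \<subseteq> tab_poly \<omega> ` I" "V.independent B" "tab_poly \<omega> ` I \<subseteq> V.span B"
      "card B = V.dim (tab_poly \<omega> ` I)"
    using V.basis_exists by blast
  have finB: "finite B" using B(1) finI finite_subset by auto
  have "\<forall>b. \<exists>L. Vector_Spaces.linear smult (*) L \<and> (\<forall>b'\<in>B. L b' = (if b' = b then 1 else 0))"
  proof
    fix b
    show "\<exists>L. Vector_Spaces.linear smult (*) L \<and> (\<forall>b'\<in>B. L b' = (if b' = b then 1 else 0))"
      by (rule VP.linear_independent_extend[OF B(2), of "\<lambda>b'. if b' = b then 1 else 0"])
  qed
  then obtain L where L: "\<And>b. Vector_Spaces.linear smult (*) (L b)"
      "\<And>b b'. b' \<in> B \<Longrightarrow> L b b' = (if b' = b then 1 else 0)" by metis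
  have "\<forall>b\<in>B. \<exists>g\<in>I. tab_poly \<omega> g = b" using B(1) by auto
  then obtain gg where gg: "\<And>b. b \<in> B \<Longrightarrow> gg b \<in> I \<and> tab_poly \<omega> (gg b) = b" by metis
  have expand: "q = (\<Sum>b\<in>B. smult (L b q) b)" if q: "q \<in> V.span B" for q
  proof -
    let ?r = "V.representation B q"
    have e: "q = (\<Sum>b\<in>B. smult (?r b) b)"
      using V.sum_representation_eq[OF B(2) q finB subset_refl] by simp
    have "L b q = ?r b" if "b \<in> B" for b
    proof -
      interpret Lb: Vector_Spaces.linear "smult :: complex \<Rightarrow> complex poly \<Rightarrow> complex poly" "(*)" "L b"
        by (rule L)
      have "L b q = (\<Sum>b'\<in>B. ?r b' * L b b')"
        by (subst e) (simp only: Lb.sum Lb.scale)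
      also have "\<dots> = (\<Sum>b'\<in>B. if b' = b then ?r b' else 0)"
        by (rule sum.cong) (auto simp: L(2))
      also have "\<dots> = ?r b" using finB that by simp
      finally show ?thesis .
    qed
    then show ?thesis using e by simp
  qed
  define \<delta> where "\<delta> = (\<lambda>h g. if g = (h::square \<Rightarrow> nat) then 1 else (0::complex))"
  define P where "P = (\<lambda>g h. act G projD (\<delta> h) g)"
  have P1: "P g h = (\<Sum>b\<in>B. L b (tab_poly \<omega> g) * P (gg b) h)" if g: "g \<in> I" for g h
  proof -
    have "act G projD (\<delta> h) = act G eD (act G cD (\<delta> h))" by (simp add: act_conv projD_def)
    then obtain M where M: "Vector_Spaces.linear smult (*) M" "\<And>g. g \<in> I \<Longrightarrow> P g h = M (tab_poly \<omega> g)"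
      unfolding P_def using functional_of_act[of "act G cD (\<delta> h)"] by auto
    interpret M: Vector_Spaces.linear "smult :: complex \<Rightarrow> complex poly \<Rightarrow> complex poly" "(*)" M by (rule M)
    have "tab_poly \<omega> g = (\<Sum>b\<in>B. smult (L b (tab_poly \<omega> g)) b)"
      by (rule expand) (use B(3) g in auto)
    then have "P g h = M (\<Sum>b\<in>B. smult (L b (tab_poly \<omega> g)) b)" using M(2)[OF g] by simp
    also have "\<dots> = (\<Sum>b\<in>B. L b (tab_poly \<omega> g) * M b)" by (simp only: M.sum M.scale)
    also have "\<dots> = (\<Sum>b\<in>B. L b (tab_poly \<omega> g) * P (gg b) h)"
      by (rule sum.cong) (use gg M(2) in auto)
    finally show ?thesis .
  qed
  have P2: "(\<Sum>g\<in>I. P h g * L b (tab_poly \<omega> g)) = L b (tab_poly \<omega> h)" if h: "h \<in> I" for h b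
  proof -
    let ?w = "\<lambda>g. if g \<in> I then L b (tab_poly \<omega> g) else 0"
    have "?w h = act G projD ?w h" by (subst act_of_functional[OF L(1)]) simp
    also have "\<dots> = (\<Sum>\<sigma>\<in>G. projD \<sigma> * (\<Sum>g\<in>I. \<delta> g (h \<circ> inv \<sigma>) * L b (tab_poly \<omega> g)))"
      unfolding act_def
    proof (rule sum.cong[OF refl])
      fix \<sigma> assume "\<sigma> \<in> G"
      have "(\<Sum>g\<in>I. \<delta> g (h \<circ> inv \<sigma>) * L b (tab_poly \<omega> g)) = (\<Sum>g\<in>I. if g = h \<circ> inv \<sigma> then L b (tab_poly \<omega> g) else 0)"
        by (rule sum.cong) (auto simp: \<delta>_def)
      also have "\<dots> = ?w (h \<circ> inv \<sigma>)" using finI by simp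
      finally show "projD \<sigma> * ?w (h \<circ> inv \<sigma>) = projD \<sigma> * (\<Sum>g\<in>I. \<delta> g (h \<circ> inv \<sigma>) * L b (tab_poly \<omega> g))"
        by simp
    qed
    also have "\<dots> = (\<Sum>g\<in>I. P h g * L b (tab_poly \<omega> g))"
      unfolding P_def act_def sum_distrib_left sum_distrib_right by (subst sum.swap) (simp add: mult.assoc)
    finally show ?thesis using h by simp
  qed
  have "(\<Sum>g\<in>I. \<Sum>\<sigma> | \<sigma> \<in> G \<and> g \<circ> \<sigma> = g. projD \<sigma>) = (\<Sum>g\<in>I. P g g)"
    by (simp add: P_def \<delta>_def trace_entry)
  also have "\<dots> = (\<Sum>g\<in>I. \<Sum>b\<in>B. P (gg b) g * L b (tab_poly \<omega> g))"
    by (rule sum.cong[OF refl], subst P1) (auto simp: mult.commute)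
  also have "\<dots> = (\<Sum>b\<in>B. L b (tab_poly \<omega> (gg b)))"
    by (subst sum.swap) (use gg P2 in auto)
  also have "\<dots> = (\<Sum>b\<in>B. 1)"
    by (rule sum.cong) (auto simp: gg L(2))
  finally show ?thesis using B(4) by simp
qed

end

end

section \<open>Standard monomials of a hexagon\<close>

lemma independent_distinct_degrees:
  fixes R :: "'i \<Rightarrow> 'a::field poly"
  assumes fin: "finite T" and inj: "inj_on (\<lambda>i. degree (R i)) T" and nz: "\<And>i. i \<in> T \<Longrightarrow> R i \<noteq> 0"
  shows "inj_on R T" "\<not> module.dependent smult (R ` T)"
proof -
  interpret V: vector_space "smult :: 'a \<Rightarrow> 'a poly \<Rightarrow> 'a poly" by (rule vector_space_poly)
  show injR: "inj_on R T" using inj unfolding inj_on_def by metis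
  show "\<not> V.dependent (R ` T)"
  proof
    assume "V.dependent (R ` T)"
    then obtain u q where u: "(\<Sum>v\<in>R ` T. smult (u v) v) = 0" "q \<in> R ` T" "u q \<noteq> 0"
      using V.dependent_finite[of "R ` T"] fin by auto
    define T' where "T' = {i\<in>T. u (R i) \<noteq> 0}"
    have T': "finite T'" "T' \<noteq> {}" using fin u by (auto simp: T'_def)
    obtain i where i: "i \<in> T'" "\<And>k. k \<in> T' \<Longrightarrow> degree (R k) \<le> degree (R i)"
    proof -
      have "Max ((\<lambda>i. degree (R i)) ` T') \<in> (\<lambda>i. degree (R i)) ` T'" using T' by (intro Max_in) auto
      then obtain i where "i \<in> T'" "degree (R i) = Max ((\<lambda>i. degree (R i)) ` T')" by auto
      then show ?thesis using T' by (intro that[of i]) auto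
    qed
    have "0 = coeff (\<Sum>k\<in>T. smult (u (R k)) (R k)) (degree (R i))"
      using u(1) injR by (simp add: sum.reindex)
    also have "\<dots> = (\<Sum>k\<in>T. if k = i then u (R i) * lead_coeff (R i) else 0)"
      unfolding coeff_sum
    proof (rule sum.cong[OF refl])
      fix k assume k: "k \<in> T"
      show "coeff (smult (u (R k)) (R k)) (degree (R i)) = (if k = i then u (R i) * lead_coeff (R i) else 0)"
      proof (cases "k = i \<or> u (R k) = 0")
        case True
        then show ?thesis using i by (auto simp: T'_def)
      next
        case False
        then have "degree (R k) \<le> degree (R i)" using i k by (auto simp: T'_def)
        moreover have "degree (R k) \<noteq> degree (R i)"
          using inj k i False unfolding T'_def inj_on_def by blast
        ultimately have "coeff (R k) (degree (R i)) = 0" by (intro coeff_eq_0) simp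
        then show ?thesis using False by simp
      qed
    qed
    also have "\<dots> = u (R i) * lead_coeff (R i)" using fin i by (simp add: T'_def)
    finally show False using i nz by (auto simp: T'_def)
  qed
qed

type_synonym expo = "nat \<Rightarrow> nat \<Rightarrow> nat"

definition expos :: "(nat \<Rightarrow> nat) \<Rightarrow> expo set"
  where "expos d = {E. (\<forall>v c. v \<ge> 6 \<or> c \<ge> 3 \<longrightarrow> E v c = 0) \<and> (\<forall>v<6. E v 0 + E v 1 + E v 2 = d v)}"

text \<open>Vertices \<open>0, 2, 4\<close> are the lines, vertices \<open>1, 3, 5\<close> the planes labelled by their missing
  colour; consecutive vertices are incident.  Along the edge from \<open>e\<close> to \<open>e + 1\<close> the incidence
  relation is used to rewrite colour \<open>e mod 3\<close>.\<close>
definition expo_weight :: "expo \<Rightarrow> nat \<Rightarrow> int"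
  where "expo_weight E c = (if c < 3 then int (E 0 c + E 2 c + E 4 c) - int (E 1 c + E 3 c + E 5 c) else 0)"

definition std_expo :: "expo \<Rightarrow> bool"
  where "std_expo E \<longleftrightarrow> (\<forall>e<6. E e (e mod 3) = 0 \<or> E ((e + 1) mod 6) (e mod 3) = 0)"

definition expo_mono :: "(nat \<Rightarrow> nat \<Rightarrow> 'a::comm_ring_1) \<Rightarrow> expo \<Rightarrow> 'a"
  where "expo_mono M E = (\<Prod>v<6. \<Prod>c<3. M v c ^ E v c)"

definition bump :: "expo \<Rightarrow> nat \<Rightarrow> nat \<Rightarrow> expo"
  where "bump E v c = E(v := (E v)(c := Suc (E v c)))"

lemma less_6_cases: "(e::nat) < 6 \<longleftrightarrow> e = 0 \<or> e = 1 \<or> e = 2 \<or> e = 3 \<or> e = 4 \<or> e = 5"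
  by auto

lemma less_3_cases: "(e::nat) < 3 \<longleftrightarrow> e = 0 \<or> e = 1 \<or> e = 2"
  by auto

lemma lessThan_6: "{..<6::nat} = {0,1,2,3,4,5}" by auto
lemma lessThan_3: "{..<3::nat} = {0,1,2}" by auto

lemma expo_mono_bump:
  assumes "v < 6" "c < 3" shows "expo_mono M (bump E v c) = expo_mono M E * M v c"
proof -
  have 1: "(\<Prod>c'<3. M v c' ^ bump E v c v c') = (\<Prod>c'<3. M v c' ^ E v c') * M v c"
    using assms(2) unfolding less_3_cases lessThan_3 by (auto simp: bump_def mult_ac)
  have "expo_mono M (bump E v c) = (\<Prod>c'<3. M v c' ^ bump E v c v c') *
     (\<Prod>v'\<in>{..<6}-{v}. \<Prod>c'<3. M v' c' ^ bump E v c v' c')"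
    unfolding expo_mono_def using assms by (intro prod.remove) auto
  also have "(\<Prod>v'\<in>{..<6}-{v}. \<Prod>c'<3. M v' c' ^ bump E v c v' c')
     = (\<Prod>v'\<in>{..<6}-{v}. \<Prod>c'<3. M v' c' ^ E v' c')"
    by (rule prod.cong) (auto simp: bump_def)
  also have "(\<Prod>c'<3. M v c' ^ bump E v c v c') * \<dots> = M v c * ((\<Prod>c'<3. M v c' ^ E v c') *
     (\<Prod>v'\<in>{..<6}-{v}. \<Prod>c'<3. M v' c' ^ E v' c'))"
    by (simp add: 1 mult_ac)
  also have "(\<Prod>c'<3. M v c' ^ E v c') *
     (\<Prod>v'\<in>{..<6}-{v}. \<Prod>c'<3. M v' c' ^ E v' c') = expo_mono M E"
    unfolding expo_mono_def using assms by (intro prod.remove[symmetric]) auto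
  finally show ?thesis by (simp add: mult.commute)
qed

lemma expo_mono_add: "expo_mono M (\<lambda>v c. E v c + F v c) = expo_mono M E * expo_mono M F"
  by (simp add: expo_mono_def power_add prod.distrib)

text \<open>The two edges at v rewrite the colours \<open>v mod 3\<close> and
  \<open>(v + 2) mod 3\<close>; counted here is the third colour, which no rewriting at v
  removes.\<close>

definition missing_count :: "expo \<Rightarrow> nat"
  where "missing_count E = (\<Sum>v<6. E v ((v + 1) mod 3))"

text \<open>Each rewriting step replaces two equal colours along an edge by one of the two other
  colours, and each new term gains exactly one unit of \<open>missing_count\<close>. The vertex
  degrees bound this count, so the process stops. The common factor \<open>W\<close> will stand for
  the full columns.\<close>

lemma straightening:
  fixes M :: "nat \<Rightarrow> nat \<Rightarrow> 'a::field poly"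
  assumes rel: "\<And>e. e < 6 \<Longrightarrow> M e 0 * M ((e + 1) mod 6) 0 + M e 1 * M ((e + 1) mod 6) 1 + M e 2 * M ((e + 1) mod 6) 2 = 0"
    and E: "E \<in> expos d"
  shows "W * expo_mono M E \<in> module.span smult
    ((\<lambda>E. W * expo_mono M E) ` {F \<in> expos d. std_expo F \<and> expo_weight F = expo_weight E})"
proof -
  interpret V: vector_space "smult :: 'a \<Rightarrow> 'a poly \<Rightarrow> 'a poly" by (rule vector_space_poly)
  have bound: "missing_count E \<le> (\<Sum>v<6. d v)" if "E \<in> expos d" for E
    unfolding missing_count_def
  proof (rule sum_mono)
    fix v :: nat assume "v \<in> {..<6}"
    then have "v < 6" by simp
    then have "E v 0 + E v 1 + E v 2 = d v" using that by (auto simp: expos_def)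
    moreover have "(v + 1) mod 3 = 0 \<or> (v + 1) mod 3 = 1 \<or> (v + 1) mod 3 = 2" by presburger
    ultimately show "E v ((v + 1) mod 3) \<le> d v" by auto
  qed
  show ?thesis using E
  proof (induction "(\<Sum>v<6. d v) - missing_count E" arbitrary: E rule: less_induct)
    case less
    show ?case
    proof (cases "std_expo E")
      case True
      then show ?thesis using less.prems by (intro V.span_base) auto
    next
      case False
      then obtain e where e: "e < 6" "E e (e mod 3) > 0" "E ((e + 1) mod 6) (e mod 3) > 0"
        by (auto simp: std_expo_def)
      define a where "a = e mod 3"
      define e' where "e' = (e + 1) mod 6"
      have ne: "e' \<noteq> e" "e' < 6" "a < 3" using e(1) unfolding less_6_cases e'_def a_def by auto
      \<comment> \<open>\<open>E0\<close> is the monomial without the two factors to be rewritten,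
        and \<open>Eb b\<close> puts colour b in their place.\<close>
      define E0 where "E0 = E(e := (E e)(a := E e a - 1), e' := (E e')(a := E e' a - 1))"
      have EE0: "E = bump (bump E0 e a) e' a"
        using e ne unfolding E0_def bump_def a_def[symmetric] e'_def[symmetric] by (auto simp: fun_eq_iff)
      define Eb where "Eb = (\<lambda>b. bump (bump E0 e b) e' b)"
      have mono: "expo_mono M (Eb b) = expo_mono M E0 * (M e b * M e' b)" if "b < 3" for b
        unfolding Eb_def using that e(1) ne by (simp add: expo_mono_bump mult.assoc)
      have sumb: "bump E v c w 0 + bump E v c w 1 + bump E v c w 2 = E w 0 + E w 1 + E w 2 + (if w = v then 1 else 0)"
        if "c < 3" for E v c w
        using that unfolding less_3_cases by (auto simp: bump_def)
      have zb: "(\<forall>v c. v \<ge> 6 \<or> c \<ge> 3 \<longrightarrow> bump E w b v c = 0) \<longleftrightarrow> (\<forall>v c. v \<ge> 6 \<or> c \<ge> 3 \<longrightarrow> E v c = 0)"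
        if "w < 6" "b < 3" for E w b
        using that by (auto simp: bump_def)
      have Eb_expos: "Eb b \<in> expos d" if "b < 3" for b
        using less.prems that e(1) ne unfolding EE0 Eb_def expos_def mem_Collect_eq
        by (simp only: zb sumb)
      have wb: "expo_weight (bump E v c) = (\<lambda>x. expo_weight E x + (if x = c then (-1) ^ v else 0))"
        if "v < 6" "c < 3" for E v c
        using that unfolding less_6_cases less_3_cases by (auto simp: expo_weight_def bump_def fun_eq_iff)
      \<comment> \<open>One end of an edge is a line and the other a plane, and these count with
        opposite signs in the weight.\<close>
      have "even e \<longleftrightarrow> odd e'" using e(1) unfolding e'_def less_6_cases by auto
      then have sgn: "(-1::int) ^ e + (-1) ^ e' = 0" by (cases "even e") auto
      have weight: "expo_weight (Eb b) = expo_weight E0" if "b < 3" for b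
        unfolding Eb_def using that e(1) ne sgn by (auto simp: wb fun_eq_iff)
      have mb: "missing_count (bump E v c) = missing_count E + (if c = (v + 1) mod 3 then 1 else 0)"
        if "v < 6" "c < 3" for E v c
        using that unfolding missing_count_def lessThan_6 less_6_cases less_3_cases
        by (elim disjE) (simp_all add: bump_def One_nat_def[symmetric] del: One_nat_def)
      have "E = Eb a" by (simp add: EE0 Eb_def)
      have step: "W * expo_mono M (Eb b) \<in> V.span
           ((\<lambda>E. W * expo_mono M E) ` {F \<in> expos d. std_expo F \<and> expo_weight F = expo_weight E})"
        if b: "b < 3" "b \<noteq> a" for b
      proof -
        have "missing_count E = missing_count E0"
          unfolding \<open>E = Eb a\<close> Eb_def mb[OF ne(2,3)] mb[OF e(1) ne(3)]
          using e(1) unfolding a_def e'_def less_6_cases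
          by (elim disjE) (simp_all add: One_nat_def[symmetric] del: One_nat_def)
        moreover have "missing_count (Eb b) = missing_count E0 + 1"
          unfolding Eb_def mb[OF ne(2) b(1)] mb[OF e(1) b(1)]
          using e(1) b unfolding a_def e'_def less_6_cases less_3_cases
          by (elim disjE) (simp_all add: One_nat_def[symmetric] del: One_nat_def)
        ultimately have "(\<Sum>v<6. d v) - missing_count (Eb b) < (\<Sum>v<6. d v) - missing_count E"
          using bound[OF Eb_expos[OF b(1)]] by linarith
        from less.hyps[OF this Eb_expos[OF b(1)]] show ?thesis
          using weight[OF b(1)] weight[OF ne(3)] \<open>E = Eb a\<close> by simp
      qed
      define b c where "b = (a + 1) mod 3" and "c = (a + 2) mod 3"
      have bc: "b < 3" "c < 3" "b \<noteq> a" "c \<noteq> a" using ne(3) unfolding b_def c_def less_3_cases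
        by (elim disjE; simp add: One_nat_def[symmetric] del: One_nat_def)+
      have r: "M e a * M e' a = - (M e b * M e' b) - M e c * M e' c"
      proof -
        have "M e a * M e' a + M e b * M e' b + M e c * M e' c = 0"
          using rel[OF e(1)] ne(3) unfolding e'_def[symmetric] b_def c_def less_3_cases
          by (elim disjE) (simp_all add: ac_simps One_nat_def[symmetric] del: One_nat_def)
        then show ?thesis by (simp add: algebra_simps eq_neg_iff_add_eq_0)
      qed
      have "W * expo_mono M E = - (W * expo_mono M (Eb b)) - W * expo_mono M (Eb c)"
        unfolding \<open>E = Eb a\<close> mono[OF ne(3)] mono[OF bc(1)] mono[OF bc(2)] r
        by (simp add: algebra_simps)
      also have "\<dots> \<in> V.span ((\<lambda>E. W * expo_mono M E) ` {F \<in> expos d. std_expo F \<and> expo_weight F = expo_weight E})"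
        using step bc by (intro V.span_diff V.span_neg) auto
      finally show ?thesis .
    qed
  qed
qed

definition cross :: "(nat \<Rightarrow> nat \<Rightarrow> 'a::comm_ring_1) \<Rightarrow> nat \<Rightarrow> nat \<Rightarrow> nat \<Rightarrow> 'a"
  where "cross X r s c = X r ((c + 1) mod 3) * X s ((c + 2) mod 3) - X r ((c + 2) mod 3) * X s ((c + 1) mod 3)"

text \<open>The vertices of a triangle alternate with its sides, the side through two vertices being their
  cross product.\<close>
definition gen :: "(nat \<Rightarrow> nat \<Rightarrow> 'a::comm_ring_1) \<Rightarrow> nat \<Rightarrow> nat \<Rightarrow> 'a"
  where "gen X v c = (if even v then X (v div 2) c else cross X (v div 2) ((v div 2 + 1) mod 3) c)"

text \<open>A vector is orthogonal to its cross product with any other: a vertex of the triangle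
  lies on the two sides through it.\<close>

lemma gen_relation:
  assumes "e < 6"
  shows "gen X e 0 * gen X ((e + 1) mod 6) 0 + gen X e 1 * gen X ((e + 1) mod 6) 1 + gen X e 2 * gen X ((e + 1) mod 6) 2 = 0"
  using assms unfolding less_6_cases
  by (elim disjE) (simp_all add: gen_def cross_def algebra_simps One_nat_def[symmetric] del: One_nat_def)

text \<open>\<open>Yx\<close> and \<open>Zx\<close> are two standard monomials with the same leading monomial; the leading
  monomial of their difference is new, and that is the only correction needed to make leading
  monomials of a standard basis distinct.\<close>
definition Yx :: expo where "Yx v c = (if v < 6 \<and> c = (v + 2) mod 3 then 1 else 0)"
definition Zx :: expo where "Zx v c = (if v < 6 \<and> c = (v + 1) mod 3 then 1 else 0)"

lemma YZ_table:
  "Yx 0 c = (if c = 2 then 1 else 0)" "Yx 1 c = (if c = 0 then 1 else 0)" "Yx 2 c = (if c = 1 then 1 else 0)"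
  "Yx 3 c = (if c = 2 then 1 else 0)" "Yx 4 c = (if c = 0 then 1 else 0)" "Yx 5 c = (if c = 1 then 1 else 0)"
  "Zx 0 c = (if c = 1 then 1 else 0)" "Zx 1 c = (if c = 2 then 1 else 0)" "Zx 2 c = (if c = 0 then 1 else 0)"
  "Zx 3 c = (if c = 1 then 1 else 0)" "Zx 4 c = (if c = 2 then 1 else 0)" "Zx 5 c = (if c = 0 then 1 else 0)"
  by (simp_all add: Yx_def Zx_def)

text \<open>The largest power of \<open>Yx\<close> dividing the monomial, but 0 as soon as some
  colour \<open>e mod 3\<close> occurs at its vertex e. In a standard exponent such an occurrence
  excludes a factor of \<open>Yx\<close>.\<close>

definition min_y :: "expo \<Rightarrow> nat"
  where "min_y E = (if \<exists>e<6. E e (e mod 3) > 0 then 0 else Min ((\<lambda>e. E ((e + 1) mod 6) (e mod 3)) ` {..<6}))"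

definition corrected :: "(nat \<Rightarrow> nat \<Rightarrow> 'a::comm_ring_1) \<Rightarrow> expo \<Rightarrow> 'a"
  where "corrected M E = expo_mono M (\<lambda>v c. E v c - min_y E * Yx v c) *
     (expo_mono M Yx - expo_mono M Zx) ^ min_y E"

lemma min_y_le:
  assumes "e < 6" shows "min_y E \<le> E ((e + 1) mod 6) (e mod 3)"
  using assms unfolding min_y_def by (auto intro!: Min_le)

lemma min_y_eqs:
  "min_y E \<le> E 1 0" "min_y E \<le> E 2 1" "min_y E \<le> E 3 2" "min_y E \<le> E 4 0" "min_y E \<le> E 5 1" "min_y E \<le> E 0 2"
  using min_y_le[of 0 E] min_y_le[of 1 E] min_y_le[of 2 E] min_y_le[of 3 E] min_y_le[of 4 E] min_y_le[of 5 E]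
  by (simp_all add: One_nat_def[symmetric] del: One_nat_def)

text \<open>\<open>Yx\<close> and \<open>Zx\<close> have the same degree at every vertex and the
  same weight, so expanding the power of their difference stays inside one weight space.\<close>

lemma corrected_in_span:
  fixes M :: "nat \<Rightarrow> nat \<Rightarrow> 'a::field poly"
  assumes E: "E \<in> expos d"
  shows "W * corrected M E \<in> module.span smult
    ((\<lambda>E. W * expo_mono M E) ` {F \<in> expos d. expo_weight F = expo_weight E})"
proof -
  interpret V: vector_space "smult :: 'a \<Rightarrow> 'a poly \<Rightarrow> 'a poly" by (rule vector_space_poly)
  let ?S = "V.span ((\<lambda>E. W * expo_mono M E) ` {F \<in> expos d. expo_weight F = expo_weight E})"
  let ?G = "expo_mono M Yx - expo_mono M Zx"
  have main: "W * (expo_mono M F * ?G ^ j) \<in> ?S"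
    if "(\<lambda>v c. F v c + j * Yx v c) \<in> expos d" "expo_weight (\<lambda>v c. F v c + j * Yx v c) = expo_weight E" for F j
    using that
  proof (induction j arbitrary: F)
    case 0
    then show ?case by (intro V.span_base image_eqI[of _ _ F]) auto
  next
    case (Suc j)
    have eY: "(\<lambda>v c. F v c + Yx v c + j * Yx v c) = (\<lambda>v c. F v c + Suc j * Yx v c)"
      by (auto simp: fun_eq_iff)
    have 1: "W * (expo_mono M (\<lambda>v c. F v c + Yx v c) * ?G ^ j) \<in> ?S"
      by (rule Suc.IH) (use Suc.prems eY in simp_all)
    have 2: "W * (expo_mono M (\<lambda>v c. F v c + Zx v c) * ?G ^ j) \<in> ?S"
    proof (rule Suc.IH)
      have row: "Yx v 0 + Yx v 1 + Yx v 2 = Zx v 0 + Zx v 1 + Zx v 2" for v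
      proof -
        have "(v + 2) mod 3 = 0 \<and> (v + 1) mod 3 = 2 \<or> (v + 2) mod 3 = 1 \<and> (v + 1) mod 3 = 0 \<or>
            (v + 2) mod 3 = 2 \<and> (v + 1) mod 3 = 1" by presburger
        then show ?thesis by (auto simp: Yx_def Zx_def)
      qed
      have z: "Zx v c = 0" if "v \<ge> 6 \<or> c \<ge> 3" for v c
        using that by (auto simp: Zx_def)
      show "(\<lambda>v c. F v c + Zx v c + j * Yx v c) \<in> expos d"
        unfolding expos_def mem_Collect_eq
      proof (intro conjI allI impI)
        fix v c :: nat assume "6 \<le> v \<or> 3 \<le> c"
        then have "F v c + Suc j * Yx v c = 0" "Zx v c = 0" using Suc.prems(1) z by (auto simp: expos_def)
        then show "F v c + Zx v c + j * Yx v c = 0" by auto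
      next
        fix v :: nat assume "v < 6"
        then have "F v 0 + Suc j * Yx v 0 + (F v 1 + Suc j * Yx v 1) + (F v 2 + Suc j * Yx v 2) = d v"
          using Suc.prems(1) by (auto simp: expos_def)
        then show "F v 0 + Zx v 0 + j * Yx v 0 + (F v 1 + Zx v 1 + j * Yx v 1) + (F v 2 + Zx v 2 + j * Yx v 2) = d v"
          using row[of v] unfolding mult_Suc by linarith
      qed
      have "expo_weight (\<lambda>v c. F v c + Zx v c + j * Yx v c) = expo_weight (\<lambda>v c. F v c + Suc j * Yx v c)"
        unfolding fun_eq_iff expo_weight_def YZ_table mult_Suc by simp
      then show "expo_weight (\<lambda>v c. F v c + Zx v c + j * Yx v c) = expo_weight E"
        using Suc.prems(2) by simp
    qed
    have "W * (expo_mono M F * ?G ^ Suc j) = W * (expo_mono M (\<lambda>v c. F v c + Yx v c) * ?G ^ j)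
       - W * (expo_mono M (\<lambda>v c. F v c + Zx v c) * ?G ^ j)"
      unfolding expo_mono_add by (simp add: algebra_simps)
    then show ?case using V.span_diff[OF 1 2] by simp
  qed
  have e: "E v c - min_y E * Yx v c + min_y E * Yx v c = E v c" for v c
  proof -
    have "min_y E * Yx v c \<le> E v c"
    proof (cases "v < 6 \<and> c = (v + 2) mod 3")
      case True
      then have "v < 6" "c = (v + 2) mod 3" by auto
      then show ?thesis using min_y_eqs[of E] unfolding less_6_cases
        by (elim disjE) (simp_all add: Yx_def One_nat_def[symmetric] del: One_nat_def)
    qed (auto simp: Yx_def)
    then show ?thesis by simp
  qed
  show ?thesis unfolding corrected_def by (rule main) (use E e in simp_all)
qed

text \<open>Reduction modulo \<open>N\<close> reads off the lowest digit, whatever stands above. The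
  terms \<open>h\<close> and \<open>h'\<close> absorb the weights that select leading terms.\<close>

lemma base_expansion_unique:
  fixes u v :: "nat \<Rightarrow> nat"
  assumes "(\<Sum>i<k. u i * N ^ i) + N ^ k * h = (\<Sum>i<k. v i * N ^ i) + N ^ k * h'"
    "\<And>i. i < k \<Longrightarrow> u i < N" "\<And>i. i < k \<Longrightarrow> v i < N" "i < k"
  shows "u i = v i"
  using assms
proof (induction k arbitrary: u v i)
  case (Suc k)
  have N: "N > 0" using Suc.prems(2)[of 0] by simp
  have s: "(\<Sum>i<Suc k. u i * N ^ i) + N ^ Suc k * h = u 0 + N * ((\<Sum>i<k. u (Suc i) * N ^ i) + N ^ k * h)" for u h
    by (simp add: sum.lessThan_Suc_shift algebra_simps sum_distrib_left del: sum.lessThan_Suc)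
  have eq: "u 0 + N * ((\<Sum>i<k. u (Suc i) * N ^ i) + N ^ k * h) = v 0 + N * ((\<Sum>i<k. v (Suc i) * N ^ i) + N ^ k * h')"
    using Suc.prems(1) unfolding s .
  have "u 0 = (u 0 + N * ((\<Sum>i<k. u (Suc i) * N ^ i) + N ^ k * h)) mod N"
    using Suc.prems(2)[of 0] by simp
  also have "\<dots> = v 0" unfolding eq using Suc.prems(3)[of 0] by simp
  finally have 0: "u 0 = v 0" .
  then have "(\<Sum>i<k. u (Suc i) * N ^ i) + N ^ k * h = (\<Sum>i<k. v (Suc i) * N ^ i) + N ^ k * h'"
    using eq N by simp
  from Suc.IH[OF this] Suc.prems(2,3) have "u (Suc i) = v (Suc i)" if "i < k" for i
    using that by simp
  with 0 show ?case using Suc.prems(4) by (cases i) auto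
qed simp

text \<open>If \<open>x\<^sub>e y\<^sub>e = 0\<close> for both solutions and the \<open>x\<^sub>e - y\<^sub>e + y\<^bsub>e-1\<^esub>\<close> agree, then the differences
  \<open>t\<^sub>e\<close> of the \<open>y\<^sub>e\<close> satisfy \<open>(t\<^sub>e - t\<^bsub>e-1\<^esub>) t\<^sub>e \<le> 0\<close>; the sum of these is half a sum of squares.\<close>
lemma cyclic_rigidity:
  fixes t0 t1 t2 t3 t4 t5 :: int
  assumes "(t0 - t5) * t0 \<le> 0" "(t1 - t0) * t1 \<le> 0" "(t2 - t1) * t2 \<le> 0"
    "(t3 - t2) * t3 \<le> 0" "(t4 - t3) * t4 \<le> 0" "(t5 - t4) * t5 \<le> 0"
  shows "t0 = t5 \<and> t1 = t5 \<and> t2 = t5 \<and> t3 = t5 \<and> t4 = t5"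
proof -
  have "(t0 - t5)^2 + (t1 - t0)^2 + (t2 - t1)^2 + (t3 - t2)^2 + (t4 - t3)^2 + (t5 - t4)^2
    = 2 * ((t0 - t5) * t0 + (t1 - t0) * t1 + (t2 - t1) * t2 + (t3 - t2) * t3 + (t4 - t3) * t4 + (t5 - t4) * t5)"
    by (simp add: power2_eq_square algebra_simps)
  also have "\<dots> \<le> 0"
  proof -
    have "2 * (a + b + c + d + e + f) \<le> 0" if "a \<le> 0" "b \<le> 0" "c \<le> 0" "d \<le> 0" "e \<le> 0" "f \<le> 0"
      for a b c d e f :: int using that by simp
    from this[OF assms] show ?thesis .
  qed
  finally have *: "(t0 - t5)^2 + (t1 - t0)^2 + (t2 - t1)^2 + (t3 - t2)^2 + (t4 - t3)^2 + (t5 - t4)^2 \<le> 0" .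
  have z: "a ^ 2 = 0" if "a ^ 2 \<le> 0" for a :: int
    using that zero_le_power2[of a] by (rule antisym)
  have aux: "a \<le> 0 \<and> b \<le> 0 \<and> c \<le> 0 \<and> d \<le> 0 \<and> e \<le> 0"
    if "a + b + c + d + e + f \<le> 0" "a \<ge> 0" "b \<ge> 0" "c \<ge> 0" "d \<ge> 0" "e \<ge> 0" "f \<ge> 0"
    for a b c d e f :: int using that by linarith
  have "(t0 - t5)^2 \<le> 0 \<and> (t1 - t0)^2 \<le> 0 \<and> (t2 - t1)^2 \<le> 0 \<and> (t3 - t2)^2 \<le> 0 \<and> (t4 - t3)^2 \<le> 0"
    by (rule aux[OF *]) simp_all
  then have "t0 - t5 = 0 \<and> t1 - t0 = 0 \<and> t2 - t1 = 0 \<and> t3 - t2 = 0 \<and> t4 - t3 = 0"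
    using z by simp
  then show ?thesis by simp
qed

text \<open>If x > x' then x > 0, hence y = 0 \<le> y'; the other case is symmetric.\<close>

lemma complementary_differences:
  fixes x y x' y' :: nat
  assumes "x = 0 \<or> y = 0" "x' = 0 \<or> y' = 0"
  shows "(int x - int x') * (int y - int y') \<le> 0"
  using assms by (auto simp: mult_nonneg_nonpos mult_nonpos_nonneg mult_le_0_iff)

section \<open>Independence by Kronecker substitution\<close>

text \<open>The values are chosen such that the two terms of every generator that is a minor have
  different weights, and such that the coincidence of \<open>Yx\<close> and \<open>Zx\<close> is the
  only one to be corrected.\<close>

definition heavy :: "nat \<Rightarrow> nat \<Rightarrow> nat"
  where "heavy r c = (if (r, c) \<in> {(0,0), (1,2), (2,1)} then 3 else if (r, c) \<in> {(0,2), (1,1)} then 1 else 0)"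

text \<open>Kronecker substitution: the digits in base \<open>N\<close> record the exponents, the coefficient of
  \<open>N\<^sup>1\<^sup>0\<close> is the weight that selects leading terms.\<close>
definition wexp :: "nat \<Rightarrow> nat \<Rightarrow> nat \<Rightarrow> nat"
  where "wexp N r c = heavy r c * N ^ 10 + N ^ (3 * r + c)"

abbreviation kron :: "nat \<Rightarrow> nat \<Rightarrow> nat \<Rightarrow> 'a::field poly"
  where "kron N r c \<equiv> monom 1 (wexp N r c)"

text \<open>The degree of the leading term of each generator; for a minor this is the heavier of its
  two terms.\<close>

definition ldeg :: "nat \<Rightarrow> nat \<Rightarrow> nat \<Rightarrow> nat"
  where "ldeg N v c =
   (if even v then wexp N (v div 2) c
    else if v = 1 then (if c = 0 then wexp N 0 1 + wexp N 1 2 else if c = 1 then wexp N 0 0 + wexp N 1 2 else wexp N 0 0 + wexp N 1 1)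
    else if v = 3 then (if c = 0 then wexp N 1 2 + wexp N 2 1 else if c = 1 then wexp N 1 2 + wexp N 2 0 else wexp N 1 0 + wexp N 2 1)
    else (if c = 0 then wexp N 0 2 + wexp N 2 1 else if c = 1 then wexp N 0 0 + wexp N 2 2 else wexp N 0 0 + wexp N 2 1))"

lemma wexp_table:
  "wexp N 0 0 = 3 * N ^ 10 + 1" "wexp N 0 1 = N" "wexp N 0 2 = N ^ 10 + N ^ 2"
  "wexp N 1 0 = N ^ 3" "wexp N 1 1 = N ^ 10 + N ^ 4" "wexp N 1 2 = 3 * N ^ 10 + N ^ 5"
  "wexp N 2 0 = N ^ 6" "wexp N 2 1 = 3 * N ^ 10 + N ^ 7" "wexp N 2 2 = N ^ 8"
  by (simp_all add: wexp_def heavy_def power2_eq_square)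

text \<open>The last bound, with 16 = 4 * 4 from \<open>N \<ge> 4\<close>, ensures that the digit
  parts of a product of nine entries add up to less than one unit of weight.\<close>

lemma pow_bounds:
  assumes "N \<ge> (4::nat)"
  shows "N \<le> N ^ 8" "1 \<le> N ^ 8" "N ^ 2 \<le> N ^ 8" "N ^ 3 \<le> N ^ 8" "N ^ 4 \<le> N ^ 8" "N ^ 5 \<le> N ^ 8" "N ^ 6 \<le> N ^ 8" "N ^ 7 \<le> N ^ 8"
    "16 * N ^ 8 \<le> N ^ 10"
proof -
  have p: "N ^ i \<le> N ^ 8" if "i \<le> 8" for i using assms that by (intro power_increasing) auto
  show "N \<le> N ^ 8" using p[of 1] by simp
  show "1 \<le> N ^ 8" using assms by simp
  show "N ^ 2 \<le> N ^ 8" "N ^ 3 \<le> N ^ 8" "N ^ 4 \<le> N ^ 8" "N ^ 5 \<le> N ^ 8" "N ^ 6 \<le> N ^ 8" "N ^ 7 \<le> N ^ 8"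
    by (auto intro!: p)
  have "4 * 4 \<le> N * N" using assms by (intro mult_le_mono) auto
  then have "16 * N ^ 8 \<le> N * N * N ^ 8" by (intro mult_right_mono) auto
  also have "\<dots> = N ^ (2 + 8)" unfolding power_add power2_eq_square ..
  also have "\<dots> = N ^ 10" by simp
  finally show "16 * N ^ 8 \<le> N ^ 10" .
qed

lemma degree_monom_diff:
  assumes "p \<noteq> q" "max p q = t"
  shows "degree (monom 1 p - monom (1::'a::field) q) = t \<and> monom 1 p \<noteq> monom (1::'a) q"
proof -
  have ne: "monom 1 p \<noteq> monom (1::'a) q"
    using assms by (metis degree_monom_eq zero_neq_one)
  have "degree (monom 1 p + - monom (1::'a) q) = t"
  proof (cases "q < p")
    case True
    then have "degree (monom 1 p + - monom (1::'a) q) = degree (monom (1::'a) p)"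
      by (intro degree_add_eq_left) (simp add: degree_monom_eq)
    then show ?thesis using True assms by (simp add: degree_monom_eq)
  next
    case False
    then have "degree (monom 1 p + - monom (1::'a) q) = degree (- monom (1::'a) q)"
      using assms by (intro degree_add_eq_right) (simp add: degree_monom_eq)
    then show ?thesis using False assms by (simp add: degree_monom_eq)
  qed
  then show ?thesis using ne by simp
qed

lemma degree_gen:
  assumes N: "N \<ge> 4" and vc: "v < 6" "c < 3"
  shows "degree (gen (kron N) v c :: 'a::field poly) = ldeg N v c \<and> gen (kron N) v c \<noteq> (0 :: 'a poly)"
  using vc unfolding less_6_cases less_3_cases
  apply (elim disjE)
  apply (simp_all add: gen_def cross_def ldeg_def mult_monom degree_monom_eq One_nat_def[symmetric] del: One_nat_def)
  apply (rule degree_monom_diff; use pow_bounds[OF N] in \<open>unfold wexp_table, linarith\<close>)+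
  done

lemma expo_mono_Yx: "expo_mono M Yx = M 1 0 * M 2 1 * M 3 2 * M 4 0 * M 5 1 * M 0 2"
  and expo_mono_Zx: "expo_mono M Zx = M 0 1 * M 1 2 * M 2 0 * M 3 1 * M 4 2 * M 5 0"
  unfolding expo_mono_def lessThan_6 lessThan_3 by (simp_all add: YZ_table mult_ac del: One_nat_def)

text \<open>The leading terms of \<open>Yx\<close> and \<open>Zx\<close> are both the product of all
  nine entries, of weight 11, and cancel in the difference. The largest remaining monomial has x_01
  x_12 replaced by x_02 x_11 and has weight 10; this is its degree.\<close>

definition gdeg :: "nat \<Rightarrow> nat"
  where "gdeg N = wexp N 0 0 + 2 * wexp N 0 2 + wexp N 1 0 + 2 * wexp N 1 1 + wexp N 2 0 + wexp N 2 1 + wexp N 2 2"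

text \<open>What is left of the difference after the common leading terms have cancelled and the
  term of degree \<open>gdeg\<close> has been split off.\<close>

definition YZ_rest :: "(nat \<Rightarrow> nat \<Rightarrow> 'a::comm_ring_1) \<Rightarrow> 'a"
  where "YZ_rest x = (x 0 2 * x 1 1 * x 2 0 *
        (- (x 0 1 * x 1 2 * x 1 1 * x 2 0 * x 2 2 * x 0 0) - x 0 1 * x 1 2 * x 1 0 * x 2 1 * x 2 0 * x 0 2
         + x 0 1 * x 1 2 * x 1 1 * x 2 0 * x 2 0 * x 0 2 + x 0 2 * x 1 1 * x 1 1 * x 2 0 * x 2 2 * x 0 0
         + x 0 2 * x 1 1 * x 1 0 * x 2 1 * x 2 0 * x 0 2 - x 0 2 * x 1 1 * x 1 1 * x 2 0 * x 2 0 * x 0 2)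
      + x 0 1 * x 1 0 * x 2 2 *
        (x 0 1 * x 1 0 * x 1 2 * x 2 0 * x 2 1 * x 0 2 + x 0 0 * x 1 1 * x 1 0 * x 2 2 * x 2 1 * x 0 2
         + x 0 0 * x 1 1 * x 1 2 * x 2 0 * x 2 2 * x 0 1 - x 0 1 * x 1 0 * x 1 0 * x 2 2 * x 2 1 * x 0 2
         - x 0 1 * x 1 0 * x 1 2 * x 2 0 * x 2 2 * x 0 1 - x 0 0 * x 1 1 * x 1 0 * x 2 2 * x 2 2 * x 0 1
         + x 0 1 * x 1 0 * x 1 0 * x 2 2 * x 2 2 * x 0 1))"

lemma YZ_expansion:
  fixes x :: "nat \<Rightarrow> nat \<Rightarrow> 'a::comm_ring_1"
  shows "expo_mono (gen x) Yx - expo_mono (gen x) Zx =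
     - (x 0 2 * x 1 1 * x 2 0 * x 0 2 * x 1 1 * x 1 0 * x 2 1 * x 2 2 * x 0 0) + YZ_rest x"
  unfolding expo_mono_Yx expo_mono_Zx YZ_rest_def
  by (simp add: gen_def cross_def algebra_simps One_nat_def[symmetric] del: One_nat_def)

lemma degree_YZ:
  assumes N: "N \<ge> 4"
  shows "degree (expo_mono (gen (kron N)) Yx - expo_mono (gen (kron N)) Zx :: 'a::field poly) = gdeg N \<and>
     expo_mono (gen (kron N)) Yx - expo_mono (gen (kron N)) Zx \<noteq> (0 :: 'a poly)"
proof -
  define p :: "nat \<Rightarrow> 'a poly" where "p = monom 1"
  have lt: "degree (p k) < gdeg N" if "k < gdeg N" for k using that by (simp add: p_def degree_monom_eq)
  have add: "degree (a + b) < gdeg N" if "degree a < gdeg N" "degree b < gdeg N" for a b :: "'a poly"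
    using that by (rule degree_add_less)
  have dif: "degree (a - b) < gdeg N" if "degree a < gdeg N" "degree b < gdeg N" for a b :: "'a poly"
    using that by (rule degree_diff_less)
  have neg: "degree (- a) < gdeg N" if "degree a < gdeg N" for a :: "'a poly"
    using that by simp
  have s: "a * (b + c) = a * b + a * c" "a * (b - c) = a * b - a * c" "a * - b = - (a * b)"
    for a b c :: "'a poly" by (simp_all add: algebra_simps)
  have mm: "p a * p b = p (a + b)" for a b by (simp add: p_def mult_monom)
  \<comment> \<open>With the powers of \<open>N\<close> as atoms, every comparison of degrees
    becomes linear.\<close>
  define P2 P3 P4 P5 P6 P7 P8 P10 where "P2 = N ^ 2" and "P3 = N ^ 3" and "P4 = N ^ 4" and "P5 = N ^ 5"
    and "P6 = N ^ 6" and "P7 = N ^ 7" and "P8 = N ^ 8" and "P10 = N ^ 10"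
  note P = P2_def P3_def P4_def P5_def P6_def P7_def P8_def P10_def
  note w = wexp_table[of N, folded P] and bd = pow_bounds[OF N, folded P]
  define r :: "'a poly" where "r = YZ_rest (kron N)"
  have r: "expo_mono (gen (kron N)) Yx - expo_mono (gen (kron N)) Zx = - p (gdeg N) + r"
    unfolding YZ_expansion r_def
    by (rule arg_cong2[where f="(+)", OF _ refl]) (simp add: mult_monom p_def gdeg_def mult_2 ac_simps)
  have r2: "degree r < gdeg N"
    unfolding r_def YZ_rest_def s p_def[symmetric] mm
    by (intro add dif neg lt; unfold gdeg_def w; use bd in simp)
  have "degree (- p (gdeg N) + r) = degree (- p (gdeg N))"
    using r2 by (intro degree_add_eq_left) (simp add: p_def degree_monom_eq)
  then have d: "degree (- p (gdeg N) + r) = gdeg N" by (simp add: p_def degree_monom_eq)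
  moreover have "gdeg N > 0" by (simp add: gdeg_def wexp_table)
  ultimately show ?thesis using r by (metis degree_0 less_irrefl)
qed

lemma expo_mono_degree:
  assumes N: "N \<ge> 4"
  shows "degree (expo_mono (gen (kron N)) F :: 'a::field poly) = (\<Sum>v<6. \<Sum>c<3. F v c * ldeg N v c) \<and>
    expo_mono (gen (kron N)) F \<noteq> (0 :: 'a poly)"
proof -
  have nz: "gen (kron N) v c ^ F v c \<noteq> (0 :: 'a poly)" if "v < 6" "c < 3" for v c
    using degree_gen[OF N that, where 'a='a] by simp
  have nz2: "(\<Prod>c<3. gen (kron N) v c ^ F v c) \<noteq> (0 :: 'a poly)" if "v < 6" for v
    using nz that by simp
  have "degree (expo_mono (gen (kron N)) F :: 'a poly) = (\<Sum>v<6. \<Sum>c<3. degree (gen (kron N) v c ^ F v c :: 'a poly))"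
    unfolding expo_mono_def using nz nz2
    by (subst degree_prod_eq_sum_degree) (auto intro!: sum.cong degree_prod_eq_sum_degree)
  also have "\<dots> = (\<Sum>v<6. \<Sum>c<3. F v c * ldeg N v c)"
    by (intro sum.cong refl) (use degree_gen[OF N, where 'a='a] in \<open>simp add: degree_power_eq\<close>)
  finally show ?thesis using nz2 by (simp add: expo_mono_def)
qed

text \<open>Position 3 r + c holds the exponent of the matrix entry (r, c) in the leading monomial
  of a corrected monomial: \<open>F\<close> counts the plain generators and \<open>j\<close> the
  factors Yx - Zx.\<close>

definition digits :: "expo \<Rightarrow> nat \<Rightarrow> nat \<Rightarrow> nat"
  where "digits F j i = [F 0 0 + F 1 1 + F 1 2 + F 5 1 + F 5 2 + j, F 0 1 + F 1 0, F 0 2 + F 5 0 + 2 * j,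
    F 2 0 + F 3 2 + j, F 2 1 + F 1 2 + 2 * j, F 2 2 + F 1 0 + F 1 1 + F 3 0 + F 3 1,
    F 4 0 + F 3 1 + j, F 4 1 + F 3 0 + F 3 2 + F 5 0 + F 5 2 + j, F 4 2 + F 5 1 + j] ! i"

lemma lessThan_9: "{..<9::nat} = {0,1,2,3,4,5,6,7,8}" by auto

lemma degree_corrected:
  fixes E :: expo
  assumes N: "N \<ge> 4"
  defines "F \<equiv> (\<lambda>v c. E v c - min_y E * Yx v c)"
  shows "\<exists>h. degree (corrected (gen (kron N)) E :: 'a::field poly) = (\<Sum>i<9. digits F (min_y E) i * N ^ i) + N ^ 9 * h"
    and "corrected (gen (kron N)) E \<noteq> (0 :: 'a poly)"
proof -
  have nz: "expo_mono (gen (kron N)) F \<noteq> (0 :: 'a poly)"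
    using expo_mono_degree[OF N] by blast
  have nz2: "(expo_mono (gen (kron N)) Yx - expo_mono (gen (kron N)) Zx) ^ min_y E \<noteq> (0 :: 'a poly)"
    using degree_YZ[OF N, where 'a='a] by simp
  show "corrected (gen (kron N)) E \<noteq> (0 :: 'a poly)"
    using nz nz2 by (simp add: corrected_def F_def)
  have "degree (corrected (gen (kron N)) E :: 'a poly) =
      degree (expo_mono (gen (kron N)) F :: 'a poly) +
      degree ((expo_mono (gen (kron N)) Yx - expo_mono (gen (kron N)) Zx) ^ min_y E :: 'a poly)"
    unfolding corrected_def F_def[symmetric] using nz nz2 by (rule degree_mult_eq)
  also have "\<dots> = (\<Sum>v<6. \<Sum>c<3. F v c * ldeg N v c) + min_y E * gdeg N"
    using expo_mono_degree[OF N, of F, where 'a='a] degree_YZ[OF N, where 'a='a]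
    by (simp add: degree_power_eq)
  also have "\<dots> = (\<Sum>i<9. digits F (min_y E) i * N ^ i) + N ^ 9 * (N * (
      3 * (digits F (min_y E) 0 + digits F (min_y E) 5 + digits F (min_y E) 7) +
      (digits F (min_y E) 2 + digits F (min_y E) 4)))"
  proof -
    \<comment> \<open>The weight sits at \<open>N ^ 10\<close>; the place of \<open>N ^ 9\<close>
      stays empty.\<close>
    have e: "N ^ 9 * (N * k) = N ^ 10 * k" for k by (simp add: eval_nat_numeral)
    show ?thesis
      unfolding e lessThan_6 lessThan_3 lessThan_9 gdeg_def
      by (simp add: ldeg_def wexp_table digits_def algebra_simps One_nat_def[symmetric] del: One_nat_def)
  qed
  finally show "\<exists>h. degree (corrected (gen (kron N)) E :: 'a poly) = (\<Sum>i<9. digits F (min_y E) i * N ^ i) + N ^ 9 * h"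
    by blast
qed

lemma digits_table:
  "digits (\<lambda>v c. E v c - j * Yx v c) j 0 = E 0 0 + E 1 1 + E 1 2 + (E 5 1 - j) + E 5 2 + j"
  "digits (\<lambda>v c. E v c - j * Yx v c) j 1 = E 0 1 + (E 1 0 - j)"
  "digits (\<lambda>v c. E v c - j * Yx v c) j 2 = (E 0 2 - j) + E 5 0 + 2 * j"
  "digits (\<lambda>v c. E v c - j * Yx v c) j 3 = E 2 0 + (E 3 2 - j) + j"
  "digits (\<lambda>v c. E v c - j * Yx v c) j 4 = (E 2 1 - j) + E 1 2 + 2 * j"
  "digits (\<lambda>v c. E v c - j * Yx v c) j 5 = E 2 2 + (E 1 0 - j) + E 1 1 + E 3 0 + E 3 1"
  "digits (\<lambda>v c. E v c - j * Yx v c) j 6 = (E 4 0 - j) + E 3 1 + j"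
  "digits (\<lambda>v c. E v c - j * Yx v c) j 7 = E 4 1 + E 3 0 + (E 3 2 - j) + E 5 0 + E 5 2 + j"
  "digits (\<lambda>v c. E v c - j * Yx v c) j 8 = E 4 2 + (E 5 1 - j) + j"
  by (simp_all add: digits_def YZ_table One_nat_def[symmetric] del: One_nat_def)

text \<open>Let x_e and y_e be the exponents of colour \<open>e mod 3\<close> at e and at e + 1;
  standardness says x_e y_e = 0. Digits and vertex degrees determine \<open>j\<close> and then all
  x_e - y_e + y_(e-1). By \<open>cyclic_rigidity\<close> only a common shift of the y_e is left,
  which standardness or the minimality of \<open>j\<close> excludes.\<close>

lemma digits_injective:
  assumes E: "E \<in> expos d" "std_expo E" and E': "E' \<in> expos d" "std_expo E'"
    and eq: "\<And>i. i < 9 \<Longrightarrow> digits (\<lambda>v c. E v c - min_y E * Yx v c) (min_y E) i =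
        digits (\<lambda>v c. E' v c - min_y E' * Yx v c) (min_y E') i"
  shows "E = E'"
proof -
  define j j' where "j = min_y E" and "j' = min_y E'"
  have s: "E 0 0 + E 0 1 + E 0 2 = d 0" "E 1 0 + E 1 1 + E 1 2 = d 1" "E 2 0 + E 2 1 + E 2 2 = d 2"
     "E 3 0 + E 3 1 + E 3 2 = d 3" "E 4 0 + E 4 1 + E 4 2 = d 4" "E 5 0 + E 5 1 + E 5 2 = d 5"
    if "E \<in> expos d" for E using that by (auto simp: expos_def)
  have st: "E 0 0 = 0 \<or> E 1 0 = 0" "E 1 1 = 0 \<or> E 2 1 = 0" "E 2 2 = 0 \<or> E 3 2 = 0"
     "E 3 0 = 0 \<or> E 4 0 = 0" "E 4 1 = 0 \<or> E 5 1 = 0" "E 5 2 = 0 \<or> E 0 2 = 0"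
    if "std_expo E" for E
    using that[unfolded std_expo_def, rule_format, of 0] that[unfolded std_expo_def, rule_format, of 1]
      that[unfolded std_expo_def, rule_format, of 2] that[unfolded std_expo_def, rule_format, of 3]
      that[unfolded std_expo_def, rule_format, of 4] that[unfolded std_expo_def, rule_format, of 5]
    by (simp_all add: One_nat_def[symmetric] del: One_nat_def)
  have eqs: "digits (\<lambda>v c. E v c - j * Yx v c) j i = digits (\<lambda>v c. E' v c - j' * Yx v c) j' i" if "i < 9" for i
    using eq[OF that] by (simp only: j_def j'_def)
  have q: "\<forall>i\<in>{0,1,2,3,4,5,6,7,8}. digits (\<lambda>v c. E v c - j * Yx v c) j i = digits (\<lambda>v c. E' v c - j' * Yx v c) j' i"
    using eqs by simp
  note jle = min_y_eqs[of E, folded j_def] min_y_eqs[of E', folded j'_def]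
  obtain a0 where a0: "E 1 0 = a0 + j" using jle(1) by (metis le_add_diff_inverse2)
  obtain b0 where b0: "E' 1 0 = b0 + j'" using jle(7) by (metis le_add_diff_inverse2)
  obtain a1 where a1: "E 2 1 = a1 + j" using jle(2) by (metis le_add_diff_inverse2)
  obtain b1 where b1: "E' 2 1 = b1 + j'" using jle(8) by (metis le_add_diff_inverse2)
  obtain a2 where a2: "E 3 2 = a2 + j" using jle(3) by (metis le_add_diff_inverse2)
  obtain b2 where b2: "E' 3 2 = b2 + j'" using jle(9) by (metis le_add_diff_inverse2)
  obtain a3 where a3: "E 4 0 = a3 + j" using jle(4) by (metis le_add_diff_inverse2)
  obtain b3 where b3: "E' 4 0 = b3 + j'" using jle(10) by (metis le_add_diff_inverse2)
  obtain a4 where a4: "E 5 1 = a4 + j" using jle(5) by (metis le_add_diff_inverse2)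
  obtain b4 where b4: "E' 5 1 = b4 + j'" using jle(11) by (metis le_add_diff_inverse2)
  obtain a5 where a5: "E 0 2 = a5 + j" using jle(6) by (metis le_add_diff_inverse2)
  obtain b5 where b5: "E' 0 2 = b5 + j'" using jle(12) by (metis le_add_diff_inverse2)
  note ab = a0 a1 a2 a3 a4 a5 b0 b1 b2 b3 b4 b5
  note q' = q[unfolded ball_simps digits_table ab add_diff_cancel_right']
  note s' = s[OF E(1), unfolded ab] s[OF E'(1), unfolded ab]
  have no_x: "E 0 0 = 0 \<and> E 1 1 = 0 \<and> E 2 2 = 0 \<and> E 3 0 = 0 \<and> E 4 1 = 0 \<and> E 5 2 = 0"
    if "\<not> (\<exists>e<6. E e (e mod 3) > 0)" for E :: expo
  proof -
    have z: "E e (e mod 3) = 0" if "e < 6" for e using \<open>\<not> (\<exists>e<6. E e (e mod 3) > 0)\<close> that by auto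
    show ?thesis using z[of 0] z[of 1] z[of 2] z[of 3] z[of 4] z[of 5]
      by (simp add: One_nat_def[symmetric] del: One_nat_def)
  qed
  have j0: "j = 0 \<or> E 0 0 + E 1 1 + E 2 2 + E 3 0 + E 4 1 + E 5 2 = 0"
  proof (cases "\<exists>e<6. E e (e mod 3) > 0")
    case True
    then show ?thesis by (simp add: j_def min_y_def)
  next
    case False
    then have "E 0 0 = 0 \<and> E 1 1 = 0 \<and> E 2 2 = 0 \<and> E 3 0 = 0 \<and> E 4 1 = 0 \<and> E 5 2 = 0"
      by (rule no_x)
    then show ?thesis by simp
  qed
  have j0': "j' = 0 \<or> E' 0 0 + E' 1 1 + E' 2 2 + E' 3 0 + E' 4 1 + E' 5 2 = 0"
  proof (cases "\<exists>e<6. E' e (e mod 3) > 0")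
    case True
    then show ?thesis by (simp add: j'_def min_y_def)
  next
    case False
    then have "E' 0 0 = 0 \<and> E' 1 1 = 0 \<and> E' 2 2 = 0 \<and> E' 3 0 = 0 \<and> E' 4 1 = 0 \<and> E' 5 2 = 0"
      by (rule no_x)
    then show ?thesis by simp
  qed
  \<comment> \<open>A linear combination of digits and degrees that isolates \<open>j\<close>. As j
    > 0 forces all x_e to vanish, and likewise on the other side, it gives j = j'.\<close>
  have "E 0 0 + E 1 1 + E 2 2 + E 3 0 + E 4 1 + E 5 2 + j' = E' 0 0 + E' 1 1 + E' 2 2 + E' 3 0 + E' 4 1 + E' 5 2 + j"
    using q' s' by linarith
  then have jj: "j = j'" using j0 j0' by linarith
  define t0 t1 t2 t3 t4 t5 where "t0 = int (E 1 0) - int (E' 1 0)" and "t1 = int (E 2 1) - int (E' 2 1)"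
    and "t2 = int (E 3 2) - int (E' 3 2)" and "t3 = int (E 4 0) - int (E' 4 0)"
    and "t4 = int (E 5 1) - int (E' 5 1)" and "t5 = int (E 0 2) - int (E' 0 2)"
  note t = t0_def t1_def t2_def t3_def t4_def t5_def
  have x: "int (E 0 0) - int (E' 0 0) = t0 - t5" "int (E 1 1) - int (E' 1 1) = t1 - t0"
    "int (E 2 2) - int (E' 2 2) = t2 - t1" "int (E 3 0) - int (E' 3 0) = t3 - t2"
    "int (E 4 1) - int (E' 4 1) = t4 - t3" "int (E 5 2) - int (E' 5 2) = t5 - t4"
    using q' s' jj unfolding t ab by linarith+
  have cyc: "t0 = t5 \<and> t1 = t5 \<and> t2 = t5 \<and> t3 = t5 \<and> t4 = t5"
  proof (rule cyclic_rigidity)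
    show "(t0 - t5) * t0 \<le> 0" using complementary_differences[OF st(1)[OF E(2)] st(1)[OF E'(2)]] by (simp only: x t0_def[symmetric])
    show "(t1 - t0) * t1 \<le> 0" using complementary_differences[OF st(2)[OF E(2)] st(2)[OF E'(2)]] by (simp only: x t1_def[symmetric])
    show "(t2 - t1) * t2 \<le> 0" using complementary_differences[OF st(3)[OF E(2)] st(3)[OF E'(2)]] by (simp only: x t2_def[symmetric])
    show "(t3 - t2) * t3 \<le> 0" using complementary_differences[OF st(4)[OF E(2)] st(4)[OF E'(2)]] by (simp only: x t3_def[symmetric])
    show "(t4 - t3) * t4 \<le> 0" using complementary_differences[OF st(5)[OF E(2)] st(5)[OF E'(2)]] by (simp only: x t4_def[symmetric])
    show "(t5 - t4) * t5 \<le> 0" using complementary_differences[OF st(6)[OF E(2)] st(6)[OF E'(2)]] by (simp only: x t5_def[symmetric])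
  qed
  \<comment> \<open>If some x_e > 0, it is the same in both exponents, so both y_e vanish. Otherwise
    \<open>j\<close> is the minimum of the y_e on either side, and equal minima exclude a
    shift.\<close>
  have "t5 = 0"
  proof (cases "\<exists>e<6. E e (e mod 3) > 0")
    case True
    then obtain e where "e < 6" "E e (e mod 3) > 0" by blast
    then have "E 0 0 > 0 \<or> E 1 1 > 0 \<or> E 2 2 > 0 \<or> E 3 0 > 0 \<or> E 4 1 > 0 \<or> E 5 2 > 0"
      unfolding less_6_cases by (elim disjE) (simp_all add: One_nat_def[symmetric] del: One_nat_def)
    moreover have zero: "t = 0" if "a > 0" "int a - int a' = t' - t''" "t' = t''" "a = 0 \<or> b = 0" "a' = 0 \<or> b' = 0"
      "t = int b - int b'" for a a' b b' :: nat and t t' t'' :: int using that by auto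
    ultimately show ?thesis
      using zero[OF _ x(1) _ st(1)[OF E(2)] st(1)[OF E'(2)] t0_def] zero[OF _ x(2) _ st(2)[OF E(2)] st(2)[OF E'(2)] t1_def]
        zero[OF _ x(3) _ st(3)[OF E(2)] st(3)[OF E'(2)] t2_def] zero[OF _ x(4) _ st(4)[OF E(2)] st(4)[OF E'(2)] t3_def]
        zero[OF _ x(5) _ st(5)[OF E(2)] st(5)[OF E'(2)] t4_def] zero[OF _ x(6) _ st(6)[OF E(2)] st(6)[OF E'(2)] t5_def] cyc
      by metis
  next
    case False
    then have z: "E 0 0 = 0 \<and> E 1 1 = 0 \<and> E 2 2 = 0 \<and> E 3 0 = 0 \<and> E 4 1 = 0 \<and> E 5 2 = 0"
      by (rule no_x)
    then have "E' 0 0 = 0 \<and> E' 1 1 = 0 \<and> E' 2 2 = 0 \<and> E' 3 0 = 0 \<and> E' 4 1 = 0 \<and> E' 5 2 = 0"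
      using x cyc by linarith
    then have "E' e (e mod 3) = 0" if "e < 6" for e
      using that unfolding less_6_cases by (elim disjE) (simp_all add: One_nat_def[symmetric] del: One_nat_def)
    then have False': "\<not> (\<exists>e<6. E' e (e mod 3) > 0)" by auto
    have im: "(\<lambda>e. E ((e + 1) mod 6) (e mod 3)) ` {..<6} = {E 1 0, E 2 1, E 3 2, E 4 0, E 5 1, E 0 2}" for E :: expo
      unfolding lessThan_6 by (simp add: One_nat_def[symmetric] del: One_nat_def)
    have "j = Min {E 1 0, E 2 1, E 3 2, E 4 0, E 5 1, E 0 2}" "j' = Min {E' 1 0, E' 2 1, E' 3 2, E' 4 0, E' 5 1, E' 0 2}"
      using False False' unfolding j_def j'_def min_y_def im by auto
    then have "j \<in> {E 1 0, E 2 1, E 3 2, E 4 0, E 5 1, E 0 2}" "j' \<in> {E' 1 0, E' 2 1, E' 3 2, E' 4 0, E' 5 1, E' 0 2}"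
      using Min_in by (metis finite.emptyI finite.insertI insert_not_empty)+
    then have "\<exists>k\<in>{t0, t1, t2, t3, t4, t5}. k \<ge> 0" "\<exists>k\<in>{t0, t1, t2, t3, t4, t5}. k \<le> 0"
      using jle jj unfolding t by force+
    then show ?thesis using cyc by auto
  qed
  then have "t0 = 0" "t1 = 0" "t2 = 0" "t3 = 0" "t4 = 0" using cyc by auto
  note tz = this \<open>t5 = 0\<close>
  have Y: "E 1 0 = E' 1 0" "E 2 1 = E' 2 1" "E 3 2 = E' 3 2" "E 4 0 = E' 4 0" "E 5 1 = E' 5 1" "E 0 2 = E' 0 2"
    using tz unfolding t by auto
  have X: "E 0 0 = E' 0 0" "E 1 1 = E' 1 1" "E 2 2 = E' 2 2" "E 3 0 = E' 3 0" "E 4 1 = E' 4 1" "E 5 2 = E' 5 2"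
    using x unfolding tz by auto
  have Z: "E 0 1 = E' 0 1" "E 1 2 = E' 1 2" "E 2 0 = E' 2 0" "E 3 1 = E' 3 1" "E 4 2 = E' 4 2" "E 5 0 = E' 5 0"
    using s[OF E(1)] s[OF E'(1)] unfolding X Y by linarith+
  have all: "E v c = E' v c" if "v < 6" "c < 3" for v c
    using that unfolding less_6_cases less_3_cases by (elim disjE) (simp_all only: X Y Z)
  show ?thesis
  proof (intro ext)
    fix v c
    show "E v c = E' v c"
      using all[of v c] E(1) E'(1) by (cases "v < 6 \<and> c < 3") (auto simp: expos_def)
  qed
qed

lemma finite_expos [simp]: "finite (expos d)"
proof -
  define B where "B = (\<Sum>v<6. d v)"
  have "expos d \<subseteq> (\<lambda>f v c. if v < 6 \<and> c < 3 then f (v, c) else 0) ` PiE ({..<6} \<times> {..<3}) (\<lambda>_. {..B})"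
  proof
    fix E assume E: "E \<in> expos d"
    let ?f = "\<lambda>p\<in>{..<6} \<times> {..<3}. E (fst p) (snd p)"
    have "E v c \<le> B" if "v < 6" "c < 3" for v c
    proof -
      have "E v c \<le> d v" using E that unfolding expos_def less_3_cases by auto
      also have "d v \<le> B" unfolding B_def by (rule member_le_sum) (use that in auto)
      finally show ?thesis .
    qed
    then have "?f \<in> PiE ({..<6} \<times> {..<3}) (\<lambda>_. {..B})" by auto
    moreover have "E = (\<lambda>v c. if v < 6 \<and> c < 3 then ?f (v, c) else 0)"
      using E by (auto simp: fun_eq_iff expos_def not_less)
    ultimately show "E \<in> (\<lambda>f v c. if v < 6 \<and> c < 3 then f (v, c) else 0) ` PiE ({..<6} \<times> {..<3}) (\<lambda>_. {..B})"
      by blast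
  qed
  then show ?thesis by (rule finite_subset) (auto intro!: finite_PiE)
qed

text \<open>The sum required to be below \<open>N\<close> is the total degree in the matrix entries:
  generators at lines count once, those at planes twice.\<close>

lemma digits_bound:
  assumes E: "E \<in> expos d" and N: "d 0 + 2 * d 1 + d 2 + 2 * d 3 + d 4 + 2 * d 5 < N" and i: "i < 9"
  shows "digits (\<lambda>v c. E v c - min_y E * Yx v c) (min_y E) i < N"
proof -
  define j where "j = min_y E"
  have s: "E 0 0 + E 0 1 + E 0 2 = d 0" "E 1 0 + E 1 1 + E 1 2 = d 1" "E 2 0 + E 2 1 + E 2 2 = d 2"
     "E 3 0 + E 3 1 + E 3 2 = d 3" "E 4 0 + E 4 1 + E 4 2 = d 4" "E 5 0 + E 5 1 + E 5 2 = d 5"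
    using E by (auto simp: expos_def)
  note jle = min_y_eqs[of E, folded j_def]
  obtain a0 a1 a2 a3 a4 a5 where a: "E 1 0 = a0 + j" "E 2 1 = a1 + j" "E 3 2 = a2 + j" "E 4 0 = a3 + j" "E 5 1 = a4 + j" "E 0 2 = a5 + j"
    using jle by (metis le_add_diff_inverse2)
  note s' = s[unfolded a]
  have "i = 0 \<or> i = 1 \<or> i = 2 \<or> i = 3 \<or> i = 4 \<or> i = 5 \<or> i = 6 \<or> i = 7 \<or> i = 8" using i by linarith
  then show ?thesis
    unfolding j_def[symmetric]
    by (elim disjE; hypsubst; unfold digits_table a add_diff_cancel_right'; use s' N in linarith)
qed

text \<open>Straightening bounds the dimension from above. The corrected standard monomials lie in
  the same span and have distinct degrees, which bounds it from below.\<close>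

theorem dim_expo_monos:
  fixes W :: "'a::field poly"
  assumes N: "N \<ge> 4" "d 0 + 2 * d 1 + d 2 + 2 * d 3 + d 4 + 2 * d 5 < N" and W: "W \<noteq> 0"
  shows "vector_space.dim smult ((\<lambda>E. W * expo_mono (gen (kron N)) E) ` {E \<in> expos d. expo_weight E = w})
     = card {E \<in> expos d. std_expo E \<and> expo_weight E = w}"
    (is "_ = card ?S")
proof -
  interpret V: vector_space "smult :: 'a \<Rightarrow> 'a poly \<Rightarrow> 'a poly" by (rule vector_space_poly)
  let ?D = "\<lambda>E. W * expo_mono (gen (kron N)) E"
  let ?R = "\<lambda>E. W * corrected (gen (kron N)) E"
  let ?A = "{E \<in> expos d. expo_weight E = w}"
  have finS: "finite ?S" by simp
  have sub: "?D ` ?A \<subseteq> V.span (?D ` ?S)"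
  proof
    fix q assume "q \<in> ?D ` ?A"
    then obtain E where E: "E \<in> expos d" "expo_weight E = w" "q = ?D E" by auto
    show "q \<in> V.span (?D ` ?S)"
      using straightening[of "gen (kron N)" E d W, OF gen_relation E(1)] E by simp
  qed
  have "V.dim (?D ` ?A) \<le> card (?D ` ?S)"
    by (rule V.dim_le_card[OF sub]) (use finS in auto)
  also have "\<dots> \<le> card ?S" by (rule card_image_le[OF finS])
  finally have le: "V.dim (?D ` ?A) \<le> card ?S" .
  have deg: "degree (?R E) = degree W + degree (corrected (gen (kron N)) E :: 'a poly)" for E
    using W degree_corrected(2)[OF N(1), of E, where 'a='a] by (rule degree_mult_eq)
  have inj: "inj_on (\<lambda>E. degree (?R E)) ?S"
  proof
    fix E E' assume E: "E \<in> ?S" and E': "E' \<in> ?S" and eq: "degree (?R E) = degree (?R E')"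
    obtain h h' where h: "degree (corrected (gen (kron N)) E :: 'a poly) =
        (\<Sum>i<9. digits (\<lambda>v c. E v c - min_y E * Yx v c) (min_y E) i * N ^ i) + N ^ 9 * h"
      "degree (corrected (gen (kron N)) E' :: 'a poly) =
        (\<Sum>i<9. digits (\<lambda>v c. E' v c - min_y E' * Yx v c) (min_y E') i * N ^ i) + N ^ 9 * h'"
      using degree_corrected(1)[OF N(1), of E, where 'a='a] degree_corrected(1)[OF N(1), of E', where 'a='a] by blast
    have eq': "(\<Sum>i<9. digits (\<lambda>v c. E v c - min_y E * Yx v c) (min_y E) i * N ^ i) + N ^ 9 * h =
        (\<Sum>i<9. digits (\<lambda>v c. E' v c - min_y E' * Yx v c) (min_y E') i * N ^ i) + N ^ 9 * h'"
      using eq unfolding deg h by simp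
    show "E = E'"
    proof (rule digits_injective)
      show "digits (\<lambda>v c. E v c - min_y E * Yx v c) (min_y E) i = digits (\<lambda>v c. E' v c - min_y E' * Yx v c) (min_y E') i"
        if "i < 9" for i
        by (rule base_expansion_unique[OF eq' _ _ that]) (use E E' digits_bound[OF _ N(2)] in auto)
    qed (use E E' in auto)
  qed
  have nz: "?R E \<noteq> 0" for E
    using W degree_corrected(2)[OF N(1), of E, where 'a='a] by simp
  note ind = independent_distinct_degrees[OF finS inj nz]
  have "?R ` ?S \<subseteq> V.span (?D ` ?A)"
  proof
    fix q assume "q \<in> ?R ` ?S"
    then obtain E where E: "E \<in> expos d" "expo_weight E = w" "q = ?R E" by auto
    show "q \<in> V.span (?D ` ?A)"
      using corrected_in_span[OF E(1), of W "gen (kron N)"] E by simp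
  qed
  then have "card (?R ` ?S) \<le> V.dim (?D ` ?A)"
  proof -
    obtain B where B: "B \<subseteq> ?D ` ?A" "V.independent B" "?D ` ?A \<subseteq> V.span B" "card B = V.dim (?D ` ?A)"
      using V.basis_exists by blast
    have finB: "finite B" using B(1) by (rule finite_subset) simp
    have "?R ` ?S \<subseteq> V.span B"
      using \<open>?R ` ?S \<subseteq> V.span (?D ` ?A)\<close> V.span_minimal[OF B(3) V.subspace_span] by blast
    then show ?thesis
      using V.independent_span_bound[OF finB ind(2)] B(4) by simp
  qed
  then have "card ?S \<le> V.dim (?D ` ?A)"
    using card_image[OF ind(1)] by simp
  with le show ?thesis by simp
qed

section \<open>Tableau polynomials as products of minors\<close>

definition block_perms :: "'b set set \<Rightarrow> ('b \<Rightarrow> 'b) set"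
  where "block_perms Cs = {\<sigma>. \<sigma> permutes \<Union>Cs \<and> (\<forall>c\<in>Cs. \<sigma> ` c \<subseteq> c)}"

text \<open>A permutation preserving disjoint blocks is the product of its restrictions, and signs
  and products of entries factor accordingly.\<close>

lemma block_determinant:
  fixes A :: "'b \<Rightarrow> 'b \<Rightarrow> 'r::comm_ring_1"
  assumes "finite Cs" "\<And>c. c \<in> Cs \<Longrightarrow> finite c" "disjoint Cs"
  shows "(\<Sum>\<sigma>\<in>block_perms Cs. of_int (sign \<sigma>) * (\<Prod>x\<in>\<Union>Cs. A x (\<sigma> x)))
     = (\<Prod>c\<in>Cs. \<Sum>\<pi> | \<pi> permutes c. of_int (sign \<pi>) * (\<Prod>x\<in>c. A x (\<pi> x)))"
  using assms
proof (induction Cs rule: finite_induct)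
  case empty
  then show ?case by (simp add: block_perms_def)
next
  case (insert c Cs)
  let ?U = "\<Union>Cs"
  have fin: "finite c" "finite ?U" using insert by auto
  have disj: "c \<inter> ?U = {}" using insert.prems(2) insert.hyps(2) by (auto simp: disjoint_def)
  interpret P: perms "c \<union> ?U" by unfold_locales (use fin in auto)
  have perm: "permutation p" if "p permutes c \<or> p permutes ?U" for p
    using that fin permutation_permutes by blast
  have pc: "p x = x" if "p permutes c" "x \<in> ?U" for p x
    using that disj permutes_not_in[of p c x] by auto
  have pU: "p x = x" if "p permutes ?U" "x \<in> c" for p x
    using that disj permutes_not_in[of p ?U x] by auto
  have "(\<Sum>\<sigma>\<in>block_perms (insert c Cs). of_int (sign \<sigma>) * (\<Prod>x\<in>\<Union>(insert c Cs). A x (\<sigma> x)))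
     = (\<Sum>(\<pi>, \<tau>)\<in>{\<pi>. \<pi> permutes c} \<times> block_perms Cs. of_int (sign (\<pi> \<circ> \<tau>)) * (\<Prod>x\<in>c \<union> ?U. A x ((\<pi> \<circ> \<tau>) x)))"
  proof (rule sum.reindex_bij_witness[of _ "\<lambda>(\<pi>, \<tau>). \<pi> \<circ> \<tau>" "\<lambda>\<sigma>. (restr \<sigma> c, restr \<sigma> ?U)"])
    fix \<sigma> assume \<sigma>: "\<sigma> \<in> block_perms (insert c Cs)"
    have s: "\<sigma> permutes (c \<union> ?U)" "\<sigma> ` c \<subseteq> c" "\<And>c'. c' \<in> Cs \<Longrightarrow> \<sigma> ` c' \<subseteq> c'"
      using \<sigma> by (auto simp: block_perms_def)
    then have sG: "\<sigma> \<in> P.G" by (simp add: P.G_def)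
    have sU: "\<sigma> ` ?U \<subseteq> ?U" using s(3) by blast
    have r1: "restr \<sigma> c permutes c" by (rule P.restr_permutes[OF sG s(2)]) auto
    have r2: "restr \<sigma> ?U permutes ?U" by (rule P.restr_permutes[OF sG sU]) auto
    have eq: "restr \<sigma> c \<circ> restr \<sigma> ?U = \<sigma>"
    proof -
      have "restr \<sigma> c (restr \<sigma> ?U x) = \<sigma> x" for x
        using disj sU permutes_not_in[OF s(1), of x] by (cases "x \<in> ?U"; cases "x \<in> c") (auto simp: restr_def)
      then show ?thesis by auto
    qed
    then show "(case (restr \<sigma> c, restr \<sigma> ?U) of (\<pi>, \<tau>) \<Rightarrow> \<pi> \<circ> \<tau>) = \<sigma>" by simp
    have "restr \<sigma> ?U ` c' \<subseteq> c'" if "c' \<in> Cs" for c'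
      using s(3)[OF that] that by (auto simp: restr_def)
    then show "(restr \<sigma> c, restr \<sigma> ?U) \<in> {\<pi>. \<pi> permutes c} \<times> block_perms Cs"
      using r1 r2 by (auto simp: block_perms_def)
    show "(case (restr \<sigma> c, restr \<sigma> ?U) of (\<pi>, \<tau>) \<Rightarrow>
        of_int (sign (\<pi> \<circ> \<tau>)) * (\<Prod>x\<in>c \<union> ?U. A x ((\<pi> \<circ> \<tau>) x))) = of_int (sign \<sigma>) * (\<Prod>x\<in>\<Union>(insert c Cs). A x (\<sigma> x))"
      unfolding prod.case eq by simp
  next
    fix p assume "p \<in> {\<pi>. \<pi> permutes c} \<times> block_perms Cs"
    then obtain \<pi> \<tau> where p: "p = (\<pi>, \<tau>)" "\<pi> permutes c" "\<tau> permutes ?U" "\<And>c'. c' \<in> Cs \<Longrightarrow> \<tau> ` c' \<subseteq> c'"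
      by (auto simp: block_perms_def)
    have inU: "\<tau> x \<in> ?U" if "x \<in> ?U" for x using that permutes_in_image[OF p(3)] by blast
    have inc: "\<pi> x \<in> c" if "x \<in> c" for x using that permutes_in_image[OF p(2)] by blast
    have c1: "\<pi> (\<tau> x) = \<pi> x" if "x \<in> c" for x using pU[OF p(3) that] by simp
    have c2: "\<pi> (\<tau> x) = \<tau> x" if "x \<in> ?U" for x using pc[OF p(2) inU[OF that]] .
    have "\<pi> \<circ> \<tau> permutes c \<union> ?U"
      using p(2,3) by (intro permutes_compose) (auto intro: permutes_subset)
    moreover have "(\<pi> \<circ> \<tau>) ` c' \<subseteq> c'" if "c' \<in> Cs" for c'
      using p(4)[OF that] c2 that by auto
    moreover have "(\<pi> \<circ> \<tau>) ` c \<subseteq> c" using c1 inc by auto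
    ultimately show "(case p of (\<pi>, \<tau>) \<Rightarrow> \<pi> \<circ> \<tau>) \<in> block_perms (insert c Cs)"
      using p by (auto simp: block_perms_def)
    have "restr (\<pi> \<circ> \<tau>) c = \<pi>"
      using c1 permutes_not_in[OF p(2)] by (auto simp: restr_def fun_eq_iff)
    moreover have "restr (\<pi> \<circ> \<tau>) ?U = \<tau>"
      using c2 permutes_not_in[OF p(3)] by (auto simp: restr_def fun_eq_iff)
    ultimately show "(restr (case p of (\<pi>, \<tau>) \<Rightarrow> \<pi> \<circ> \<tau>) c, restr (case p of (\<pi>, \<tau>) \<Rightarrow> \<pi> \<circ> \<tau>) ?U) = p"
      using p by simp
  qed
  also have "\<dots> = (\<Sum>(\<pi>, \<tau>)\<in>{\<pi>. \<pi> permutes c} \<times> block_perms Cs.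
      (of_int (sign \<pi>) * (\<Prod>x\<in>c. A x (\<pi> x))) * (of_int (sign \<tau>) * (\<Prod>x\<in>?U. A x (\<tau> x))))"
  proof (rule sum.cong[OF refl], clarify)
    fix \<pi> \<tau> assume p: "\<pi> permutes c" and t: "\<tau> \<in> block_perms Cs"
    then have t': "\<tau> permutes ?U" by (auto simp: block_perms_def)
    have "(\<Prod>x\<in>c \<union> ?U. A x ((\<pi> \<circ> \<tau>) x)) = (\<Prod>x\<in>c. A x ((\<pi> \<circ> \<tau>) x)) * (\<Prod>x\<in>?U. A x ((\<pi> \<circ> \<tau>) x))"
      using fin disj by (intro prod.union_disjoint) auto
    also have "(\<Prod>x\<in>c. A x ((\<pi> \<circ> \<tau>) x)) = (\<Prod>x\<in>c. A x (\<pi> x))"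
      using pU[OF t'] by (intro prod.cong) auto
    also have "(\<Prod>x\<in>?U. A x ((\<pi> \<circ> \<tau>) x)) = (\<Prod>x\<in>?U. A x (\<tau> x))"
    proof (rule prod.cong[OF refl])
      fix x assume "x \<in> ?U"
      then have "\<tau> x \<in> ?U" using permutes_in_image[OF t'] by blast
      then show "A x ((\<pi> \<circ> \<tau>) x) = A x (\<tau> x)" using pc[OF p] by simp
    qed
    finally show "of_int (sign (\<pi> \<circ> \<tau>)) * (\<Prod>x\<in>c \<union> ?U. A x ((\<pi> \<circ> \<tau>) x)) =
      of_int (sign \<pi>) * (\<Prod>x\<in>c. A x (\<pi> x)) * (of_int (sign \<tau>) * (\<Prod>x\<in>?U. A x (\<tau> x)))"
      using perm p t' by (simp add: sign_compose mult_ac)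
  qed
  also have "\<dots> = (\<Sum>\<pi> | \<pi> permutes c. of_int (sign \<pi>) * (\<Prod>x\<in>c. A x (\<pi> x))) *
      (\<Sum>\<tau>\<in>block_perms Cs. of_int (sign \<tau>) * (\<Prod>x\<in>?U. A x (\<tau> x)))"
    unfolding sum_product sum.cartesian_product ..
  also have "(\<Sum>\<tau>\<in>block_perms Cs. of_int (sign \<tau>) * (\<Prod>x\<in>?U. A x (\<tau> x)))
     = (\<Prod>c\<in>Cs. \<Sum>\<pi> | \<pi> permutes c. of_int (sign \<pi>) * (\<Prod>x\<in>c. A x (\<pi> x)))"
    using insert.prems by (intro insert.IH) (auto simp: disjoint_def)
  finally show ?case using insert.hyps by simp
qed

lemma minor_2:
  fixes A :: "'b \<Rightarrow> 'b \<Rightarrow> 'r::comm_ring_1"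
  assumes "x \<noteq> y"
  shows "(\<Sum>\<pi> | \<pi> permutes {x, y}. of_int (sign \<pi>) * (\<Prod>z\<in>{x, y}. A z (\<pi> z)))
    = A x x * A y y - A x y * A y x"
  using assms
  by (subst sum_over_permutations_insert) (auto simp: sign_compose permutation_swap_id sign_swap_id)

lemma minor_3:
  fixes A :: "'b \<Rightarrow> 'b \<Rightarrow> 'r::comm_ring_1"
  assumes "x \<noteq> y" "x \<noteq> w" "y \<noteq> w"
  shows "(\<Sum>\<pi> | \<pi> permutes {x, y, w}. of_int (sign \<pi>) * (\<Prod>z\<in>{x, y, w}. A z (\<pi> z)))
    = A x x * (A y y * A w w - A y w * A w y) - A x y * (A y x * A w w - A y w * A w x)
      + A x w * (A y x * A w y - A y y * A w x)"
proof -
  show ?thesis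
    using assms
    by (subst sum_over_permutations_insert, simp, simp, subst sum_over_permutations_insert, simp, simp)
       (simp add: sign_compose permutation_swap_id sign_swap_id Transposition.transpose_def algebra_simps)
qed

context diagram
begin

definition column :: "nat set \<Rightarrow> nat \<Rightarrow> square set"
  where "column C j = (\<lambda>r. (C, j, r)) ` C"

definition columns :: "square set set"
  where "columns = (\<lambda>(C, j). column C j) ` (SIGMA C:col_shapes. {..<m C})"

lemma Union_columns: "\<Union>columns = squares m"
  by (auto simp: columns_def column_def squares_def)

lemma col_group_blocks: "col_group m = block_perms columns"
proof (intro set_eqI iffI)
  fix \<sigma> assume s: "\<sigma> \<in> col_group m"
  then have p: "\<sigma> permutes squares m" and c: "\<And>x. sq_col (\<sigma> x) = sq_col x"
    unfolding col_group_def by blast+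
  have "\<sigma> ` c' \<subseteq> c'" if c': "c' \<in> columns" for c'
  proof
    fix y assume "y \<in> \<sigma> ` c'"
    then obtain x where x: "x \<in> c'" "y = \<sigma> x" by auto
    obtain C j where Cj: "C \<in> col_shapes" "j < m C" "c' = column C j" using c' by (auto simp: columns_def)
    obtain r where r: "x = (C, j, r)" "r \<in> C" using x Cj by (auto simp: column_def)
    have "x \<in> squares m" using r Cj by (auto simp: squares_def)
    then have "y \<in> squares m" using p x by (simp add: permutes_in_image)
    moreover have "sq_col y = (C, j)" using c[of x] x r by (simp add: sq_col_def)
    ultimately show "y \<in> c'" unfolding Cj column_def by (cases y) (auto simp: sq_col_def squares_def)
  qed
  then show "\<sigma> \<in> block_perms columns" using p by (auto simp: block_perms_def Union_columns)
next
  fix \<sigma> assume s: "\<sigma> \<in> block_perms columns"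
  then have p: "\<sigma> permutes squares m" by (auto simp: block_perms_def Union_columns)
  have "sq_col (\<sigma> x) = sq_col x" for x
  proof (cases "x \<in> squares m")
    case True
    then obtain c where c: "c \<in> columns" "x \<in> c" using Union_columns by auto
    then have "\<sigma> x \<in> c" using s by (auto simp: block_perms_def)
    then show ?thesis using c by (auto simp: columns_def column_def sq_col_def)
  qed (use p in \<open>simp add: permutes_not_in\<close>)
  then show "\<sigma> \<in> col_group m" using p unfolding col_group_def by blast
qed

lemma finite_columns: "finite columns" "\<And>c. c \<in> columns \<Longrightarrow> finite c" "disjoint columns"
proof -
  show "finite columns" unfolding columns_def by (intro finite_imageI finite_SigmaI) auto
  show "finite c" if "c \<in> columns" for c
  proof (rule finite_subset[OF _ finite_squares[of m]])
    show "c \<subseteq> squares m" using that Union_columns by auto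
  qed
  show "disjoint columns"
    unfolding disjoint_def by (auto simp: columns_def column_def)
qed

definition minor :: "(nat \<Rightarrow> nat \<Rightarrow> 'r::comm_ring_1) \<Rightarrow> (square \<Rightarrow> nat) \<Rightarrow> nat set \<Rightarrow> nat \<Rightarrow> 'r"
  where "minor X g C j = (\<Sum>\<pi> | \<pi> permutes column C j. of_int (sign \<pi>) *
     (\<Prod>x\<in>column C j. X (sq_row x) (g (\<pi> x))))"

lemma tab_poly_minors:
  "tab_poly \<omega> g = (\<Prod>C\<in>col_shapes. \<Prod>j<m C. minor (\<lambda>r k. monom 1 (\<omega> r k)) g C j)"
proof -
  let ?X = "\<lambda>r k. monom (1::complex) (\<omega> r k)"
  have mon: "monom (1::complex) (code \<omega> h) = (\<Prod>x\<in>squares m. ?X (sq_row x) (h x))" for h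
  proof -
    have mm: "monom (1::complex) (a + b) = monom 1 a * monom 1 b" for a b by (simp add: mult_monom)
    have "monom (1::complex) (\<Sum>x\<in>T. \<omega> (sq_row x) (h x)) = (\<Prod>x\<in>T. ?X (sq_row x) (h x))" for T
      by (induction T rule: infinite_finite_induct) (simp_all add: mm monom_eq_1)
    then show ?thesis by (simp add: code_def)
  qed
  have "tab_poly \<omega> g = (\<Sum>\<sigma>\<in>col_group m. of_int (sign \<sigma>) * (\<Prod>x\<in>squares m. ?X (sq_row x) (g (inv \<sigma> x))))"
    unfolding tab_poly_def mon by (rule sum.cong) (auto simp: sign_def)
  \<comment> \<open>The column group is closed under inversion, and inversion keeps the
    sign.\<close>
  also have "\<dots> = (\<Sum>\<sigma>\<in>col_group m. of_int (sign \<sigma>) * (\<Prod>x\<in>squares m. ?X (sq_row x) (g (\<sigma> x))))"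
  proof (rule sum.reindex_bij_witness[of _ inv inv])
    fix \<sigma> assume s: "\<sigma> \<in> col_group m"
    then have p: "\<sigma> permutes squares m" and c: "\<And>x. sq_col (\<sigma> x) = sq_col x"
      unfolding col_group_def by blast+
    show i: "inv (inv \<sigma>) = \<sigma>" using p by (rule permutes_inv_inv)
    then show "inv (inv \<sigma>) = \<sigma>" .
    have "sq_col (inv \<sigma> x) = sq_col x" for x
      using c[of "inv \<sigma> x"] permutes_inverses(1)[OF p, of x] by simp
    then show "inv \<sigma> \<in> col_group m" using permutes_inv[OF p] unfolding col_group_def by blast
    then show "inv \<sigma> \<in> col_group m" .
    show "of_int (sign (inv \<sigma>)) * (\<Prod>x\<in>squares m. ?X (sq_row x) (g (inv \<sigma> x))) =
      of_int (sign \<sigma>) * (\<Prod>x\<in>squares m. ?X (sq_row x) (g (inv \<sigma> x)))"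
      using sign_inverse[OF permutes_imp_permutation[OF finite_squares p]] by simp
  qed
  also have "\<dots> = (\<Prod>c\<in>columns. \<Sum>\<pi> | \<pi> permutes c. of_int (sign \<pi>) * (\<Prod>x\<in>c. ?X (sq_row x) (g (\<pi> x))))"
    unfolding col_group_blocks Union_columns[symmetric]
    using finite_columns by (intro block_determinant[of columns "\<lambda>x y. ?X (sq_row x) (g y)"]) auto
  also have "\<dots> = (\<Prod>(C, j)\<in>(SIGMA C:col_shapes. {..<m C}). minor ?X g C j)"
    unfolding columns_def
  proof (subst prod.reindex)
    show "inj_on (\<lambda>(C, j). column C j) (SIGMA C:col_shapes. {..<m C})"
    proof (rule inj_onI, clarify)
      fix C j C' j' assume "C \<in> col_shapes" and eq: "column C j = column C' j'"
      then obtain r where "r \<in> C" by (auto simp: col_shapes_def)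
      then have "(C, j, r) \<in> column C' j'" using eq by (auto simp: column_def)
      then show "C = C' \<and> j = j'" by (auto simp: column_def)
    qed
  qed (simp add: minor_def case_prod_unfold)
  also have "\<dots> = (\<Prod>C\<in>col_shapes. \<Prod>j<m C. minor ?X g C j)"
    by (subst prod.Sigma) auto
  finally show ?thesis .
qed

end

text \<open>For distinct i and i' below 3 the missing colour is 3 - (i + i'), and the sign is given
  by their cyclic order. It is reversed for rows 0 and 2, because the generator at vertex 5 takes
  these rows in the order 2, 0.\<close>

lemma gen_plane:
  fixes x :: "nat \<Rightarrow> nat \<Rightarrow> 'a::comm_ring_1"
  assumes "i < 3" "i' < 3"
  shows "x 0 i * x 1 i' - x 0 i' * x 1 i =
      (if i = i' then 0 else if i' = (i + 1) mod 3 then gen x 1 (3 - (i + i')) else - gen x 1 (3 - (i + i')))"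
    and "x 1 i * x 2 i' - x 1 i' * x 2 i =
      (if i = i' then 0 else if i' = (i + 1) mod 3 then gen x 3 (3 - (i + i')) else - gen x 3 (3 - (i + i')))"
    and "x 0 i * x 2 i' - x 0 i' * x 2 i =
      (if i = i' then 0 else if i' = (i + 1) mod 3 then - gen x 5 (3 - (i + i')) else gen x 5 (3 - (i + i')))"
  using assms unfolding less_3_cases
  by (elim disjE; simp add: gen_def cross_def mult.commute One_nat_def[symmetric] del: One_nat_def)+

lemma det_permuted:
  fixes x :: "nat \<Rightarrow> nat \<Rightarrow> 'a::comm_ring_1"
  assumes "i1 < 3" "i2 < 3" "i3 < 3"
  shows "x 0 i1 * (x 1 i2 * x 2 i3 - x 1 i3 * x 2 i2) - x 0 i2 * (x 1 i1 * x 2 i3 - x 1 i3 * x 2 i1)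
     + x 0 i3 * (x 1 i1 * x 2 i2 - x 1 i2 * x 2 i1) =
     (if i1 \<noteq> i2 \<and> i1 \<noteq> i3 \<and> i2 \<noteq> i3 then
        (if i2 = (i1 + 1) mod 3 then
          x 0 0 * (x 1 1 * x 2 2 - x 1 2 * x 2 1) + x 0 1 * (x 1 2 * x 2 0 - x 1 0 * x 2 2)
            + x 0 2 * (x 1 0 * x 2 1 - x 1 1 * x 2 0)
         else - (x 0 0 * (x 1 1 * x 2 2 - x 1 2 * x 2 1) + x 0 1 * (x 1 2 * x 2 0 - x 1 0 * x 2 2)
            + x 0 2 * (x 1 0 * x 2 1 - x 1 1 * x 2 0)))
      else 0)"
  using assms unfolding less_3_cases
  by (elim disjE) (simp_all add: algebra_simps One_nat_def[symmetric] del: One_nat_def)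

section \<open>Diagrams filled with three colours\<close>

text \<open>The hexagon of proper nonempty subsets: even vertices are lines, odd ones planes.\<close>
definition shape :: "nat \<Rightarrow> nat set"
  where "shape v = [{1}, {1,2}, {2}, {2,3}, {3}, {1,3}] ! v"

lemma shape_table:
  "shape 0 = {1}" "shape 1 = {1,2}" "shape 2 = {2}" "shape 3 = {2,3}" "shape 4 = {3}" "shape 5 = {1,3}"
  by (simp_all add: shape_def)

lemma col_shapes_eq: "col_shapes = insert {1,2,3} (shape ` {..<6})"
proof
  show "col_shapes \<subseteq> insert {1,2,3} (shape ` {..<6})"
  proof
    fix C assume "C \<in> col_shapes"
    then have C: "C \<subseteq> {1,2,3}" "C \<noteq> {}" by (auto simp: col_shapes_def)
    have "C = (if 1 \<in> C then {1} else {}) \<union> (if 2 \<in> C then {2} else {}) \<union> (if 3 \<in> C then {3} else {})"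
      using C(1) by auto
    then show "C \<in> insert {1,2,3} (shape ` {..<6})"
      using C(2) unfolding lessThan_6 image_insert shape_table image_empty
      by (cases "1 \<in> C"; cases "2 \<in> C"; cases "3 \<in> C") (simp_all add: insert_commute)
  qed
  show "insert {1,2,3} (shape ` {..<6}) \<subseteq> col_shapes"
    unfolding lessThan_6 image_insert shape_table image_empty col_shapes_def by auto
qed

lemma shape_in_col_shapes: "v < 6 \<Longrightarrow> shape v \<in> col_shapes"
  by (simp add: col_shapes_eq)

lemma full_in_col_shapes: "{1,2,3} \<in> col_shapes"
  by (simp add: col_shapes_eq)

lemma shape_mem: assumes "v < 6"
  shows "1 \<in> shape v \<longleftrightarrow> v \<in> {0,1,5}" "2 \<in> shape v \<longleftrightarrow> v \<in> {1,2,3}" "3 \<in> shape v \<longleftrightarrow> v \<in> {3,4,5}"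
  using assms unfolding less_6_cases by (elim disjE; simp add: shape_table One_nat_def[symmetric] del: One_nat_def)+

lemma card_shape: "v < 6 \<Longrightarrow> card (shape v) = (if even v then 1 else 2)"
  unfolding less_6_cases by (elim disjE) (simp_all add: shape_table One_nat_def[symmetric] del: One_nat_def)

lemma inj_shape: "inj_on shape {..<6}"
proof (rule inj_on_inverseI)
  fix v assume "v \<in> {..<6::nat}"
  then show "(if 1 \<in> shape v then if 2 \<in> shape v then 1 else if 3 \<in> shape v then 5 else 0
     else if 2 \<in> shape v then if 3 \<in> shape v then 3 else 2 else 4) = v"
    unfolding lessThan_iff less_6_cases by (elim disjE) (simp_all add: shape_table One_nat_def[symmetric] del: One_nat_def)
qed

lemma full_not_shape: "{1,2,3} \<notin> shape ` {..<6}"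
proof
  assume "{1,2,3} \<in> shape ` {..<6}"
  then obtain v where "v < 6" "shape v = {1,2,3}" by auto
  then show False using shape_mem[of v] by auto
qed

lemma prod_col_shapes:
  fixes f :: "nat set \<Rightarrow> 'a::comm_monoid_mult"
  shows "(\<Prod>C\<in>col_shapes. f C) = f {1,2,3} * (\<Prod>v<6. f (shape v))"
  unfolding col_shapes_eq using full_not_shape by (simp add: prod.reindex[OF inj_shape])

lemma sum_col_shapes:
  fixes f :: "nat set \<Rightarrow> 'a::comm_monoid_add"
  shows "(\<Sum>C\<in>col_shapes. f C) = f {1,2,3} + (\<Sum>v<6. f (shape v))"
  unfolding col_shapes_eq using full_not_shape by (simp add: sum.reindex[OF inj_shape])

lemma prod_sign_choice:
  fixes f t :: "'i \<Rightarrow> 'a::idom"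
  assumes "\<And>i. i \<in> I \<Longrightarrow> f i = 0 \<or> f i = t i \<or> f i = - t i"
  shows "prod f I = 0 \<or> prod f I = prod t I \<or> prod f I = - prod t I"
  using assms by (induction I rule: infinite_finite_induct) force+

lemma prod_fibres:
  fixes f :: "nat \<Rightarrow> 'a::comm_monoid_mult" and n :: nat
  assumes "\<And>j. j < n \<Longrightarrow> l j < 3"
  shows "(\<Prod>j<n. f (l j)) = (\<Prod>c<3. f c ^ card {j. j < n \<and> l j = c})"
proof -
  have "(\<Prod>c<3. f c ^ card {j. j < n \<and> l j = c}) = (\<Prod>c<3. \<Prod>j\<in>{j \<in> {..<n}. l j = c}. f (l j))"
    by (rule prod.cong) (auto intro!: arg_cong2[where f=power] arg_cong[where f=card])
  also have "\<dots> = (\<Prod>j<n. f (l j))"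
    by (rule prod.group) (use assms in auto)
  finally show ?thesis by simp
qed

lemma labelling_exists:
  fixes e :: "nat \<Rightarrow> nat"
  shows "\<exists>l. (\<forall>j<e 0 + e 1 + e 2. l j < (3::nat)) \<and> (\<forall>c<3. card {j. j < e 0 + e 1 + e 2 \<and> l j = c} = e c)"
proof -
  define l where "l = (\<lambda>j. if j < e 0 then 0 else if j < e 0 + e 1 then 1 else (2::nat))"
  have "{j. j < e 0 + e 1 + e 2 \<and> l j = 0} = {..<e 0}" by (auto simp: l_def)
  moreover have "{j. j < e 0 + e 1 + e 2 \<and> l j = 1} = {e 0..<e 0 + e 1}" by (auto simp: l_def)
  moreover have "{j. j < e 0 + e 1 + e 2 \<and> l j = 2} = {e 0 + e 1..<e 0 + e 1 + e 2}" by (auto simp: l_def)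
  ultimately have "\<forall>c<3. card {j. j < e 0 + e 1 + e 2 \<and> l j = c} = e c"
    unfolding less_3_cases by (auto simp del: One_nat_def)
  then show ?thesis by (intro exI[of _ l]) (auto simp: l_def)
qed

context diagram
begin

lemma squares_Sigma: "squares m = (SIGMA C:col_shapes. {..<m C} \<times> C)"
  by (auto simp: squares_def)

lemma sum_squares:
  "(\<Sum>x\<in>squares m. F x) = (\<Sum>C\<in>col_shapes. \<Sum>j<m C. \<Sum>r\<in>C. F (C, j, r))"
proof -
  have fC: "finite C" if "C \<in> col_shapes" for C using that finite_subset by (auto simp: col_shapes_def)
  have "(\<Sum>x\<in>squares m. F x) = (\<Sum>C\<in>col_shapes. \<Sum>p\<in>{..<m C} \<times> C. F (C, p))"
    unfolding squares_Sigma using fC by (subst sum.Sigma) (auto simp: case_prod_unfold)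
  also have "\<dots> = (\<Sum>C\<in>col_shapes. \<Sum>j<m C. \<Sum>r\<in>C. F (C, j, r))"
    by (rule sum.cong[OF refl]) (simp add: sum.cartesian_product case_prod_unfold)
  finally show ?thesis .
qed

lemma minor_line: "minor X g {a} j = X a (g ({a}, j, a))"
  unfolding minor_def column_def by (simp add: sq_row_def)

lemma minor_plane:
  assumes "a \<noteq> b"
  shows "minor X g {a, b} j = X a (g ({a,b}, j, a)) * X b (g ({a,b}, j, b)) - X a (g ({a,b}, j, b)) * X b (g ({a,b}, j, a))"
  unfolding minor_def column_def image_insert image_empty using assms
  by (subst minor_2[of _ _ "\<lambda>x y. X (sq_row x) (g y)"]) (auto simp: sq_row_def)

lemma minor_full:
  "minor X g {1,2,3} j = (let f = (\<lambda>r. g ({1,2,3}, j, r)) in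
     X 1 (f 1) * (X 2 (f 2) * X 3 (f 3) - X 2 (f 3) * X 3 (f 2))
   - X 1 (f 2) * (X 2 (f 1) * X 3 (f 3) - X 2 (f 3) * X 3 (f 1))
   + X 1 (f 3) * (X 2 (f 1) * X 3 (f 2) - X 2 (f 2) * X 3 (f 1)))"
  unfolding minor_def column_def image_insert image_empty
  by (subst minor_3[of _ _ _ "\<lambda>x y. X (sq_row x) (g y)"]) (auto simp: sq_row_def)

end

locale coloured_diagram = diagram m for m :: "nat set \<Rightarrow> nat" +
  fixes kc :: "nat \<Rightarrow> nat"
  assumes kc: "inj_on kc {..<3}"
begin

definition K where "K = kc ` {..<3}"
definition idx where "idx = the_inv_into {..<3} kc"
definition d where "d v = m (shape v)"
definition q where "q = m {1,2,3}"
text \<open>Larger than the total degree of the monomials, so that digits of leading monomials do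
  not overflow, and than the number of squares, so that digits of codes do not; the 5 secures
  \<open>N \<ge> 4\<close>.\<close>

definition N where "N = d 0 + 2 * d 1 + d 2 + 2 * d 3 + d 4 + 2 * d 5 + card (squares m) + 5"
definition \<omega> where "\<omega> r k = wexp N (r - 1) (idx k)"
abbreviation X :: "nat \<Rightarrow> nat \<Rightarrow> complex poly" where "X r k \<equiv> monom 1 (\<omega> r k)"
abbreviation M :: "nat \<Rightarrow> nat \<Rightarrow> complex poly" where "M \<equiv> gen (kron N)"
definition det_full :: "complex poly"
  where "det_full = kron N 0 0 * M 3 0 + kron N 0 1 * M 3 1 + kron N 0 2 * M 3 2"

lemma idx_kc [simp]: "c < 3 \<Longrightarrow> idx (kc c) = c"
  unfolding idx_def by (rule the_inv_into_f_f[OF kc]) simp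

lemma kc_idx: "k \<in> K \<Longrightarrow> kc (idx k) = k"
  by (auto simp: K_def)

lemma idx_less: "k \<in> K \<Longrightarrow> idx k < 3"
  by (auto simp: K_def)

lemma N_ge: "N \<ge> 4" "d 0 + 2 * d 1 + d 2 + 2 * d 3 + d 4 + 2 * d 5 < N" "card (squares m) < N"
  by (auto simp: N_def)

text \<open>The term x_00 x_12 x_21 collects all three entries of weight 3 and cannot be
  cancelled.\<close>

lemma det_full_nonzero: "det_full \<noteq> 0"
proof -
  note dg = degree_gen[OF N_ge(1), of 3, where 'a=complex, simplified]
  have deg: "degree (kron N 0 c * M 3 c) = wexp N 0 c + ldeg N 3 c" if "c < 3" for c
    using dg[OF that] by (subst degree_mult_eq) (auto simp: degree_monom_eq)
  define P2 P3 P4 P5 P6 P7 P8 P10 where "P2 = N ^ 2" and "P3 = N ^ 3" and "P4 = N ^ 4" and "P5 = N ^ 5"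
    and "P6 = N ^ 6" and "P7 = N ^ 7" and "P8 = N ^ 8" and "P10 = N ^ 10"
  note P = P2_def P3_def P4_def P5_def P6_def P7_def P8_def P10_def
  note w = wexp_table[of N, folded P] and bd = pow_bounds[OF N_ge(1), folded P]
  have three: "(0::nat) < 3" "(1::nat) < 3" "(2::nat) < 3" by auto
  have lt: "degree (kron N 0 1 * M 3 1) < degree (kron N 0 0 * M 3 0)"
     "degree (kron N 0 2 * M 3 2) < degree (kron N 0 0 * M 3 0)"
    unfolding deg[OF three(1)] deg[OF three(2)] deg[OF three(3)]
    using bd by (simp_all add: ldeg_def w One_nat_def[symmetric] del: One_nat_def)
  then have "degree (kron N 0 0 * M 3 0 + (kron N 0 1 * M 3 1 + kron N 0 2 * M 3 2)) = degree (kron N 0 0 * M 3 0)"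
    by (intro degree_add_eq_left degree_add_less)
  then have d: "degree det_full = degree (kron N 0 0 * M 3 0)" by (simp only: det_full_def add.assoc)
  show ?thesis
  proof
    assume "det_full = 0"
    then show False using d lt(1) by simp
  qed
qed

text \<open>A column on a line is labelled by its colour, one on a plane by the missing colour; the
  formula gives the latter provided its two colours differ.\<close>

definition lab :: "(square \<Rightarrow> nat) \<Rightarrow> nat \<Rightarrow> nat \<Rightarrow> nat"
  where "lab g v j = (if even v then idx (g (shape v, j, v div 2 + 1))
     else 3 - (idx (g (shape v, j, Min (shape v))) + idx (g (shape v, j, Max (shape v)))))"

text \<open>No column repeats a colour, which is exactly when no minor vanishes.\<close>

definition good :: "(square \<Rightarrow> nat) \<Rightarrow> bool"
  where "good g \<longleftrightarrow> (\<forall>v<6. odd v \<longrightarrow> (\<forall>j<d v. idx (g (shape v, j, Min (shape v))) \<noteq> idx (g (shape v, j, Max (shape v)))))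
     \<and> (\<forall>j<q. inj_on (\<lambda>r. idx (g ({1,2,3}, j, r))) {1,2,3})"

lemma colour_in_K:
  assumes "g \<in> colourings (squares m) K" "C \<in> col_shapes" "j < m C" "r \<in> C"
  shows "idx (g (C, j, r)) < 3" 
proof -
  have "(C, j, r) \<in> squares m" using assms by (auto simp: squares_def)
  then have "g (C, j, r) \<in> K" using assms by (auto simp: colourings_def)
  then show ?thesis by (rule idx_less)
qed

lemma MinMax_shape: "Min (shape 1) = 1" "Max (shape 1) = 2" "Min (shape 3) = 2" "Max (shape 3) = 3"
  "Min (shape 5) = 1" "Max (shape 5) = 3"
  by (simp_all add: shape_table One_nat_def[symmetric] del: One_nat_def)

lemma plane_minor:
  assumes v: "v < 6" "odd v" and i: "i < 3" "i' < 3"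
    and g: "idx (g (shape v, j, Min (shape v))) = i" "idx (g (shape v, j, Max (shape v))) = i'"
  shows "minor X g (shape v) j = (if i = i' then 0 else if (v = 5) = (i' = (i + 1) mod 3) then - M v (3 - (i + i')) else M v (3 - (i + i')))"
proof -
  define x where "x = (kron N :: nat \<Rightarrow> nat \<Rightarrow> complex poly)"
  have om: "X 1 k = x 0 (idx k)" "X 2 k = x 1 (idx k)" "X 3 k = x 2 (idx k)" for k
    by (simp_all add: \<omega>_def x_def)
  have "v = 1 \<or> v = 3 \<or> v = 5" using v unfolding less_6_cases by auto
  then show ?thesis
  proof (elim disjE)
    assume [simp]: "v = 1"
    have g': "idx (g ({1,2}, j, 1)) = i" "idx (g ({1,2}, j, 2)) = i'"
      using g by (simp_all add: MinMax_shape shape_table del: One_nat_def)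
    have "minor X g {1,2} j = X 1 (g ({1,2}, j, 1)) * X 2 (g ({1,2}, j, 2)) - X 1 (g ({1,2}, j, 2)) * X 2 (g ({1,2}, j, 1))"
      by (rule minor_plane) simp
    also have "\<dots> = x 0 i * x 1 i' - x 0 i' * x 1 i" unfolding om g' ..
    finally have "minor X g {1,2} j = x 0 i * x 1 i' - x 0 i' * x 1 i" .
    then show ?thesis unfolding \<open>v = 1\<close> shape_table x_def[symmetric] using gen_plane(1)[OF i, of x] by simp
  next
    assume [simp]: "v = 3"
    have g': "idx (g ({2,3}, j, 2)) = i" "idx (g ({2,3}, j, 3)) = i'"
      using g by (simp_all add: MinMax_shape shape_table del: One_nat_def)
    have "minor X g {2,3} j = X 2 (g ({2,3}, j, 2)) * X 3 (g ({2,3}, j, 3)) - X 2 (g ({2,3}, j, 3)) * X 3 (g ({2,3}, j, 2))"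
      by (rule minor_plane) simp
    also have "\<dots> = x 1 i * x 2 i' - x 1 i' * x 2 i" unfolding om g' ..
    finally have "minor X g {2,3} j = x 1 i * x 2 i' - x 1 i' * x 2 i" .
    then show ?thesis unfolding \<open>v = 3\<close> shape_table x_def[symmetric] using gen_plane(2)[OF i, of x] by simp
  next
    assume [simp]: "v = 5"
    have g': "idx (g ({1,3}, j, 1)) = i" "idx (g ({1,3}, j, 3)) = i'"
      using g by (simp_all add: MinMax_shape shape_table del: One_nat_def)
    have "minor X g {1,3} j = X 1 (g ({1,3}, j, 1)) * X 3 (g ({1,3}, j, 3)) - X 1 (g ({1,3}, j, 3)) * X 3 (g ({1,3}, j, 1))"
      by (rule minor_plane) simp
    also have "\<dots> = x 0 i * x 2 i' - x 0 i' * x 2 i" unfolding om g' ..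
    finally have "minor X g {1,3} j = x 0 i * x 2 i' - x 0 i' * x 2 i" .
    then show ?thesis unfolding \<open>v = 5\<close> shape_table x_def[symmetric] using gen_plane(3)[OF i, of x] by simp
  qed
qed

lemma line_minor:
  assumes v: "v < 6" "even v"
  shows "minor X g (shape v) j = M v (lab g v j)"
proof -
  have "v = 0 \<or> v = 2 \<or> v = 4" using v unfolding less_6_cases by auto
  then show ?thesis
    by (elim disjE) (simp_all add: lab_def shape_table minor_line \<omega>_def gen_def One_nat_def[symmetric] del: One_nat_def)
qed

lemma full_minor:
  assumes i: "idx (g ({1,2,3}, j, 1)) = i1" "idx (g ({1,2,3}, j, 2)) = i2" "idx (g ({1,2,3}, j, 3)) = i3"
    and l: "i1 < 3" "i2 < 3" "i3 < 3"
  shows "minor X g {1,2,3} j = (if inj_on (\<lambda>r. idx (g ({1,2,3}, j, r))) {1,2,3} then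
      (if i2 = (i1 + 1) mod 3 then det_full else - det_full) else 0)"
proof -
  have inj: "inj_on (\<lambda>r. idx (g ({1,2,3}, j, r))) {1,2,3} \<longleftrightarrow> i1 \<noteq> i2 \<and> i1 \<noteq> i3 \<and> i2 \<noteq> i3"
    using i by (auto simp: inj_on_def)
  define x where "x = (kron N :: nat \<Rightarrow> nat \<Rightarrow> complex poly)"
  have om: "X 1 (g ({1,2,3}, j, r)) = x 0 (idx (g ({1,2,3}, j, r)))"
    "X 2 (g ({1,2,3}, j, r)) = x 1 (idx (g ({1,2,3}, j, r)))"
    "X 3 (g ({1,2,3}, j, r)) = x 2 (idx (g ({1,2,3}, j, r)))" for r
    by (simp_all add: \<omega>_def x_def)
  have det: "det_full = x 0 0 * (x 1 1 * x 2 2 - x 1 2 * x 2 1) + x 0 1 * (x 1 2 * x 2 0 - x 1 0 * x 2 2)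
     + x 0 2 * (x 1 0 * x 2 1 - x 1 1 * x 2 0)"
    unfolding det_full_def x_def by (simp add: gen_def cross_def One_nat_def[symmetric] del: One_nat_def)
  show ?thesis
    unfolding minor_full Let_def om i inj det by (rule det_permuted[OF l])
qed

definition expo_of :: "(square \<Rightarrow> nat) \<Rightarrow> expo"
  where "expo_of g v c = (if v < 6 \<and> c < 3 then card {j. j < d v \<and> lab g v j = c} else 0)"

lemma MinMax_in: assumes "v < 6" "odd v"
  shows "Min (shape v) \<in> shape v" "Max (shape v) \<in> shape v"
    "Min (shape v) \<noteq> Max (shape v)" "shape v = {Min (shape v), Max (shape v)}"
proof -
  have "v = 1 \<or> v = 3 \<or> v = 5" using assms unfolding less_6_cases by auto
  then have "Min (shape v) \<in> shape v \<and> Max (shape v) \<in> shape v \<and> Min (shape v) \<noteq> Max (shape v)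
      \<and> shape v = {Min (shape v), Max (shape v)}"
    by (elim disjE; hypsubst; unfold MinMax_shape; simp only: shape_table; simp)
  then show "Min (shape v) \<in> shape v" "Max (shape v) \<in> shape v"
    "Min (shape v) \<noteq> Max (shape v)" "shape v = {Min (shape v), Max (shape v)}" by blast+
qed

lemma line_shape: assumes "v < 6" "even v" shows "shape v = {v div 2 + 1}"
  using assms unfolding less_6_cases by (elim disjE) (simp_all add: shape_table One_nat_def[symmetric] del: One_nat_def)

lemma lab_less:
  assumes g: "g \<in> colourings (squares m) K" "good g" and v: "v < 6" "j < d v"
  shows "lab g v j < 3"
proof (cases "even v")
  case True
  have "v div 2 + 1 \<in> shape v" using line_shape[OF v(1) True] by simp
  then show ?thesis
    using colour_in_K[OF g(1) shape_in_col_shapes[OF v(1)], of j] v(2) True by (simp add: lab_def d_def)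
next
  case False
  then have "idx (g (shape v, j, Min (shape v))) \<noteq> idx (g (shape v, j, Max (shape v)))"
    using g(2) v by (auto simp: good_def)
  then show ?thesis using False by (simp add: lab_def)
qed

lemma expo_of_expos:
  assumes g: "g \<in> colourings (squares m) K" "good g"
  shows "expo_of g \<in> expos d"
proof -
  have "expo_of g v 0 + expo_of g v 1 + expo_of g v 2 = d v" if v: "v < 6" for v
  proof -
    have "(\<Sum>c<3. expo_of g v c) = (\<Sum>c<3. \<Sum>j\<in>{j \<in> {..<d v}. lab g v j = c}. 1)"
      by (rule sum.cong) (auto simp: expo_of_def v)
    also have "\<dots> = (\<Sum>j<d v. 1)"
      by (rule sum.group) (use lab_less[OF g v] in auto)
    finally show ?thesis unfolding lessThan_3 by (simp add: add.assoc)
  qed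
  then show ?thesis by (auto simp: expos_def expo_of_def)
qed

text \<open>The sign depends on the order of the entries within the columns; spans do not see
  it.\<close>

lemma tab_poly_good:
  assumes g: "g \<in> colourings (squares m) K" "good g"
  shows "tab_poly \<omega> g = det_full ^ q * expo_mono M (expo_of g) \<or>
     tab_poly \<omega> g = - (det_full ^ q * expo_mono M (expo_of g)) \<or> tab_poly \<omega> g = 0"
proof -
  have 1: "minor X g {1,2,3} j = 0 \<or> minor X g {1,2,3} j = det_full \<or> minor X g {1,2,3} j = - det_full"
    if "j \<in> {..<q}" for j
    using that colour_in_K[OF g(1) full_in_col_shapes, of j]
    by (subst (1 2 3) full_minor[OF refl refl refl]) (auto simp: q_def)
  have 2: "minor X g (shape v) j = 0 \<or> minor X g (shape v) j = M v (lab g v j) \<or> minor X g (shape v) j = - M v (lab g v j)"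
    if v: "v < 6" "j \<in> {..<d v}" for v j
  proof (cases "even v")
    case True
    then show ?thesis using line_minor[OF v(1)] by simp
  next
    case False
    have lt: "idx (g (shape v, j, Min (shape v))) < 3" "idx (g (shape v, j, Max (shape v))) < 3"
      using colour_in_K[OF g(1) shape_in_col_shapes[OF v(1)], of j] MinMax_in[OF v(1) False] v(2) by (auto simp: d_def)
    show ?thesis
      unfolding plane_minor[OF v(1) False lt refl refl] using False by (simp add: lab_def)
  qed
  have A: "(\<Prod>j<q. minor X g {1,2,3} j) = 0 \<or> (\<Prod>j<q. minor X g {1,2,3} j) = det_full ^ q
     \<or> (\<Prod>j<q. minor X g {1,2,3} j) = - (det_full ^ q)"
    using prod_sign_choice[of "{..<q}" "minor X g {1,2,3}" "\<lambda>_. det_full", OF 1]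
    by (simp only: prod_constant card_lessThan)
  have B': "(\<Prod>j<d v. minor X g (shape v) j) = 0 \<or> (\<Prod>j<d v. minor X g (shape v) j) = (\<Prod>c<3. M v c ^ expo_of g v c)
     \<or> (\<Prod>j<d v. minor X g (shape v) j) = - (\<Prod>c<3. M v c ^ expo_of g v c)" if v: "v \<in> {..<6}" for v
  proof -
    have "(\<Prod>j<d v. M v (lab g v j)) = (\<Prod>c<3. M v c ^ expo_of g v c)"
      using v by (subst prod_fibres) (auto simp: lab_less[OF g] expo_of_def intro!: prod.cong)
    then show ?thesis using prod_sign_choice[of "{..<d v}" "minor X g (shape v)" "\<lambda>j. M v (lab g v j)"] 2[of v] v by auto
  qed
  have B: "(\<Prod>v<6. \<Prod>j<d v. minor X g (shape v) j) = 0 \<or>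
     (\<Prod>v<6. \<Prod>j<d v. minor X g (shape v) j) = expo_mono M (expo_of g) \<or>
     (\<Prod>v<6. \<Prod>j<d v. minor X g (shape v) j) = - expo_mono M (expo_of g)"
    unfolding expo_mono_def by (rule prod_sign_choice[OF B'])
  have "tab_poly \<omega> g = (\<Prod>j<q. minor X g {1,2,3} j) * (\<Prod>v<6. \<Prod>j<d v. minor X g (shape v) j)"
    unfolding tab_poly_minors prod_col_shapes by (simp add: q_def d_def)
  then show ?thesis using A B by auto
qed

lemma tab_poly_good_nonzero:
  assumes g: "g \<in> colourings (squares m) K" "good g"
  shows "tab_poly \<omega> g \<noteq> 0"
proof -
  have 1: "minor X g {1,2,3} j \<noteq> 0" if j: "j < q" for j
  proof -
    have "inj_on (\<lambda>r. idx (g ({1,2,3}, j, r))) {1,2,3}" using g(2) j unfolding good_def by blast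
    then show ?thesis
      using j colour_in_K[OF g(1) full_in_col_shapes, of j] det_full_nonzero
      by (subst full_minor[OF refl refl refl]) (auto simp: q_def)
  qed
  have 2: "minor X g (shape v) j \<noteq> 0" if v: "v < 6" "j < d v" for v j
  proof (cases "even v")
    case True
    then show ?thesis
      using degree_gen[OF N_ge(1) v(1) lab_less[OF g v], where 'a=complex] line_minor[OF v(1) True] by simp
  next
    case False
    have lt: "idx (g (shape v, j, Min (shape v))) < 3" "idx (g (shape v, j, Max (shape v))) < 3"
      using colour_in_K[OF g(1) shape_in_col_shapes[OF v(1)], of j] MinMax_in[OF v(1) False] v(2) by (auto simp: d_def)
    have ne: "idx (g (shape v, j, Min (shape v))) \<noteq> idx (g (shape v, j, Max (shape v)))"
      using g(2) v False by (auto simp: good_def)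
    show ?thesis
      using degree_gen[OF N_ge(1) v(1) lab_less[OF g v], where 'a=complex] ne False
      unfolding plane_minor[OF v(1) False lt refl refl] by (simp add: lab_def)
  qed
  show ?thesis
    unfolding tab_poly_minors prod_col_shapes using 1 2 by (simp add: q_def d_def)
qed

lemma tab_poly_bad:
  assumes g: "g \<in> colourings (squares m) K" "\<not> good g"
  shows "tab_poly \<omega> g = 0"
proof -
  consider v j where "v < 6" "odd v" "j < d v" "idx (g (shape v, j, Min (shape v))) = idx (g (shape v, j, Max (shape v)))"
    | j where "j < q" "\<not> inj_on (\<lambda>r. idx (g ({1,2,3}, j, r))) {1,2,3}"
    using g(2) unfolding good_def by blast
  then show ?thesis
  proof cases
    case 1
    have lt: "idx (g (shape v, j, Min (shape v))) < 3" "idx (g (shape v, j, Max (shape v))) < 3"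
      using colour_in_K[OF g(1) shape_in_col_shapes[OF 1(1)], of j] MinMax_in[OF 1(1,2)] 1(3) by (auto simp: d_def)
    have "minor X g (shape v) j = 0"
      unfolding plane_minor[OF 1(1,2) lt refl refl] using 1(4) by simp
    then have "(\<Prod>j<m (shape v). minor X g (shape v) j) = 0"
      using 1(3) by (auto simp: d_def)
    then have "(\<Prod>v<6. \<Prod>j<m (shape v). minor X g (shape v) j) = 0"
      using 1(1) by (intro prod_zero) auto
    then show ?thesis unfolding tab_poly_minors prod_col_shapes by simp
  next
    case 2
    have "minor X g {1,2,3} j = 0"
      using 2 colour_in_K[OF g(1) full_in_col_shapes, of j] by (subst full_minor[OF refl refl refl]) (auto simp: q_def)
    then have "(\<Prod>j<m {1,2,3}. minor X g {1,2,3} j) = 0"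
      using 2(1) unfolding q_def by (intro prod_zero) auto
    then show ?thesis unfolding tab_poly_minors prod_col_shapes by simp
  qed
qed

text \<open>The shift turns the colour count into \<open>expo_weight\<close>: a plane contributes
  every colour once minus its missing one, and a full column every colour once.\<close>

definition content :: "(square \<Rightarrow> nat) \<Rightarrow> nat \<Rightarrow> int"
  where "content g c = (if c < 3 then (\<Sum>x\<in>squares m. if idx (g x) = c then 1 else 0) - int (d 1 + d 3 + d 5 + q) else 0)"

lemma content_good:
  assumes g: "g \<in> colourings (squares m) K" "good g"
  shows "content g = expo_weight (expo_of g)"
proof
  fix c
  show "content g c = expo_weight (expo_of g) c"
  proof (cases "c < 3")
    case c: True
    let ?i = "\<lambda>C j r. if idx (g (C, j, r)) = c then (1::int) else 0"
    have full: "(\<Sum>j<q. \<Sum>r\<in>{1,2,3}. ?i {1,2,3} j r) = int q"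
    proof -
      have "(\<Sum>r\<in>{1,2,3}. ?i {1,2,3} j r) = 1" if j: "j < q" for j
      proof -
        let ?f = "\<lambda>r. idx (g ({1,2,3}, j, r))"
        have inj: "inj_on ?f {1,2,3}" using g(2) j unfolding good_def by blast
        have "?f ` {1,2,3} \<subseteq> {..<3}"
          using colour_in_K[OF g(1) full_in_col_shapes, of j] j by (auto simp: q_def)
        moreover have "card (?f ` {1,2,3}) = 3" using inj by (simp add: card_image)
        ultimately have "?f ` {1,2,3} = {..<3}" by (intro card_subset_eq) auto
        have "(\<Sum>r\<in>{1,2,3}. ?i {1,2,3} j r) = (\<Sum>k\<in>?f ` {1,2,3}. if k = c then 1 else 0)"
          by (subst sum.reindex[OF inj]) simp
        then show ?thesis unfolding \<open>?f ` {1,2,3} = {..<3}\<close> using c by simp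
      qed
      then have "(\<Sum>j<q. \<Sum>r\<in>{1,2,3}. ?i {1,2,3} j r) = (\<Sum>j<q. 1)"
        by (intro sum.cong refl) (simp only: lessThan_iff)
      then show ?thesis by (simp only: sum_constant card_lessThan mult_1_right of_nat_id)
    qed
    have cnt: "(\<Sum>j<d v. if lab g v j = c then 1 else 0) = int (expo_of g v c)" if "v < 6" for v
    proof -
      have "(\<Sum>j<d v. if lab g v j = c then 1 else (0::int)) = (\<Sum>j\<in>{j\<in>{..<d v}. lab g v j = c}. 1)"
        by (rule sum.inter_filter[symmetric]) simp
      then show ?thesis using that c by (simp add: expo_of_def)
    qed
    have line: "(\<Sum>j<d v. \<Sum>r\<in>shape v. ?i (shape v) j r) = int (expo_of g v c)" if "v < 6" "even v" for v
    proof -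
      have "(\<Sum>r\<in>shape v. ?i (shape v) j r) = (if lab g v j = c then 1 else 0)" for j
        using that(2) unfolding lab_def by (subst line_shape[OF that]) simp
      then show ?thesis using cnt[OF that(1)] by simp
    qed
    have plane: "(\<Sum>j<d v. \<Sum>r\<in>shape v. ?i (shape v) j r) = int (d v) - int (expo_of g v c)" if v: "v < 6" "odd v" for v
    proof -
      have "(\<Sum>r\<in>shape v. ?i (shape v) j r) = 1 - (if lab g v j = c then 1 else 0)" if j: "j < d v" for j
      proof -
        let ?a = "idx (g (shape v, j, Min (shape v)))" and ?b = "idx (g (shape v, j, Max (shape v)))"
        have lt: "?a < 3" "?b < 3"
          using colour_in_K[OF g(1) shape_in_col_shapes[OF v(1)], of j] MinMax_in[OF v] j by (auto simp: d_def)
        have ne: "?a \<noteq> ?b" using g(2) v j by (auto simp: good_def)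
        have "(\<Sum>r\<in>shape v. ?i (shape v) j r) = (\<Sum>r\<in>{Min (shape v), Max (shape v)}. ?i (shape v) j r)"
          by (rule sum.cong[OF MinMax_in(4)[OF v] refl])
        also have "\<dots> = (if ?a = c then 1 else 0) + (if ?b = c then 1 else 0)"
          using MinMax_in(3)[OF v] by simp
        also have "\<dots> = 1 - (if 3 - (?a + ?b) = c then 1 else 0)"
          using lt ne c unfolding less_3_cases by (elim disjE) simp_all
        finally show ?thesis using v(2) by (simp add: lab_def)
      qed
      then have "(\<Sum>j<d v. \<Sum>r\<in>shape v. ?i (shape v) j r) = (\<Sum>j<d v. 1 - (if lab g v j = c then 1 else 0))"
        by simp
      then show ?thesis using cnt[OF v(1)] by (simp add: sum_subtractf)
    qed
    have "(\<Sum>x\<in>squares m. if idx (g x) = c then (1::int) else 0) = (\<Sum>C\<in>col_shapes. \<Sum>j<m C. \<Sum>r\<in>C. ?i C j r)"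
      by (rule sum_squares)
    also have "\<dots> = int q + (\<Sum>v<6. \<Sum>j<d v. \<Sum>r\<in>shape v. ?i (shape v) j r)"
      unfolding sum_col_shapes by (simp only: full[unfolded q_def] d_def q_def)
    also have "\<dots> = int q + (int (expo_of g 0 c) + (int (d 1) - int (expo_of g 1 c)) + int (expo_of g 2 c)
       + (int (d 3) - int (expo_of g 3 c)) + int (expo_of g 4 c) + (int (d 5) - int (expo_of g 5 c)))"
      unfolding lessThan_6 using line[of 0] line[of 2] line[of 4] plane[of 1] plane[of 3] plane[of 5] by simp
    finally show ?thesis using c by (simp add: content_def expo_weight_def)
  qed (simp add: content_def expo_weight_def)
qed

lemma colouring_exists:
  assumes E: "E \<in> expos d"
  shows "\<exists>g. g \<in> colourings (squares m) K \<and> good g \<and> expo_of g = E"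
proof -
  have "\<forall>v. \<exists>l. v < 6 \<longrightarrow> (\<forall>j<d v. l j < (3::nat)) \<and> (\<forall>c<3. card {j. j < d v \<and> l j = c} = E v c)"
  proof
    fix v
    show "\<exists>l. v < 6 \<longrightarrow> (\<forall>j<d v. l j < (3::nat)) \<and> (\<forall>c<3. card {j. j < d v \<and> l j = c} = E v c)"
      using labelling_exists[of "E v"] E by (cases "v < 6") (auto simp: expos_def)
  qed
  then obtain l where l: "\<And>v j. v < 6 \<Longrightarrow> j < d v \<Longrightarrow> l v j < (3::nat)"
    "\<And>v c. v < 6 \<Longrightarrow> c < 3 \<Longrightarrow> card {j. j < d v \<and> l v j = c} = E v c" by metis
  define sh where "sh = the_inv_into {..<6} shape"
  have sh: "sh (shape v) = v" if "v < 6" for v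
    unfolding sh_def by (rule the_inv_into_f_f[OF inj_shape]) (use that in simp)
  \<comment> \<open>A plane with label l receives the colours l + 1 and l + 2 modulo 3, so that l is
    missing; a full column receives all three colours in order.\<close>
  define g where "g = (\<lambda>(C, j, r). if (C, j, r) \<in> squares m then
     kc (if C = {1,2,3} then r - 1 else if card C = 1 then l (sh C) j
         else if r = Min C then (l (sh C) j + 1) mod 3 else (l (sh C) j + 2) mod 3) else 0)"
  have ne: "shape v \<noteq> {1,2,3}" if "v < 6" for v using full_not_shape that by blast
  have sq: "(shape v, j, r) \<in> squares m" if "v < 6" "j < d v" "r \<in> shape v" for v j r
    using that shape_in_col_shapes by (auto simp: squares_def d_def)
  have sqf: "({1,2,3}, j, r) \<in> squares m" if "j < q" "r \<in> {1,2,3}" for j r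
    using that full_in_col_shapes by (auto simp: squares_def q_def)
  have gl: "g (shape v, j, v div 2 + 1) = kc (l v j)" if v: "v < 6" "even v" "j < d v" for v j
    using sq[OF v(1,3), of "v div 2 + 1"] line_shape[OF v(1,2)] ne[OF v(1)] sh[OF v(1)] by (simp add: g_def)
  have gp: "g (shape v, j, Min (shape v)) = kc ((l v j + 1) mod 3)" "g (shape v, j, Max (shape v)) = kc ((l v j + 2) mod 3)"
    if v: "v < 6" "odd v" "j < d v" for v j
  proof -
    have c2: "card (shape v) \<noteq> 1" using MinMax_in[OF v(1,2)] by (metis card_1_singletonE singletonD)
    show "g (shape v, j, Min (shape v)) = kc ((l v j + 1) mod 3)" "g (shape v, j, Max (shape v)) = kc ((l v j + 2) mod 3)"
      using sq[OF v(1,3) MinMax_in(1)[OF v(1,2)]] sq[OF v(1,3) MinMax_in(2)[OF v(1,2)]] MinMax_in(3)[OF v(1,2)]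
        ne[OF v(1)] sh[OF v(1)] c2 by (simp_all add: g_def)
  qed
  have gf: "g ({1,2,3}, j, r) = kc (r - 1)" if "j < q" "r \<in> {1,2,3}" for j r
    using sqf[OF that] by (simp add: g_def)
  have labg: "lab g v j = l v j" if v: "v < 6" "j < d v" for v j
  proof (cases "even v")
    case True
    then show ?thesis using gl[OF v(1) True v(2)] l(1)[OF v] by (simp add: lab_def)
  next
    case False
    have "idx (kc ((l v j + 1) mod 3)) = (l v j + 1) mod 3" "idx (kc ((l v j + 2) mod 3)) = (l v j + 2) mod 3"
      by simp_all
    then show ?thesis using False l(1)[OF v] unfolding lab_def gp[OF v(1) False v(2)] less_3_cases
      by (elim disjE) simp_all
  qed
  have "good g"
    unfolding good_def
  proof (intro conjI allI impI)
    fix v j assume v: "v < 6" "odd v" "j < d v"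
    have "(l v j + 1) mod 3 \<noteq> (l v j + 2) mod 3" by presburger
    then show "idx (g (shape v, j, Min (shape v))) \<noteq> idx (g (shape v, j, Max (shape v)))"
      unfolding gp[OF v] by simp
  next
    fix j assume j: "j < q"
    show "inj_on (\<lambda>r. idx (g ({1,2,3}, j, r))) {1,2,3}"
      unfolding inj_on_def using gf[OF j] by auto
  qed
  moreover have "g \<in> colourings (squares m) K"
  proof -
    have "g x \<in> K" if x: "x \<in> squares m" for x
    proof -
      obtain C j r where xe: "x = (C, j, r)" by (cases x)
      have Cj: "C \<in> col_shapes" "j < m C" "r \<in> C" using x by (auto simp: xe squares_def)
      have K3: "kc i \<in> K" if "i < 3" for i using that by (auto simp: K_def)
      show ?thesis
      proof (cases "C = {1,2,3}")
        case True
        then show ?thesis using gf[of j r] Cj K3[of "r - 1"] by (auto simp: xe q_def)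
      next
        case False
        then obtain v where v: "v < 6" "C = shape v" using Cj(1) by (auto simp: col_shapes_eq)
        have j: "j < d v" using Cj v by (simp add: d_def)
        show ?thesis
        proof (cases "even v")
          case True
          then have "r = v div 2 + 1" using Cj(3) line_shape[OF v(1) True] v by simp
          then show ?thesis using gl[OF v(1) True j] l(1)[OF v(1) j] K3 by (simp add: xe v)
        next
          case False
          then have "r = Min (shape v) \<or> r = Max (shape v)" using Cj(3) MinMax_in(4)[OF v(1) False] v by blast
          then show ?thesis using gp[OF v(1) False j] K3 by (auto simp: xe v)
        qed
      qed
    qed
    moreover have "g x = 0" if "x \<notin> squares m" for x using that by (cases x) (simp add: g_def)
    ultimately show ?thesis by (simp add: colourings_def)
  qed
  moreover have "expo_of g = E"
  proof (intro ext)
    fix v c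
    show "expo_of g v c = E v c"
    proof (cases "v < 6 \<and> c < 3")
      case True
      then have "{j. j < d v \<and> lab g v j = c} = {j. j < d v \<and> l v j = c}" using labg by auto
      then show ?thesis using True l(2) by (simp add: expo_of_def)
    next
      case False
      then show ?thesis using E by (auto simp: expo_of_def expos_def)
    qed
  qed
  ultimately show ?thesis by blast
qed

section \<open>Row orbits, contents and the character for three colours\<close>

lemma code_digits:
  assumes g: "g \<in> colourings (squares m) K"
  shows "\<exists>h. code \<omega> g = (\<Sum>i<9. card {x \<in> squares m. 3 * (sq_row x - 1) + idx (g x) = i} * N ^ i) + N ^ 9 * h"
proof -
  have r: "3 * (sq_row x - 1) + idx (g x) < 9" if "x \<in> squares m" for x
  proof -
    have "sq_row x \<le> 3" using that by (auto simp: squares_def sq_row_def col_shapes_def)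
    moreover have "idx (g x) < 3" using that g idx_less by (auto simp: colourings_def)
    ultimately show ?thesis by linarith
  qed
  have "code \<omega> g = (\<Sum>x\<in>squares m. N ^ (3 * (sq_row x - 1) + idx (g x)) + N ^ 10 * heavy (sq_row x - 1) (idx (g x)))"
    by (simp add: code_def \<omega>_def wexp_def add.commute mult.commute)
  also have "\<dots> = (\<Sum>x\<in>squares m. N ^ (3 * (sq_row x - 1) + idx (g x)))
     + N ^ 9 * (N * (\<Sum>x\<in>squares m. heavy (sq_row x - 1) (idx (g x))))"
    by (simp add: sum.distrib sum_distrib_left eval_nat_numeral mult.assoc)
  also have "(\<Sum>x\<in>squares m. N ^ (3 * (sq_row x - 1) + idx (g x)))
     = (\<Sum>i<9. \<Sum>x\<in>{x \<in> squares m. 3 * (sq_row x - 1) + idx (g x) = i}. N ^ (3 * (sq_row x - 1) + idx (g x)))"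
    by (rule sum.group[symmetric]) (use r in auto)
  also have "\<dots> = (\<Sum>i<9. card {x \<in> squares m. 3 * (sq_row x - 1) + idx (g x) = i} * N ^ i)"
    by (rule sum.cong) auto
  finally show ?thesis by blast
qed

text \<open>The digits of a code count the squares of each row and colour, and two fillings with
  equal counts differ by a permutation within the rows.\<close>

lemma code_row_orbit:
  assumes g: "g \<in> colourings (squares m) K" and h: "h \<in> colourings (squares m) K"
    and eq: "code \<omega> g = code \<omega> h"
  shows "\<exists>\<kappa>\<in>row_group m. h = g \<circ> \<kappa>"
proof -
  let ?u = "\<lambda>g i. card {x \<in> squares m. 3 * (sq_row x - 1) + idx (g x) = i}"
  have bound: "?u g i < N" for g i
    by (rule le_less_trans[OF card_mono N_ge(3)]) auto
  obtain a b where ab: "code \<omega> g = (\<Sum>i<9. ?u g i * N ^ i) + N ^ 9 * a" "code \<omega> h = (\<Sum>i<9. ?u h i * N ^ i) + N ^ 9 * b"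
    using code_digits[OF g] code_digits[OF h] by blast
  have u: "?u g i = ?u h i" if "i < 9" for i
    by (rule base_expansion_unique[of "?u g" N 9 a "?u h" b i]) (use ab eq bound that in auto)
  have row: "sq_row x \<in> {1,2,3}" if "x \<in> squares m" for x
    using that by (auto simp: squares_def sq_row_def col_shapes_def)
  let ?f = "\<lambda>g x. (sq_row x, g x)"
  have "image_mset (?f g) (mset_set (squares m)) = image_mset (?f h) (mset_set (squares m))"
  proof (rule multiset_eqI)
    fix p :: "nat \<times> nat"
    have cnt: "count (image_mset (?f g) (mset_set (squares m))) p = card {x \<in> squares m. ?f g x = p}" for g
    proof -
      have "count (image_mset (?f g) (mset_set (squares m))) p = (\<Sum>x\<in>?f g -` {p} \<inter> squares m. 1)"
        by (simp add: count_image_mset)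
      also have "\<dots> = card (?f g -` {p} \<inter> squares m)" by simp
      also have "?f g -` {p} \<inter> squares m = {x \<in> squares m. ?f g x = p}" by auto
      finally show ?thesis .
    qed
    obtain r k where p: "p = (r, k)" by (cases p)
    show "count (image_mset (?f g) (mset_set (squares m))) p = count (image_mset (?f h) (mset_set (squares m))) p"
    proof (cases "r \<in> {1,2,3} \<and> k \<in> K")
      case True
      have e: "{x \<in> squares m. ?f g x = p} = {x \<in> squares m. 3 * (sq_row x - 1) + idx (g x) = 3 * (r - 1) + idx k}"
        if g: "g \<in> colourings (squares m) K" for g
      proof -
        have "?f g x = p \<longleftrightarrow> 3 * (sq_row x - 1) + idx (g x) = 3 * (r - 1) + idx k" if x: "x \<in> squares m" for x
        proof -
          have gx: "g x \<in> K" using g x by (simp add: colourings_def)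
          have "3 * (sq_row x - 1) + idx (g x) = 3 * (r - 1) + idx k \<longleftrightarrow> sq_row x = r \<and> idx (g x) = idx k"
            using row[OF x] True idx_less[OF gx] idx_less[of k] by auto
          moreover have "idx (g x) = idx k \<longleftrightarrow> g x = k" using kc_idx[OF gx] kc_idx[of k] True by metis
          ultimately show ?thesis by (simp add: p)
        qed
        then show ?thesis by blast
      qed
      have "3 * (r - 1) + idx k < 9" using True idx_less[of k] by auto
      then show ?thesis unfolding cnt e[OF g] e[OF h] by (rule u)
    next
      case False
      have em: "{x \<in> squares m. ?f g x = p} = {}" if "g \<in> colourings (squares m) K" for g
        using False row that by (auto simp: p colourings_def)
      show ?thesis unfolding cnt em[OF g] em[OF h] ..
    qed
  qed
  then obtain p where p: "p permutes squares m" "\<forall>x\<in>squares m. ?f h x = ?f g (p x)"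
    using image_mset_eq_implies_permutes[OF finite_squares, of "?f h" m "?f g"] by metis
  have "sq_row (p x) = sq_row x" for x
    using p by (cases "x \<in> squares m") (simp_all add: permutes_not_in)
  then have "p \<in> row_group m" using p(1) unfolding row_group_def by blast
  moreover have "h = g \<circ> p"
  proof
    fix x
    show "h x = (g \<circ> p) x"
    proof (cases "x \<in> squares m")
      case False
      then have "h x = 0" "g x = 0" using g h unfolding colourings_def by blast+
      then show ?thesis using permutes_not_in[OF p(1) False] by simp
    qed (use p in simp)
  qed
  ultimately show ?thesis by blast
qed

lemma finite_K: "finite K" by (simp add: K_def)

lemma content_comp:
  assumes "\<sigma> \<in> G" shows "content (g \<circ> \<sigma>) = content g"
proof -
  have p: "\<sigma> permutes squares m" using assms by (simp add: G_def)
  have "(\<Sum>x\<in>squares m. if idx ((g \<circ> \<sigma>) x) = c then 1 else 0) = (\<Sum>x\<in>squares m. if idx (g x) = c then 1 else (0::int))" for c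
    using sum.permute[OF p, of "\<lambda>x. if idx (g x) = c then 1 else (0::int)"] by (simp add: o_def)
  then show ?thesis by (simp add: content_def fun_eq_iff)
qed

text \<open>Within one content, tableau polynomials and monomials in the generators span the same
  space: good fillings give all the monomials up to sign, the other fillings give 0.\<close>

lemma trace_content:
  "(\<Sum>g | g \<in> colourings (squares m) K \<and> content g = w. \<Sum>\<sigma> | \<sigma> \<in> G \<and> g \<circ> \<sigma> = g. projD \<sigma>)
    = of_nat (card {E \<in> expos d. std_expo E \<and> expo_weight E = w})"
proof -
  interpret V: vector_space "smult :: complex \<Rightarrow> complex poly \<Rightarrow> complex poly" by (rule vector_space_poly)
  let ?I = "{g. g \<in> colourings (squares m) K \<and> content g = w}"
  let ?D = "\<lambda>E. det_full ^ q * expo_mono M E"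
  let ?A = "{E \<in> expos d. expo_weight E = w}"
  have "(\<Sum>g\<in>?I. \<Sum>\<sigma> | \<sigma> \<in> G \<and> g \<circ> \<sigma> = g. projD \<sigma>) = of_nat (V.dim (tab_poly \<omega> ` ?I))"
  proof (rule trace_dim_span)
    show "finite ?I" using finite_colourings[OF finite_squares[of m] finite_K] by simp
    show "g \<circ> \<sigma> \<in> ?I \<longleftrightarrow> g \<in> ?I" if "\<sigma> \<in> G" for g \<sigma>
      using that by (simp add: content_comp)
    show "\<exists>\<kappa>\<in>row_group m. h = g \<circ> \<kappa>" if "g \<in> ?I" "h \<in> ?I" "code \<omega> g = code \<omega> h" for g h
      using that code_row_orbit by blast
  qed
  also have "V.dim (tab_poly \<omega> ` ?I) = V.dim (?D ` ?A)"
  proof -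
    have 1: "tab_poly \<omega> ` ?I \<subseteq> V.span (?D ` ?A)"
    proof
      fix p assume "p \<in> tab_poly \<omega> ` ?I"
      then obtain g where g: "g \<in> colourings (squares m) K" "content g = w" "p = tab_poly \<omega> g" by auto
      show "p \<in> V.span (?D ` ?A)"
      proof (cases "good g")
        case True
        have "?D (expo_of g) \<in> V.span (?D ` ?A)"
          using expo_of_expos[OF g(1) True] content_good[OF g(1) True] g(2) by (intro V.span_base imageI) simp
        then show ?thesis
          using tab_poly_good[OF g(1) True] V.span_neg V.span_zero g(3) by auto
      next
        case False
        then show ?thesis using tab_poly_bad[OF g(1)] V.span_zero g(3) by simp
      qed
    qed
    have 2: "?D ` ?A \<subseteq> V.span (tab_poly \<omega> ` ?I)"
    proof
      fix p assume "p \<in> ?D ` ?A"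
      then obtain E where E: "E \<in> expos d" "expo_weight E = w" "p = ?D E" by auto
      obtain g where g: "g \<in> colourings (squares m) K" "good g" "expo_of g = E"
        using colouring_exists[OF E(1)] by blast
      have "g \<in> ?I" using g content_good[OF g(1,2)] E(2) by simp
      then have b: "tab_poly \<omega> g \<in> V.span (tab_poly \<omega> ` ?I)" by (intro V.span_base imageI)
      have "?D E = tab_poly \<omega> g \<or> ?D E = - tab_poly \<omega> g"
        using tab_poly_good[OF g(1,2)] tab_poly_good_nonzero[OF g(1,2)] g(3) by auto
      then show "p \<in> V.span (tab_poly \<omega> ` ?I)" using b V.span_neg[OF b] E(3) by auto
    qed
    have "V.span (tab_poly \<omega> ` ?I) = V.span (?D ` ?A)"
      using V.span_minimal[OF 1 V.subspace_span] V.span_minimal[OF 2 V.subspace_span] by blast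
    then have "V.dim (V.span (tab_poly \<omega> ` ?I)) = V.dim (V.span (?D ` ?A))" by (rule arg_cong)
    then show ?thesis by (simp only: V.dim_span)
  qed
  also have "V.dim (?D ` ?A) = card {E \<in> expos d. std_expo E \<and> expo_weight E = w}"
    by (rule dim_expo_monos) (use N_ge det_full_nonzero in auto)
  finally show ?thesis .
qed

text \<open>The weight of a generator; a plane with missing colour c carries the product of the two
  other colour weights.\<close>

definition yvar :: "(nat \<Rightarrow> 'a::field) \<Rightarrow> nat \<Rightarrow> nat \<Rightarrow> 'a"
  where "yvar x v c = (if even v then x (kc c) else x (kc ((c + 1) mod 3)) * x (kc ((c + 2) mod 3)))"

text \<open>Adding the shift back turns the weight into the number of squares of a colour, which is
  nonnegative, so \<open>nat\<close> loses nothing.\<close>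

lemma weight_monomial:
  fixes x :: "nat \<Rightarrow> 'a::field"
  assumes E: "E \<in> expos d"
  shows "(\<Prod>c<3. x (kc c) ^ nat (expo_weight E c + int (d 1 + d 3 + d 5 + q)))
    = (\<Prod>c<3. x (kc c)) ^ q * (\<Prod>v<6. \<Prod>c<3. yvar x v c ^ E v c)"
proof -
  have s: "d 1 = E 1 0 + E 1 1 + E 1 2" "d 3 = E 3 0 + E 3 1 + E 3 2" "d 5 = E 5 0 + E 5 1 + E 5 2"
    using E by (auto simp: expos_def)
  define a b c where "a = x (kc 0)" and "b = x (kc 1)" and "c = x (kc 2)"
  have n: "nat (expo_weight E 0 + int (d 1 + d 3 + d 5 + q)) = E 0 0 + E 2 0 + E 4 0 + (E 1 1 + E 1 2) + (E 3 1 + E 3 2) + (E 5 1 + E 5 2) + q"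
    "nat (expo_weight E 1 + int (d 1 + d 3 + d 5 + q)) = E 0 1 + E 2 1 + E 4 1 + (E 1 0 + E 1 2) + (E 3 0 + E 3 2) + (E 5 0 + E 5 2) + q"
    "nat (expo_weight E 2 + int (d 1 + d 3 + d 5 + q)) = E 0 2 + E 2 2 + E 4 2 + (E 1 0 + E 1 1) + (E 3 0 + E 3 1) + (E 5 0 + E 5 1) + q"
    unfolding s expo_weight_def by auto
  have y: "yvar x 0 k = x (kc k)" "yvar x 2 k = x (kc k)" "yvar x 4 k = x (kc k)"
    "yvar x 1 k = x (kc ((k + 1) mod 3)) * x (kc ((k + 2) mod 3))"
    "yvar x 3 k = x (kc ((k + 1) mod 3)) * x (kc ((k + 2) mod 3))"
    "yvar x 5 k = x (kc ((k + 1) mod 3)) * x (kc ((k + 2) mod 3))" for k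
    by (simp_all add: yvar_def)
  have t: "(0 + 1) mod 3 = (1::nat)" "(0 + 2) mod 3 = (2::nat)" "(1 + 1) mod 3 = (2::nat)" "(1 + 2) mod 3 = (0::nat)"
    "(2 + 1) mod 3 = (0::nat)" "(2 + 2) mod 3 = (1::nat)" by simp_all
  have p3: "(\<Prod>c<3. f c) = f 0 * f 1 * f 2" for f :: "nat \<Rightarrow> 'a"
    unfolding lessThan_3 by (simp add: mult.assoc)
  have p6: "(\<Prod>v<6. f v) = f 0 * f 1 * f 2 * f 3 * f 4 * f 5" for f :: "nat \<Rightarrow> 'a"
    unfolding lessThan_6 by (simp add: mult.assoc)
  show ?thesis
    unfolding p3 p6 y t n a_def[symmetric] b_def[symmetric] c_def[symmetric]
    by (simp only: power_add power_mult_distrib mult_ac)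
qed

lemma colouring_monomial:
  fixes x :: "nat \<Rightarrow> 'a::field"
  assumes g: "g \<in> colourings (squares m) K"
  shows "(\<Prod>z\<in>squares m. x (g z)) = (\<Prod>c<3. x (kc c) ^ nat (content g c + int (d 1 + d 3 + d 5 + q)))"
proof -
  have gK: "g z \<in> K" if "z \<in> squares m" for z using g that by (simp add: colourings_def)
  have "(\<Prod>z\<in>squares m. x (g z)) = (\<Prod>c<3. \<Prod>z\<in>{z \<in> squares m. idx (g z) = c}. x (g z))"
    by (rule prod.group[symmetric]) (use gK idx_less in auto)
  also have "\<dots> = (\<Prod>c<3. x (kc c) ^ nat (content g c + int (d 1 + d 3 + d 5 + q)))"
  proof (rule prod.cong[OF refl])
    fix c :: nat assume c: "c \<in> {..<3}"
    have "(\<Sum>x\<in>squares m. if idx (g x) = c then (1::int) else 0) = (\<Sum>x\<in>{x\<in>squares m. idx (g x) = c}. 1)"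
      by (rule sum.inter_filter[symmetric]) simp
    then have "nat (content g c + int (d 1 + d 3 + d 5 + q)) = card {x\<in>squares m. idx (g x) = c}"
      using c by (simp add: content_def)
    moreover have "(\<Prod>z\<in>{z \<in> squares m. idx (g z) = c}. x (g z)) = (\<Prod>z\<in>{z \<in> squares m. idx (g z) = c}. x (kc c))"
      by (rule prod.cong) (use gK kc_idx in auto)
    ultimately show "(\<Prod>z\<in>{z \<in> squares m. idx (g z) = c}. x (g z)) = x (kc c) ^ nat (content g c + int (d 1 + d 3 + d 5 + q))"
      by simp
  qed
  finally show ?thesis .
qed

text \<open>The map \<open>\<iota>\<close> carries complex traces into the field of the weights. It
  is only asked to be additive and to respect natural numbers, so that it may be built from the real
  part, which is not multiplicative.\<close>

theorem weighted_trace_std: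
  fixes x :: "nat \<Rightarrow> 'a::field_char_0" and \<iota> :: "complex \<Rightarrow> 'a"
  assumes \<iota>: "\<And>a b. \<iota> (a + b) = \<iota> a + \<iota> b" "\<And>n. \<iota> (of_nat n) = of_nat n"
  shows "weighted_trace (\<lambda>\<sigma>. \<iota> (projD \<sigma>)) K x =
     (\<Prod>c<3. x (kc c)) ^ q * (\<Sum>E | E \<in> expos d \<and> std_expo E. \<Prod>v<6. \<Prod>c<3. yvar x v c ^ E v c)"
proof -
  have \<iota>0: "\<iota> 0 = 0" using \<iota>(2)[of 0] by simp
  have \<iota>s: "\<iota> (sum f A) = (\<Sum>i\<in>A. \<iota> (f i))" for f :: "'i \<Rightarrow> complex" and A
    by (induction A rule: infinite_finite_induct) (simp_all add: \<iota> \<iota>0)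
  define XX where "XX = (\<lambda>w. \<Prod>c<3. x (kc c) ^ nat (w c + int (d 1 + d 3 + d 5 + q)))"
  define t :: "(square \<Rightarrow> nat) \<Rightarrow> complex" where "t = (\<lambda>g. \<Sum>\<sigma> | \<sigma> \<in> G \<and> g \<circ> \<sigma> = g. projD \<sigma>)"
  let ?C = "colourings (squares m) K"
  have finC: "finite ?C" using finite_colourings[OF finite_squares[of m] finite_K] .
  have std_in: "expo_weight E \<in> content ` ?C" if "E \<in> expos d" for E
  proof -
    obtain g where g: "g \<in> ?C" "good g" "expo_of g = E" using colouring_exists[OF \<open>E \<in> expos d\<close>] by blast
    then show ?thesis using content_good[OF g(1,2)] by (intro image_eqI[of _ _ g]) simp_all
  qed
  have "weighted_trace (\<lambda>\<sigma>. \<iota> (projD \<sigma>)) K x = (\<Sum>g\<in>?C. XX (content g) * \<iota> (t g))"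
    unfolding weighted_trace_def XX_def t_def by (rule sum.cong) (simp_all add: colouring_monomial \<iota>s)
  also have "\<dots> = (\<Sum>w\<in>content ` ?C. \<Sum>g\<in>{g\<in>?C. content g = w}. XX (content g) * \<iota> (t g))"
    by (rule sum.group[symmetric]) (use finC in auto)
  also have "\<dots> = (\<Sum>w\<in>content ` ?C. \<Sum>E\<in>{E\<in>{E. E \<in> expos d \<and> std_expo E}. expo_weight E = w}. XX (expo_weight E))"
  proof (rule sum.cong[OF refl])
    fix w
    have "(\<Sum>g\<in>{g\<in>?C. content g = w}. XX (content g) * \<iota> (t g)) = XX w * \<iota> (\<Sum>g\<in>{g\<in>?C. content g = w}. t g)"
      by (simp add: \<iota>s sum_distrib_left)
    also have "(\<Sum>g\<in>{g\<in>?C. content g = w}. t g) = of_nat (card {E \<in> expos d. std_expo E \<and> expo_weight E = w})"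
      unfolding t_def by (rule trace_content)
    also have "XX w * \<iota> (of_nat (card {E \<in> expos d. std_expo E \<and> expo_weight E = w})) =
       (\<Sum>E\<in>{E\<in>{E. E \<in> expos d \<and> std_expo E}. expo_weight E = w}. XX (expo_weight E))"
      by (simp add: \<iota> conj_assoc mult.commute)
    finally show "(\<Sum>g\<in>{g\<in>?C. content g = w}. XX (content g) * \<iota> (t g)) =
       (\<Sum>E\<in>{E\<in>{E. E \<in> expos d \<and> std_expo E}. expo_weight E = w}. XX (expo_weight E))" .
  qed
  also have "\<dots> = (\<Sum>E | E \<in> expos d \<and> std_expo E. XX (expo_weight E))"
    by (rule sum.group) (use finC std_in in auto)
  also have "\<dots> = (\<Sum>E | E \<in> expos d \<and> std_expo E. (\<Prod>c<3. x (kc c)) ^ q * (\<Prod>v<6. \<Prod>c<3. yvar x v c ^ E v c))"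
    unfolding XX_def by (rule sum.cong[OF refl], rule weight_monomial) simp
  finally show ?thesis by (simp add: sum_distrib_left)
qed

end

section \<open>Localization of the sum of standard monomials\<close>

definition comps :: "nat \<Rightarrow> (nat \<Rightarrow> nat) set"
  where "comps n = {t. (\<forall>c\<ge>3. t c = 0) \<and> t 0 + t 1 + t 2 = n}"

lemma finite_comps [simp]: "finite (comps n)"
proof -
  have "comps n \<subseteq> (\<lambda>(a, b, c) i. if i = 0 then a else if i = 1 then b else if i = 2 then c else 0) ` ({..n} \<times> {..n} \<times> {..n})"
  proof
    fix t assume t: "t \<in> comps n"
    have "t = (\<lambda>i. if i = 0 then t 0 else if i = 1 then t 1 else if i = 2 then t 2 else 0)"
    proof
      fix i :: nat
      show "t i = (if i = 0 then t 0 else if i = 1 then t 1 else if i = 2 then t 2 else 0)"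
        using t less_3_cases[of i] by (auto simp: comps_def not_less[symmetric])
    qed
    then show "t \<in> (\<lambda>(a, b, c) i. if i = 0 then a else if i = 1 then b else if i = 2 then c else 0) ` ({..n} \<times> {..n} \<times> {..n})"
      using t by (intro image_eqI[of _ _ "(t 0, t 1, t 2)"]) (auto simp: comps_def)
  qed
  then show ?thesis by (rule finite_subset) auto
qed

definition tmono :: "(nat \<Rightarrow> 'a::field) \<Rightarrow> (nat \<Rightarrow> nat) \<Rightarrow> 'a"
  where "tmono y t = y 0 ^ t 0 * y 1 ^ t 1 * y 2 ^ t 2"

lemma comps_raise:
  assumes p: "p < 3" and P: "\<And>t. P (t(p := Suc (t p))) = Q t"
  shows "(\<Sum>t | t \<in> comps (Suc n) \<and> t p > 0 \<and> P t. tmono y t) = y p * (\<Sum>t | t \<in> comps n \<and> Q t. tmono y t)"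
proof -
  have m: "tmono y (t(p := Suc (t p))) = y p * tmono y t" for t
    using p unfolding less_3_cases by (auto simp: tmono_def mult_ac)
  have c: "t(p := Suc (t p)) \<in> comps (Suc n) \<longleftrightarrow> t \<in> comps n" for t
    using p unfolding less_3_cases by (auto simp: comps_def)
  have d: "t(p := t p - Suc 0) \<in> comps n" if "t \<in> comps (Suc n)" "t p > 0" for t
    using c[of "t(p := t p - Suc 0)"] that by simp
  have "(\<Sum>t | t \<in> comps (Suc n) \<and> t p > 0 \<and> P t. tmono y t)
     = (\<Sum>t | t \<in> comps n \<and> Q t. tmono y (t(p := Suc (t p))))"
  proof (rule sum.reindex_bij_witness[of _ "\<lambda>t. t(p := Suc (t p))" "\<lambda>t. t(p := t p - 1)"], goal_cases)
    case (2 t)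
    have "Q (t(p := t p - 1))" using 2 P[of "t(p := t p - 1)"] by simp
    then show ?case using 2 d[of t] by simp
  qed (use c P in auto)
  then show ?thesis by (simp add: m sum_distrib_left)
qed

lemma comps_split:
  "(\<Sum>t | t \<in> comps n \<and> P t. f t) =
   (\<Sum>t | t \<in> comps n \<and> t p > (0::nat) \<and> P t. f t) + (\<Sum>t | t \<in> comps n \<and> t p = 0 \<and> P t. (f t :: 'a::field))"
proof -
  have "{t. t \<in> comps n \<and> P t} = {t. t \<in> comps n \<and> t p > 0 \<and> P t} \<union> {t. t \<in> comps n \<and> t p = 0 \<and> P t}" by auto
  then show ?thesis by (simp only:) (rule sum.union_disjoint, auto)
qed

lemma comps_zero: "comps 0 = {\<lambda>_. 0}"
proof
  show "comps 0 \<subseteq> {\<lambda>_. 0}"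
  proof
    fix t assume t: "t \<in> comps 0"
    have "t c = 0" for c
      using t less_3_cases[of c] by (cases "c < 3") (auto simp: comps_def)
    then show "t \<in> {\<lambda>_. 0}" by auto
  qed
qed (auto simp: comps_def)

text \<open>The fixed-point factor at the coordinate point c of a projective plane whose coordinates
  have weights \<open>y\<close>.\<close>

definition local_weight :: "(nat \<Rightarrow> 'a::field) \<Rightarrow> nat \<Rightarrow> 'a"
  where "local_weight y c = 1 / (\<Prod>c'\<in>{..<3} - {c}. 1 - y c' / y c)"

locale three_vars =
  fixes y :: "nat \<Rightarrow> 'a::field"
  assumes nz: "y 0 \<noteq> 0" "y 1 \<noteq> 0" "y 2 \<noteq> 0" and ne: "y 0 \<noteq> y 1" "y 0 \<noteq> y 2" "y 1 \<noteq> y 2"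
begin

lemma local_weights:
  "local_weight y 0 = (y 0)^2 / ((y 0 - y 1) * (y 0 - y 2))"
  "local_weight y 1 = (y 1)^2 / ((y 1 - y 0) * (y 1 - y 2))"
  "local_weight y 2 = (y 2)^2 / ((y 2 - y 0) * (y 2 - y 1))"
proof -
  have s: "{..<3::nat} - {0} = {1, 2}" "{..<3::nat} - {1} = {0, 2}" "{..<3::nat} - {2} = {0, 1}" by auto
  have q: "1 - b / a = (a - b) / a" if "a \<noteq> 0" for a b :: 'a using that by (simp add: field_simps)
  show "local_weight y 0 = (y 0)^2 / ((y 0 - y 1) * (y 0 - y 2))"
    "local_weight y 1 = (y 1)^2 / ((y 1 - y 0) * (y 1 - y 2))"
    "local_weight y 2 = (y 2)^2 / ((y 2 - y 0) * (y 2 - y 1))"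
    unfolding local_weight_def s using q[OF nz(1)] q[OF nz(2)] q[OF nz(3)] nz
    by (simp_all add: power2_eq_square)
qed

text \<open>These are the values of the formula for complete symmetric polynomials in degrees -1, -2
  and 0. The two zeros make the indicator sums below correct in degrees too small to be
  lowered.\<close>

lemma local_vanishing:
  "local_weight y 0 / y 0 + local_weight y 1 / y 1 + local_weight y 2 / y 2 = 0"
  "local_weight y 0 / (y 0)^2 + local_weight y 1 / (y 1)^2 + local_weight y 2 / (y 2)^2 = 0"
  "local_weight y 0 + local_weight y 1 + local_weight y 2 = 1"
proof -
  define a b c where "a = y 0 - y 1" and "b = y 0 - y 2" and "c = y 1 - y 2"
  have abc: "a \<noteq> 0" "b \<noteq> 0" "c \<noteq> 0" "y 0 = b + y 2" "y 1 = c + y 2" "a = b - c"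
    using ne by (auto simp: a_def b_def c_def)
  have L: "local_weight y 0 = (y 0)^2 / (a * b)" "local_weight y 1 = - ((y 1)^2 / (a * c))" "local_weight y 2 = (y 2)^2 / (b * c)"
    unfolding local_weights using ne by (simp_all add: a_def b_def c_def divide_simps) (simp_all add: algebra_simps)
  have k: "u / (a * b) - v / (a * c) + w / (b * c) = (u * c - v * b + w * a) / (a * b * c)" for u v w
    using abc(1-3) by (simp add: field_simps)
  have "local_weight y 0 / y 0 + local_weight y 1 / y 1 + local_weight y 2 / y 2 = y 0 / (a * b) - y 1 / (a * c) + y 2 / (b * c)"
    unfolding L using nz by (simp add: power2_eq_square)
  also have "\<dots> = 0 / (a * b * c)" unfolding k
    by (rule arg_cong2[where f="(/)", OF _ refl]) (simp add: abc(4,6) abc(5)[unfolded One_nat_def] algebra_simps)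
  also have "\<dots> = 0" by simp
  finally show "local_weight y 0 / y 0 + local_weight y 1 / y 1 + local_weight y 2 / y 2 = 0" .
  have "local_weight y 0 / (y 0)^2 + local_weight y 1 / (y 1)^2 + local_weight y 2 / (y 2)^2 = 1 / (a * b) - 1 / (a * c) + 1 / (b * c)"
    unfolding L using nz by simp
  also have "\<dots> = 0 / (a * b * c)" unfolding k
    by (rule arg_cong2[where f="(/)", OF _ refl]) (simp add: abc(6))
  also have "\<dots> = 0" by simp
  finally show "local_weight y 0 / (y 0)^2 + local_weight y 1 / (y 1)^2 + local_weight y 2 / (y 2)^2 = 0" .
  have "local_weight y 0 + local_weight y 1 + local_weight y 2 = (y 0)^2 / (a * b) - (y 1)^2 / (a * c) + (y 2)^2 / (b * c)"
    unfolding L by simp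
  also have "\<dots> = (a * b * c) / (a * b * c)" unfolding k
    by (rule arg_cong2[where f="(/)", OF _ refl]) (simp add: abc(4,6) abc(5)[unfolded One_nat_def] algebra_simps power2_eq_square)
  finally show "local_weight y 0 + local_weight y 1 + local_weight y 2 = 1" using abc by simp
qed

lemma two_variable_sum:
  "(\<Sum>t | t \<in> comps n \<and> t 2 = 0. tmono y t) * (y 0 - y 1) = y 0 ^ Suc n - y 1 ^ Suc n"
proof (induction n)
  case 0
  have "{t. t \<in> comps 0 \<and> t 2 = 0} = {\<lambda>_. 0}" by (auto simp: comps_zero)
  then show ?case by (simp add: tmono_def)
next
  case (Suc n)
  have "{t. t \<in> comps (Suc n) \<and> t 1 = 0 \<and> t 2 = 0} = {\<lambda>c. if c = 0 then Suc n else 0}"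
  proof
    show "{t. t \<in> comps (Suc n) \<and> t 1 = 0 \<and> t 2 = 0} \<subseteq> {\<lambda>c. if c = 0 then Suc n else 0}"
    proof
      fix t assume t: "t \<in> {t. t \<in> comps (Suc n) \<and> t 1 = 0 \<and> t 2 = 0}"
      have "t c = (if c = 0 then Suc n else 0)" for c
        using t less_3_cases[of c] by (cases "c < 3") (auto simp: comps_def)
      then show "t \<in> {\<lambda>c. if c = 0 then Suc n else 0}" by auto
    qed
  qed (auto simp: comps_def)
  then have "(\<Sum>t | t \<in> comps (Suc n) \<and> t 1 = 0 \<and> t 2 = 0. tmono y t) = y 0 ^ Suc n"
    by (simp add: tmono_def)
  moreover have "(\<Sum>t | t \<in> comps (Suc n) \<and> t 1 > 0 \<and> t 2 = 0. tmono y t) = y 1 * (\<Sum>t | t \<in> comps n \<and> t 2 = 0. tmono y t)"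
    by (rule comps_raise) auto
  ultimately have "(\<Sum>t | t \<in> comps (Suc n) \<and> t 2 = 0. tmono y t) = y 1 * (\<Sum>t | t \<in> comps n \<and> t 2 = 0. tmono y t) + y 0 ^ Suc n"
    by (subst comps_split[of _ _ _ 1]) simp
  then have "(\<Sum>t | t \<in> comps (Suc n) \<and> t 2 = 0. tmono y t) * (y 0 - y 1) =
     y 1 * ((\<Sum>t | t \<in> comps n \<and> t 2 = 0. tmono y t) * (y 0 - y 1)) + y 0 ^ Suc n * (y 0 - y 1)"
    by (simp add: algebra_simps)
  then show ?case unfolding Suc.IH by (simp add: algebra_simps)
qed

text \<open>Splitting by whether the last variable occurs gives y_2 times degree n plus the
  two-variable sum of degree n + 1; the localized side obeys the same recursion.\<close>

lemma complete_symmetric: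
  "(\<Sum>t\<in>comps n. tmono y t) = local_weight y 0 * y 0 ^ n + local_weight y 1 * y 1 ^ n + local_weight y 2 * y 2 ^ n"
proof (induction n)
  case 0
  show ?case using local_vanishing(3) by (simp add: tmono_def comps_zero)
next
  case (Suc n)
  have 1: "(\<Sum>t\<in>comps (Suc n). tmono y t) = (\<Sum>t | t \<in> comps (Suc n) \<and> t 2 > 0 \<and> True. tmono y t)
     + (\<Sum>t | t \<in> comps (Suc n) \<and> t 2 = 0. tmono y t)"
    using comps_split[of "tmono y" "Suc n" "\<lambda>_. True" 2] by simp
  have 2: "(\<Sum>t | t \<in> comps (Suc n) \<and> t 2 > 0 \<and> True. tmono y t) = y 2 * (\<Sum>t\<in>comps n. tmono y t)"
    by (subst comps_raise[where Q="\<lambda>_. True"]) auto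
  have 3: "(\<Sum>t | t \<in> comps (Suc n) \<and> t 2 = 0. tmono y t) = (y 0 ^ Suc (Suc n) - y 1 ^ Suc (Suc n)) / (y 0 - y 1)"
    using two_variable_sum[of "Suc n"] ne by (simp add: field_simps)
  have e0: "local_weight y 0 * (y 0 - y 2) = (y 0)^2 / (y 0 - y 1)" and e1: "local_weight y 1 * (y 1 - y 2) = - ((y 1)^2 / (y 0 - y 1))"
    unfolding local_weights using ne by (simp_all add: divide_simps) (simp_all add: algebra_simps)
  have "local_weight y 0 * y 0 ^ Suc n + local_weight y 1 * y 1 ^ Suc n + local_weight y 2 * y 2 ^ Suc n
    - y 2 * (local_weight y 0 * y 0 ^ n + local_weight y 1 * y 1 ^ n + local_weight y 2 * y 2 ^ n)
    = (local_weight y 0 * (y 0 - y 2)) * y 0 ^ n + (local_weight y 1 * (y 1 - y 2)) * y 1 ^ n"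
    by (simp add: algebra_simps)
  also have "\<dots> = (y 0 ^ Suc (Suc n) - y 1 ^ Suc (Suc n)) / (y 0 - y 1)"
    unfolding e0 e1 by (simp add: power2_eq_square diff_divide_distrib mult_ac)
  finally show ?case unfolding 1 2 3 Suc.IH by (simp add: algebra_simps)
qed

lemma sum_positive_one:
  assumes p: "p < 3"
  shows "(\<Sum>t | t \<in> comps n \<and> t p > 0. tmono y t) =
     y p * (local_weight y 0 * y 0 ^ n / y 0 + local_weight y 1 * y 1 ^ n / y 1 + local_weight y 2 * y 2 ^ n / y 2)"
proof (cases n)
  case 0
  have e: "{t. t \<in> comps n \<and> t p > 0} = {}" by (auto simp: comps_zero 0)
  show ?thesis unfolding e using 0 local_vanishing(1) by simp
next
  case (Suc k)
  have "(\<Sum>t | t \<in> comps n \<and> t p > 0 \<and> True. tmono y t) = y p * (\<Sum>t | t \<in> comps k \<and> True. tmono y t)"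
    unfolding Suc by (rule comps_raise[OF p]) simp
  then show ?thesis using Suc nz by (simp add: complete_symmetric)
qed

lemma sum_positive_two:
  assumes p: "p < 3" "p' < 3" "p \<noteq> p'"
  shows "(\<Sum>t | t \<in> comps n \<and> t p > 0 \<and> t p' > 0. tmono y t) =
     y p * y p' * (local_weight y 0 * y 0 ^ n / (y 0)^2 + local_weight y 1 * y 1 ^ n / (y 1)^2 + local_weight y 2 * y 2 ^ n / (y 2)^2)"
proof (cases n)
  case 0
  have e: "{t. t \<in> comps n \<and> t p > 0 \<and> t p' > 0} = {}" by (auto simp: comps_zero 0)
  show ?thesis unfolding e using 0 local_vanishing(2) by simp
next
  case (Suc k)
  have "(\<Sum>t | t \<in> comps n \<and> t p > 0 \<and> t p' > 0. tmono y t) = y p * (\<Sum>t | t \<in> comps k \<and> t p' > 0. tmono y t)"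
    unfolding Suc by (rule comps_raise[OF p(1)]) (use p in auto)
  then show ?thesis using Suc nz sum_positive_one[OF p(2)] by (simp add: power2_eq_square mult.assoc)
qed

text \<open>Requiring t p > 0 takes out one factor y p and lowers the degree by one, which
  multiplies the localized term of c by y p / y c. Thus indicators turn into ratios.\<close>

lemma vertex_localization:
  assumes p: "p < 3" "p' < 3" "p \<noteq> p'"
  shows "(\<Sum>t\<in>comps n. tmono y t * (1 - u * (if t p > 0 then 1 else 0)) * (1 - w * (if t p' > 0 then 1 else 0)))
    = (\<Sum>c<3. local_weight y c * y c ^ n * (1 - u * (y p / y c)) * (1 - w * (y p' / y c)))"
proof -
  have ind: "(\<Sum>t\<in>comps n. tmono y t * (if P t then 1 else 0)) = (\<Sum>t | t \<in> comps n \<and> P t. tmono y t)" for P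
    by (simp add: sum.inter_filter[symmetric] if_distrib[where f="\<lambda>x. _ * x"] cong: if_cong)
  have "(\<Sum>t\<in>comps n. tmono y t * (1 - u * (if t p > 0 then 1 else 0)) * (1 - w * (if t p' > 0 then 1 else 0)))
    = (\<Sum>t\<in>comps n. tmono y t - u * (tmono y t * (if t p > 0 then 1 else 0)) - w * (tmono y t * (if t p' > 0 then 1 else 0))
        + u * w * (tmono y t * (if t p > 0 \<and> t p' > 0 then 1 else 0)))"
    by (rule sum.cong) (auto simp: algebra_simps)
  also have "\<dots> = (\<Sum>t\<in>comps n. tmono y t) - u * (\<Sum>t | t \<in> comps n \<and> t p > 0. tmono y t)
     - w * (\<Sum>t | t \<in> comps n \<and> t p' > 0. tmono y t) + u * w * (\<Sum>t | t \<in> comps n \<and> t p > 0 \<and> t p' > 0. tmono y t)"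
    by (simp only: sum.distrib sum_subtractf sum_distrib_left[symmetric] ind)
  also have "\<dots> = (\<Sum>c<3. local_weight y c * y c ^ n * (1 - u * (y p / y c)) * (1 - w * (y p' / y c)))"
    unfolding complete_symmetric sum_positive_one[OF p(1)] sum_positive_one[OF p(2)] sum_positive_two[OF p] lessThan_3
    by (simp add: divide_inverse algebra_simps power2_eq_square)
  finally show ?thesis .
qed

end

section \<open>Cyclic sums over six vertices\<close>

datatype ('t, 'a) vertex = Vertex (vset: "'t set") (vwt: "'t \<Rightarrow> 'a") (vin: "'t \<Rightarrow> 'a") (vout: "'t \<Rightarrow> 'a")

definition hexsum :: "('t0, 'a::comm_ring_1) vertex \<Rightarrow> ('t1, 'a) vertex \<Rightarrow> ('t2, 'a) vertex \<Rightarrow> ('t3, 'a) vertex \<Rightarrow> ('t4, 'a) vertex \<Rightarrow> ('t5, 'a) vertex \<Rightarrow> 'a"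
  where "hexsum V0 V1 V2 V3 V4 V5 =
    (\<Sum>(t0, t1, t2, t3, t4, t5) \<in> vset V0 \<times> vset V1 \<times> vset V2 \<times> vset V3 \<times> vset V4 \<times> vset V5.
       vwt V0 t0 * vwt V1 t1 * vwt V2 t2 * vwt V3 t3 * vwt V4 t4 * vwt V5 t5 *
       (1 - vout V0 t0 * vin V1 t1) * (1 - vout V1 t1 * vin V2 t2) * (1 - vout V2 t2 * vin V3 t3) *
       (1 - vout V3 t3 * vin V4 t4) * (1 - vout V4 t4 * vin V5 t5) * (1 - vout V5 t5 * vin V0 t0))"

text \<open>In a cyclic sum each vertex enters only through affine functions of its two neighbours, so
  vertices with the same such sums may be exchanged one at a time.\<close>
definition vequiv :: "('t, 'a::comm_ring_1) vertex \<Rightarrow> ('s, 'a) vertex \<Rightarrow> bool"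
  where "vequiv V W \<longleftrightarrow> (\<forall>u w. (\<Sum>t\<in>vset V. vwt V t * (1 - u * vin V t) * (1 - w * vout V t)) =
     (\<Sum>t\<in>vset W. vwt W t * (1 - u * vin W t) * (1 - w * vout W t)))"

lemma hexsum_rotate: "hexsum V0 V1 V2 V3 V4 V5 = hexsum V1 V2 V3 V4 V5 V0"
  unfolding hexsum_def
  by (rule sum.reindex_bij_witness[of _ "\<lambda>(t1, t2, t3, t4, t5, t0). (t0, t1, t2, t3, t4, t5)"
        "\<lambda>(t0, t1, t2, t3, t4, t5). (t1, t2, t3, t4, t5, t0)"]) (auto simp: mult_ac)

text \<open>With the other five vertices fixed, the sum over the first has the form compared in
  \<open>vequiv\<close>, its parameters u and w being supplied by the two neighbours.\<close>

lemma hexsum_replace: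
  assumes "vequiv V W" shows "hexsum V V1 V2 V3 V4 V5 = hexsum W V1 V2 V3 V4 V5"
proof -
  define rest where "rest = (\<lambda>(t1, t2, t3, t4, t5).
       vwt V1 t1 * vwt V2 t2 * vwt V3 t3 * vwt V4 t4 * vwt V5 t5 *
       (1 - vout V1 t1 * vin V2 t2) * (1 - vout V2 t2 * vin V3 t3) *
       (1 - vout V3 t3 * vin V4 t4) * (1 - vout V4 t4 * vin V5 t5))"
  have h: "hexsum V V1 V2 V3 V4 V5 = (\<Sum>p \<in> vset V1 \<times> vset V2 \<times> vset V3 \<times> vset V4 \<times> vset V5.
      rest p * (\<Sum>t\<in>vset V. vwt V t * (1 - vout V5 (snd (snd (snd (snd p)))) * vin V t) * (1 - vin V1 (fst p) * vout V t)))"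
    for V :: "('x, 'b) vertex"
  proof -
    have "hexsum V V1 V2 V3 V4 V5 = (\<Sum>t\<in>vset V. \<Sum>p \<in> vset V1 \<times> vset V2 \<times> vset V3 \<times> vset V4 \<times> vset V5.
      rest p * (vwt V t * (1 - vout V5 (snd (snd (snd (snd p)))) * vin V t) * (1 - vin V1 (fst p) * vout V t)))"
      unfolding hexsum_def rest_def
      by (subst sum.cartesian_product[symmetric]) (auto intro!: sum.cong simp: mult_ac)
    then show ?thesis by (subst (asm) sum.swap) (simp add: sum_distrib_left)
  qed
  show ?thesis unfolding h using assms by (simp add: vequiv_def)
qed

lemma hexsum_cong:
  assumes "vequiv V0 W0" "vequiv V1 W1" "vequiv V2 W2" "vequiv V3 W3" "vequiv V4 W4" "vequiv V5 W5"
  shows "hexsum V0 V1 V2 V3 V4 V5 = hexsum W0 W1 W2 W3 W4 W5"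
proof -
  have "hexsum V0 V1 V2 V3 V4 V5 = hexsum V1 V2 V3 V4 V5 W0"
    using hexsum_replace[OF assms(1), of V1 V2 V3 V4 V5] hexsum_rotate by metis
  also have "\<dots> = hexsum V2 V3 V4 V5 W0 W1"
    using hexsum_replace[OF assms(2), of V2 V3 V4 V5 W0] hexsum_rotate by metis
  also have "\<dots> = hexsum V3 V4 V5 W0 W1 W2"
    using hexsum_replace[OF assms(3), of V3 V4 V5 W0 W1] hexsum_rotate by metis
  also have "\<dots> = hexsum V4 V5 W0 W1 W2 W3"
    using hexsum_replace[OF assms(4), of V4 V5 W0 W1 W2] hexsum_rotate by metis
  also have "\<dots> = hexsum V5 W0 W1 W2 W3 W4"
    using hexsum_replace[OF assms(5), of V5 W0 W1 W2 W3] hexsum_rotate by metis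
  also have "\<dots> = hexsum W0 W1 W2 W3 W4 W5"
    using hexsum_replace[OF assms(6), of W0 W1 W2 W3 W4] hexsum_rotate by metis
  finally show ?thesis .
qed

text \<open>The incoming indicator tests the colour rewritten on the edge from v - 1, the outgoing
  one the colour rewritten on the edge to v + 1. So the edge factors in \<open>hexsum\<close> are
  the indicators of standardness.\<close>

definition expo_vertex :: "(nat \<Rightarrow> nat \<Rightarrow> 'a::field) \<Rightarrow> (nat \<Rightarrow> nat) \<Rightarrow> nat \<Rightarrow> (nat \<Rightarrow> nat, 'a) vertex"
  where "expo_vertex y d v = Vertex (comps (d v)) (tmono (y v))
     (\<lambda>t. if t ((v + 2) mod 3) > 0 then 1 else 0) (\<lambda>t. if t (v mod 3) > 0 then 1 else 0)"

definition colour_vertex :: "(nat \<Rightarrow> nat \<Rightarrow> 'a::field) \<Rightarrow> (nat \<Rightarrow> nat) \<Rightarrow> nat \<Rightarrow> (nat, 'a) vertex"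
  where "colour_vertex y d v = Vertex {..<3} (\<lambda>c. local_weight (y v) c * y v c ^ d v)
     (\<lambda>c. y v ((v + 2) mod 3) / y v c) (\<lambda>c. y v (v mod 3) / y v c)"

lemma vertex_equivalence:
  assumes "three_vars (y v)" shows "vequiv (expo_vertex y d v) (colour_vertex y d v)"
proof -
  interpret three_vars "y v" by (rule assms)
  have "(v + 2) mod 3 \<noteq> v mod 3" by presburger
  then show ?thesis
    unfolding vequiv_def expo_vertex_def colour_vertex_def vertex.sel
    by (intro allI vertex_localization) auto
qed

lemma std_sum_hexsum:
  "(\<Sum>E | E \<in> expos d \<and> std_expo E. \<Prod>v<6. \<Prod>c<3. y v c ^ E v c) =
    hexsum (expo_vertex y d 0) (expo_vertex y d 1) (expo_vertex y d 2)
      (expo_vertex y d 3) (expo_vertex y d 4) (expo_vertex y d 5)"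
proof -
  let ?T = "comps (d 0) \<times> comps (d 1) \<times> comps (d 2) \<times> comps (d 3) \<times> comps (d 4) \<times> comps (d 5)"
  define mk :: "_ \<Rightarrow> expo" where "mk = (\<lambda>(t0, t1, t2, t3, t4, t5) v. if v = 0 then t0 else if v = 1 then t1 else if v = 2 then t2
     else if v = 3 then t3 else if v = 4 then t4 else if v = 5 then t5 else (\<lambda>_. 0))"
  define br :: "expo \<Rightarrow> _" where "br = (\<lambda>E. (E 0, E 1, E 2, E 3, E 4, E 5))"
  have bm: "br (mk p) = p" for p by (cases p) (simp add: br_def mk_def)
  have mb: "mk (br E) = E" if "E \<in> expos d" for E
  proof
    fix v
    show "mk (br E) v = E v"
    proof (cases "v < 6")
      case True
      then show ?thesis unfolding less_6_cases by (elim disjE) (simp_all add: mk_def br_def)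
    next
      case False
      then have "E v = (\<lambda>_. 0)" using that by (auto simp: expos_def)
      then show ?thesis using False by (simp add: mk_def br_def)
    qed
  qed
  have bT: "br E \<in> ?T" if "E \<in> expos d" for E
    using that by (auto simp: br_def expos_def comps_def)
  have mT: "mk p \<in> expos d" if "p \<in> ?T" for p
  proof -
    obtain t0 t1 t2 t3 t4 t5 where p: "p = (t0, t1, t2, t3, t4, t5)" by (cases p)
    have "mk p v c = 0" if "v \<ge> 6 \<or> c \<ge> 3" for v c
      using that \<open>p \<in> ?T\<close> unfolding p by (auto simp: mk_def comps_def)
    moreover have "mk p v 0 + mk p v 1 + mk p v 2 = d v" if "v < 6" for v
      using that \<open>p \<in> ?T\<close> unfolding p less_6_cases by (elim disjE) (simp_all add: mk_def comps_def)
    ultimately show ?thesis unfolding expos_def by blast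
  qed
  define W where "W = (\<lambda>E. (\<Prod>v<6. \<Prod>c<3. y v c ^ E v c))"
  have "(\<Sum>E | E \<in> expos d \<and> std_expo E. W E) = (\<Sum>E\<in>expos d. if std_expo E then W E else 0)"
  proof -
    have "expos d = mk ` ?T" using mT bT mb by (metis (no_types, lifting) image_eqI image_subsetI subsetI subset_antisym)
    then have "finite (expos d)" by simp
    then show ?thesis by (simp add: sum.inter_filter[symmetric])
  qed
  also have "\<dots> = hexsum (expo_vertex y d 0) (expo_vertex y d 1) (expo_vertex y d 2)
      (expo_vertex y d 3) (expo_vertex y d 4) (expo_vertex y d 5)"
    unfolding hexsum_def expo_vertex_def vertex.sel
  proof (rule sum.reindex_bij_witness[of _ mk br])
    fix E assume E: "E \<in> expos d"
    have W: "W E = tmono (y 0) (E 0) * tmono (y 1) (E 1) * tmono (y 2) (E 2) * tmono (y 3) (E 3) * tmono (y 4) (E 4) * tmono (y 5) (E 5)"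
      unfolding W_def lessThan_6 lessThan_3 by (simp add: tmono_def mult_ac del: One_nat_def)
    have st: "std_expo E \<longleftrightarrow> (E 0 0 = 0 \<or> E 1 0 = 0) \<and> (E 1 1 = 0 \<or> E 2 1 = 0) \<and> (E 2 2 = 0 \<or> E 3 2 = 0) \<and>
       (E 3 0 = 0 \<or> E 4 0 = 0) \<and> (E 4 1 = 0 \<or> E 5 1 = 0) \<and> (E 5 2 = 0 \<or> E 0 2 = 0)"
    proof
      assume s: "std_expo E"
      show "(E 0 0 = 0 \<or> E 1 0 = 0) \<and> (E 1 1 = 0 \<or> E 2 1 = 0) \<and> (E 2 2 = 0 \<or> E 3 2 = 0) \<and>
       (E 3 0 = 0 \<or> E 4 0 = 0) \<and> (E 4 1 = 0 \<or> E 5 1 = 0) \<and> (E 5 2 = 0 \<or> E 0 2 = 0)"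
        using s[unfolded std_expo_def, rule_format, of 0] s[unfolded std_expo_def, rule_format, of 1]
          s[unfolded std_expo_def, rule_format, of 2] s[unfolded std_expo_def, rule_format, of 3]
          s[unfolded std_expo_def, rule_format, of 4] s[unfolded std_expo_def, rule_format, of 5]
        by (simp add: One_nat_def[symmetric] del: One_nat_def)
    next
      assume s: "(E 0 0 = 0 \<or> E 1 0 = 0) \<and> (E 1 1 = 0 \<or> E 2 1 = 0) \<and> (E 2 2 = 0 \<or> E 3 2 = 0) \<and>
       (E 3 0 = 0 \<or> E 4 0 = 0) \<and> (E 4 1 = 0 \<or> E 5 1 = 0) \<and> (E 5 2 = 0 \<or> E 0 2 = 0)"
      show "std_expo E"
        unfolding std_expo_def
      proof (intro allI impI)
        fix e :: nat assume "e < 6"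
        then show "E e (e mod 3) = 0 \<or> E ((e + 1) mod 6) (e mod 3) = 0"
          using s unfolding less_6_cases by (elim disjE) (simp_all add: One_nat_def[symmetric] del: One_nat_def)
      qed
    qed
    have i: "1 - (if a > 0 then 1 else 0) * (if b > 0 then 1 else 0) = (if a = 0 \<or> b = 0 then 1 else (0::'a))" for a b :: nat by auto
    show "(case br E of (t0, t1, t2, t3, t4, t5) \<Rightarrow>
       tmono (y 0) t0 * tmono (y 1) t1 * tmono (y 2) t2 * tmono (y 3) t3 * tmono (y 4) t4 * tmono (y 5) t5 *
       (1 - (if 0 < t0 (0 mod 3) then 1 else 0) * (if 0 < t1 ((1 + 2) mod 3) then 1 else 0)) *
       (1 - (if 0 < t1 (1 mod 3) then 1 else 0) * (if 0 < t2 ((2 + 2) mod 3) then 1 else 0)) *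
       (1 - (if 0 < t2 (2 mod 3) then 1 else 0) * (if 0 < t3 ((3 + 2) mod 3) then 1 else 0)) *
       (1 - (if 0 < t3 (3 mod 3) then 1 else 0) * (if 0 < t4 ((4 + 2) mod 3) then 1 else 0)) *
       (1 - (if 0 < t4 (4 mod 3) then 1 else 0) * (if 0 < t5 ((5 + 2) mod 3) then 1 else 0)) *
       (1 - (if 0 < t5 (5 mod 3) then 1 else 0) * (if 0 < t0 ((0 + 2) mod 3) then 1 else 0)))
      = (if std_expo E then W E else 0)"
      unfolding br_def prod.case i W st by (simp add: One_nat_def[symmetric] del: One_nat_def)
  qed (use bm mb bT mT in auto)
  finally show ?thesis by (simp add: W_def)
qed

theorem std_sum_localization:
  assumes "\<And>v. v < 6 \<Longrightarrow> three_vars (y v)"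
  shows "(\<Sum>E | E \<in> expos d \<and> std_expo E. \<Prod>v<6. \<Prod>c<3. y v c ^ E v c) =
    hexsum (colour_vertex y d 0) (colour_vertex y d 1) (colour_vertex y d 2)
      (colour_vertex y d 3) (colour_vertex y d 4) (colour_vertex y d 5)"
  unfolding std_sum_hexsum by (intro hexsum_cong vertex_equivalence assms) simp_all

section \<open>Components of the graphs attached to a tabloid\<close>

text \<open>The invariant \<open>\<psi>\<close> is constant on components, and each component
  contains the representative named by its value; so values and components correspond.\<close>

lemma card_components:
  assumes sym: "sym E"
    and const: "\<And>C C'. (C, C') \<in> E \<Longrightarrow> \<psi> C = \<psi> C'"
    and rep: "\<And>C. C \<in> V \<Longrightarrow> (C, r (\<psi> C)) \<in> E\<^sup>*"
  shows "card (V // E\<^sup>*) = card (\<psi> ` V)"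
proof -
  have const': "\<psi> C = \<psi> C'" if "(C, C') \<in> E\<^sup>*" for C C'
    using that by (induction rule: rtrancl_induct) (auto dest: const)
  have symE: "(C', C) \<in> E\<^sup>*" if "(C, C') \<in> E\<^sup>*" for C C'
    using that sym_rtrancl[OF sym] by (auto dest: symD)
  have cls: "E\<^sup>* `` {C} = E\<^sup>* `` {r (\<psi> C)}" if "C \<in> V" for C
    using rep[OF that] symE by (blast intro: rtrancl_trans)
  have "V // E\<^sup>* = (\<lambda>s. E\<^sup>* `` {r s}) ` \<psi> ` V"
    unfolding quotient_def using cls by (auto simp: image_iff)
  moreover have "inj_on (\<lambda>s. E\<^sup>* `` {r s}) (\<psi> ` V)"
  proof (rule inj_onI)
    fix s s' assume s: "s \<in> \<psi> ` V" "s' \<in> \<psi> ` V" and eq: "E\<^sup>* `` {r s} = E\<^sup>* `` {r s'}"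
    have "\<psi> (r t) = t" if "t \<in> \<psi> ` V" for t using that rep const' by force
    moreover have "(r s, r s') \<in> E\<^sup>*" using eq by blast
    ultimately show "s = s'" using const' s by metis
  qed
  ultimately show ?thesis by (simp add: card_image)
qed

lemma shape_comparable:
  assumes "v < 6" "v' < 6"
  shows "shape v \<subset> shape v' \<or> shape v' \<subset> shape v \<longleftrightarrow> v' = (v + 1) mod 6 \<or> v = (v' + 1) mod 6"
proof -
  have p: "shape v \<subset> shape v' \<longleftrightarrow> shape v \<subseteq> shape v' \<and> v \<noteq> v'"
    using inj_shape assms by (auto simp: inj_on_def)
  have p': "shape v' \<subset> shape v \<longleftrightarrow> shape v' \<subseteq> shape v \<and> v \<noteq> v'"
    using inj_shape assms by (auto simp: inj_on_def)
  show ?thesis unfolding p p' using assms unfolding less_6_cases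
    by (elim disjE) (simp_all add: shape_table One_nat_def[symmetric] del: One_nat_def)
qed

lemma shape_less_full: "v < 6 \<Longrightarrow> shape v \<subset> {1,2,3}"
  using shape_in_col_shapes[of v] full_not_shape by (auto simp: col_shapes_def)

text \<open>Comparable shapes are neighbours on the hexagon, so the components of a proper subset
  are arcs, and an arc has exactly one last vertex. The class invariant \<open>\<rho>\<close>
  follows the arc to that vertex.\<close>

lemma arc_components:
  assumes W: "W \<subseteq> {..<6}" "W \<noteq> {..<6}"
  shows "card (shape ` W // {(C, C'). C \<in> shape ` W \<and> C' \<in> shape ` W \<and> (C \<subset> C' \<or> C' \<subset> C)}\<^sup>*)
    = card {v\<in>W. (v + 1) mod 6 \<notin> W}"
proof -
  let ?E = "{(C, C'). C \<in> shape ` W \<and> C' \<in> shape ` W \<and> (C \<subset> C' \<or> C' \<subset> C)}"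
  define L where "L v = (LEAST k. (v + k + 1) mod 6 \<notin> W)" for v
  define \<rho> where "\<rho> v = (v + L v) mod 6" for v
  define pos where "pos = the_inv_into {..<6} shape"
  have pos: "pos (shape v) = v" if "v \<in> W" for v
    unfolding pos_def using W that by (intro the_inv_into_f_f[OF inj_shape]) auto
  have gap: "\<exists>k. (v + k + 1) mod 6 \<notin> W" for v
  proof -
    obtain u where u: "u < 6" "u \<notin> W" using W by auto
    \<comment> \<open>The witness is u - v - 1 modulo 6, with a multiple of 6 added so that the
      subtraction is not truncated.\<close>
    have "(v + (6 * v + 5 + u - v) + 1) mod 6 = (u + 6 * (v + 1)) mod 6"
      by (rule arg_cong[where f="\<lambda>k. k mod 6"]) simp
    then show ?thesis using u by (intro exI[of _ "6 * v + 5 + u - v"]) simp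
  qed
  have L: "(v + L v + 1) mod 6 \<notin> W" for v
    unfolding L_def by (rule LeastI_ex[OF gap])
  have before: "(v + k + 1) mod 6 \<in> W" if "k < L v" for k v
    using not_less_Least that unfolding L_def by blast
  have in_W: "(v + k) mod 6 \<in> W" if "v \<in> W" "k \<le> L v" for v k
    using that W before[of "k - 1" v] by (cases k) auto
  have step: "\<rho> v = \<rho> ((v + 1) mod 6)" if "(v + 1) mod 6 \<in> W" for v
  proof -
    have "L v = Suc (LEAST k. (v + Suc k + 1) mod 6 \<notin> W)"
      unfolding L_def using L[of v] that by (intro Least_Suc[of _ "L v"]) auto
    also have "(LEAST k. (v + Suc k + 1) mod 6 \<notin> W) = L ((v + 1) mod 6)"
    proof -
      have "((v + 1) mod 6 + k + 1) mod 6 = (v + Suc k + 1) mod 6" for k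
        using mod_add_left_eq[of "v + 1" 6 "k + 1"] by (simp only: add.assoc add_Suc_right add_Suc Suc_eq_plus1 add.commute add.left_commute)
      then show ?thesis unfolding L_def by simp
    qed
    finally show ?thesis unfolding \<rho>_def by (simp add: mod_simps)
  qed
  have "card (shape ` W // ?E\<^sup>*) = card ((\<rho> \<circ> pos) ` (shape ` W))"
  proof (rule card_components[where r=shape])
    show "sym ?E" by (auto simp: sym_def)
  next
    fix C C' assume "(C, C') \<in> ?E"
    then obtain v v' where v: "v \<in> W" "v' \<in> W" "C = shape v" "C' = shape v'" "C \<subset> C' \<or> C' \<subset> C" by auto
    then have "v' = (v + 1) mod 6 \<or> v = (v' + 1) mod 6"
      using shape_comparable[of v v'] W by auto
    then show "(\<rho> \<circ> pos) C = (\<rho> \<circ> pos) C'" using v step by (auto simp: pos)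
  next
    fix C assume "C \<in> shape ` W"
    then obtain v where v: "v \<in> W" "C = shape v" by auto
    have "(shape v, shape ((v + k) mod 6)) \<in> ?E\<^sup>*" if "k \<le> L v" for k
      using that
    proof (induction k)
      case 0
      then show ?case using v W by auto
    next
      case (Suc k)
      have s: "(v + Suc k) mod 6 = ((v + k) mod 6 + 1) mod 6" by (simp add: mod_simps)
      have "shape ((v + k) mod 6) \<subset> shape ((v + Suc k) mod 6) \<or> shape ((v + Suc k) mod 6) \<subset> shape ((v + k) mod 6)"
        using shape_comparable[of "(v + k) mod 6" "(v + Suc k) mod 6"] s by simp
      moreover have "shape ((v + k) mod 6) \<in> shape ` W" "shape ((v + Suc k) mod 6) \<in> shape ` W"
        using Suc.prems by (intro imageI in_W[OF v(1)]; simp)+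
      ultimately have "(shape ((v + k) mod 6), shape ((v + Suc k) mod 6)) \<in> ?E"
        unfolding mem_Collect_eq case_prod_conv by blast
      then show ?case using Suc by (meson Suc_leD rtrancl.rtrancl_into_rtrancl)
    qed
    then show "(C, shape ((\<rho> \<circ> pos) C)) \<in> ?E\<^sup>*"
      unfolding v(2) by (simp add: pos v(1) \<rho>_def)
  qed
  also have "(\<rho> \<circ> pos) ` (shape ` W) = {v\<in>W. (v + 1) mod 6 \<notin> W}"
  proof (intro equalityI subsetI)
    fix u assume "u \<in> (\<rho> \<circ> pos) ` (shape ` W)"
    then obtain v where v: "v \<in> W" "u = \<rho> v" by (auto simp: pos)
    then show "u \<in> {v\<in>W. (v + 1) mod 6 \<notin> W}"
      using in_W[OF v(1), of "L v"] L[of v] by (simp add: \<rho>_def mod_simps)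
  next
    fix v assume v: "v \<in> {v\<in>W. (v + 1) mod 6 \<notin> W}"
    then have "L v = 0" unfolding L_def by (intro Least_equality) auto
    then have "v = (\<rho> \<circ> pos) (shape v)" using v W by (auto simp: \<rho>_def pos)
    then show "v \<in> (\<rho> \<circ> pos) ` (shape ` W)" using v by blast
  qed
  finally show ?thesis .
qed

definition supp :: "(nat set \<Rightarrow> nat set) \<Rightarrow> nat \<Rightarrow> nat \<Rightarrow> nat set"
  where "supp \<tau> a b = {v. v < 6 \<and> a \<in> \<tau> (shape v) \<and> b \<notin> \<tau> (shape v)}"

lemma supp_subset: "supp \<tau> a b \<subseteq> {..<6}" and finite_supp [simp]: "finite (supp \<tau> a b)"
  by (auto simp: supp_def)

text \<open>The arcs of the support are counted by their right ends: this is the number of vertices minus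
  the number of edges, also when the support is the whole hexagon and the count is \<open>0\<close>.\<close>
definition euler :: "(nat set \<Rightarrow> nat set) \<Rightarrow> nat \<Rightarrow> nat \<Rightarrow> nat"
  where "euler \<tau> a b = card {v\<in>supp \<tau> a b. (v + 1) mod 6 \<notin> supp \<tau> a b}"

lemma card_supp: "card (supp \<tau> a b) = card {v\<in>supp \<tau> a b. (v + 1) mod 6 \<in> supp \<tau> a b} + euler \<tau> a b"
proof -
  have "card (supp \<tau> a b) = card ({v\<in>supp \<tau> a b. (v + 1) mod 6 \<in> supp \<tau> a b} \<union> {v\<in>supp \<tau> a b. (v + 1) mod 6 \<notin> supp \<tau> a b})"
    by (rule arg_cong[where f=card]) auto
  also have "\<dots> = card {v\<in>supp \<tau> a b. (v + 1) mod 6 \<in> supp \<tau> a b} + card {v\<in>supp \<tau> a b. (v + 1) mod 6 \<notin> supp \<tau> a b}"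
    by (rule card_Un_disjoint) auto
  finally show ?thesis unfolding euler_def .
qed

context
  fixes n :: nat and \<tau> :: "nat set \<Rightarrow> nat set"
  assumes \<tau>: "\<tau> \<in> std_tabloids n"
begin

lemma tab_mono: "C \<in> col_shapes \<Longrightarrow> C' \<in> col_shapes \<Longrightarrow> C \<subset> C' \<Longrightarrow> \<tau> C \<subset> \<tau> C'"
  using \<tau> by (simp add: std_tabloids_def)

lemma tab_card: "C \<in> col_shapes \<Longrightarrow> card (\<tau> C) = card C"
  and tab_bound: "C \<in> col_shapes \<Longrightarrow> \<tau> C \<subseteq> {1..n}"
  using \<tau> by (auto simp: std_tabloids_def)

lemma tab_top: "C \<in> col_shapes \<Longrightarrow> \<tau> C \<subseteq> \<tau> {1,2,3}"
  using tab_mono[of C "{1,2,3}"] full_in_col_shapes shape_less_full by (auto simp: col_shapes_eq)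

text \<open>As b lies in the top set, the full shape is not a vertex, and the graph is a subgraph of
  the hexagon.\<close>

lemma d_ab_inside:
  assumes b: "b \<in> \<tau> {1,2,3}" and W: "supp \<tau> a b \<noteq> {..<6}"
  shows "d_ab \<tau> a b = euler \<tau> a b"
proof -
  have V: "{C\<in>col_shapes. a \<in> \<tau> C \<and> b \<notin> \<tau> C} = shape ` supp \<tau> a b"
    using b by (auto simp: col_shapes_eq supp_def)
  show ?thesis unfolding d_ab_def Let_def V euler_def by (rule arc_components[OF supp_subset W])
qed

text \<open>Here the full shape is a vertex and comparable to all the others, so the graph is
  connected.\<close>

lemma d_ab_boundary:
  assumes a: "a \<in> \<tau> {1,2,3}" and b: "b \<notin> \<tau> {1,2,3}"
  shows "d_ab \<tau> a b = 1"
proof -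
  let ?V = "{C\<in>col_shapes. a \<in> \<tau> C \<and> b \<notin> \<tau> C}"
  have top: "{1,2,3} \<in> ?V" using a b full_in_col_shapes by blast
  have "d_ab \<tau> a b = card ((\<lambda>_. ()) ` ?V)"
    unfolding d_ab_def Let_def
  proof (rule card_components[where r="\<lambda>_. {1,2,3}"])
    fix C assume C: "C \<in> ?V"
    show "(C, {1,2,3}) \<in> {(C, C'). C \<in> ?V \<and> C' \<in> ?V \<and> (C \<subset> C' \<or> C' \<subset> C)}\<^sup>*"
    proof (cases "C = {1,2,3}")
      case False
      then have "C \<subset> {1,2,3}" using C by (auto simp: col_shapes_def)
      then show ?thesis using C top by (intro r_into_rtrancl) blast
    qed blast
  qed (auto simp: sym_def)
  also have "(\<lambda>_. ()) ` ?V = {()}" using top by blast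
  finally show ?thesis by simp
qed

lemma d_ab_outside:
  assumes "a \<notin> \<tau> {1,2,3}" shows "d_ab \<tau> a b = 0"
proof -
  have V: "{C\<in>col_shapes. a \<in> \<tau> C \<and> b \<notin> \<tau> C} = {}" using assms tab_top by blast
  show ?thesis unfolding d_ab_def Let_def V by (simp add: quotient_def)
qed

end

section \<open>Matching the localized sum with tabloids\<close>

lemma hexsum_colour_functions:
  "hexsum (colour_vertex y d 0) (colour_vertex y d 1) (colour_vertex y d 2)
      (colour_vertex y d 3) (colour_vertex y d 4) (colour_vertex y d 5) =
   (\<Sum>c \<in> Pi\<^sub>E {..<6::nat} (\<lambda>_. {..<3}). \<Prod>v<6. local_weight (y v) (c v) * y v (c v) ^ d v *
      (1 - vout (colour_vertex y d v) (c v) * vin (colour_vertex y d ((v + 1) mod 6)) (c ((v + 1) mod 6))))"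
proof -
  define mk :: "nat \<times> nat \<times> nat \<times> nat \<times> nat \<times> nat \<Rightarrow> nat \<Rightarrow> nat"
    where "mk = (\<lambda>(t0, t1, t2, t3, t4, t5). restrict ((!) [t0, t1, t2, t3, t4, t5]) {..<6})"
  define br where "br = (\<lambda>c :: nat \<Rightarrow> nat. (c 0, c 1, c 2, c 3, c 4, c 5))"
  have bm: "br (mk p) = p" for p by (cases p) (simp add: br_def mk_def)
  have mb: "mk (br c) = c" if "c \<in> Pi\<^sub>E {..<6} (\<lambda>_. {..<3})" for c :: "nat \<Rightarrow> nat"
  proof
    fix v
    show "mk (br c) v = c v"
    proof (cases "v < 6")
      case True
      then show ?thesis unfolding less_6_cases by (elim disjE) (simp_all add: mk_def br_def)
    next
      case False
      then show ?thesis using that by (auto simp: mk_def br_def PiE_def extensional_def)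
    qed
  qed
  have mT: "mk p \<in> Pi\<^sub>E {..<6} (\<lambda>_. {..<3})"
    if "p \<in> {..<3} \<times> {..<3} \<times> {..<3} \<times> {..<3} \<times> {..<3} \<times> {..<3}" for p
  proof -
    obtain t0 t1 t2 t3 t4 t5 where p: "p = (t0, t1, t2, t3, t4, t5)" by (cases p)
    have "mk p v \<in> {..<3}" if "v < 6" for v
      using that \<open>p \<in> _\<close> unfolding p less_6_cases by (elim disjE) (simp_all add: mk_def)
    then show ?thesis by (auto simp: mk_def p)
  qed
  show ?thesis
    unfolding hexsum_def
  proof (rule sum.reindex_bij_witness[of _ br mk])
    fix p assume "p \<in> vset (colour_vertex y d 0) \<times> vset (colour_vertex y d 1) \<times> vset (colour_vertex y d 2) \<times>
      vset (colour_vertex y d 3) \<times> vset (colour_vertex y d 4) \<times> vset (colour_vertex y d 5)"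
    then have p: "p \<in> {..<3} \<times> {..<3} \<times> {..<3} \<times> {..<3} \<times> {..<3} \<times> {..<3}"
      by (simp add: colour_vertex_def)
    show "br (mk p) = p" by (rule bm)
    show "mk p \<in> Pi\<^sub>E {..<6} (\<lambda>_. {..<3})" by (rule mT[OF p])
    obtain t0 t1 t2 t3 t4 t5 where t: "p = (t0, t1, t2, t3, t4, t5)" by (cases p)
    have k: "mk p 0 = t0" "mk p 1 = t1" "mk p 2 = t2" "mk p 3 = t3" "mk p 4 = t4" "mk p 5 = t5"
      by (simp_all add: mk_def t)
    have w: "local_weight (y v) c * y v c ^ d v = vwt (colour_vertex y d v) c" for v :: nat and c :: nat
      by (simp add: colour_vertex_def)
    have p6: "(\<Prod>v<6. f v) = f 0 * f 1 * f 2 * f 3 * f 4 * f 5" for f :: "nat \<Rightarrow> 'a"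
      unfolding lessThan_6 by (simp add: mult.assoc)
    have s: "(0 + 1) mod 6 = (1::nat)" "(1 + 1) mod 6 = (2::nat)" "(2 + 1) mod 6 = (3::nat)" "(3 + 1) mod 6 = (4::nat)"
      "(4 + 1) mod 6 = (5::nat)" "(5 + 1) mod 6 = (0::nat)" by simp_all
    show "(\<Prod>v<6. local_weight (y v) (mk p v) * y v (mk p v) ^ d v *
      (1 - vout (colour_vertex y d v) (mk p v) * vin (colour_vertex y d ((v + 1) mod 6)) (mk p ((v + 1) mod 6)))) =
      (case p of (t0, t1, t2, t3, t4, t5) \<Rightarrow>
       vwt (colour_vertex y d 0) t0 * vwt (colour_vertex y d 1) t1 * vwt (colour_vertex y d 2) t2 *
       vwt (colour_vertex y d 3) t3 * vwt (colour_vertex y d 4) t4 * vwt (colour_vertex y d 5) t5 *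
       (1 - vout (colour_vertex y d 0) t0 * vin (colour_vertex y d 1) t1) *
       (1 - vout (colour_vertex y d 1) t1 * vin (colour_vertex y d 2) t2) *
       (1 - vout (colour_vertex y d 2) t2 * vin (colour_vertex y d 3) t3) *
       (1 - vout (colour_vertex y d 3) t3 * vin (colour_vertex y d 4) t4) *
       (1 - vout (colour_vertex y d 4) t4 * vin (colour_vertex y d 5) t5) *
       (1 - vout (colour_vertex y d 5) t5 * vin (colour_vertex y d 0) t0))"
      unfolding w p6 s k unfolding t prod.case by (simp only: mult_ac)
  next
    fix c assume c: "c \<in> Pi\<^sub>E {..<6::nat} (\<lambda>_. {..<3::nat})"
    show "mk (br c) = c" by (rule mb[OF c])
    have "c v \<in> {..<3}" if "v < 6" for v using c that by auto
    then show "br c \<in> vset (colour_vertex y d 0) \<times> vset (colour_vertex y d 1) \<times> vset (colour_vertex y d 2) \<times>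
      vset (colour_vertex y d 3) \<times> vset (colour_vertex y d 4) \<times> vset (colour_vertex y d 5)"
      by (simp add: br_def colour_vertex_def)
  qed
qed

definition gap :: "(nat \<Rightarrow> 'a::field) \<Rightarrow> nat \<Rightarrow> nat \<Rightarrow> 'a"
  where "gap x a b = 1 - x b / x a"

lemma prod_pairs_fibres:
  fixes f :: "nat \<Rightarrow> nat \<Rightarrow> 'a::comm_monoid_mult" and A B :: "nat \<Rightarrow> nat set"
  assumes K: "finite K" and AB: "\<And>v. v < N \<Longrightarrow> A v \<subseteq> K" "\<And>v. v < N \<Longrightarrow> B v \<subseteq> K" "\<And>v. v < N \<Longrightarrow> A v \<inter> B v = {}"
  shows "(\<Prod>v<N. \<Prod>a\<in>A v. \<Prod>b\<in>B v. f a b) = (\<Prod>a\<in>K. \<Prod>b\<in>K - {a}. f a b ^ card {v. v < N \<and> a \<in> A v \<and> b \<in> B v})"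
proof -
  have "(\<Prod>v<N. \<Prod>a\<in>A v. \<Prod>b\<in>B v. f a b) = (\<Prod>v<N. \<Prod>a\<in>K. \<Prod>b\<in>K - {a}. if a \<in> A v \<and> b \<in> B v then f a b else 1)"
  proof (rule prod.cong[OF refl])
    fix v assume "v \<in> {..<N}"
    then have v: "A v \<subseteq> K" "B v \<subseteq> K" "A v \<inter> B v = {}" using AB by auto
    have "(\<Prod>a\<in>K. \<Prod>b\<in>K - {a}. if a \<in> A v \<and> b \<in> B v then f a b else 1) = (\<Prod>a\<in>A v. \<Prod>b\<in>K - {a}. if a \<in> A v \<and> b \<in> B v then f a b else 1)"
      by (rule prod.mono_neutral_right) (use v K in auto)
    also have "\<dots> = (\<Prod>a\<in>A v. \<Prod>b\<in>B v. f a b)"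
    proof (rule prod.cong[OF refl])
      fix a assume a: "a \<in> A v"
      have "(\<Prod>b\<in>K - {a}. if a \<in> A v \<and> b \<in> B v then f a b else 1) = (\<Prod>b\<in>B v. if a \<in> A v \<and> b \<in> B v then f a b else 1)"
        by (rule prod.mono_neutral_right) (use v K a in auto)
      then show "(\<Prod>b\<in>K - {a}. if a \<in> A v \<and> b \<in> B v then f a b else 1) = (\<Prod>b\<in>B v. f a b)"
        using a by simp
    qed
    finally show "(\<Prod>a\<in>A v. \<Prod>b\<in>B v. f a b) = (\<Prod>a\<in>K. \<Prod>b\<in>K - {a}. if a \<in> A v \<and> b \<in> B v then f a b else 1)" by simp
  qed
  also have "\<dots> = (\<Prod>a\<in>K. \<Prod>b\<in>K - {a}. \<Prod>v<N. if a \<in> A v \<and> b \<in> B v then f a b else 1)"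
    by (simp only: prod.swap[of _ "{..<N}"])
  also have "\<dots> = (\<Prod>a\<in>K. \<Prod>b\<in>K - {a}. f a b ^ card {v. v < N \<and> a \<in> A v \<and> b \<in> B v})"
    by (simp add: prod.inter_filter[symmetric])
  finally show ?thesis .
qed

text \<open>On the left the exponent of f a b counts the vertices of \<open>supp \<tau> a b\<close>;
  on the right the first product accounts for its edges and the second for the difference.\<close>

lemma prod_euler:
  fixes f :: "nat \<Rightarrow> nat \<Rightarrow> 'a::comm_monoid_mult"
  assumes \<tau>: "\<tau> \<in> std_tabloids n" and K: "\<tau> {1,2,3} = K"
  shows "(\<Prod>v<6. \<Prod>a\<in>\<tau> (shape v). \<Prod>b\<in>K - \<tau> (shape v). f a b) =
    (\<Prod>v<6. \<Prod>a\<in>\<tau> (shape v) \<inter> \<tau> (shape ((v + 1) mod 6)). \<Prod>b\<in>K - (\<tau> (shape v) \<union> \<tau> (shape ((v + 1) mod 6))). f a b) *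
    (\<Prod>a\<in>K. \<Prod>b\<in>K - {a}. f a b ^ euler \<tau> a b)"
proof -
  have K1: "finite K" using tab_bound[OF \<tau> full_in_col_shapes] K finite_subset by blast
  have sub: "\<tau> (shape v) \<subseteq> K" if "v < 6" for v
    using tab_top[OF \<tau> shape_in_col_shapes[OF that]] K by simp
  have 1: "(\<Prod>v<6. \<Prod>a\<in>\<tau> (shape v). \<Prod>b\<in>K - \<tau> (shape v). f a b) =
     (\<Prod>a\<in>K. \<Prod>b\<in>K - {a}. f a b ^ card {v. v < 6 \<and> a \<in> \<tau> (shape v) \<and> b \<in> K - \<tau> (shape v)})"
    by (rule prod_pairs_fibres[OF K1]) (use sub in auto)
  have 2: "(\<Prod>v<6. \<Prod>a\<in>\<tau> (shape v) \<inter> \<tau> (shape ((v + 1) mod 6)). \<Prod>b\<in>K - (\<tau> (shape v) \<union> \<tau> (shape ((v + 1) mod 6))). f a b) =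
     (\<Prod>a\<in>K. \<Prod>b\<in>K - {a}. f a b ^ card {v. v < 6 \<and> a \<in> \<tau> (shape v) \<inter> \<tau> (shape ((v + 1) mod 6)) \<and> b \<in> K - (\<tau> (shape v) \<union> \<tau> (shape ((v + 1) mod 6)))})"
    by (rule prod_pairs_fibres[OF K1]) (use sub in auto)
  have 3: "{v. v < 6 \<and> a \<in> \<tau> (shape v) \<and> b \<in> K - \<tau> (shape v)} = supp \<tau> a b" if "b \<in> K" for a b
    using that by (auto simp: supp_def)
  have 4: "{v. v < 6 \<and> a \<in> \<tau> (shape v) \<inter> \<tau> (shape ((v + 1) mod 6)) \<and> b \<in> K - (\<tau> (shape v) \<union> \<tau> (shape ((v + 1) mod 6)))}
     = {v\<in>supp \<tau> a b. (v + 1) mod 6 \<in> supp \<tau> a b}" if "b \<in> K" for a b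
    using that by (auto simp: supp_def)
  show ?thesis
    unfolding 1 2 prod.distrib[symmetric] power_add[symmetric]
  proof (intro prod.cong refl arg_cong2[where f="(^)"])
    fix a b assume "b \<in> K - {a}"
    then show "card {v. v < 6 \<and> a \<in> \<tau> (shape v) \<and> b \<in> K - \<tau> (shape v)} =
      card {v. v < 6 \<and> a \<in> \<tau> (shape v) \<inter> \<tau> (shape ((v + 1) mod 6)) \<and>
        b \<in> K - (\<tau> (shape v) \<union> \<tau> (shape ((v + 1) mod 6)))} + euler \<tau> a b"
      using 3[of b a] 4[of b a] card_supp[of \<tau> a b] by (simp only: Diff_iff simp_thms)
  qed
qed

text \<open>At each vertex there are two pairs with a inside and b outside, along each edge one
  common pair; so the sum is 12 - 6.\<close>

lemma sum_euler:
  assumes \<tau>: "\<tau> \<in> std_tabloids n" and K: "\<tau> {1,2,3} = K"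
  shows "(\<Sum>a\<in>K. \<Sum>b\<in>K - {a}. euler \<tau> a b) = 6"
proof -
  have K1: "finite K" using tab_bound[OF \<tau> full_in_col_shapes] K finite_subset by blast
  have cK: "card K = 3" using tab_card[OF \<tau> full_in_col_shapes] K by simp
  have sub: "\<tau> (shape v) \<subseteq> K" if "v < 6" for v
    using tab_top[OF \<tau> shape_in_col_shapes[OF that]] K by simp
  have ct: "card (\<tau> (shape v)) = (if even v then 1 else 2)" if "v < 6" for v
    using tab_card[OF \<tau> shape_in_col_shapes[OF that]] card_shape[OF that] by simp
  have f: "finite (\<tau> (shape v))" if "v < 6" for v using sub[OF that] K1 finite_subset by blast
  have cv: "card (\<tau> (shape v)) * card (K - \<tau> (shape v)) = 2" if "v < 6" for v
    using card_Diff_subset[OF f[OF that] sub[OF that]] ct[OF that] cK by (cases "even v") simp_all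
  have ce: "card (\<tau> (shape v) \<inter> \<tau> (shape ((v + 1) mod 6))) * card (K - (\<tau> (shape v) \<union> \<tau> (shape ((v + 1) mod 6)))) = 1" if "v < 6" for v
  proof -
    let ?w = "(v + 1) mod 6"
    have w: "?w < 6" "even ?w \<longleftrightarrow> odd v" by (simp, presburger)
    have "shape v \<subset> shape ?w \<or> shape ?w \<subset> shape v" using shape_comparable[OF that w(1)] by blast
    then have "\<tau> (shape v) \<subset> \<tau> (shape ?w) \<or> \<tau> (shape ?w) \<subset> \<tau> (shape v)"
      using tab_mono[OF \<tau> shape_in_col_shapes[OF that] shape_in_col_shapes[OF w(1)]]
        tab_mono[OF \<tau> shape_in_col_shapes[OF w(1)] shape_in_col_shapes[OF that]] by (elim disjE) simp_all
    then show ?thesis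
    proof
      assume s: "\<tau> (shape v) \<subset> \<tau> (shape ?w)"
      then have "\<tau> (shape v) \<inter> \<tau> (shape ?w) = \<tau> (shape v)" "\<tau> (shape v) \<union> \<tau> (shape ?w) = \<tau> (shape ?w)" by auto
      moreover have "card (\<tau> (shape v)) < card (\<tau> (shape ?w))" using s f w psubset_card_mono by blast
      ultimately show ?thesis
        using card_Diff_subset[OF f[OF w(1)] sub[OF w(1)]] ct[OF that] ct[OF w(1)] cK by (auto split: if_splits)
    next
      assume s: "\<tau> (shape ?w) \<subset> \<tau> (shape v)"
      then have "\<tau> (shape v) \<inter> \<tau> (shape ?w) = \<tau> (shape ?w)" "\<tau> (shape v) \<union> \<tau> (shape ?w) = \<tau> (shape v)" by auto
      moreover have "card (\<tau> (shape ?w)) < card (\<tau> (shape v))" using s f that psubset_card_mono by blast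
      ultimately show ?thesis
        using card_Diff_subset[OF f[OF that] sub[OF that]] ct[OF that] ct[OF w(1)] cK by (auto split: if_splits)
    qed
  qed
  \<comment> \<open>Evaluating the product identity at the constant 2 turns it into an identity of
    exponents.\<close>
  have "(2::nat) ^ 12 = 2 ^ 6 * 2 ^ (\<Sum>a\<in>K. \<Sum>b\<in>K - {a}. euler \<tau> a b)"
    using prod_euler[OF \<tau> K, of "\<lambda>_ _. 2::nat"] cv ce
    by (simp add: power_mult[symmetric] power_sum[symmetric] mult.commute cong: prod.cong)
  then have "(2::nat) ^ 12 = 2 ^ (6 + (\<Sum>a\<in>K. \<Sum>b\<in>K - {a}. euler \<tau> a b))" by (simp only: power_add)
  then show ?thesis by (subst (asm) power_inject_exp) simp_all
qed

lemma col_shape_cases: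
  assumes "C \<in> col_shapes"
  obtains "C = {1,2,3}" | v where "v < 6" "C = shape v"
proof -
  have "C = {1,2,3} \<or> C \<in> shape ` {..<6}" using assms unfolding col_shapes_eq by (rule insertE) (rule disjI1, assumption, rule disjI2, assumption)
  then show thesis using that by (elim disjE imageE) auto
qed

lemma shape_less_parity:
  assumes "v < 6" "v' < 6" "shape v \<subset> shape v'" shows "even v" "odd v'"
proof -
  have "finite (shape v')" using shape_less_full[OF assms(2)] finite_subset by blast
  then have "card (shape v) < card (shape v')" using assms(3) by (rule psubset_card_mono)
  then show "even v" "odd v'" using card_shape assms by (auto split: if_splits)
qed

section \<open>Colour functions on the hexagon and tabloids with a given top set\<close>

context coloured_diagram
begin

definition face :: "nat \<Rightarrow> nat \<Rightarrow> nat set"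
  where "face v c = (if even v then {kc c} else K - {kc c})"

definition tab_of :: "(nat \<Rightarrow> nat) \<Rightarrow> nat set \<Rightarrow> nat set"
  where "tab_of c C = (if C = {1,2,3} then K else if C \<in> shape ` {..<6}
     then face (the_inv_into {..<6} shape C) (c (the_inv_into {..<6} shape C)) else {})"

definition apex :: "(nat set \<Rightarrow> nat set) \<Rightarrow> nat \<Rightarrow> nat"
  where "apex \<tau> = (\<lambda>v\<in>{..<6}. idx (the_elem (if even v then \<tau> (shape v) else K - \<tau> (shape v))))"

lemma card_K: "card K = 3"
  unfolding K_def by (simp add: card_image[OF kc])

lemma kc_K: "c < 3 \<Longrightarrow> kc c \<in> K"
  by (simp add: K_def)

lemma kc_eq: "c < 3 \<Longrightarrow> c' < 3 \<Longrightarrow> kc c = kc c' \<longleftrightarrow> c = c'"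
  using kc by (auto simp: inj_on_def)

lemma K_minus: "c < 3 \<Longrightarrow> K - {kc c} = kc ` ({..<3} - {c})"
  unfolding K_def using kc by (auto simp: inj_on_def)

lemma tab_of_shape: "v < 6 \<Longrightarrow> tab_of c (shape v) = face v (c v)"
  unfolding tab_of_def using shape_less_full[of v] by (auto simp: the_inv_into_f_f[OF inj_shape])

lemma tab_of_full: "tab_of c {1,2,3} = K"
  by (simp add: tab_of_def)

text \<open>The colour of a line lies in a plane exactly if it differs from the missing colour of
  the plane, so inclusion along an edge is inequality of the two labels.\<close>

lemma tab_of_std:
  assumes c: "\<And>v. v < 6 \<Longrightarrow> c v < 3" and good: "\<And>v. v < 6 \<Longrightarrow> c v \<noteq> c ((v + 1) mod 6)" and Kn: "K \<subseteq> {1..n}"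
  shows "tab_of c \<in> std_tabloids n"
proof -
  have sub: "face v (c v) \<subseteq> K" if "v < 6" for v using kc_K[OF c[OF that]] by (auto simp: face_def)
  have cf: "card (face v (c v)) = (if even v then 1 else 2)" if "v < 6" for v
    using kc_K[OF c[OF that]] card_K by (simp add: face_def)
  have A: "tab_of c C \<subseteq> K \<and> card (tab_of c C) = card C" if "C \<in> col_shapes" for C
  proof -
    show ?thesis
      using that
    proof (cases rule: col_shape_cases)
      case 1
      have "card {1, 2, 3 :: nat} = 3" by simp
      then show ?thesis unfolding 1 tab_of_full card_K by (simp only: subset_refl simp_thms)
    next
      case 2
      then show ?thesis using sub[OF 2(1)] by (simp add: tab_of_shape cf card_shape)
    qed
  qed
  have B: "tab_of c C \<subset> tab_of c C'" if C: "C \<in> col_shapes" "C' \<in> col_shapes" "C \<subset> C'" for C C'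
  proof -
    obtain v where v: "v < 6" "C = shape v" 
    proof (rule col_shape_cases[OF C(1)])
      assume "C = {1,2,3}"
      then have "C' \<subseteq> C" using C(2) by (simp add: col_shapes_def)
      then show thesis using C(3) by blast
    qed
    show ?thesis
    proof (cases "C' = {1,2,3}")
      case True
      then have "card (face v (c v)) < card K" using cf[OF v(1)] card_K by simp
      then show ?thesis using sub[OF v(1)] v True unfolding True tab_of_full by (auto simp: tab_of_shape)
    next
      case False
      then obtain v' where v': "v' < 6" "C' = shape v'" using col_shape_cases[OF C(2)] by metis
      have p: "even v" "odd v'" using shape_less_parity[OF v(1) v'(1)] C(3) v v' by auto
      have "v' = (v + 1) mod 6 \<or> v = (v' + 1) mod 6" using shape_comparable[OF v(1) v'(1)] C(3) v v' by auto
      then have "c v \<noteq> c v'" using good v v' by metis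
      then have "face v (c v) \<subseteq> face v' (c v')"
        using p kc_eq[OF c c] v v' kc_K[OF c] by (simp add: face_def)
      moreover have "card (face v (c v)) < card (face v' (c v'))" using cf v v' p by simp
      ultimately show ?thesis using v v' by (auto simp: tab_of_shape)
    qed
  qed
  have out: "tab_of c C = {}" if "C \<notin> col_shapes" for C
    using that unfolding col_shapes_eq tab_of_def by auto
  show ?thesis
    unfolding std_tabloids_def mem_Collect_eq
  proof (intro conjI ballI impI allI)
    fix C assume "C \<in> col_shapes"
    then show "tab_of c C \<subseteq> {1..n}" "card (tab_of c C) = card C" using A Kn by blast+
  qed (fact B out)+
qed

lemma tab_of_bij:
  assumes Kn: "K \<subseteq> {1..n}"
  shows "bij_betw tab_of {c \<in> Pi\<^sub>E {..<6::nat} (\<lambda>_. {..<3::nat}). \<forall>v<6. c v \<noteq> c ((v + 1) mod 6)} {\<tau> \<in> std_tabloids n. \<tau> {1,2,3} = K}"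
proof (rule bij_betw_byWitness[where f'=apex])
  show "\<forall>c\<in>{c \<in> Pi\<^sub>E {..<6::nat} (\<lambda>_. {..<3::nat}). \<forall>v<6. c v \<noteq> c ((v + 1) mod 6)}. apex (tab_of c) = c"
  proof
    fix c assume "c \<in> {c \<in> Pi\<^sub>E {..<6::nat} (\<lambda>_. {..<3::nat}). \<forall>v<6. c v \<noteq> c ((v + 1) mod 6)}"
    then have c: "c \<in> Pi\<^sub>E {..<6::nat} (\<lambda>_. {..<3::nat})" by simp
    show "apex (tab_of c) = c"
    proof
      fix v
      show "apex (tab_of c) v = c v"
      proof (cases "v < 6")
        case True
        then have "c v < 3" using c by auto
        moreover have "K - (K - {kc (c v)}) = {kc (c v)}" using kc_K[OF \<open>c v < 3\<close>] by auto
        ultimately show ?thesis using True by (simp add: apex_def tab_of_shape face_def)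
      qed (use c in \<open>auto simp: apex_def PiE_def extensional_def\<close>)
    qed
  qed
next
  have P: "apex \<tau> v < 3 \<and> face v (apex \<tau> v) = \<tau> (shape v)" if \<tau>: "\<tau> \<in> std_tabloids n" "\<tau> {1,2,3} = K" and v: "v < 6" for \<tau> v
  proof -
    have ct: "card (\<tau> (shape v)) = (if even v then 1 else 2)"
      using tab_card[OF \<tau>(1) shape_in_col_shapes[OF v]] card_shape[OF v] by simp
    have sub: "\<tau> (shape v) \<subseteq> K" using tab_top[OF \<tau>(1) shape_in_col_shapes[OF v]] \<tau>(2) by simp
    then have "card (if even v then \<tau> (shape v) else K - \<tau> (shape v)) = 1"
      using card_Diff_subset[OF finite_subset[OF sub finite_K] sub] ct card_K by simp
    then obtain k where k: "(if even v then \<tau> (shape v) else K - \<tau> (shape v)) = {k}"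
      by (auto simp: card_1_singleton_iff)
    have kK: "k \<in> K" using k sub by (auto split: if_splits)
    have "apex \<tau> v = idx k" using v k by (simp add: apex_def)
    then show ?thesis using idx_less[OF kK] kc_idx[OF kK] k sub by (auto simp: face_def split: if_splits)
  qed
  show "\<forall>\<tau>\<in>{\<tau> \<in> std_tabloids n. \<tau> {1,2,3} = K}. tab_of (apex \<tau>) = \<tau>"
  proof
    fix \<tau> assume "\<tau> \<in> {\<tau> \<in> std_tabloids n. \<tau> {1,2,3} = K}"
    then have \<tau>: "\<tau> \<in> std_tabloids n" "\<tau> {1,2,3} = K" by auto
    show "tab_of (apex \<tau>) = \<tau>"
    proof
      fix C
      consider "C = {1,2,3}" | v where "v < 6" "C = shape v" | "C \<notin> col_shapes" using col_shape_cases by metis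
      then show "tab_of (apex \<tau>) C = \<tau> C"
      proof cases
        case 1
        then show ?thesis using \<tau>(2) tab_of_full by simp
      next
        case 2
        then show ?thesis using P[OF \<tau>] by (simp add: tab_of_shape)
      next
        case 3
        then have "\<tau> C = {}" using \<tau>(1) by (simp add: std_tabloids_def)
        then show ?thesis using 3 unfolding col_shapes_eq tab_of_def by simp
      qed
    qed
  qed
  show "apex ` {\<tau> \<in> std_tabloids n. \<tau> {1,2,3} = K} \<subseteq> {c \<in> Pi\<^sub>E {..<6::nat} (\<lambda>_. {..<3::nat}). \<forall>v<6. c v \<noteq> c ((v + 1) mod 6)}"
  proof
    fix c assume "c \<in> apex ` {\<tau> \<in> std_tabloids n. \<tau> {1,2,3} = K}"
    then obtain \<tau> where \<tau>: "\<tau> \<in> std_tabloids n" "\<tau> {1,2,3} = K" and c: "c = apex \<tau>" by auto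
    have "c \<in> Pi\<^sub>E {..<6::nat} (\<lambda>_. {..<3::nat})" using P[OF \<tau>] unfolding c by (auto simp: apex_def)
    moreover have "c v \<noteq> c ((v + 1) mod 6)" if v: "v < 6" for v
    proof
      let ?w = "(v + 1) mod 6"
      assume eq: "c v = c ?w"
      have w: "?w < 6" "even ?w \<longleftrightarrow> odd v" by (simp, presburger)
      have "shape v \<subset> shape ?w \<or> shape ?w \<subset> shape v" using shape_comparable[OF v w(1)] by blast
      then have "\<tau> (shape v) \<subset> \<tau> (shape ?w) \<or> \<tau> (shape ?w) \<subset> \<tau> (shape v)"
        using tab_mono[OF \<tau>(1) shape_in_col_shapes[OF v] shape_in_col_shapes[OF w(1)]]
          tab_mono[OF \<tau>(1) shape_in_col_shapes[OF w(1)] shape_in_col_shapes[OF v]] by (elim disjE) simp_all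
      then have "face v (c v) \<subset> face ?w (c v) \<or> face ?w (c v) \<subset> face v (c v)"
        using P[OF \<tau>] v w(1) eq unfolding c by metis
      moreover have "\<not> K \<subseteq> {kc (c v)}" using card_mono[of "{kc (c v)}" K] card_K by auto
      ultimately show False using w(2) kc_K[of "c v"] P[OF \<tau> v] c by (auto simp: face_def split: if_splits)
    qed
    ultimately show "c \<in> {c \<in> Pi\<^sub>E {..<6::nat} (\<lambda>_. {..<3::nat}). \<forall>v<6. c v \<noteq> c ((v + 1) mod 6)}" by blast
  qed
next
  show "tab_of ` {c \<in> Pi\<^sub>E {..<6::nat} (\<lambda>_. {..<3::nat}). \<forall>v<6. c v \<noteq> c ((v + 1) mod 6)} \<subseteq> {\<tau> \<in> std_tabloids n. \<tau> {1,2,3} = K}"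
  proof
    fix \<tau> assume "\<tau> \<in> tab_of ` {c \<in> Pi\<^sub>E {..<6::nat} (\<lambda>_. {..<3::nat}). \<forall>v<6. c v \<noteq> c ((v + 1) mod 6)}"
    then obtain c where c: "c \<in> Pi\<^sub>E {..<6::nat} (\<lambda>_. {..<3::nat})" "\<forall>v<6. c v \<noteq> c ((v + 1) mod 6)" "\<tau> = tab_of c" by auto
    have "c v < 3" if "v < 6" for v using c(1) that by auto
    then show "\<tau> \<in> {\<tau> \<in> std_tabloids n. \<tau> {1,2,3} = K}"
      using tab_of_std[OF _ _ Kn, of c] c tab_of_full by simp
  qed
qed

section \<open>Local factors as products of gaps\<close>

context
  fixes x :: "nat \<Rightarrow> 'a::field"
  assumes x: "\<And>a. a \<in> K \<Longrightarrow> x a \<noteq> 0" and injx: "inj_on x K"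
begin

lemma prod_K: "(\<Prod>a\<in>K. x a) = x (kc 0) * x (kc 1) * x (kc 2)"
  unfolding K_def by (subst prod.reindex[OF kc]) (simp add: lessThan_3 mult_ac)

lemma yvar_odd: "odd v \<Longrightarrow> c < 3 \<Longrightarrow> yvar x v c = (\<Prod>a\<in>K. x a) / x (kc c)"
  using x[OF kc_K, of c] unfolding prod_K yvar_def
  by (auto simp: field_simps less_3_cases One_nat_def[symmetric] simp del: One_nat_def)

lemma yvar_even: "even v \<Longrightarrow> yvar x v c = x (kc c)"
  by (simp add: yvar_def)

lemma prod_K_nz: "(\<Prod>a\<in>K. x a) \<noteq> 0"
  using x by (simp add: finite_K)

lemma yvar_face: "c < 3 \<Longrightarrow> yvar x v c = (\<Prod>a\<in>face v c. x a)"
  using kc_K[of c] x by (cases "even v") (simp_all add: yvar_even yvar_odd face_def prod.remove[OF finite_K, of "kc c"] prod_diff1)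

lemma yvar_nz: "c < 3 \<Longrightarrow> yvar x v c \<noteq> 0"
  using x kc_K prod_K_nz by (cases "even v") (simp_all add: yvar_even yvar_odd)

lemma yvar_inj: "c < 3 \<Longrightarrow> c' < 3 \<Longrightarrow> yvar x v c = yvar x v c' \<longleftrightarrow> c = c'"
  using x[OF kc_K] prod_K_nz kc_eq inj_on_eq_iff[OF injx kc_K kc_K]
  by (cases "even v") (auto simp: yvar_even yvar_odd field_simps)

lemma three_vars_yvar: "three_vars (yvar x v)"
  by unfold_locales (simp_all add: yvar_nz yvar_inj del: One_nat_def)

text \<open>For planes the ratio of two values of \<open>yvar\<close> is inverse to that of the
  missing colours. Hence for both kinds of vertices a runs through the face and b through its
  complement.\<close>

lemma local_weight_face:
  assumes c: "c < 3"
  shows "local_weight (yvar x v) c = 1 / (\<Prod>a\<in>face v c. \<Prod>b\<in>K - face v c. gap x a b)"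
proof (cases "even v")
  case True
  have "(\<Prod>a\<in>face v c. \<Prod>b\<in>K - face v c. gap x a b) = (\<Prod>b\<in>K - {kc c}. gap x (kc c) b)"
    using True by (simp add: face_def)
  also have "\<dots> = (\<Prod>c'\<in>{..<3} - {c}. 1 - yvar x v c' / yvar x v c)"
    unfolding K_minus[OF c] by (subst prod.reindex) (use True kc in \<open>auto simp: gap_def yvar_even intro: inj_on_subset\<close>)
  finally show ?thesis by (simp add: local_weight_def)
next
  case False
  have "K - face v c = {kc c}" using False kc_K[OF c] by (auto simp: face_def)
  then have "(\<Prod>a\<in>face v c. \<Prod>b\<in>K - face v c. gap x a b) = (\<Prod>a\<in>K - {kc c}. gap x a (kc c))"
    using False by (simp add: face_def)
  also have "\<dots> = (\<Prod>c'\<in>{..<3} - {c}. 1 - yvar x v c' / yvar x v c)"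
    unfolding K_minus[OF c]
  proof (subst prod.reindex)
    show "inj_on kc ({..<3} - {c})" using kc by (rule inj_on_subset) auto
    show "prod ((\<lambda>a. gap x a (kc c)) \<circ> kc) ({..<3} - {c}) = (\<Prod>c'\<in>{..<3} - {c}. 1 - yvar x v c' / yvar x v c)"
      using False c prod_K_nz by (intro prod.cong) (auto simp: gap_def yvar_odd)
  qed
  finally show ?thesis by (simp add: local_weight_def)
qed

text \<open>Both ends of an edge test the same colour, and line times plane of one colour is the
  product of all three weights. The tested colour thus drops out, leaving a single gap, or 0 if the
  labels agree.\<close>

lemma edge_factor:
  assumes v: "v < 6" and c: "c < 3" "c' < 3" and w: "w = (v + 1) mod 6"
  shows "1 - vout (colour_vertex (yvar x) d v) c * vin (colour_vertex (yvar x) d w) c' =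
    (if c = c' then 0 else \<Prod>a\<in>face v c \<inter> face w c'. \<Prod>b\<in>K - (face v c \<union> face w c'). gap x a b)"
proof -
  have m: "(w + 2) mod 3 = v mod 3" "v mod 3 < 3"
    using v unfolding w less_6_cases by (elim disjE; simp)+
  have pw: "even w \<longleftrightarrow> odd v" unfolding w by presburger
  have out: "vout (colour_vertex (yvar x) d v) c * vin (colour_vertex (yvar x) d w) c' =
      (yvar x v (v mod 3) * yvar x w (v mod 3)) / (yvar x v c * yvar x w c')"
    unfolding colour_vertex_def vertex.sel m by simp
  have e3: "yvar x v (v mod 3) * yvar x w (v mod 3) = (\<Prod>a\<in>K. x a)"
    using m(2) pw x[OF kc_K[OF m(2)]] by (cases "even v") (simp_all add: yvar_even yvar_odd)
  have xc: "x (kc c) \<noteq> 0" "x (kc c') \<noteq> 0" using x kc_K c by auto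
  show ?thesis
  proof (cases "even v")
    case True
    have r: "1 - vout (colour_vertex (yvar x) d v) c * vin (colour_vertex (yvar x) d w) c' = gap x (kc c) (kc c')"
      unfolding out e3 using True pw c xc prod_K_nz by (simp add: yvar_even yvar_odd gap_def)
    have "face v c \<inter> face w c' = {kc c} \<and> K - (face v c \<union> face w c') = {kc c'}" if "c \<noteq> c'"
      using True pw c that kc_eq[OF c] kc_K by (auto simp: face_def)
    then show ?thesis unfolding r using xc by (auto simp: gap_def)
  next
    case False
    have r: "1 - vout (colour_vertex (yvar x) d v) c * vin (colour_vertex (yvar x) d w) c' = gap x (kc c') (kc c)"
      unfolding out e3 using False pw c xc prod_K_nz by (simp add: yvar_even yvar_odd gap_def)
    have "face v c \<inter> face w c' = {kc c'} \<and> K - (face v c \<union> face w c') = {kc c}" if "c \<noteq> c'"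
      using False pw c that kc_eq[OF c] kc_K by (auto simp: face_def)
    then show ?thesis unfolding r using xc by (auto simp: gap_def)
  qed
qed

text \<open>Colour functions with equal neighbours have a vanishing edge factor, and the others are
  the tabloids with top set \<open>K\<close>. Their edge factors cancel part of the vertex
  denominators, and by \<open>prod_euler\<close> the Euler characteristics remain.\<close>

theorem localized_sum:
  assumes Kn: "K \<subseteq> {1..n}"
  shows "(\<Prod>c<3. x (kc c)) ^ q * (\<Sum>E | E \<in> expos d \<and> std_expo E. \<Prod>v<6. \<Prod>c<3. yvar x v c ^ E v c)
    = (\<Sum>\<tau> | \<tau> \<in> std_tabloids n \<and> \<tau> {1,2,3} = K.
        (\<Prod>C\<in>col_shapes. (\<Prod>a\<in>\<tau> C. x a) ^ m C) / (\<Prod>a\<in>K. \<Prod>b\<in>K - {a}. gap x a b ^ euler \<tau> a b))"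
proof -
  let ?P = "Pi\<^sub>E {..<6::nat} (\<lambda>_. {..<3::nat})"
  let ?Q = "{c \<in> ?P. \<forall>v<6. c v \<noteq> c ((v + 1) mod 6)}"
  define F where "F \<tau> = (\<Prod>C\<in>col_shapes. (\<Prod>a\<in>\<tau> C. x a) ^ m C) / (\<Prod>a\<in>K. \<Prod>b\<in>K - {a}. gap x a b ^ euler \<tau> a b)" for \<tau>
  define T where "T c = (\<Prod>v<6. local_weight (yvar x v) (c v) * yvar x v (c v) ^ d v *
      (1 - vout (colour_vertex (yvar x) d v) (c v) * vin (colour_vertex (yvar x) d ((v + 1) mod 6)) (c ((v + 1) mod 6))))" for c
  have zero: "T c = 0" if c: "c \<in> ?P - ?Q" for c
  proof -
    obtain v where v: "v < 6" "c v = c ((v + 1) mod 6)" using c by auto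
    have "c u < 3" if "u < 6" for u using c that by auto
    then have "1 - vout (colour_vertex (yvar x) d v) (c v) * vin (colour_vertex (yvar x) d ((v + 1) mod 6)) (c ((v + 1) mod 6)) = 0"
      using edge_factor[OF v(1) _ _ refl, of "c v" "c ((v + 1) mod 6)"] v by simp
    then show ?thesis unfolding T_def using v(1) by (subst prod_zero_iff) auto
  qed
  have "(\<Sum>E | E \<in> expos d \<and> std_expo E. \<Prod>v<6. \<Prod>c<3. yvar x v c ^ E v c) = (\<Sum>c\<in>?P. T c)"
    unfolding T_def hexsum_colour_functions[symmetric] by (rule std_sum_localization) (rule three_vars_yvar)
  also have "\<dots> = (\<Sum>c\<in>?Q. T c)"
    by (rule sum.mono_neutral_right) (use zero in \<open>auto intro!: finite_PiE\<close>)
  finally have "(\<Prod>c<3. x (kc c)) ^ q * (\<Sum>E | E \<in> expos d \<and> std_expo E. \<Prod>v<6. \<Prod>c<3. yvar x v c ^ E v c)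
    = (\<Sum>c\<in>?Q. (\<Prod>c<3. x (kc c)) ^ q * T c)" by (simp add: sum_distrib_left)
  also have "\<dots> = (\<Sum>c\<in>?Q. F (tab_of c))"
  proof (rule sum.cong[OF refl])
    fix c assume cQ: "c \<in> ?Q"
    then have c: "c v < 3" if "v < 6" for v using that by auto
    have good: "c v \<noteq> c ((v + 1) mod 6)" if "v < 6" for v using cQ that by auto
    define \<tau> where "\<tau> = tab_of c"
    have \<tau>: "\<tau> \<in> std_tabloids n" "\<tau> {1,2,3} = K"
      unfolding \<tau>_def using tab_of_std[of c n] c good Kn tab_of_full by blast+
    have s: "\<tau> (shape v) = face v (c v)" if "v < 6" for v
      unfolding \<tau>_def using tab_of_shape[OF that] .
    define V where "V = (\<Prod>v<6. \<Prod>a\<in>\<tau> (shape v). \<Prod>b\<in>K - \<tau> (shape v). gap x a b)"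
    define Ed where "Ed = (\<Prod>v<6. \<Prod>a\<in>\<tau> (shape v) \<inter> \<tau> (shape ((v + 1) mod 6)). \<Prod>b\<in>K - (\<tau> (shape v) \<union> \<tau> (shape ((v + 1) mod 6))). gap x a b)"
    define D where "D = (\<Prod>a\<in>K. \<Prod>b\<in>K - {a}. gap x a b ^ euler \<tau> a b)"
    have VED: "V = Ed * D" unfolding V_def Ed_def D_def by (rule prod_euler[OF \<tau>])
    have g: "gap x a b \<noteq> 0" if "a \<in> K" "b \<in> K" "a \<noteq> b" for a b
      using that x[OF that(1)] injx by (auto simp: gap_def inj_on_def)
    have sub: "\<tau> (shape v) \<subseteq> K" if "v < 6" for v
      using tab_top[OF \<tau>(1) shape_in_col_shapes[OF that]] \<tau>(2) by simp
    have nz: "Ed \<noteq> 0"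
      unfolding Ed_def using sub finite_K finite_subset[OF sub finite_K] g by (fastforce simp: prod_zero_iff)
    have "T c = (\<Prod>v<6. (\<Prod>a\<in>\<tau> (shape v). x a) ^ d v) * (Ed / V)"
    proof -
      have "T c = (\<Prod>v<6. (\<Prod>a\<in>\<tau> (shape v). x a) ^ d v *
        ((\<Prod>a\<in>\<tau> (shape v) \<inter> \<tau> (shape ((v + 1) mod 6)). \<Prod>b\<in>K - (\<tau> (shape v) \<union> \<tau> (shape ((v + 1) mod 6))). gap x a b) /
         (\<Prod>a\<in>\<tau> (shape v). \<Prod>b\<in>K - \<tau> (shape v). gap x a b)))"
        unfolding T_def
      proof (rule prod.cong[OF refl])
        fix v assume "v \<in> {..<6::nat}"
        then have v: "v < 6" and w: "(v + 1) mod 6 < 6" by auto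
        show "local_weight (yvar x v) (c v) * yvar x v (c v) ^ d v *
          (1 - vout (colour_vertex (yvar x) d v) (c v) * vin (colour_vertex (yvar x) d ((v + 1) mod 6)) (c ((v + 1) mod 6))) =
          (\<Prod>a\<in>\<tau> (shape v). x a) ^ d v *
        ((\<Prod>a\<in>\<tau> (shape v) \<inter> \<tau> (shape ((v + 1) mod 6)). \<Prod>b\<in>K - (\<tau> (shape v) \<union> \<tau> (shape ((v + 1) mod 6))). gap x a b) /
         (\<Prod>a\<in>\<tau> (shape v). \<Prod>b\<in>K - \<tau> (shape v). gap x a b))"
          unfolding edge_factor[OF v c[OF v] c[OF w] refl] local_weight_face[OF c[OF v]] yvar_face[OF c[OF v]] s[OF v] s[OF w]
          using good[OF v] by simp
      qed
      then show ?thesis by (simp add: prod.distrib prod_dividef V_def Ed_def)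
    qed
    moreover have "Ed / V = 1 / D" unfolding VED using nz by simp
    moreover have "(\<Prod>C\<in>col_shapes. (\<Prod>a\<in>\<tau> C. x a) ^ m C) = (\<Prod>c<3. x (kc c)) ^ q * (\<Prod>v<6. (\<Prod>a\<in>\<tau> (shape v). x a) ^ d v)"
    proof -
      have "(\<Prod>c<3. x (kc c)) = (\<Prod>a\<in>K. x a)" unfolding K_def by (simp add: prod.reindex[OF kc])
      then show ?thesis unfolding prod_col_shapes \<tau>(2) q_def d_def by simp
    qed
    ultimately show "(\<Prod>c<3. x (kc c)) ^ q * T c = F (tab_of c)"
      unfolding F_def \<tau>_def[symmetric] D_def[symmetric] by simp
  qed
  also have "\<dots> = (\<Sum>\<tau>\<in>{\<tau> \<in> std_tabloids n. \<tau> {1,2,3} = K}. F \<tau>)"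
    by (rule sum.reindex_bij_betw[OF tab_of_bij[OF Kn]])
  finally show ?thesis unfolding F_def by simp
qed

end

end

section \<open>The Riemann--Roch numbers as constant coefficients\<close>

text \<open>The weight of colour \<open>a\<close> is specialised to \<open>exp (a U)\<close>.\<close>
definition expX :: "int \<Rightarrow> real fls"
  where "expX r = fps_to_fls (fps_exp (real_of_int r))"

lemma expX_nz: "expX r \<noteq> 0"
  by (simp add: expX_def)

lemma expX_add: "expX (r + s) = expX r * expX s"
  by (simp add: expX_def fps_exp_add_mult fls_times_fps_to_fls)

lemma expX_inj: "expX r = expX s \<longleftrightarrow> r = s"
  by (simp add: expX_def)

lemma expX_0: "expX 0 = 1"
  by (simp add: expX_def)

lemma expX_sum: "expX (sum f A) = (\<Prod>a\<in>A. expX (f a))"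
  by (induction A rule: infinite_finite_induct) (simp_all add: expX_0 expX_add)

lemma expX_power: "expX (int k * r) = expX r ^ k"
  by (induction k) (simp_all add: expX_0 expX_add algebra_simps)

lemma expX_diff: "expX (r - s) = expX r / expX s"
  using expX_add[of "r - s" s] expX_nz[of s] by (simp add: field_simps)

definition todd_denominator :: "int multiset \<Rightarrow> real fls"
  where "todd_denominator rs = (\<Prod>r\<in>#rs. 1 - expX (- r))"

lemma todd_factor:
  assumes "r \<noteq> 0"
  shows "fps_to_fls (fps_const (real_of_int r) * fps_X / (1 - fps_exp (- real_of_int r))) =
    fls_const (real_of_int r) * fls_X / (1 - expX (- r))"
proof -
  \<comment> \<open>The quotient of power series agrees with the Laurent quotient because the order
    of the denominator at 0 does not exceed that of the numerator.\<close>
  have "fps_nth (1 - fps_exp (- real_of_int r)) 1 \<noteq> 0" using assms by simp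
  then have "subdegree (1 - fps_exp (- real_of_int r)) \<le> 1" by (rule subdegree_leI)
  moreover have "subdegree (fps_const (real_of_int r) * fps_X) = 1" using assms by simp
  ultimately show ?thesis
    by (simp add: fls_divide_fps_to_fls[symmetric] fls_times_fps_to_fls expX_def)
qed

lemma todd_product:
  assumes "0 \<notin># rs"
  shows "fps_to_fls (\<Prod>r\<in>#rs. fps_const (real_of_int r) * fps_X / (1 - fps_exp (- real_of_int r))) =
    fls_const (real_of_int (\<Prod>r\<in>#rs. r)) * fls_X ^ size rs / todd_denominator rs"
  using assms
proof (induction rs)
  case empty
  then show ?case by (simp add: todd_denominator_def)
next
  case (add r rs)
  then have r: "r \<noteq> 0" and IH: "fps_to_fls (\<Prod>r\<in>#rs. fps_const (real_of_int r) * fps_X / (1 - fps_exp (- real_of_int r))) =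
    fls_const (real_of_int (\<Prod>r\<in>#rs. r)) * fls_X ^ size rs / todd_denominator rs" by auto
  have "fls_const (real_of_int (\<Prod>r\<in>#add_mset r rs. r)) = fls_const (real_of_int r) * fls_const (real_of_int (\<Prod>r\<in>#rs. r))"
    by simp
  moreover have "todd_denominator (add_mset r rs) = (1 - expX (- r)) * todd_denominator rs" by (simp add: todd_denominator_def)
  moreover have "fps_to_fls (\<Prod>r\<in>#add_mset r rs. fps_const (real_of_int r) * fps_X / (1 - fps_exp (- real_of_int r))) =
    fps_to_fls (fps_const (real_of_int r) * fps_X / (1 - fps_exp (- real_of_int r))) *
    fps_to_fls (\<Prod>r\<in>#rs. fps_const (real_of_int r) * fps_X / (1 - fps_exp (- real_of_int r)))"
    by (simp only: image_mset_add_mset prod_mset.add_mset fls_times_fps_to_fls)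
  ultimately show ?case unfolding IH todd_factor[OF r] by (simp add: mult_ac)
qed

text \<open>The M numerators r_s U supply U^M and the product of the r_s. Removing both leaves the
  constant coefficient of a Laurent series, in which no numerators occur.\<close>

lemma RR_constant_coefficient:
  assumes "0 \<notin># rs" "size rs = M"
  shows "RR M b rs / real_of_int (\<Prod>r\<in>#rs. r) = fls_nth (expX b / todd_denominator rs) 0"
proof -
  have nz: "real_of_int (\<Prod>r\<in>#rs. r) \<noteq> 0" using assms(1) by simp
  have "RR M b rs = fls_nth (fps_to_fls (fps_exp (real_of_int b) * (\<Prod>r\<in>#rs. (fps_const (real_of_int r) * fps_X) / (1 - fps_exp (- real_of_int r))))) (int M)"
    by (simp add: RR_def)
  also have "\<dots> = fls_nth (fls_X ^ M * (fls_const (real_of_int (\<Prod>r\<in>#rs. r)) * (expX b / todd_denominator rs))) (int M)"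
    unfolding fls_times_fps_to_fls todd_product[OF assms(1)] assms(2) expX_def[symmetric] by (simp add: mult_ac)
  also have "\<dots> = real_of_int (\<Prod>r\<in>#rs. r) * fls_nth (expX b / todd_denominator rs) 0"
  proof -
    have "fls_nth (fls_X ^ M * (fls_const c * F)) (int M) = c * fls_nth F 0" for c :: real and F
      by (simp add: fls_X_power_times_conv_shift)
    then show ?thesis .
  qed
  finally show ?thesis using nz by simp
qed

text \<open>\<open>euler\<close> differs from \<open>d_ab\<close> only when the support is the whole hexagon, which happens
  exactly for \<open>sing_tab a j b\<close>; so this multiset treats both kinds of tabloids.\<close>
definition r_uniform :: "nat \<Rightarrow> (nat set \<Rightarrow> nat set) \<Rightarrow> int multiset"
  where "r_uniform n \<tau> =
    (\<Sum>a\<in>\<tau> {1,2,3}. \<Sum>b\<in>\<tau> {1,2,3} - {a}. replicate_mset (euler \<tau> a b) (int a - int b)) +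
    (\<Sum>a\<in>\<tau> {1,2,3}. \<Sum>b\<in>{1..n} - \<tau> {1,2,3}. {#int a - int b#})"

text \<open>If a belongs to all six sets and b to none, every line is {a}, and every plane consists
  of a and the only other element j of the top set.\<close>

lemma supp_full_singular:
  assumes \<tau>: "\<tau> \<in> std_tabloids n" and ab: "a \<in> \<tau> {1,2,3}" "b \<in> \<tau> {1,2,3}" and full: "supp \<tau> a b = {..<6}"
  shows "is_singular n \<tau>"
proof -
  define K where "K = \<tau> {1,2,3}"
  have mem: "a \<in> \<tau> (shape v) \<and> b \<notin> \<tau> (shape v)" if "v < 6" for v
    using full that by (auto simp: supp_def set_eq_iff)
  have "a \<noteq> b" using mem[of 0] by auto
  have cK: "card K = 3" using tab_card[OF \<tau> full_in_col_shapes] unfolding K_def by simp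
  have Kn: "K \<subseteq> {1..n}" using tab_bound[OF \<tau> full_in_col_shapes] unfolding K_def .
  have "card (K - {a, b}) = 1" using cK ab \<open>a \<noteq> b\<close> unfolding K_def by (subst card_Diff_subset) auto
  then obtain j where j: "K - {a, b} = {j}" by (auto simp: card_1_singleton_iff)
  then have jK: "j \<in> K" "j \<noteq> a" "j \<noteq> b" and K: "K = {a, j, b}" using ab unfolding K_def by auto
  have sub: "\<tau> (shape v) \<subseteq> {a, j}" if "v < 6" for v
    using tab_top[OF \<tau> shape_in_col_shapes[OF that]] mem[OF that] K unfolding K_def by auto
  have cs: "card (\<tau> (shape v)) = card (shape v)" if "v < 6" for v
    using tab_card[OF \<tau> shape_in_col_shapes[OF that]] .
  have line: "\<tau> (shape v) = {a}" if "v < 6" "card (shape v) = 1" for v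
    using cs[OF that(1)] that mem[OF that(1)] by (auto simp: card_1_singleton_iff)
  have plane: "\<tau> (shape v) = {a, j}" if "v < 6" "card (shape v) = 2" for v
    using cs[OF that(1)] that sub[OF that(1)] jK by (intro card_subset_eq) auto
  have c12: "card (shape v) = 1 \<or> card (shape v) = 2" if "v < 6" for v
    using card_shape[OF that] by simp
  have "\<tau> = sing_tab a j b"
  proof
    fix C
    consider "C = {1,2,3}" | v where "v < 6" "C = shape v" | "C \<notin> col_shapes" using col_shape_cases by metis
    then show "\<tau> C = sing_tab a j b C"
    proof cases
      case 1
      have "card {1, 2, 3 :: nat} = 3" by simp
      then show ?thesis using full_in_col_shapes K unfolding 1 sing_tab_def K_def by simp
    next
      case (2 v)
      then show ?thesis using line[OF 2(1)] plane[OF 2(1)] c12[OF 2(1)] shape_in_col_shapes[OF 2(1)]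
        unfolding sing_tab_def by auto
    next
      case 3
      then show ?thesis using \<tau> by (simp add: std_tabloids_def sing_tab_def)
    qed
  qed
  moreover have "a \<in> {1..n}" "j \<in> {1..n}" "b \<in> {1..n}" using Kn ab jK(1) unfolding K_def by blast+
  moreover have "a \<noteq> j \<and> j \<noteq> b \<and> a \<noteq> b" using jK \<open>a \<noteq> b\<close> by simp
  ultimately show ?thesis unfolding is_singular_def by metis
qed

lemma sum_pairs_split:
  fixes f :: "nat \<Rightarrow> nat \<Rightarrow> 'a::comm_monoid_add"
  assumes "K \<subseteq> A" "finite A" "\<And>a b. a \<notin> K \<Longrightarrow> f a b = 0"
  shows "(\<Sum>a\<in>A. \<Sum>b\<in>A - {a}. f a b) = (\<Sum>a\<in>K. \<Sum>b\<in>K - {a}. f a b) + (\<Sum>a\<in>K. \<Sum>b\<in>A - K. f a b)"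
proof -
  have "(\<Sum>a\<in>A. \<Sum>b\<in>A - {a}. f a b) = (\<Sum>a\<in>K. \<Sum>b\<in>A - {a}. f a b)"
    by (rule sum.mono_neutral_right) (use assms in auto)
  also have "\<dots> = (\<Sum>a\<in>K. (\<Sum>b\<in>K - {a}. f a b) + (\<Sum>b\<in>A - K. f a b))"
  proof (rule sum.cong[OF refl])
    fix a assume "a \<in> K"
    then have "A - {a} = (K - {a}) \<union> (A - K)" using assms(1) by auto
    then show "(\<Sum>b\<in>A - {a}. f a b) = (\<Sum>b\<in>K - {a}. f a b) + (\<Sum>b\<in>A - K. f a b)"
      using assms(1,2) finite_subset[OF assms(1,2)] by (simp add: sum.union_disjoint Int_Diff disjoint_iff)
  qed
  finally show ?thesis by (simp add: sum.distrib)
qed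

lemma r_tab_nonsingular:
  assumes \<tau>: "\<tau> \<in> std_tabloids n" and ns: "\<not> is_singular n \<tau>"
  shows "r_tab n \<tau> = r_uniform n \<tau>"
proof -
  have "r_tab n \<tau> = (\<Sum>a\<in>\<tau> {1,2,3}. \<Sum>b\<in>\<tau> {1,2,3} - {a}. replicate_mset (d_ab \<tau> a b) (int a - int b)) +
     (\<Sum>a\<in>\<tau> {1,2,3}. \<Sum>b\<in>{1..n} - \<tau> {1,2,3}. replicate_mset (d_ab \<tau> a b) (int a - int b))"
    unfolding r_tab_def
    by (rule sum_pairs_split) (use tab_bound[OF \<tau> full_in_col_shapes] d_ab_outside[OF \<tau>] in auto)
  also have "\<dots> = r_uniform n \<tau>"
    unfolding r_uniform_def
  proof (intro arg_cong2[where f="(+)"] sum.cong refl)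
    fix a b assume "a \<in> \<tau> {1,2,3}" "b \<in> \<tau> {1,2,3} - {a}"
    then have "d_ab \<tau> a b = euler \<tau> a b"
      using d_ab_inside[OF \<tau>] supp_full_singular[OF \<tau>] ns by blast
    then show "replicate_mset (d_ab \<tau> a b) (int a - int b) = replicate_mset (euler \<tau> a b) (int a - int b)" by simp
  next
    fix a b assume "a \<in> \<tau> {1,2,3}" "b \<in> {1..n} - \<tau> {1,2,3}"
    then have "d_ab \<tau> a b = 1" using d_ab_boundary[OF \<tau>] by blast
    then show "replicate_mset (d_ab \<tau> a b) (int a - int b) = {#int a - int b#}" by simp
  qed
  finally show ?thesis .
qed

lemma sing_tab_shape:
  assumes "v < 6" shows "sing_tab i j k (shape v) = (if even v then {i} else {i, j})"
  using shape_in_col_shapes[OF assms] card_shape[OF assms] by (simp add: sing_tab_def)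

lemma sing_tab_full: "sing_tab i j k {1,2,3} = {i, j, k}"
proof -
  have "card {1, 2, 3 :: nat} = 3" by simp
  then show ?thesis using full_in_col_shapes unfolding sing_tab_def by simp
qed

lemma sing_tab_inject:
  assumes "sing_tab i j k = sing_tab i' j' k'" "i \<noteq> j" "j \<noteq> k" "i \<noteq> k" "i' \<noteq> j'" "j' \<noteq> k'" "i' \<noteq> k'"
  shows "i = i' \<and> j = j' \<and> k = k'"
proof -
  have "{i} = {i'}" "{i, j} = {i', j'}" "{i, j, k} = {i', j', k'}"
    using sing_tab_shape[of 0 i j k] sing_tab_shape[of 0 i' j' k'] sing_tab_shape[of 1 i j k] sing_tab_shape[of 1 i' j' k']
      sing_tab_full[of i j k] sing_tab_full[of i' j' k'] unfolding assms(1) by simp_all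
  then show ?thesis using assms(2-) by auto
qed

text \<open>The support of (i, j) consists of the three lines and that of (j, k) of the three
  planes, with no edges. The support of (i, k) is the whole hexagon, which counts 0.\<close>

lemma euler_sing_tab:
  assumes "i \<noteq> j" "j \<noteq> k" "i \<noteq> k" and ab: "a \<in> {i, j, k}" "b \<in> {i, j, k}" "a \<noteq> b"
  shows "euler (sing_tab i j k) a b = (if (a, b) = (i, j) \<or> (a, b) = (j, k) then 3 else 0)"
proof -
  have s: "supp (sing_tab i j k) a b = {v. v < 6 \<and> (if even v then a = i \<and> b \<noteq> i else a \<in> {i, j} \<and> b \<notin> {i, j})}"
    unfolding supp_def by (auto simp: sing_tab_shape split: if_splits)
  have pm: "even ((v + 1) mod 6) \<longleftrightarrow> odd v" for v :: nat by presburger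
  have c3: "card {v::nat. v < 6 \<and> even v} = 3" "card {v::nat. v < 6 \<and> odd v} = 3"
  proof -
    have "v \<in> {v::nat. v < 6 \<and> even v} \<longleftrightarrow> v \<in> {0, 2, 4}" "v \<in> {v::nat. v < 6 \<and> odd v} \<longleftrightarrow> v \<in> {1, 3, 5}" for v
    proof -
      show "v \<in> {v::nat. v < 6 \<and> even v} \<longleftrightarrow> v \<in> {0, 2, 4}"
      proof
        assume "v \<in> {v::nat. v < 6 \<and> even v}"
        then show "v \<in> {0, 2, 4}" unfolding mem_Collect_eq less_6_cases by (elim conjE disjE) simp_all
      qed auto
      show "v \<in> {v::nat. v < 6 \<and> odd v} \<longleftrightarrow> v \<in> {1, 3, 5}"
      proof
        assume "v \<in> {v::nat. v < 6 \<and> odd v}"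
        then show "v \<in> {1, 3, 5}" unfolding mem_Collect_eq less_6_cases by (elim conjE disjE) simp_all
      qed auto
    qed
    then have "{v::nat. v < 6 \<and> even v} = {0, 2, 4}" "{v::nat. v < 6 \<and> odd v} = {1, 3, 5}" by blast+
    then show "card {v::nat. v < 6 \<and> even v} = 3" "card {v::nat. v < 6 \<and> odd v} = 3" by simp_all
  qed
  have e: "euler (sing_tab i j k) a b = card {v::nat. (v < 6 \<and> (if even v then a = i \<and> b \<noteq> i else a \<in> {i, j} \<and> b \<notin> {i, j})) \<and>
     \<not> (if odd v then a = i \<and> b \<noteq> i else a \<in> {i, j} \<and> b \<notin> {i, j})}"
    unfolding euler_def s mem_Collect_eq pm by (intro arg_cong[where f=card] Collect_cong) simp
  consider "a = i" "b = j" | "a = j" "b = k" | "a = i" "b = k" | "b = i" | "a = k" using ab by auto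
  then show ?thesis
  proof cases
    case 1
    then have "euler (sing_tab i j k) a b = card {v::nat. v < 6 \<and> even v}"
      unfolding e using assms by (intro arg_cong[where f=card]) auto
    then show ?thesis using 1 c3 by simp
  next
    case 2
    then have "euler (sing_tab i j k) a b = card {v::nat. v < 6 \<and> odd v}"
      unfolding e using assms by (intro arg_cong[where f=card]) auto
    then show ?thesis using 2 c3 by simp
  next
    case 3
    then have "euler (sing_tab i j k) a b = card ({} :: nat set)"
      unfolding e using assms by (intro arg_cong[where f=card]) auto
    then show ?thesis using 3 assms by simp
  next
    case 4
    then have "euler (sing_tab i j k) a b = card ({} :: nat set)"
      unfolding e using assms by (intro arg_cong[where f=card]) auto
    then show ?thesis using 4 assms by simp
  next
    case 5
    then have "euler (sing_tab i j k) a b = card ({} :: nat set)"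
      unfolding e using assms by (intro arg_cong[where f=card]) auto
    then show ?thesis using 5 assms by simp
  qed
qed

lemma r_uniform_singular:
  assumes d: "i \<noteq> j" "j \<noteq> k" "i \<noteq> k"
  shows "r_uniform n (sing_tab i j k) =
    replicate_mset 3 (int i - int j) + replicate_mset 3 (int j - int k) + r'_mset n i j k"
proof -
  let ?K = "{i, j, k}"
  have "(\<Sum>a\<in>?K. \<Sum>b\<in>?K - {a}. replicate_mset (euler (sing_tab i j k) a b) (int a - int b)) =
     (\<Sum>a\<in>?K. \<Sum>b\<in>?K - {a}. replicate_mset (if (a, b) = (i, j) \<or> (a, b) = (j, k) then 3 else 0) (int a - int b))"
    by (intro sum.cong refl) (subst euler_sing_tab[OF d]; simp)
  also have "\<dots> = replicate_mset 3 (int i - int j) + replicate_mset 3 (int j - int k)"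
  proof -
    have "?K - {i} = {j, k}" "?K - {j} = {i, k}" "?K - {k} = {i, j}" using d by auto
    then show ?thesis using d by simp
  qed
  finally have 1: "(\<Sum>a\<in>?K. \<Sum>b\<in>?K - {a}. replicate_mset (euler (sing_tab i j k) a b) (int a - int b)) =
    replicate_mset 3 (int i - int j) + replicate_mset 3 (int j - int k)" .
  have "(\<Sum>a\<in>?K. \<Sum>b\<in>{1..n} - ?K. {#int a - int b#}) = (\<Sum>l\<in>{1..n} - ?K. \<Sum>a\<in>?K. {#int a - int l#})"
    by (rule sum.swap)
  also have "\<dots> = r'_mset n i j k"
    unfolding r'_mset_def by (rule sum.cong[OF refl]) (use d in simp)
  finally show ?thesis unfolding r_uniform_def sing_tab_full 1 by simp
qed

lemma R_contrib_uniform: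
  assumes \<tau>: "\<tau> \<in> std_tabloids n"
  shows "R_contrib n m \<tau> = RR (3 * n - 3) (b_tab m \<tau>) (r_uniform n \<tau>) / real_of_int (\<Prod>r\<in>#r_uniform n \<tau>. r)"
proof (cases "is_singular n \<tau>")
  case False
  then show ?thesis by (simp add: R_contrib_def r_tab_nonsingular[OF \<tau>])
next
  case True
  then obtain i j k where ijk: "i \<in> {1..n}" "j \<in> {1..n}" "k \<in> {1..n}" and d: "i \<noteq> j" "j \<noteq> k" "i \<noteq> k"
    and t: "\<tau> = sing_tab i j k" unfolding is_singular_def by blast
  \<comment> \<open>A singular tabloid determines its triple, so the definite description returns
    the one at hand.\<close>
  have the: "(THE (i, j, k). i \<in> {1..n} \<and> j \<in> {1..n} \<and> k \<in> {1..n} \<and> i \<noteq> j \<and> j \<noteq> k \<and> i \<noteq> k \<and> \<tau> = sing_tab i j k) = (i, j, k)"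
  proof (rule the_equality)
    fix p assume p: "case p of (i, j, k) \<Rightarrow> i \<in> {1..n} \<and> j \<in> {1..n} \<and> k \<in> {1..n} \<and> i \<noteq> j \<and> j \<noteq> k \<and> i \<noteq> k \<and> \<tau> = sing_tab i j k"
    obtain i' j' k' where p': "p = (i', j', k')" by (cases p)
    have "i = i' \<and> j = j' \<and> k = k'"
      by (rule sing_tab_inject) (use p d t p' in auto)
    then show "p = (i, j, k)" using p' by simp
  qed (use ijk d t in simp)
  have "real_of_int (\<Prod>r\<in>#r_uniform n \<tau>. r) = real_of_int (int i - int j) ^ 3 * real_of_int (int j - int k) ^ 3 * real_of_int (\<Prod>r\<in>#r'_mset n i j k. r)"
    unfolding t r_uniform_singular[OF d] by simp
  then show ?thesis
    unfolding R_contrib_def the Let_def prod.case using True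
    unfolding t r_uniform_singular[OF d] by simp
qed

lemma zero_notin_r_uniform:
  assumes \<tau>: "\<tau> \<in> std_tabloids n" shows "0 \<notin># r_uniform n \<tau>"
proof -
  have "finite (\<tau> {1,2,3})" using tab_bound[OF \<tau> full_in_col_shapes] finite_subset by blast
  then show ?thesis unfolding r_uniform_def by (auto simp: set_mset_sum)
qed

text \<open>Six differences come from inside the top set and three from each of the n - 3 other
  colours.\<close>

lemma size_r_uniform:
  assumes \<tau>: "\<tau> \<in> std_tabloids n" shows "size (r_uniform n \<tau>) = 3 * n - 3"
proof -
  let ?K = "\<tau> {1,2,3}"
  have Kn: "?K \<subseteq> {1..n}" by (rule tab_bound[OF \<tau> full_in_col_shapes])
  have cK: "card ?K = 3" using tab_card[OF \<tau> full_in_col_shapes] by simp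
  then have "3 \<le> n" using card_mono[OF _ Kn] by simp
  have "card ({1..n} - ?K) = n - 3" using card_Diff_subset[OF finite_subset[OF Kn] Kn] cK by simp
  then have "size (r_uniform n \<tau>) = (\<Sum>a\<in>?K. \<Sum>b\<in>?K - {a}. euler \<tau> a b) + 3 * (n - 3)"
    unfolding r_uniform_def size_union size_multiset_sum by (simp only: size_replicate_mset size_single sum_constant cK of_nat_id)
  then show ?thesis using sum_euler[OF \<tau> refl] \<open>3 \<le> n\<close> by simp
qed

lemma prod_mset_sum:
  "(\<Prod>r\<in>#(\<Sum>i\<in>I. M i). f r) = (\<Prod>i\<in>I. \<Prod>r\<in>#M i. f r)"
  by (induction I rule: infinite_finite_induct) simp_all

lemma todd_denominator_uniform:
  "todd_denominator (r_uniform n \<tau>) =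
    (\<Prod>a\<in>\<tau> {1,2,3}. \<Prod>b\<in>\<tau> {1,2,3} - {a}. gap (\<lambda>a. expX (int a)) a b ^ euler \<tau> a b) *
    (\<Prod>a\<in>\<tau> {1,2,3}. \<Prod>b\<in>{1..n} - \<tau> {1,2,3}. gap (\<lambda>a. expX (int a)) a b)"
proof -
  have g: "gap (\<lambda>a. expX (int a)) a b = 1 - expX (- (int a - int b))" for a b
    by (simp add: gap_def expX_diff)
  show ?thesis unfolding todd_denominator_def r_uniform_def g
    by (simp add: prod_mset_sum image_replicate_mset del: minus_diff_eq)
qed

lemma expX_b_tab:
  assumes \<tau>: "\<tau> \<in> std_tabloids n"
  shows "(\<Prod>C\<in>col_shapes. (\<Prod>a\<in>\<tau> C. expX (int a)) ^ m C) = expX (b_tab m \<tau>)"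
  unfolding b_tab_def expX_sum expX_power by simp

section \<open>The character of the diagram as a sum over tabloids\<close>

context diagram
begin

text \<open>The trace to be found is a natural number, so real parts suffice; they move the
  coefficients of \<open>projD\<close> into the real Laurent series and keep its
  antisymmetry.\<close>

abbreviation proj_weight :: "(square \<Rightarrow> square) \<Rightarrow> real fls"
  where "proj_weight \<equiv> \<lambda>\<sigma>. fls_const (Re (projD \<sigma>))"

text \<open>The weights exp(aU) have constant coefficient 1, so the constant coefficient of the
  character is the plain trace.\<close>

lemma weighted_trace_constant_coefficient:
  "fls_nth (weighted_trace proj_weight {1..n} (\<lambda>a. expX (int a))) 0 = real (dim_schur n m)"
proof -
  have term0: "fls_nth ((\<Prod>z\<in>Z. expX (f z)) * fls_const c) 0 = c" for Z :: "square set" and f c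
    unfolding expX_sum[symmetric] by (simp add: expX_def fps_const_to_fls[symmetric] fls_times_fps_to_fls[symmetric] del: fps_const_to_fls)
  have cs: "(\<Sum>\<sigma>\<in>A. proj_weight \<sigma>) = fls_const (Re (\<Sum>\<sigma>\<in>A. projD \<sigma>))" for A
    by (induction A rule: infinite_finite_induct) (simp_all add: fls_plus_const)
  have "fls_nth (weighted_trace proj_weight {1..n} (\<lambda>a. expX (int a))) 0 =
     (\<Sum>g\<in>colourings (squares m) {1..n}. Re (\<Sum>\<sigma> | \<sigma> \<in> G \<and> g \<circ> \<sigma> = g. projD \<sigma>))"
    unfolding weighted_trace_def cs fls_nth_sum term0 by simp
  also have "\<dots> = Re (of_nat (dim_schur n m))" unfolding dim_schur_trace by simp
  finally show ?thesis by simp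
qed

lemma proj_weight_antisym:
  assumes "T \<subseteq> squares m" "card T \<ge> 4" "\<sigma> \<in> G"
  shows "(\<Sum>\<pi> | \<pi> permutes T. of_int (sign \<pi>) * proj_weight (\<sigma> \<circ> \<pi>)) = 0"
proof -
  have sc: "of_int s * fls_const (Re z) = fls_const (Re (of_int s * z))" for s z
    by (simp add: fls_of_int)
  have e: "(\<Sum>\<pi>\<in>P. of_int (sign \<pi>) * proj_weight (\<sigma> \<circ> \<pi>)) = fls_const (Re (\<Sum>\<pi>\<in>P. of_int (sign \<pi>) * projD (\<sigma> \<circ> \<pi>)))" for P
    unfolding sc by (induction P rule: infinite_finite_induct) (simp_all add: fls_plus_const)
  show ?thesis unfolding e projD_antisym[OF assms] by simp
qed

lemma weighted_trace_triple:
  assumes K: "K \<subseteq> {1..n}" "card K = 3"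
  shows "finite {\<tau> \<in> std_tabloids n. \<tau> {1,2,3} = K}"
    and "weighted_trace proj_weight K (\<lambda>a. expX (int a)) =
      (\<Sum>\<tau> | \<tau> \<in> std_tabloids n \<and> \<tau> {1,2,3} = K. expX (b_tab m \<tau>) /
        (\<Prod>a\<in>K. \<Prod>b\<in>K - {a}. gap (\<lambda>a. expX (int a)) a b ^ euler \<tau> a b))"
proof -
  have "finite K" using K(1) finite_subset by blast
  then obtain kc where kc: "bij_betw kc {..<3::nat} K"
    using ex_bij_betw_nat_finite[of K] K(2) by (auto simp: lessThan_atLeast0)
  interpret C: coloured_diagram m kc
    by unfold_locales (use kc in \<open>simp add: bij_betw_def\<close>)
  have CK: "C.K = K" unfolding C.K_def using kc by (simp add: bij_betw_def)
  show "finite {\<tau> \<in> std_tabloids n. \<tau> {1,2,3} = K}"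
    using bij_betw_finite[OF C.tab_of_bij[of n]] K(1) unfolding CK by (auto intro!: finite_PiE)
  have "weighted_trace proj_weight K (\<lambda>a. expX (int a)) =
     (\<Prod>c<3. expX (int (kc c))) ^ C.q * (\<Sum>E | E \<in> expos C.d \<and> std_expo E. \<Prod>v<6. \<Prod>c<3. C.yvar (\<lambda>a. expX (int a)) v c ^ E v c)"
    using C.weighted_trace_std[of "\<lambda>z. fls_const (Re z)" "\<lambda>a. expX (int a)"] unfolding CK
    by (simp add: fls_plus_const fls_of_nat)
  also have "\<dots> = (\<Sum>\<tau> | \<tau> \<in> std_tabloids n \<and> \<tau> {1,2,3} = K.
        (\<Prod>C\<in>col_shapes. (\<Prod>a\<in>\<tau> C. expX (int a)) ^ m C) /
        (\<Prod>a\<in>K. \<Prod>b\<in>K - {a}. gap (\<lambda>a. expX (int a)) a b ^ euler \<tau> a b))"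
    using C.localized_sum[of "\<lambda>a. expX (int a)" n] K(1) unfolding CK
    by (simp add: expX_nz inj_on_def expX_inj)
  also have "\<dots> = (\<Sum>\<tau> | \<tau> \<in> std_tabloids n \<and> \<tau> {1,2,3} = K. expX (b_tab m \<tau>) /
        (\<Prod>a\<in>K. \<Prod>b\<in>K - {a}. gap (\<lambda>a. expX (int a)) a b ^ euler \<tau> a b))"
    by (intro sum.cong refl arg_cong2[where f="(/)"] expX_b_tab) auto
  finally show "weighted_trace proj_weight K (\<lambda>a. expX (int a)) =
      (\<Sum>\<tau> | \<tau> \<in> std_tabloids n \<and> \<tau> {1,2,3} = K. expX (b_tab m \<tau>) /
        (\<Prod>a\<in>K. \<Prod>b\<in>K - {a}. gap (\<lambda>a. expX (int a)) a b ^ euler \<tau> a b))" .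
qed

text \<open>Tabloids are grouped by their top set \<open>K\<close>: reduction to three colours
  supplies the factors with b outside \<open>K\<close>, and localization supplies those
  inside.\<close>

lemma weighted_trace_tabloids:
  assumes "n \<ge> 3"
  shows "weighted_trace proj_weight {1..n} (\<lambda>a. expX (int a)) =
    (\<Sum>\<tau>\<in>std_tabloids n. expX (b_tab m \<tau>) / todd_denominator (r_uniform n \<tau>))"
proof -
  let ?x = "\<lambda>a. expX (int a)"
  let ?Ks = "{K. K \<subseteq> {1..n} \<and> card K = 3}"
  define F where "F \<tau> = expX (b_tab m \<tau>) / todd_denominator (r_uniform n \<tau>)" for \<tau>
  have top: "\<tau> {1,2,3} \<in> ?Ks" if "\<tau> \<in> std_tabloids n" for \<tau>
    using tab_card[OF that full_in_col_shapes] tab_bound[OF that full_in_col_shapes] by simp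
  have fKs: "finite ?Ks" by (rule finite_subset[of _ "Pow {1..n}"]) auto
  have "std_tabloids n = (\<Union>K\<in>?Ks. {\<tau> \<in> std_tabloids n. \<tau> {1,2,3} = K})" using top by blast
  then have fin: "finite (std_tabloids n)"
    using finite_UN_I[OF fKs, of "\<lambda>K. {\<tau> \<in> std_tabloids n. \<tau> {1,2,3} = K}"] weighted_trace_triple(1) by simp
  have "weighted_trace proj_weight {1..n} ?x =
     (\<Sum>K\<in>?Ks. weighted_trace proj_weight K ?x / (\<Prod>a\<in>K. \<Prod>b\<in>{1..n}-K. 1 - ?x b / ?x a))"
    by (rule weighted_trace_subsets) (use assms proj_weight_antisym in \<open>auto simp: inj_on_def expX_inj expX_nz\<close>)
  also have "\<dots> = (\<Sum>K\<in>?Ks. \<Sum>\<tau> | \<tau> \<in> std_tabloids n \<and> \<tau> {1,2,3} = K. F \<tau>)"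
  proof (rule sum.cong[OF refl])
    fix K assume K: "K \<in> ?Ks"
    have g: "1 - ?x b / ?x a = gap ?x a b" for a b by (simp add: gap_def)
    have "weighted_trace proj_weight K ?x = (\<Sum>\<tau> | \<tau> \<in> std_tabloids n \<and> \<tau> {1,2,3} = K. expX (b_tab m \<tau>) /
        (\<Prod>a\<in>K. \<Prod>b\<in>K - {a}. gap ?x a b ^ euler \<tau> a b))"
      using weighted_trace_triple(2)[of K n] K by blast
    then have "weighted_trace proj_weight K ?x / (\<Prod>a\<in>K. \<Prod>b\<in>{1..n}-K. 1 - ?x b / ?x a) =
       (\<Sum>\<tau> | \<tau> \<in> std_tabloids n \<and> \<tau> {1,2,3} = K. expX (b_tab m \<tau>) /
        (\<Prod>a\<in>K. \<Prod>b\<in>K - {a}. gap ?x a b ^ euler \<tau> a b) / (\<Prod>a\<in>K. \<Prod>b\<in>{1..n}-K. gap ?x a b))"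
      unfolding g by (simp only: sum_divide_distrib)
    also have "\<dots> = (\<Sum>\<tau> | \<tau> \<in> std_tabloids n \<and> \<tau> {1,2,3} = K. F \<tau>)"
    proof (rule sum.cong[OF refl])
      fix \<tau> assume "\<tau> \<in> {\<tau> \<in> std_tabloids n. \<tau> {1,2,3} = K}"
      then have t: "\<tau> {1,2,3} = K" by blast
      show "expX (b_tab m \<tau>) / (\<Prod>a\<in>K. \<Prod>b\<in>K - {a}. gap ?x a b ^ euler \<tau> a b) / (\<Prod>a\<in>K. \<Prod>b\<in>{1..n}-K. gap ?x a b) = F \<tau>"
        unfolding F_def todd_denominator_uniform t by simp
    qed
    finally show "weighted_trace proj_weight K ?x / (\<Prod>a\<in>K. \<Prod>b\<in>{1..n}-K. 1 - ?x b / ?x a) =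
       (\<Sum>\<tau> | \<tau> \<in> std_tabloids n \<and> \<tau> {1,2,3} = K. F \<tau>)" .
  qed
  also have "\<dots> = (\<Sum>\<tau>\<in>std_tabloids n. F \<tau>)"
    by (rule sum.group) (use fin fKs top in auto)
  finally show ?thesis unfolding F_def .
qed

end

theorem theorem5p5:
  fixes n :: nat and m :: "nat set \<Rightarrow> nat"
  assumes "n \<ge> 3"
  shows "real (dim_schur n m) = (\<Sum>\<tau>\<in>std_tabloids n. R_contrib n m \<tau>)"
proof -
  interpret diagram m .
  have "real (dim_schur n m) = (\<Sum>\<tau>\<in>std_tabloids n. fls_nth (expX (b_tab m \<tau>) / todd_denominator (r_uniform n \<tau>)) 0)"
    unfolding weighted_trace_constant_coefficient[symmetric] weighted_trace_tabloids[OF assms] by (rule fls_nth_sum)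
  also have "\<dots> = (\<Sum>\<tau>\<in>std_tabloids n. R_contrib n m \<tau>)"
  proof (rule sum.cong[OF refl])
    fix \<tau> assume \<tau>: "\<tau> \<in> std_tabloids n"
    show "fls_nth (expX (b_tab m \<tau>) / todd_denominator (r_uniform n \<tau>)) 0 = R_contrib n m \<tau>"
      unfolding R_contrib_uniform[OF \<tau>]
      by (rule RR_constant_coefficient[OF zero_notin_r_uniform[OF \<tau>] size_r_uniform[OF \<tau>], symmetric])
  qed
  finally show ?thesis .
qed

end
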